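(* Let $f\in L^2(\Omega)$, let $\mathcal T\in\mathbb T$ with $h_{\max}\le1$, let $u\in H^1_0(\Omega)$ be the weak solution of $\mathcal Lu=f$, let $\boldsymbol\sigma:=\mathbf A\nabla u+\mathbf bu$, and let $u_h\in V_h$ be the solution of the discrete problem. Then, for every $P\in\mathcal T$, $$\begin{aligned} \zeta_P^2&\lesssim|u-u_h|_{1,P}^2+|u-\Pi_1u_h|_{1,P}^2,\\ \eta_P^2&\lesssim\|u-u_h\|_{1,P}^2+|u-\Pi_1u_h|_{1,P}^2+\|(1-\Pi_0)\boldsymbol\sigma\|_{L^2(P)}^2+\mathrm{osc}_1^2(f-\gamma u,P),\\ \Lambda_P^2&\lesssim\|u-u_h\|_{1,P}^2+|u-\Pi_1u_h|_{1,P}^2+\|(1-\Pi_0)\boldsymbol\sigma\|_{L^2(P)}^2,\\ \Xi_P^2&\lesssim\sum_{E\in\mathcal E(P)}\ \sum_{P'\in\mathcal T(E)}\big(\|u-u_h\|_{1,P'}^2+|u-\Pi_1u_h|_{1,P'}^2\big), \end{aligned}$$ where $a\lesssim b$ means $a\le Cb$ with a constant $C$ that may depend on the coefficients, $\sigma$, $\rho$ (and the stabilization constant $C_s$), but is independent of the mesh-size (and of $f$, $P$, $\mathcal T$).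
   Context: **Meshes.** $\Omega\subset\mathbb R^2$ is a fixed bounded polygonal Lipschitz domain. A polygonal domain $P$ is a nonempty compact simply connected set such that $\mathrm{int}(P)$ is a Lipschitz domain and $\partial P$ is a simple closed polygon given by finitely many distinct nodes; consecutive nodes span the edges and $\mathcal E(P)$ is the set of edges of $P$. $h_P$ is the diameter of $P$, $|E|$ the length of an edge $E$, $\mathbf n_P$ the outer unit normal, and $H^s(P):=H^s(\mathrm{int}(P))$. $\mathbb T$ is a family of partitions $\mathcal T$ of $\overline\Omega$ into polygonal domains such that, with a universal constant $\rho>0$: (M1) any two distinct $P,P'\in\mathcal T$ are disjoint or share a finite number of edges or vertices; (M2) every $P\in\mathcal T$ is star-shaped with respect to every point of a ball of radius $\ge\rho h_P$, and every edge $E$ of $P$ satisfies $|E|\ge\rho h_P$. $\mathcal E$ is the set of edges of $\mathcal T$; $h_{\max}:=\max_{P\in\mathcal T}h_P$. For $E\in\mathcal E$, $\mathcal T(E):=\{P'\in\mathcal T:E\subset\partial P'\}$ is the set of the one or two polygons sharing $E$. **Discrete space.** $\mathcal P_k(P)$ are the polynomials of degree $\le k$ on $P$, $\mathcal P_k(\mathcal T)$ the piecewise polynomials, $\Pi_k$ the $L^2$ projection onto $\mathcal P_k(\mathcal T)$ (componentwise for vectors); $\mathrm{osc}_1(g,P):=h_P\|(1-\Pi_1)g\|_{L^2(P)}$. For $v\in H^1(P)$ the Ritz projection $\Pi_1^\nabla v\in\mathcal P_1(P)$ is given by $(\nabla\Pi^\nabla_1v-\nabla v,\nabla\chi)_{L^2(P)}=0$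 for all $\chi\in\mathcal P_1(P)$ and $\int_{\partial P}\Pi_1^\nabla v\,ds=\int_{\partial P}v\,ds$. Set $\widehat V_h(P):=\{v\in H^1(P):\Delta v\in\mathcal P_1(P),\ \frac{\partial v}{\partial\mathbf n_P}|_E\in\mathcal P_0(E)\ \forall E\in\mathcal E(P)\}$ and $V_h(P):=\{v\in\widehat V_h(P): v-\Pi_1^\nabla v\perp\mathcal P_1(P)\text{ in }L^2(P)\}$. With $H^1(\mathcal T):=\{v\in L^2(\Omega): v|_P\in H^1(P)\ \forall P\in\mathcal T\}$, $V_h:=\{v_h\in H^1(\mathcal T): v_h|_P\in V_h(P)\ \forall P\in\mathcal T,\ \int_E[v_h]_E\,ds=0\ \forall E\in\mathcal E\}$, where $[v]_E$ is the jump of $v$ across an interior edge and $[v]_E=v|_E$ for $E\subset\partial\Omega$. **Coefficients.** $\mathbf A=(\mathbf A_{jk})$, $\mathbf b=(\mathbf b_j)$, $\gamma$ on $\Omega$ satisfy: (A1) $\mathbf A_{jk},\mathbf b_j,\gamma$ are Lipschitz continuous on each $P\in\mathcal T$ for each $\mathcal T\in\mathbb T$, bounded a.e. by $\|\mathbf A\|_\infty,\|\mathbf b\|_\infty,\|\gamma\|_\infty$, with piecewise first derivatives bounded by $|\mathbf A|_{1,\infty},|\mathbf b|_{1,\infty},|\gamma|_{1,\infty}$; (A2) $\mathbf A(x)$ is symmetric positive definite with $a_0|\xi|^2\le\xi\cdot\mathbf A(x)\xi\le a_1|\xi|^2$ for all $\xi\in\mathbb R^2$, a.e. $x$, with constants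 $0<a_0\le a_1$; (A3) $\mathcal L u:=-\mathrm{div}(\mathbf A\nabla u+\mathbf b u)+\gamma u$ is injective as an operator $H^1_0(\Omega)\to H^{-1}(\Omega)$. The weak form of $\mathcal Lu=f$ is $(\mathbf A\nabla u,\nabla v)_{L^2(\Omega)}+(u,\mathbf b\cdot\nabla v)_{L^2(\Omega)}+(\gamma u,v)_{L^2(\Omega)}=(f,v)_{L^2(\Omega)}$ for all $v\in H^1_0(\Omega)$. The index $\sigma\in(0,1]$ is the elliptic regularity index: weak solutions of $\mathcal Lu=f$ and of the adjoint problem $\mathcal L^*\Phi=g$ with $L^2$ data lie in $H^{1+\sigma}(\Omega)$ with norms bounded by a constant times the $L^2$ norm of the data. **Discrete problem.** $u_h\in V_h$ solves $B_h(u_h,v_h)=\sum_{P\in\mathcal T}(f,\Pi_1v_h)_{L^2(P)}$ for all $v_h\in V_h$ (existence and uniqueness of $u_h$ is assumed; it holds for $h_{\max}$ sufficiently small), where $B_h(u_h,v_h):=\sum_{P\in\mathcal T}\big[(\mathbf A\nabla\Pi_1u_h,\nabla\Pi_1v_h)_{L^2(P)}+S^P((1-\Pi_1)u_h,(1-\Pi_1)v_h)+(\Pi_1u_h,\mathbf b\cdot\nabla\Pi_1v_h)_{L^2(P)}+(\gamma\Pi_1u_h,\Pi_1v_h)_{L^2(P)}\big]$ and $S^P$ is a symmetric positive definite bilinear form on $V_h(P)\times V_h(P)$ with, for a constant $C_s>0$ independent of $P$ and $h_P$, $C_s^{-1}(\mathbf A\nabla v_h,\nabla v_h)_{L^2(P)}\le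 S^P(v_h,v_h)\le C_s(\mathbf A\nabla v_h,\nabla v_h)_{L^2(P)}$ for all $v_h\in V_h(P)$ with $\Pi_1v_h=0$. **Estimator.** For $P\in\mathcal T$: $\eta_P^2:=h_P^2\|f-\gamma\Pi_1u_h\|_{L^2(P)}^2$, $\zeta_P^2:=S^P((1-\Pi_1)u_h,(1-\Pi_1)u_h)$, $\Lambda_P^2:=\|(1-\Pi_0)(\mathbf A\nabla\Pi_1u_h+\mathbf b\Pi_1u_h)\|_{L^2(P)}^2$, $\Xi_P^2:=\sum_{E\in\mathcal E(P)}|E|^{-1}\|[\Pi_1u_h]_E\|_{L^2(E)}^2$. *)

theory Defs
  imports "HOL-Analysis.Analysis"
begin

type_synonym plane = "real^2"

section \<open>Lebesgue and Sobolev spaces on subsets of the plane\<close>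

text \<open>Elements of function spaces are represented by functions on the whole plane; values outside
  the set under consideration are irrelevant, and equality in the space is equality almost
  everywhere on that set.\<close>

definition L2 :: "plane measure \<Rightarrow> (plane \<Rightarrow> 'a::euclidean_space) set" where
  "L2 M = {f. f \<in> borel_measurable M \<and> integrable M (\<lambda>x. (norm (f x))\<^sup>2)}"

definition L2_norm :: "plane measure \<Rightarrow> (plane \<Rightarrow> 'a::euclidean_space) \<Rightarrow> real" where
  "L2_norm M f = sqrt (LINT x|M. (norm (f x))\<^sup>2)"

definition L2_inner ::
  "plane measure \<Rightarrow> (plane \<Rightarrow> 'a::euclidean_space) \<Rightarrow> (plane \<Rightarrow> 'a) \<Rightarrow> real" where
  "L2_inner M f g = (LINT x|M. f x \<bullet> g x)"

definition grad :: "(plane \<Rightarrow> real) \<Rightarrow> plane \<Rightarrow> plane" where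
  "grad \<phi> x = (\<chi> i. frechet_derivative \<phi> (at x) (axis i 1))"

primrec Ck :: "nat \<Rightarrow> (plane \<Rightarrow> real) \<Rightarrow> bool" where
  "Ck 0 \<phi> \<longleftrightarrow> continuous_on UNIV \<phi>"
| "Ck (Suc k) \<phi> \<longleftrightarrow> (\<forall>x. \<phi> differentiable (at x)) \<and> (\<forall>i. Ck k (\<lambda>x. grad \<phi> x $ i))"

definition smooth :: "(plane \<Rightarrow> real) \<Rightarrow> bool" where
  "smooth \<phi> \<longleftrightarrow> (\<forall>k. Ck k \<phi>)"

definition test_functions :: "plane set \<Rightarrow> (plane \<Rightarrow> real) set" where
  "test_functions G = {\<phi>. smooth \<phi> \<and> (\<exists>K. compact K \<and> K \<subseteq> G \<and> (\<forall>x. x \<notin> K \<longrightarrow> \<phi> x = 0))}"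

definition is_weak_gradient :: "plane set \<Rightarrow> (plane \<Rightarrow> real) \<Rightarrow> (plane \<Rightarrow> plane) \<Rightarrow> bool" where
  "is_weak_gradient G v g \<longleftrightarrow> (\<forall>\<phi>\<in>test_functions G. \<forall>i.
     (LINT x|lebesgue_on G. v x * grad \<phi> x $ i) = - (LINT x|lebesgue_on G. g x $ i * \<phi> x))"

definition H1 :: "plane set \<Rightarrow> (plane \<Rightarrow> real) set" where
  "H1 G = {v. v \<in> L2 (lebesgue_on G) \<and> (\<exists>g. g \<in> L2 (lebesgue_on G) \<and> is_weak_gradient G v g)}"

text \<open>The weak gradient, which is unique up to a null set.\<close>

definition wgrad :: "plane set \<Rightarrow> (plane \<Rightarrow> real) \<Rightarrow> plane \<Rightarrow> plane" where
  "wgrad G v = (SOME g. g \<in> L2 (lebesgue_on G) \<and> is_weak_gradient G v g)"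

definition H1_seminorm :: "plane set \<Rightarrow> (plane \<Rightarrow> real) \<Rightarrow> real" where
  "H1_seminorm G v = L2_norm (lebesgue_on G) (wgrad G v)"

definition H1_norm :: "plane set \<Rightarrow> (plane \<Rightarrow> real) \<Rightarrow> real" where
  "H1_norm G v = sqrt ((L2_norm (lebesgue_on G) v)\<^sup>2 + (H1_seminorm G v)\<^sup>2)"

definition H10 :: "plane set \<Rightarrow> (plane \<Rightarrow> real) set" where
  "H10 G = {v \<in> H1 G. \<exists>\<phi> :: nat \<Rightarrow> plane \<Rightarrow> real. (\<forall>n. \<phi> n \<in> test_functions G) \<and>
     (\<lambda>n. H1_norm G (\<lambda>x. v x - \<phi> n x)) \<longlonglongrightarrow> 0}"

text \<open>The space \<open>H\<^bsup>1+s\<^esup>\<close> for \<open>0 < s \<le> 1\<close>: the gradient has finite Sobolev-Slobodeckij seminorm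
  if \<open>s < 1\<close>, and its components belong to \<open>H\<^sup>1\<close> if \<open>s = 1\<close>.\<close>

definition slobodeckij :: "real \<Rightarrow> plane set \<Rightarrow> (plane \<Rightarrow> plane) \<Rightarrow> ennreal" where
  "slobodeckij s G g = (\<integral>\<^sup>+x. \<integral>\<^sup>+y. ennreal ((norm (g x - g y))\<^sup>2 / (norm (x - y)) powr (2 + 2 * s))
     \<partial>lebesgue_on G \<partial>lebesgue_on G)"

definition H1s :: "real \<Rightarrow> plane set \<Rightarrow> (plane \<Rightarrow> real) set" where
  "H1s s G = {v \<in> H1 G. if s = 1 then \<forall>i. (\<lambda>x. wgrad G v x $ i) \<in> H1 G
                          else slobodeckij s G (wgrad G v) < \<infinity>}"

definition H1s_norm :: "real \<Rightarrow> plane set \<Rightarrow> (plane \<Rightarrow> real) \<Rightarrow> real" where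
  "H1s_norm s G v = sqrt ((H1_norm G v)\<^sup>2 +
     (if s = 1 then \<Sum>i\<in>UNIV. (H1_seminorm G (\<lambda>x. wgrad G v x $ i))\<^sup>2
      else enn2real (slobodeckij s G (wgrad G v))))"


section \<open>Domains and meshes\<close>

text \<open>Near each boundary point the set lies on one side of the graph of a Lipschitz function, in
  suitable Cartesian coordinates.\<close>

definition lipschitz_domain :: "plane set \<Rightarrow> bool" where
  "lipschitz_domain G \<longleftrightarrow> open G \<and> connected G \<and> G \<noteq> {} \<and> bounded G \<and>
     (\<forall>z\<in>frontier G. \<exists>r>0. \<exists>Q :: plane \<Rightarrow> plane. \<exists>\<psi> :: real \<Rightarrow> real. \<exists>L.
        orthogonal_transformation Q \<and> L-lipschitz_on UNIV \<psi> \<and>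
        G \<inter> ball z r = {y \<in> ball z r. Q (y - z) $ 2 < \<psi> (Q (y - z) $ 1)})"

definition polygonal_lipschitz_domain :: "plane set \<Rightarrow> bool" where
  "polygonal_lipschitz_domain G \<longleftrightarrow> lipschitz_domain G \<and>
     (\<exists>F. finite F \<and> frontier G = (\<Union>(a, b)\<in>F. closed_segment a b))"

text \<open>A polygonal domain carries its list of nodes, because hanging nodes (with an interior angle
  \<open>\<pi>\<close>) are allowed, so that the nodes and edges are not determined by the point set.\<close>

record polygon =
  pts :: "plane set"
  nodes :: "plane list"

fun polypath :: "plane list \<Rightarrow> real \<Rightarrow> plane" where
  "polypath [] = linepath 0 0"
| "polypath [a] = linepath a a"
| "polypath [a, b] = linepath a b"
| "polypath (a # b # c # zs) = linepath a b +++ polypath (b # c # zs)"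

definition edges :: "polygon \<Rightarrow> plane set set" where
  "edges P = (\<lambda>i. closed_segment (nodes P ! i) (nodes P ! (Suc i mod length (nodes P))))
     ` {..<length (nodes P)}"

definition polygonal_domain :: "polygon \<Rightarrow> bool" where
  "polygonal_domain P \<longleftrightarrow>
     pts P \<noteq> {} \<and> compact (pts P) \<and> simply_connected (pts P) \<and> lipschitz_domain (interior (pts P)) \<and>
     length (nodes P) \<ge> 3 \<and> distinct (nodes P) \<and>
     simple_path (polypath (nodes P @ [hd (nodes P)])) \<and>
     frontier (pts P) = path_image (polypath (nodes P @ [hd (nodes P)]))"

definition mesh :: "plane set \<Rightarrow> real \<Rightarrow> polygon set \<Rightarrow> bool" where
  "mesh \<Omega> \<rho> \<T> \<longleftrightarrow>
     finite \<T> \<and> (\<forall>P\<in>\<T>. polygonal_domain P) \<and> (\<Union>P\<in>\<T>. pts P) = closure \<Omega> \<and>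
     (\<forall>P\<in>\<T>. \<forall>P'\<in>\<T>. P \<noteq> P' \<longrightarrow>
        (\<exists>F N. F \<subseteq> edges P \<inter> edges P' \<and> N \<subseteq> set (nodes P) \<inter> set (nodes P') \<and>
               pts P \<inter> pts P' = \<Union>F \<union> N)) \<and>
     (\<forall>P\<in>\<T>. (\<exists>z r. r \<ge> \<rho> * diameter (pts P) \<and> ball z r \<subseteq> pts P \<and>
                (\<forall>y\<in>ball z r. \<forall>x\<in>pts P. closed_segment y x \<subseteq> pts P)) \<and>
            (\<forall>E\<in>edges P. diameter E \<ge> \<rho> * diameter (pts P)))"

definition h_max :: "polygon set \<Rightarrow> real" where
  "h_max \<T> = Max ((\<lambda>P. diameter (pts P)) ` \<T>)"

definition mesh_edges :: "polygon set \<Rightarrow> plane set set" where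
  "mesh_edges \<T> = (\<Union>P\<in>\<T>. edges P)"

definition sharing :: "polygon set \<Rightarrow> plane set \<Rightarrow> polygon set" where
  "sharing \<T> E = {P' \<in> \<T>. E \<subseteq> frontier (pts P')}"


section \<open>Traces and jumps\<close>

text \<open>Arc length on a segment. The choice of the order of the endpoints is immaterial.\<close>

definition edge_measure :: "plane set \<Rightarrow> plane measure" where
  "edge_measure E = (case (SOME (a, b). E = closed_segment a b) of (a, b) \<Rightarrow>
     scale_measure (ennreal (dist a b)) (distr (lebesgue_on {0..1}) borel (linepath a b)))"

abbreviation Leb :: "polygon \<Rightarrow> plane measure" where
  "Leb P \<equiv> lebesgue_on (pts P)"

abbreviation H1P :: "polygon \<Rightarrow> (plane \<Rightarrow> real) set" where
  "H1P P \<equiv> H1 (interior (pts P))"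

abbreviation pgrad :: "polygon \<Rightarrow> (plane \<Rightarrow> real) \<Rightarrow> plane \<Rightarrow> plane" where
  "pgrad P \<equiv> wgrad (interior (pts P))"

text \<open>The trace on an edge, by continuous extension from functions that are smooth up to the
  boundary.\<close>

definition is_trace ::
  "polygon \<Rightarrow> plane set \<Rightarrow> (plane \<Rightarrow> real) \<Rightarrow> (plane \<Rightarrow> real) \<Rightarrow> bool" where
  "is_trace P E v \<tau> \<longleftrightarrow> \<tau> \<in> L2 (edge_measure E) \<and>
     (\<exists>\<phi> :: nat \<Rightarrow> plane \<Rightarrow> real. (\<forall>n. smooth (\<phi> n)) \<and>
        (\<lambda>n. H1_norm (interior (pts P)) (\<lambda>x. v x - \<phi> n x)) \<longlonglongrightarrow> 0 \<and>
        (\<lambda>n. L2_norm (edge_measure E) (\<lambda>x. \<tau> x - \<phi> n x)) \<longlonglongrightarrow> 0)"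

definition trace :: "polygon \<Rightarrow> plane set \<Rightarrow> (plane \<Rightarrow> real) \<Rightarrow> plane \<Rightarrow> real" where
  "trace P E v = (SOME \<tau>. is_trace P E v \<tau>)"

definition boundary_integral :: "polygon \<Rightarrow> (plane \<Rightarrow> real) \<Rightarrow> real" where
  "boundary_integral P v = (\<Sum>E\<in>edges P. LINT x|edge_measure E. trace P E v x)"

text \<open>The jump of a piecewise function, given by its restriction \<open>w P\<close> to each polygon \<open>P\<close>. On
  interior edges the sign of the jump is fixed by an arbitrary choice.\<close>

definition jump ::
  "plane set \<Rightarrow> polygon set \<Rightarrow> (polygon \<Rightarrow> plane \<Rightarrow> real) \<Rightarrow> plane set \<Rightarrow> plane \<Rightarrow> real" where
  "jump \<Omega> \<T> w E =
     (if E \<subseteq> frontier \<Omega>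
      then (let P = (SOME P. P \<in> sharing \<T> E) in trace P E (w P))
      else (case (SOME (P, P'). P \<noteq> P' \<and> sharing \<T> E = {P, P'}) of (P, P') \<Rightarrow>
              (\<lambda>x. trace P E (w P) x - trace P' E (w P') x)))"


section \<open>Polynomials, projections and the virtual element space\<close>

definition polys :: "nat \<Rightarrow> (plane \<Rightarrow> real) set" where
  "polys k = {p. \<exists>c :: nat \<Rightarrow> nat \<Rightarrow> real. p = (\<lambda>x. \<Sum>i\<le>k. \<Sum>j\<le>k - i. c i j * (x $ 1) ^ i * (x $ 2) ^ j)}"

definition proj :: "nat \<Rightarrow> polygon \<Rightarrow> (plane \<Rightarrow> real) \<Rightarrow> plane \<Rightarrow> real" where
  "proj k P v = (THE p. p \<in> polys k \<and> (\<forall>q\<in>polys k. L2_inner (Leb P) (\<lambda>x. v x - p x) q = 0))"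

definition vproj :: "nat \<Rightarrow> polygon \<Rightarrow> (plane \<Rightarrow> plane) \<Rightarrow> plane \<Rightarrow> plane" where
  "vproj k P F x = (\<chi> i. proj k P (\<lambda>y. F y $ i) x)"

definition osc1 :: "(plane \<Rightarrow> real) \<Rightarrow> polygon \<Rightarrow> real" where
  "osc1 g P = diameter (pts P) * L2_norm (Leb P) (\<lambda>x. g x - proj 1 P g x)"

definition ritz :: "polygon \<Rightarrow> (plane \<Rightarrow> real) \<Rightarrow> plane \<Rightarrow> real" where
  "ritz P v = (THE p. p \<in> polys 1 \<and>
     (\<forall>q\<in>polys 1. L2_inner (Leb P) (\<lambda>x. pgrad P p x - pgrad P v x) (pgrad P q) = 0) \<and>
     boundary_integral P p = boundary_integral P v)"

definition is_weak_laplacian :: "polygon \<Rightarrow> (plane \<Rightarrow> real) \<Rightarrow> (plane \<Rightarrow> real) \<Rightarrow> bool" where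
  "is_weak_laplacian P v q \<longleftrightarrow> (\<forall>\<phi>\<in>test_functions (interior (pts P)).
     L2_inner (Leb P) (pgrad P v) (grad \<phi>) = - L2_inner (Leb P) q \<phi>)"

text \<open>The normal derivative of a function \<open>v\<close> with Laplacian \<open>q\<close> in \<open>L\<^sup>2\<close> is the functional on
  traces given by Green's formula; it is represented here by square integrable functions \<open>g E\<close> on
  the edges \<open>E\<close>.\<close>

definition is_normal_derivative ::
  "polygon \<Rightarrow> (plane \<Rightarrow> real) \<Rightarrow> (plane \<Rightarrow> real) \<Rightarrow> (plane set \<Rightarrow> plane \<Rightarrow> real) \<Rightarrow> bool" where
  "is_normal_derivative P v q g \<longleftrightarrow> (\<forall>E\<in>edges P. g E \<in> L2 (edge_measure E)) \<and>
     (\<forall>w\<in>H1P P. L2_inner (Leb P) (pgrad P v) (pgrad P w) + L2_inner (Leb P) q w =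
                 (\<Sum>E\<in>edges P. L2_inner (edge_measure E) (g E) (trace P E w)))"

definition Vhat :: "polygon \<Rightarrow> (plane \<Rightarrow> real) set" where
  "Vhat P = {v \<in> H1P P. \<exists>q\<in>polys 1. \<exists>g. is_weak_laplacian P v q \<and> is_normal_derivative P v q g \<and>
     (\<forall>E\<in>edges P. \<exists>p\<in>polys 0. \<forall>x\<in>E. g E x = p x)}"

definition VP :: "polygon \<Rightarrow> (plane \<Rightarrow> real) set" where
  "VP P = {v \<in> Vhat P. \<forall>q\<in>polys 1. L2_inner (Leb P) (\<lambda>x. v x - ritz P v x) q = 0}"

definition H1_broken :: "plane set \<Rightarrow> polygon set \<Rightarrow> (plane \<Rightarrow> real) set" where
  "H1_broken \<Omega> \<T> = {v \<in> L2 (lebesgue_on \<Omega>). \<forall>P\<in>\<T>. v \<in> H1P P}"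

definition Vh :: "plane set \<Rightarrow> polygon set \<Rightarrow> (plane \<Rightarrow> real) set" where
  "Vh \<Omega> \<T> = {v \<in> H1_broken \<Omega> \<T>. (\<forall>P\<in>\<T>. v \<in> VP P) \<and>
     (\<forall>E\<in>mesh_edges \<T>. (LINT x|edge_measure E. jump \<Omega> \<T> (\<lambda>_. v) E x) = 0)}"


section \<open>The continuous problem\<close>

definition bounded_coeffs ::
  "plane set \<Rightarrow> (plane \<Rightarrow> real^2^2) \<Rightarrow> (plane \<Rightarrow> plane) \<Rightarrow> (plane \<Rightarrow> real) \<Rightarrow>
   real \<Rightarrow> real \<Rightarrow> real \<Rightarrow> bool" where
  "bounded_coeffs \<Omega> A b \<gamma> M\<^sub>A M\<^sub>b M\<^sub>\<gamma> \<longleftrightarrow>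
     (AE x in lebesgue_on \<Omega>. norm (A x) \<le> M\<^sub>A \<and> norm (b x) \<le> M\<^sub>b \<and> \<bar>\<gamma> x\<bar> \<le> M\<^sub>\<gamma>)"

text \<open>Lipschitz continuity is required on the open polygons, so that the coefficients may jump across
  edges. The Lipschitz constant itself need not be uniform in \<open>P\<close>, but the bound \<open>M\<close> on the first
  derivatives, which exist almost everywhere, is.\<close>

definition piecewise_lipschitz :: "polygon set \<Rightarrow> real \<Rightarrow> (plane \<Rightarrow> real) \<Rightarrow> bool" where
  "piecewise_lipschitz \<T> M c \<longleftrightarrow> (\<forall>P\<in>\<T>.
     (\<exists>L. L-lipschitz_on (interior (pts P)) c) \<and>
     (AE x in lebesgue_on (interior (pts P)). \<forall>D. (c has_derivative D) (at x) \<longrightarrow> onorm D \<le> M))"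

definition elliptic :: "plane set \<Rightarrow> (plane \<Rightarrow> real^2^2) \<Rightarrow> real \<Rightarrow> real \<Rightarrow> bool" where
  "elliptic \<Omega> A a\<^sub>0 a\<^sub>1 \<longleftrightarrow> 0 < a\<^sub>0 \<and> a\<^sub>0 \<le> a\<^sub>1 \<and>
     (AE x in lebesgue_on \<Omega>. transpose (A x) = A x \<and>
        (\<forall>\<xi>. a\<^sub>0 * (norm \<xi>)\<^sup>2 \<le> \<xi> \<bullet> (A x *v \<xi>) \<and> \<xi> \<bullet> (A x *v \<xi>) \<le> a\<^sub>1 * (norm \<xi>)\<^sup>2))"

definition weak_form ::
  "plane set \<Rightarrow> (plane \<Rightarrow> real^2^2) \<Rightarrow> (plane \<Rightarrow> plane) \<Rightarrow> (plane \<Rightarrow> real) \<Rightarrow>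
   (plane \<Rightarrow> real) \<Rightarrow> (plane \<Rightarrow> real) \<Rightarrow> real" where
  "weak_form \<Omega> A b \<gamma> u v =
     L2_inner (lebesgue_on \<Omega>) (\<lambda>x. A x *v wgrad \<Omega> u x) (wgrad \<Omega> v)
     + L2_inner (lebesgue_on \<Omega>) u (\<lambda>x. b x \<bullet> wgrad \<Omega> v x)
     + L2_inner (lebesgue_on \<Omega>) (\<lambda>x. \<gamma> x * u x) v"

definition weak_solution ::
  "plane set \<Rightarrow> (plane \<Rightarrow> real^2^2) \<Rightarrow> (plane \<Rightarrow> plane) \<Rightarrow> (plane \<Rightarrow> real) \<Rightarrow>
   (plane \<Rightarrow> real) \<Rightarrow> (plane \<Rightarrow> real) \<Rightarrow> bool" where
  "weak_solution \<Omega> A b \<gamma> f u \<longleftrightarrow>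
     u \<in> H10 \<Omega> \<and> (\<forall>v\<in>H10 \<Omega>. weak_form \<Omega> A b \<gamma> u v = L2_inner (lebesgue_on \<Omega>) f v)"

definition adjoint_weak_solution ::
  "plane set \<Rightarrow> (plane \<Rightarrow> real^2^2) \<Rightarrow> (plane \<Rightarrow> plane) \<Rightarrow> (plane \<Rightarrow> real) \<Rightarrow>
   (plane \<Rightarrow> real) \<Rightarrow> (plane \<Rightarrow> real) \<Rightarrow> bool" where
  "adjoint_weak_solution \<Omega> A b \<gamma> g \<Phi> \<longleftrightarrow>
     \<Phi> \<in> H10 \<Omega> \<and> (\<forall>v\<in>H10 \<Omega>. weak_form \<Omega> A b \<gamma> v \<Phi> = L2_inner (lebesgue_on \<Omega>) g v)"

definition injective_operator ::
  "plane set \<Rightarrow> (plane \<Rightarrow> real^2^2) \<Rightarrow> (plane \<Rightarrow> plane) \<Rightarrow> (plane \<Rightarrow> real) \<Rightarrow> bool" where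
  "injective_operator \<Omega> A b \<gamma> \<longleftrightarrow>
     (\<forall>u\<in>H10 \<Omega>. (\<forall>v\<in>H10 \<Omega>. weak_form \<Omega> A b \<gamma> u v = 0) \<longrightarrow> (AE x in lebesgue_on \<Omega>. u x = 0))"

definition elliptic_regularity ::
  "plane set \<Rightarrow> (plane \<Rightarrow> real^2^2) \<Rightarrow> (plane \<Rightarrow> plane) \<Rightarrow> (plane \<Rightarrow> real) \<Rightarrow> real \<Rightarrow> bool" where
  "elliptic_regularity \<Omega> A b \<gamma> s \<longleftrightarrow> 0 < s \<and> s \<le> 1 \<and>
     (\<exists>C. \<forall>f \<in> L2 (lebesgue_on \<Omega>). \<forall>u.
        weak_solution \<Omega> A b \<gamma> f u \<or> adjoint_weak_solution \<Omega> A b \<gamma> f u \<longrightarrow>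
        u \<in> H1s s \<Omega> \<and> H1s_norm s \<Omega> u \<le> C * L2_norm (lebesgue_on \<Omega>) f)"


section \<open>The discrete problem\<close>

type_synonym stabilization = "polygon \<Rightarrow> (plane \<Rightarrow> real) \<Rightarrow> (plane \<Rightarrow> real) \<Rightarrow> real"

text \<open>Together with the Cauchy-Schwarz inequality, the last condition in the definition of \<open>spd_form\<close>
  makes the form well defined on classes of functions that agree almost everywhere.\<close>

definition spd_form :: "polygon \<Rightarrow> ((plane \<Rightarrow> real) \<Rightarrow> (plane \<Rightarrow> real) \<Rightarrow> real) \<Rightarrow> bool" where
  "spd_form P s \<longleftrightarrow>
     (\<forall>v\<in>VP P. \<forall>w\<in>VP P. s v w = s w v) \<and>
     (\<forall>v\<in>VP P. \<forall>w\<in>VP P. \<forall>z\<in>VP P. \<forall>\<alpha> \<beta>.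
        s (\<lambda>x. \<alpha> * v x + \<beta> * w x) z = \<alpha> * s v z + \<beta> * s w z) \<and>
     (\<forall>v\<in>VP P. s v v \<ge> 0 \<and> (s v v = 0 \<longleftrightarrow> (AE x in Leb P. v x = 0)))"

definition admissible_stabilization ::
  "(plane \<Rightarrow> real^2^2) \<Rightarrow> real \<Rightarrow> polygon set \<Rightarrow> stabilization \<Rightarrow> bool" where
  "admissible_stabilization A C\<^sub>s \<T> S \<longleftrightarrow> (\<forall>P\<in>\<T>. spd_form P (S P) \<and>
     (\<forall>v\<in>VP P. proj 1 P v = (\<lambda>x. 0) \<longrightarrow>
        inverse C\<^sub>s * L2_inner (Leb P) (\<lambda>x. A x *v pgrad P v x) (pgrad P v) \<le> S P v v \<and>
        S P v v \<le> C\<^sub>s * L2_inner (Leb P) (\<lambda>x. A x *v pgrad P v x) (pgrad P v)))"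

definition Bh ::
  "polygon set \<Rightarrow> (plane \<Rightarrow> real^2^2) \<Rightarrow> (plane \<Rightarrow> plane) \<Rightarrow> (plane \<Rightarrow> real) \<Rightarrow> stabilization \<Rightarrow>
   (plane \<Rightarrow> real) \<Rightarrow> (plane \<Rightarrow> real) \<Rightarrow> real" where
  "Bh \<T> A b \<gamma> S u v = (\<Sum>P\<in>\<T>.
     L2_inner (Leb P) (\<lambda>x. A x *v pgrad P (proj 1 P u) x) (pgrad P (proj 1 P v))
     + S P (\<lambda>x. u x - proj 1 P u x) (\<lambda>x. v x - proj 1 P v x)
     + L2_inner (Leb P) (proj 1 P u) (\<lambda>x. b x \<bullet> pgrad P (proj 1 P v) x)
     + L2_inner (Leb P) (\<lambda>x. \<gamma> x * proj 1 P u x) (proj 1 P v))"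

definition discrete_solution ::
  "plane set \<Rightarrow> polygon set \<Rightarrow> (plane \<Rightarrow> real^2^2) \<Rightarrow> (plane \<Rightarrow> plane) \<Rightarrow> (plane \<Rightarrow> real) \<Rightarrow>
   stabilization \<Rightarrow> (plane \<Rightarrow> real) \<Rightarrow> (plane \<Rightarrow> real) \<Rightarrow> bool" where
  "discrete_solution \<Omega> \<T> A b \<gamma> S f u\<^sub>h \<longleftrightarrow> u\<^sub>h \<in> Vh \<Omega> \<T> \<and>
     (\<forall>v\<in>Vh \<Omega> \<T>. Bh \<T> A b \<gamma> S u\<^sub>h v = (\<Sum>P\<in>\<T>. L2_inner (Leb P) f (proj 1 P v)))"

definition unique_discrete_solution ::
  "plane set \<Rightarrow> polygon set \<Rightarrow> (plane \<Rightarrow> real^2^2) \<Rightarrow> (plane \<Rightarrow> plane) \<Rightarrow> (plane \<Rightarrow> real) \<Rightarrow>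
   stabilization \<Rightarrow> (plane \<Rightarrow> real) \<Rightarrow> (plane \<Rightarrow> real) \<Rightarrow> bool" where
  "unique_discrete_solution \<Omega> \<T> A b \<gamma> S f u\<^sub>h \<longleftrightarrow> discrete_solution \<Omega> \<T> A b \<gamma> S f u\<^sub>h \<and>
     (\<forall>w. discrete_solution \<Omega> \<T> A b \<gamma> S f w \<longrightarrow> (AE x in lebesgue_on \<Omega>. w x = u\<^sub>h x))"


section \<open>The error estimator\<close>

definition eta :: "(plane \<Rightarrow> real) \<Rightarrow> (plane \<Rightarrow> real) \<Rightarrow> (plane \<Rightarrow> real) \<Rightarrow> polygon \<Rightarrow> real" where
  "eta \<gamma> f u\<^sub>h P = diameter (pts P) * L2_norm (Leb P) (\<lambda>x. f x - \<gamma> x * proj 1 P u\<^sub>h x)"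

definition zeta :: "stabilization \<Rightarrow> (plane \<Rightarrow> real) \<Rightarrow> polygon \<Rightarrow> real" where
  "zeta S u\<^sub>h P = sqrt (S P (\<lambda>x. u\<^sub>h x - proj 1 P u\<^sub>h x) (\<lambda>x. u\<^sub>h x - proj 1 P u\<^sub>h x))"

definition Lam ::
  "(plane \<Rightarrow> real^2^2) \<Rightarrow> (plane \<Rightarrow> plane) \<Rightarrow> (plane \<Rightarrow> real) \<Rightarrow> polygon \<Rightarrow> real" where
  "Lam A b u\<^sub>h P =
     (let F = (\<lambda>x. A x *v pgrad P (proj 1 P u\<^sub>h) x + proj 1 P u\<^sub>h x *\<^sub>R b x)
      in L2_norm (Leb P) (\<lambda>x. F x - vproj 0 P F x))"

definition Xi :: "plane set \<Rightarrow> polygon set \<Rightarrow> (plane \<Rightarrow> real) \<Rightarrow> polygon \<Rightarrow> real" where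
  "Xi \<Omega> \<T> u\<^sub>h P = sqrt (\<Sum>E\<in>edges P. inverse (diameter E) *
     (L2_norm (edge_measure E) (jump \<Omega> \<T> (\<lambda>P'. proj 1 P' u\<^sub>h) E))\<^sup>2)"

definition flux ::
  "plane set \<Rightarrow> (plane \<Rightarrow> real^2^2) \<Rightarrow> (plane \<Rightarrow> plane) \<Rightarrow> (plane \<Rightarrow> real) \<Rightarrow> plane \<Rightarrow> plane" where
  "flux \<Omega> A b u x = A x *v wgrad \<Omega> u x + u x *\<^sub>R b x"

abbreviation err_norm :: "(plane \<Rightarrow> real) \<Rightarrow> (plane \<Rightarrow> real) \<Rightarrow> polygon \<Rightarrow> real" where
  "err_norm u u\<^sub>h P \<equiv> H1_norm (interior (pts P)) (\<lambda>x. u x - u\<^sub>h x)"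

abbreviation err_semi :: "(plane \<Rightarrow> real) \<Rightarrow> (plane \<Rightarrow> real) \<Rightarrow> polygon \<Rightarrow> real" where
  "err_semi u u\<^sub>h P \<equiv> H1_seminorm (interior (pts P)) (\<lambda>x. u x - u\<^sub>h x)"

abbreviation err_proj :: "(plane \<Rightarrow> real) \<Rightarrow> (plane \<Rightarrow> real) \<Rightarrow> polygon \<Rightarrow> real" where
  "err_proj u u\<^sub>h P \<equiv> H1_seminorm (interior (pts P)) (\<lambda>x. u x - proj 1 P u\<^sub>h x)"

abbreviation flux_osc :: "(plane \<Rightarrow> plane) \<Rightarrow> polygon \<Rightarrow> real" where
  "flux_osc F P \<equiv> L2_norm (Leb P) (\<lambda>x. F x - vproj 0 P F x)"

end

theory Submission
  imports Defs
begin

text \<open>The bound for \<open>\<zeta>\<^sub>P\<close> is the equivalence of the stabilization with the energy, and that for \<open>\<Lambda>\<^sub>P\<close> follows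
  from the best approximation property of \<open>\<Pi>\<^sub>0\<close>. For \<open>\<eta>\<^sub>P\<close> the weak equation is tested with a bubble function
  times the affine part of the residual; the bubble may be supported in a ball inside \<open>P\<close> because affine
  functions on \<open>P\<close> are controlled by their values on that ball. Lower order terms are absorbed by the
  Poincare inequality for \<open>u\<^sub>h - \<Pi>\<^sub>1 u\<^sub>h\<close>, which has mean zero on \<open>P\<close>. For \<open>\<Xi>\<^sub>P\<close> the jump of \<open>u - u\<^sub>h\<close> has mean
  zero on each edge, so that constants can be subtracted from the two traces before the trace and Poincare
  inequalities are applied.

  Since \<open>P\<close> is the union of the triangles spanned by a point \<open>y\<close> of its star centre and the edges,
  integrating \<open>2 F + \<nabla>F \<bullet> (x - y)\<close> along rays from \<open>y\<close> gives a weighted sum of the integrals of \<open>F\<close> over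
  the edges. With \<open>F = v\<^sup>2\<close> this is the trace inequality, and the difference for two choices of \<open>y\<close> is the
  divergence theorem.\<close>

section \<open>Square integrable functions\<close>

text \<open>Weak gradients and traces are chosen from a defining property, so nothing can be
  computed before uniqueness of the gradient and existence of the trace are known; both rest on
  mollification. Contracting a polygon towards its star centre before convolving keeps the kernel
  away from the boundary. Hence functions smooth on the whole plane are dense in H^1 of the polygon,
  and every estimate is proved for them and passed to the limit. Uniformity in the mesh comes from
  scaling: \<open>h / r \<le> 1 / \<rho>\<close>, the Poincare inequality gains a factor
  \<open>h\<close>, the trace inequality a factor \<open>sqrt h\<close>, which cancels the weight
  \<open>|E|^(-1/2)\<close> of the jumps. The stabilization is controlled only on
  \<open>VP P\<close>, so the remainder of the projection must be shown to lie there: an affine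
  function has constant normal derivative on each edge, which is what the divergence theorem is
  needed for. That \<open>u\<close> itself does not jump holds because its traces from the two sides
  of an edge are limits of the same test functions on \<Omega>, and these vanish on the
  boundary.\<close>

lemma norm_vec2_sq: "(norm (v::plane))\<^sup>2 = (v $ 1)\<^sup>2 + (v $ 2)\<^sup>2"
  by (simp add: norm_vec_def L2_set_def sum_2)

lemma L2D:
  assumes "f \<in> L2 M"
  shows "f \<in> borel_measurable M" "integrable M (\<lambda>x. (norm (f x))\<^sup>2)"
  using assms by (auto simp: L2_def)

lemma L2_norm_nonneg [simp]: "0 \<le> L2_norm M f"
  by (simp add: L2_norm_def)

lemma L2_norm_power2: "(L2_norm M f)\<^sup>2 = (LINT x|M. (norm (f x))\<^sup>2)"
  by (simp add: L2_norm_def)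

lemma L2_norm_eq_inner: "(L2_norm M f)\<^sup>2 = L2_inner M f f"
  by (simp add: L2_norm_def L2_inner_def dot_square_norm)

text \<open>Membership and norm bound come from one pointwise domination; products with bounded
  factors such as coefficients, bubbles and indicators are all treated this way.\<close>

lemma L2_dominated:
  assumes g: "g \<in> L2 M" and f: "f \<in> borel_measurable M" and K: "K \<ge> 0"
    and le: "AE x in M. norm (f x) \<le> K * norm (g x)"
  shows "f \<in> L2 M" "L2_norm M f \<le> K * L2_norm M g"
proof -
  have le2: "AE x in M. (norm (f x))\<^sup>2 \<le> K\<^sup>2 * (norm (g x))\<^sup>2"
    using le
  proof eventually_elim
    case (elim x)
    from power_mono[OF elim norm_ge_zero, of 2] show ?case by (simp add: power_mult_distrib)
  qed
  have i: "integrable M (\<lambda>x. K\<^sup>2 * (norm (g x))\<^sup>2)"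
    using L2D(2)[OF g] by simp
  have j: "integrable M (\<lambda>x. (norm (f x))\<^sup>2)"
    by (rule Bochner_Integration.integrable_bound[OF i]) (use f le2 in auto)
  then show "f \<in> L2 M" using f by (simp add: L2_def)
  have "(L2_norm M f)\<^sup>2 \<le> (LINT x|M. K\<^sup>2 * (norm (g x))\<^sup>2)"
    unfolding L2_norm_power2 by (rule integral_mono_AE[OF j i le2])
  also have "\<dots> = (K * L2_norm M g)\<^sup>2" by (simp add: L2_norm_power2 power_mult_distrib)
  finally show "L2_norm M f \<le> K * L2_norm M g"
    using K by (meson L2_norm_nonneg mult_nonneg_nonneg power2_le_imp_le)
qed

lemma L2_add:
  fixes f g :: "plane \<Rightarrow> 'a::euclidean_space"
  assumes f: "f \<in> L2 M" and g: "g \<in> L2 M"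
  shows "(\<lambda>x. f x + g x) \<in> L2 M"
proof -
  have le: "(norm (f x + g x))\<^sup>2 \<le> 2 * (norm (f x))\<^sup>2 + 2 * (norm (g x))\<^sup>2" for x
  proof -
    have "(norm (f x + g x))\<^sup>2 \<le> (norm (f x) + norm (g x))\<^sup>2"
      by (intro power_mono norm_triangle_ineq) simp
    also have "\<dots> \<le> 2 * (norm (f x))\<^sup>2 + 2 * (norm (g x))\<^sup>2"
      using sum_squares_bound[of "norm (f x)" "norm (g x)"] by (simp add: power2_sum)
    finally show ?thesis .
  qed
  have "integrable M (\<lambda>x. 2 * (norm (f x))\<^sup>2 + 2 * (norm (g x))\<^sup>2)"
    using L2D[OF f] L2D[OF g] by simp
  then have "integrable M (\<lambda>x. (norm (f x + g x))\<^sup>2)"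
    by (rule Bochner_Integration.integrable_bound) (use L2D[OF f] L2D[OF g] le in auto)
  then show ?thesis using L2D[OF f] L2D[OF g] by (simp add: L2_def)
qed

lemma L2_scaleR:
  fixes f :: "plane \<Rightarrow> 'a::euclidean_space"
  shows "f \<in> L2 M \<Longrightarrow> (\<lambda>x. c *\<^sub>R f x) \<in> L2 M"
  by (rule L2_dominated(1)[where g = f and K = "\<bar>c\<bar>"]) (auto dest: L2D)

lemma L2_mult:
  fixes f :: "plane \<Rightarrow> real"
  shows "f \<in> L2 M \<Longrightarrow> (\<lambda>x. c * f x) \<in> L2 M"
  using L2_scaleR[of f M c] by simp

lemma L2_diff:
  fixes f g :: "plane \<Rightarrow> 'a::euclidean_space"
  assumes "f \<in> L2 M" "g \<in> L2 M"
  shows "(\<lambda>x. f x - g x) \<in> L2 M"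
  using L2_add[OF assms(1) L2_scaleR[OF assms(2), of "-1"]] by simp

lemma L2_zero [simp]: "(\<lambda>x. 0) \<in> L2 M"
  by (simp add: L2_def)

lemma L2_norm_zero [simp]: "L2_norm M (\<lambda>x. 0) = 0"
  by (simp add: L2_norm_def)

lemma L2_const: "finite_measure M \<Longrightarrow> (\<lambda>x. c) \<in> L2 M"
  by (simp add: L2_def finite_measure.integrable_const)

lemma L2_inner_integrable:
  fixes f g :: "plane \<Rightarrow> 'a::euclidean_space"
  assumes f: "f \<in> L2 M" and g: "g \<in> L2 M"
  shows "integrable M (\<lambda>x. f x \<bullet> g x)"
proof -
  have i: "integrable M (\<lambda>x. (norm (f x))\<^sup>2 + (norm (g x))\<^sup>2)"
    using L2D[OF f] L2D[OF g] by simp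
  have le: "norm (f x \<bullet> g x) \<le> norm ((norm (f x))\<^sup>2 + (norm (g x))\<^sup>2)" for x
  proof -
    have "\<bar>f x \<bullet> g x\<bar> \<le> norm (f x) * norm (g x)" by (rule Cauchy_Schwarz_ineq2)
    moreover have "2 * norm (f x) * norm (g x) \<le> (norm (f x))\<^sup>2 + (norm (g x))\<^sup>2"
      by (rule sum_squares_bound)
    moreover have "0 \<le> norm (f x) * norm (g x)" by simp
    ultimately show ?thesis by simp
  qed
  show ?thesis
    by (rule Bochner_Integration.integrable_bound[OF i]) (use L2D[OF f] L2D[OF g] le in auto)
qed

lemma L2_mult_integrable:
  fixes f g :: "plane \<Rightarrow> real"
  assumes "f \<in> L2 M" "g \<in> L2 M"
  shows "integrable M (\<lambda>x. f x * g x)"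
  using L2_inner_integrable[OF assms] by simp

lemma L2_integrable:
  fixes f :: "plane \<Rightarrow> 'a::euclidean_space"
  assumes "f \<in> L2 M" and "finite_measure M"
  shows "integrable M f"
proof -
  have i: "integrable M (\<lambda>x. 1 + (norm (f x))\<^sup>2)"
    by (rule Bochner_Integration.integrable_add[OF finite_measure.integrable_const[OF assms(2)] L2D(2)[OF assms(1)]])
  have le: "norm (f x) \<le> norm (1 + (norm (f x))\<^sup>2)" for x
  proof -
    have "2 * norm (f x) \<le> 1 + (norm (f x))\<^sup>2" using sum_squares_bound[of 1 "norm (f x)"] by simp
    then have "norm (f x) \<le> 1 + (norm (f x))\<^sup>2" using norm_ge_zero[of "f x"] by linarith
    then show ?thesis by simp
  qed
  show ?thesis
    by (rule Bochner_Integration.integrable_bound[OF i]) (use L2D[OF assms(1)] le in auto)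
qed

text \<open>Nonnegativity of this quadratic polynomial in \<open>t\<close> gives the Cauchy-Schwarz
  inequality, \<open>t = 1\<close> the triangle inequality, and a vanishing middle term Pythagoras
  and hence best approximation by constants.\<close>

lemma L2_norm_add_scaleR_sq:
  fixes f g :: "plane \<Rightarrow> 'a::euclidean_space"
  assumes f: "f \<in> L2 M" and g: "g \<in> L2 M"
  shows "(L2_norm M (\<lambda>x. f x + t *\<^sub>R g x))\<^sup>2
    = (L2_norm M f)\<^sup>2 + 2 * t * L2_inner M f g + t\<^sup>2 * (L2_norm M g)\<^sup>2"
proof -
  have "(norm (f x + t *\<^sub>R g x))\<^sup>2 = (norm (f x))\<^sup>2 + 2 * t * (f x \<bullet> g x) + t\<^sup>2 * (norm (g x))\<^sup>2" for x
    unfolding power2_norm_eq_inner by (simp add: inner_simps inner_commute algebra_simps power2_eq_square)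
  then show ?thesis
    using L2_inner_integrable[OF f g] L2D[OF f] L2D[OF g] unfolding L2_norm_power2 L2_inner_def by simp
qed

text \<open>The polynomial in \<open>t\<close> is evaluated at its minimum \<open>- b / c\<close>.
  If \<open>c = 0\<close> it is affine in \<open>t\<close>, and \<open>t = - (a + 1) / b\<close>
  would make it negative unless \<open>b = 0\<close>.\<close>

lemma L2_Cauchy_Schwarz:
  fixes f g :: "plane \<Rightarrow> 'a::euclidean_space"
  assumes f: "f \<in> L2 M" and g: "g \<in> L2 M"
  shows "\<bar>L2_inner M f g\<bar> \<le> L2_norm M f * L2_norm M g"
proof -
  define a where "a = (L2_norm M f)\<^sup>2"
  define b where "b = L2_inner M f g"
  define c where "c = (L2_norm M g)\<^sup>2"
  have q: "0 \<le> a + 2 * t * b + t\<^sup>2 * c" for t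
    using L2_norm_add_scaleR_sq[OF f g, of t] zero_le_power2[of "L2_norm M (\<lambda>x. f x + t *\<^sub>R g x)"]
    unfolding a_def b_def c_def by simp
  have "b\<^sup>2 \<le> a * c"
  proof (cases "c = 0")
    case True
    have "b = 0"
    proof (rule ccontr)
      assume "b \<noteq> 0"
      moreover have "0 \<le> a + 2 * (- (a + 1) / b) * b" using q[of "- (a + 1) / b"] True by simp
      ultimately have "0 \<le> a + 2 * (- (a + 1))" by simp
      moreover have "a \<ge> 0" by (simp add: a_def)
      ultimately show False by simp
    qed
    then show ?thesis using True by simp
  next
    case False
    then have "c > 0" by (simp add: c_def)
    have "0 \<le> a + 2 * (- b / c) * b + (- b / c)\<^sup>2 * c" by (rule q)
    also have "\<dots> = a - b\<^sup>2 / c" using \<open>c > 0\<close> by (simp add: field_simps power2_eq_square)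
    finally show ?thesis using \<open>c > 0\<close> by (simp add: field_simps)
  qed
  then have "b\<^sup>2 \<le> (L2_norm M f * L2_norm M g)\<^sup>2"
    by (simp add: a_def c_def power_mult_distrib)
  then show ?thesis
    unfolding b_def by (metis abs_le_square_iff abs_mult abs_of_nonneg L2_norm_nonneg)
qed

lemma L2_norm_triangle:
  fixes f g :: "plane \<Rightarrow> 'a::euclidean_space"
  assumes f: "f \<in> L2 M" and g: "g \<in> L2 M"
  shows "L2_norm M (\<lambda>x. f x + g x) \<le> L2_norm M f + L2_norm M g"
proof (rule power2_le_imp_le)
  show "(L2_norm M (\<lambda>x. f x + g x))\<^sup>2 \<le> (L2_norm M f + L2_norm M g)\<^sup>2"
    using L2_norm_add_scaleR_sq[OF f g, of 1] L2_Cauchy_Schwarz[OF f g] by (simp add: power2_sum)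
qed simp

lemma L2_norm_minus: "L2_norm M (\<lambda>x. - f x) = L2_norm M f"
  by (simp add: L2_norm_def)

lemma L2_norm_minus_commute: "L2_norm M (\<lambda>x. f x - g x) = L2_norm M (\<lambda>x. g x - f x)"
  by (simp add: L2_norm_def norm_minus_commute)

lemma L2_norm_triangle_diff:
  fixes f g :: "plane \<Rightarrow> 'a::euclidean_space"
  assumes f: "f \<in> L2 M" and g: "g \<in> L2 M"
  shows "L2_norm M (\<lambda>x. f x - g x) \<le> L2_norm M f + L2_norm M g"
  using L2_norm_triangle[OF f L2_scaleR[OF g, of "-1"]] by (simp add: L2_norm_minus)

lemma L2_norm_triangle3:
  fixes f g h :: "plane \<Rightarrow> 'a::euclidean_space"
  assumes f: "f \<in> L2 M" and g: "g \<in> L2 M" and h: "h \<in> L2 M"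
  shows "L2_norm M (\<lambda>x. f x - h x) \<le> L2_norm M (\<lambda>x. f x - g x) + L2_norm M (\<lambda>x. g x - h x)"
  using L2_norm_triangle[OF L2_diff[OF f g] L2_diff[OF g h]] by simp

lemma L2_norm_scaleR: "L2_norm M (\<lambda>x. c *\<^sub>R f x) = \<bar>c\<bar> * L2_norm M f"
  by (simp add: L2_norm_def power_mult_distrib real_sqrt_mult)

lemma L2_norm_mult: "L2_norm M (\<lambda>x. c * f x) = \<bar>c\<bar> * L2_norm M (f :: plane \<Rightarrow> real)"
  by (simp add: L2_norm_def power_mult_distrib abs_mult real_sqrt_mult)

lemma L2_norm_eq_0_iff:
  assumes "f \<in> L2 M"
  shows "L2_norm M f = 0 \<longleftrightarrow> (AE x in M. f x = 0)"
proof -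
  have "L2_norm M f = 0 \<longleftrightarrow> (LINT x|M. (norm (f x))\<^sup>2) = 0"
    by (simp add: L2_norm_def)
  also have "\<dots> \<longleftrightarrow> (AE x in M. (norm (f x))\<^sup>2 = 0)"
    by (rule integral_nonneg_eq_0_iff_AE) (use L2D[OF assms] in auto)
  finally show ?thesis by simp
qed

lemma L2_norm_const: "L2_norm M (\<lambda>x. c) = norm c * sqrt (measure M (space M))"
  by (simp add: L2_norm_def real_sqrt_mult)

lemma L2_vec_iff:
  fixes g :: "plane \<Rightarrow> plane"
  shows "g \<in> L2 M \<longleftrightarrow> (\<forall>i. (\<lambda>x. g x $ i) \<in> L2 M)"
proof
  assume g: "g \<in> L2 M"
  show "\<forall>i. (\<lambda>x. g x $ i) \<in> L2 M"
  proof
    fix i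
    have m: "(\<lambda>x. g x $ i) \<in> borel_measurable M"
      using L2D(1)[OF g] by (intro borel_measurable_continuous_on[where g = g and f = "\<lambda>v. v $ i"] continuous_intros)
    show "(\<lambda>x. g x $ i) \<in> L2 M"
      by (rule L2_dominated(1)[OF g m, of 1]) (simp_all add: component_le_norm_cart)
  qed
next
  assume a: "\<forall>i. (\<lambda>x. g x $ i) \<in> L2 M"
  have e: "g = (\<lambda>x. (g x $ 1) *\<^sub>R axis 1 1 + (g x $ 2) *\<^sub>R axis 2 1)"
    by (auto simp: fun_eq_iff vec_eq_iff axis_def forall_2)
  have s: "(\<lambda>x. (g x $ i) *\<^sub>R (axis i 1::plane)) \<in> L2 M" for i
  proof (rule L2_dominated(1)[where g = "\<lambda>x. g x $ i" and K = 1])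
    have "(\<lambda>x. g x $ i) \<in> borel_measurable M" using a by (auto dest: L2D)
    then show "(\<lambda>x. (g x $ i) *\<^sub>R (axis i 1::plane)) \<in> borel_measurable M" by measurable
  qed (use a in auto)
  show "g \<in> L2 M" by (subst e, rule L2_add) (auto intro: s)
qed

lemma L2_norm_vec:
  fixes g :: "plane \<Rightarrow> plane"
  assumes "g \<in> L2 M"
  shows "(L2_norm M g)\<^sup>2 = (L2_norm M (\<lambda>x. g x $ 1))\<^sup>2 + (L2_norm M (\<lambda>x. g x $ 2))\<^sup>2"
  using L2D(2)[of "\<lambda>x. g x $ 1" M] L2D(2)[of "\<lambda>x. g x $ 2" M] assms
  by (simp add: L2_norm_power2 norm_vec2_sq L2_vec_iff)

lemma L2_inner_add_left:
  fixes f g h :: "plane \<Rightarrow> 'a::euclidean_space"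
  assumes "f \<in> L2 M" "g \<in> L2 M" "h \<in> L2 M"
  shows "L2_inner M (\<lambda>x. f x + g x) h = L2_inner M f h + L2_inner M g h"
  using L2_inner_integrable[OF assms(1,3)] L2_inner_integrable[OF assms(2,3)]
  by (simp add: L2_inner_def inner_add_left)

lemma L2_inner_diff_left:
  fixes f g h :: "plane \<Rightarrow> 'a::euclidean_space"
  assumes "f \<in> L2 M" "g \<in> L2 M" "h \<in> L2 M"
  shows "L2_inner M (\<lambda>x. f x - g x) h = L2_inner M f h - L2_inner M g h"
  using L2_inner_integrable[OF assms(1,3)] L2_inner_integrable[OF assms(2,3)]
  by (simp add: L2_inner_def inner_diff_left)

lemma L2_inner_commute: "L2_inner M f g = L2_inner M g f"
  by (simp add: L2_inner_def inner_commute)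

lemma L2_inner_diff_right:
  fixes f g h :: "plane \<Rightarrow> 'a::euclidean_space"
  assumes "f \<in> L2 M" "g \<in> L2 M" "h \<in> L2 M"
  shows "L2_inner M h (\<lambda>x. f x - g x) = L2_inner M h f - L2_inner M h g"
  using L2_inner_diff_left[OF assms] by (simp add: L2_inner_commute)

text \<open>Riesz-Fischer, needed for the edge measures, on which traces arise as limits. A
  subsequence with summable L1 gaps converges almost everywhere, and Fatou's lemma turns its
  pointwise limit into the L2 limit of the whole sequence.\<close>

lemma L2_complete:
  fixes f :: "nat \<Rightarrow> plane \<Rightarrow> real"
  assumes fin: "finite_measure M" and f: "\<And>n. f n \<in> L2 M"
    and cauchy: "\<And>e. e > 0 \<Longrightarrow> \<exists>N. \<forall>m\<ge>N. \<forall>n\<ge>N. L2_norm M (\<lambda>x. f m x - f n x) < e"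
  shows "\<exists>g. g \<in> L2 M \<and> (\<lambda>n. L2_norm M (\<lambda>x. g x - f n x)) \<longlonglongrightarrow> 0"
proof -
  interpret finite_measure M by (rule fin)
  have [measurable]: "f n \<in> borel_measurable M" for n using f L2D by blast
  \<comment> \<open>\<open>V\<close> dominates the factor between the L1 and L2 norms and is
    positive even for the zero measure, so dividing by it makes the L1 gaps at most
    \<open>(1/2)^k\<close>.\<close>
  define V where "V = 1 + sqrt (measure M (space M))"
  have V: "V > 0" by (simp add: V_def add_pos_nonneg)
  have "\<exists>N. \<forall>m\<ge>N. \<forall>n\<ge>N. L2_norm M (\<lambda>x. f m x - f n x) < (1/2)^k / V" for k
    by (rule cauchy) (simp add: V)
  then obtain N where N: "\<And>k m n. N k \<le> m \<Longrightarrow> N k \<le> n \<Longrightarrow> L2_norm M (\<lambda>x. f m x - f n x) < (1/2)^k / V"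
    by metis
  \<comment> \<open>The sum makes \<open>r\<close> monotone and at least \<open>N k\<close>; the
    summand \<open>k\<close> makes it tend to infinity even if all \<open>N j\<close>
    vanish.\<close>
  define r where "r k = k + (\<Sum>j\<le>k. N j)" for k
  have rN: "N k \<le> r k" for k unfolding r_def by (simp add: member_le_sum trans_le_add2)
  have rS: "r k \<le> r (Suc k)" for k unfolding r_def by simp
  have L1: "(LINT x|M. \<bar>f m x - f n x\<bar>) \<le> L2_norm M (\<lambda>x. f m x - f n x) * sqrt (measure M (space M))" for m n
  proof -
    have "(\<lambda>x. \<bar>f m x - f n x\<bar>) \<in> L2 M"
      by (rule L2_dominated(1)[OF L2_diff[OF f f], of _ 1 m n]) auto
    from L2_Cauchy_Schwarz[OF this L2_const[OF fin, of 1]] show ?thesis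
      by (simp add: L2_inner_def L2_norm_def)
  qed
  have i1: "integrable M (\<lambda>x. f m x - f n x)" for m n
    by (rule L2_integrable[OF L2_diff[OF f f] fin])
  have small: "(\<integral>\<^sup>+x. ennreal \<bar>f (r (Suc k)) x - f (r k) x\<bar> \<partial>M) \<le> ennreal ((1/2)^k)" for k
  proof -
    have "(\<integral>\<^sup>+x. ennreal \<bar>f (r (Suc k)) x - f (r k) x\<bar> \<partial>M) = ennreal (LINT x|M. \<bar>f (r (Suc k)) x - f (r k) x\<bar>)"
      by (rule nn_integral_eq_integral) (use i1 in auto)
    also have "(LINT x|M. \<bar>f (r (Suc k)) x - f (r k) x\<bar>) \<le> ((1/2)^k / V) * V"
      by (rule order_trans[OF L1 mult_mono]) (use N[of k] rN[of k] rS[of k] V in \<open>auto simp: V_def intro: less_imp_le\<close>)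
    finally show ?thesis using V by (simp add: ennreal_leI)
  qed
  have "(\<integral>\<^sup>+x. (\<Sum>k. ennreal \<bar>f (r (Suc k)) x - f (r k) x\<bar>) \<partial>M) = (\<Sum>k. \<integral>\<^sup>+x. ennreal \<bar>f (r (Suc k)) x - f (r k) x\<bar> \<partial>M)"
    by (rule nn_integral_suminf) measurable
  also have "\<dots> \<le> (\<Sum>k. ennreal ((1/2)^k))" by (intro suminf_le small) auto
  also have "\<dots> = ennreal (\<Sum>k. (1/2)^k)" by (rule suminf_ennreal2) auto
  also have "\<dots> < \<infinity>" by simp
  finally have "AE x in M. (\<Sum>k. ennreal \<bar>f (r (Suc k)) x - f (r k) x\<bar>) \<noteq> \<infinity>"
    by (intro nn_integral_PInf_AE) auto
  then have "AE x in M. convergent (\<lambda>k. f (r k) x)"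
  proof eventually_elim
    case (elim x)
    have "summable (\<lambda>k. \<bar>f (r (Suc k)) x - f (r k) x\<bar>)"
      using elim by (intro summable_suminf_not_top) auto
    then have "summable (\<lambda>k. f (r (Suc k)) x - f (r k) x)"
      by (rule summable_rabs_cancel)
    then have "convergent (\<lambda>n. \<Sum>k<n. f (r (Suc k)) x - f (r k) x)"
      by (simp add: summable_iff_convergent)
    from convergent_add[OF this convergent_const[of "f (r 0) x"]]
    have "convergent (\<lambda>n. (f (r n) x - f (r 0) x) + f (r 0) x)"
      using sum_lessThan_telescope[of "\<lambda>k. f (r k) x"] by simp
    then show ?case by simp
  qed
  then have lim: "AE x in M. (\<lambda>k. f (r k) x) \<longlonglongrightarrow> lim (\<lambda>k. f (r k) x)"
    by eventually_elim (simp add: convergent_LIMSEQ_iff)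
  define g where "g x = lim (\<lambda>k. f (r k) x)" for x
  have gm [measurable]: "g \<in> borel_measurable M"
    unfolding g_def by measurable
  \<comment> \<open>Fatou's lemma along the subsequence, with \<open>n\<close> arbitrary beyond the
    Cauchy index; this is where the whole sequence is reached.\<close>
  have key: "(\<integral>\<^sup>+x. ennreal ((g x - f n x)\<^sup>2) \<partial>M) \<le> ennreal (e\<^sup>2)"
    if "e > 0" and E: "\<forall>m\<ge>N. \<forall>n\<ge>N. L2_norm M (\<lambda>x. f m x - f n x) < e" and n: "n \<ge> N" for e N n
  proof -
    have "(\<integral>\<^sup>+x. ennreal ((g x - f n x)\<^sup>2) \<partial>M) = (\<integral>\<^sup>+x. liminf (\<lambda>k. ennreal ((f (r k) x - f n x)\<^sup>2)) \<partial>M)"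
    proof (rule nn_integral_cong_AE, use lim in eventually_elim)
      fix x assume "(\<lambda>k. f (r k) x) \<longlonglongrightarrow> lim (\<lambda>k. f (r k) x)"
      then have "(\<lambda>k. f (r k) x) \<longlonglongrightarrow> g x" by (simp add: g_def)
      then have "(\<lambda>k. ennreal ((f (r k) x - f n x)\<^sup>2)) \<longlonglongrightarrow> ennreal ((g x - f n x)\<^sup>2)"
        by (intro tendsto_intros)
      then show "ennreal ((g x - f n x)\<^sup>2) = liminf (\<lambda>k. ennreal ((f (r k) x - f n x)\<^sup>2))"
        using lim_imp_Liminf by (metis sequentially_bot)
    qed
    also have "\<dots> \<le> liminf (\<lambda>k. \<integral>\<^sup>+x. ennreal ((f (r k) x - f n x)\<^sup>2) \<partial>M)"
      by (rule nn_integral_liminf) measurable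
    also have "\<dots> \<le> liminf (\<lambda>k::nat. ennreal (e\<^sup>2))"
    proof (rule Liminf_mono)
      show "\<forall>\<^sub>F k in sequentially. (\<integral>\<^sup>+x. ennreal ((f (r k) x - f n x)\<^sup>2) \<partial>M) \<le> ennreal (e\<^sup>2)"
        using eventually_ge_at_top[of N]
      proof eventually_elim
        case (elim k)
        then have "r k \<ge> N" by (simp add: r_def)
        then have l: "L2_norm M (\<lambda>x. f (r k) x - f n x) < e" using E n by blast
        have "(\<integral>\<^sup>+x. ennreal ((f (r k) x - f n x)\<^sup>2) \<partial>M) = ennreal (LINT x|M. (f (r k) x - f n x)\<^sup>2)"
          by (rule nn_integral_eq_integral) (use L2D(2)[OF L2_diff[OF f f, of "r k" n]] in auto)
        also have "(LINT x|M. (f (r k) x - f n x)\<^sup>2) = (L2_norm M (\<lambda>x. f (r k) x - f n x))\<^sup>2"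
          by (simp add: L2_norm_power2)
        also have "\<dots> \<le> e\<^sup>2" by (rule power_mono) (use l in auto)
        finally show ?case by (simp add: ennreal_leI)
      qed
    qed
    also have "\<dots> = ennreal (e\<^sup>2)" by (simp add: Liminf_const)
    finally show ?thesis .
  qed
  have key2: "(\<lambda>x. g x - f n x) \<in> L2 M \<and> L2_norm M (\<lambda>x. g x - f n x) \<le> e"
    if "e > 0" and E: "\<forall>m\<ge>N. \<forall>n\<ge>N. L2_norm M (\<lambda>x. f m x - f n x) < e" and n: "n \<ge> N" for e N n
  proof -
    have k: "(\<integral>\<^sup>+x. ennreal ((g x - f n x)\<^sup>2) \<partial>M) \<le> ennreal (e\<^sup>2)" by (rule key[OF that])
    then have i: "integrable M (\<lambda>x. (g x - f n x)\<^sup>2)"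
      by (intro integrableI_bounded) (auto simp: less_top[symmetric] top_unique)
    then have "ennreal (LINT x|M. (g x - f n x)\<^sup>2) \<le> ennreal (e\<^sup>2)"
      using k by (subst (asm) nn_integral_eq_integral) auto
    then have "(LINT x|M. (g x - f n x)\<^sup>2) \<le> e\<^sup>2" by (simp add: ennreal_le_iff)
    then have "(L2_norm M (\<lambda>x. g x - f n x))\<^sup>2 \<le> e\<^sup>2" by (simp add: L2_norm_power2)
    then have "L2_norm M (\<lambda>x. g x - f n x) \<le> e"
      using \<open>e > 0\<close> by (simp add: power2_le_iff_abs_le abs_of_nonneg)
    moreover have "(\<lambda>x. g x - f n x) \<in> L2 M" using i by (simp add: L2_def)
    ultimately show ?thesis by simp
  qed
  have "g \<in> L2 M"
  proof -
    obtain N where "\<forall>m\<ge>N. \<forall>n\<ge>N. L2_norm M (\<lambda>x. f m x - f n x) < 1" using cauchy[of 1] by auto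
    with key2[of 1 N N] have "(\<lambda>x. g x - f N x) \<in> L2 M" by simp
    from L2_add[OF this f[of N]] show ?thesis by simp
  qed
  moreover have "(\<lambda>n. L2_norm M (\<lambda>x. g x - f n x)) \<longlonglongrightarrow> 0"
  proof (rule LIMSEQ_I)
    fix e :: real assume "e > 0"
    then obtain N where N: "\<forall>m\<ge>N. \<forall>n\<ge>N. L2_norm M (\<lambda>x. f m x - f n x) < e/2" using cauchy[of "e/2"] by auto
    have "L2_norm M (\<lambda>x. g x - f n x) < e" if "n \<ge> N" for n
      using key2[OF _ N that] \<open>e > 0\<close> by auto
    then show "\<exists>no. \<forall>n\<ge>no. norm (L2_norm M (\<lambda>x. g x - f n x) - 0) < e"
      by auto
  qed
  ultimately show ?thesis by blast
qed

subsection \<open>Completeness of Lebesgue measure\<close>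

lemma borel_measurable_lebesgue_on_AE:
  fixes f g :: "'a::euclidean_space \<Rightarrow> 'b::euclidean_space"
  assumes S: "S \<in> sets lebesgue" and f: "f \<in> borel_measurable (lebesgue_on S)"
    and ae: "AE x in lebesgue_on S. f x = g x"
  shows "g \<in> borel_measurable (lebesgue_on S)"
proof -
  have "(\<lambda>x. if x \<in> S then f x else 0) \<in> borel_measurable lebesgue"
    using f S by (simp add: borel_measurable_if)
  moreover have "AE x in lebesgue. (if x \<in> S then f x else 0) = (if x \<in> S then g x else 0)"
    using ae S by (auto simp: AE_restrict_space_iff)
  ultimately have "(\<lambda>x. if x \<in> S then g x else 0) \<in> borel_measurable lebesgue"
    by (rule borel_measurable_AE)
  then show ?thesis using S by (simp add: borel_measurable_if)
qed

lemma integrable_lebesgue_on_cong_AE: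
  fixes f g :: "'a::euclidean_space \<Rightarrow> 'b::euclidean_space"
  assumes S: "S \<in> sets lebesgue" and ae: "AE x in lebesgue_on S. f x = g x"
  shows "integrable (lebesgue_on S) f \<longleftrightarrow> integrable (lebesgue_on S) g"
proof -
  have ae': "AE x in lebesgue_on S. g x = f x" using ae by eventually_elim simp
  show ?thesis
    using integrable_cong_AE_imp[OF _ _ ae] integrable_cong_AE_imp[OF _ _ ae']
      borel_measurable_lebesgue_on_AE[OF S _ ae] borel_measurable_lebesgue_on_AE[OF S _ ae']
    by (metis borel_measurable_integrable)
qed

text \<open>No measurability is assumed: by completeness the two functions are integrable together,
  and otherwise both integrals are zero by convention. This allows a chosen gradient to be replaced
  under an integral whose other factor is not known to be measurable.\<close>

lemma integral_lebesgue_on_cong_AE: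
  fixes f g :: "'a::euclidean_space \<Rightarrow> 'b::euclidean_space"
  assumes S: "S \<in> sets lebesgue" and ae: "AE x in lebesgue_on S. f x = g x"
  shows "integral\<^sup>L (lebesgue_on S) f = integral\<^sup>L (lebesgue_on S) g"
proof (cases "integrable (lebesgue_on S) f")
  case True
  then have "integrable (lebesgue_on S) g" using integrable_lebesgue_on_cong_AE[OF S ae] by simp
  with True ae show ?thesis by (intro integral_cong_AE) auto
next
  case False
  then have "\<not> integrable (lebesgue_on S) g" using integrable_lebesgue_on_cong_AE[OF S ae] by simp
  with False show ?thesis by (simp add: not_integrable_integral_eq)
qed

text \<open>Projections and estimator terms are integrals over the closed polygon, Sobolev norms
  over its interior; this is the bridge between them.\<close>

lemma integral_lebesgue_on_null_difference:
  fixes f :: "'a::euclidean_space \<Rightarrow> 'b::euclidean_space"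
  assumes S: "S \<in> sets lebesgue" and T: "T \<in> sets lebesgue" and sub: "T \<subseteq> S" and n: "negligible (S - T)"
  shows "integral\<^sup>L (lebesgue_on S) f = integral\<^sup>L (lebesgue_on T) f"
proof -
  have "AE x in lebesgue. x \<notin> S - T"
    using n unfolding negligible_iff_null_sets by (rule AE_not_in)
  then have "AE x in lebesgue_on UNIV. indicator S x *\<^sub>R f x = indicator T x *\<^sub>R f x"
    unfolding lebesgue_on_UNIV_eq by eventually_elim (use sub in \<open>auto simp: indicator_def\<close>)
  from integral_lebesgue_on_cong_AE[OF _ this] show ?thesis
    using S T by (simp add: integral_restrict_space)
qed

lemma lebesgue_on_AE_cong:
  fixes f g :: "plane \<Rightarrow> 'a::euclidean_space"
  assumes S: "S \<in> sets lebesgue" and ae: "AE x in lebesgue_on S. f x = g x"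
  shows L2_norm_cong_AE: "L2_norm (lebesgue_on S) f = L2_norm (lebesgue_on S) g"
    and L2_inner_cong_AE: "L2_inner (lebesgue_on S) f h = L2_inner (lebesgue_on S) g h"
    and L2_cong_AE: "f \<in> L2 (lebesgue_on S) \<longleftrightarrow> g \<in> L2 (lebesgue_on S)"
proof -
  have e: "AE x in lebesgue_on S. (norm (f x))\<^sup>2 = (norm (g x))\<^sup>2" using ae by eventually_elim simp
  have ae': "AE x in lebesgue_on S. g x = f x" using ae by eventually_elim simp
  show "L2_norm (lebesgue_on S) f = L2_norm (lebesgue_on S) g"
    unfolding L2_norm_def using integral_lebesgue_on_cong_AE[OF S e] by simp
  have i: "AE x in lebesgue_on S. f x \<bullet> h x = g x \<bullet> h x" using ae by eventually_elim simp
  show "L2_inner (lebesgue_on S) f h = L2_inner (lebesgue_on S) g h"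
    unfolding L2_inner_def by (rule integral_lebesgue_on_cong_AE[OF S i])
  show "f \<in> L2 (lebesgue_on S) \<longleftrightarrow> g \<in> L2 (lebesgue_on S)"
    using integrable_lebesgue_on_cong_AE[OF S e] borel_measurable_lebesgue_on_AE[OF S _ ae]
      borel_measurable_lebesgue_on_AE[OF S _ ae'] unfolding L2_def mem_Collect_eq by blast
qed

lemma L2_inner_cong_AE_right:
  fixes f g :: "plane \<Rightarrow> 'a::euclidean_space"
  assumes "S \<in> sets lebesgue" and "AE x in lebesgue_on S. f x = g x"
  shows "L2_inner (lebesgue_on S) h f = L2_inner (lebesgue_on S) h g"
  using L2_inner_cong_AE[OF assms] by (metis L2_inner_commute)

lemma finite_measure_lebesgue_on_bounded:
  "bounded S \<Longrightarrow> S \<in> sets lebesgue \<Longrightarrow> finite_measure (lebesgue_on (S :: plane set))"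
  by (rule finite_measure_lebesgue_on) (rule bounded_set_imp_lmeasurable)

lemma L2_continuous:
  fixes f :: "plane \<Rightarrow> 'a::euclidean_space"
  assumes f: "continuous_on UNIV f" and S: "bounded S" "S \<in> sets lebesgue"
  shows "f \<in> L2 (lebesgue_on S)"
proof -
  have "compact (f ` closure S)"
    using S f by (intro compact_continuous_image) (auto intro: continuous_on_subset simp: compact_closure)
  then obtain B where B: "\<And>x. x \<in> closure S \<Longrightarrow> norm (f x) \<le> B"
    by (metis compact_imp_bounded bounded_iff imageI)
  have m: "f \<in> borel_measurable (lebesgue_on S)"
    using continuous_imp_measurable_on_sets_lebesgue[OF continuous_on_subset[OF f subset_UNIV] S(2)] .
  have "AE x in lebesgue_on S. norm (f x) \<le> \<bar>B\<bar> * norm (1::real)"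
    using S(2) by (intro AE_I2) (use B closure_subset in force)
  from L2_dominated(1)[OF L2_const[OF finite_measure_lebesgue_on_bounded[OF S]] m _ this] show ?thesis by simp
qed

section \<open>Smooth functions\<close>

lemma inner_vec2: "(v::plane) \<bullet> w = v $ 1 * w $ 1 + v $ 2 * w $ 2"
  by (simp add: inner_vec_def sum_2)

lemma has_derivative_grad:
  assumes "\<phi> differentiable (at x)"
  shows "(\<phi> has_derivative (\<lambda>h. grad \<phi> x \<bullet> h)) (at x)"
proof -
  let ?D = "frechet_derivative \<phi> (at x)"
  have D: "(\<phi> has_derivative ?D) (at x)" using assms frechet_derivative_works by blast
  then interpret linear ?D by (rule has_derivative_linear)
  have "?D h = grad \<phi> x \<bullet> h" for h
  proof -
    have "h = h $ 1 *\<^sub>R axis 1 1 + h $ 2 *\<^sub>R axis 2 1"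
      by (auto simp: vec_eq_iff axis_def forall_2)
    then have "?D h = ?D (h $ 1 *\<^sub>R axis 1 1 + h $ 2 *\<^sub>R axis 2 1)" by simp
    also have "\<dots> = h $ 1 * ?D (axis 1 1) + h $ 2 * ?D (axis 2 1)" by (simp add: add scale)
    finally show ?thesis by (simp add: grad_def inner_vec2 mult.commute)
  qed
  then have "?D = (\<lambda>h. grad \<phi> x \<bullet> h)" by (rule ext)
  with D show ?thesis by simp
qed

lemma grad_eqI:
  assumes "(\<phi> has_derivative (\<lambda>h. v \<bullet> h)) (at x)"
  shows "grad \<phi> x = v"
proof -
  have "frechet_derivative \<phi> (at x) = (\<lambda>h. v \<bullet> h)"
    using frechet_derivative_at[OF assms] by simp
  then show ?thesis by (simp add: grad_def vec_eq_iff inner_axis)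
qed

lemma Ck_SucI:
  assumes "\<And>x. (\<phi> has_derivative (\<lambda>h. g x \<bullet> h)) (at x)" and "\<And>i. Ck k (\<lambda>x. g x $ i)"
  shows "Ck (Suc k) \<phi>"
proof -
  have "grad \<phi> x = g x" for x by (rule grad_eqI[OF assms(1)])
  then show ?thesis using assms by (auto simp: differentiable_def)
qed

lemma Ck_SucD:
  assumes "Ck (Suc k) \<phi>"
  shows "(\<phi> has_derivative (\<lambda>h. grad \<phi> x \<bullet> h)) (at x)" "Ck k (\<lambda>x. grad \<phi> x $ i)"
  using assms has_derivative_grad by auto

lemma Ck_Suc_imp: "Ck (Suc k) \<phi> \<Longrightarrow> Ck k \<phi>"
proof (induction k arbitrary: \<phi>)
  case 0
  then show ?case
    by (auto simp: continuous_on_eq_continuous_within intro!: differentiable_imp_continuous_within)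
next
  case (Suc k)
  then show ?case by auto
qed

lemma Ck_const: "Ck k (\<lambda>x. c)"
proof (induction k arbitrary: c)
  case (Suc k)
  show ?case by (rule Ck_SucI[where g = "\<lambda>x. 0"]) (use Suc in auto)
qed simp

lemma Ck_coord: "Ck k (\<lambda>x. x $ i)"
proof (cases k)
  case 0
  then show ?thesis by (auto intro: continuous_intros)
next
  case (Suc j)
  show ?thesis unfolding Suc
  proof (rule Ck_SucI[where g = "\<lambda>x. axis i 1"])
    fix x :: plane
    have "((\<lambda>x. x $ i) has_derivative (\<lambda>h. h $ i)) (at x)"
      by (rule bounded_linear_imp_has_derivative[OF bounded_linear_vec_nth])
    then show "((\<lambda>x. x $ i) has_derivative (\<lambda>h. axis i 1 \<bullet> h)) (at x)"
      by (simp add: inner_axis')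
  qed (simp add: Ck_const)
qed

lemma Ck_add: "Ck k \<phi> \<Longrightarrow> Ck k \<psi> \<Longrightarrow> Ck k (\<lambda>x. \<phi> x + \<psi> x)"
proof (induction k arbitrary: \<phi> \<psi>)
  case 0
  then show ?case by (auto intro: continuous_intros)
next
  case (Suc k)
  show ?case
  proof (rule Ck_SucI[where g = "\<lambda>x. grad \<phi> x + grad \<psi> x"])
    fix x
    show "((\<lambda>x. \<phi> x + \<psi> x) has_derivative (\<lambda>h. (grad \<phi> x + grad \<psi> x) \<bullet> h)) (at x)"
      using has_derivative_add[OF Ck_SucD(1)[OF Suc.prems(1)] Ck_SucD(1)[OF Suc.prems(2)]]
      by (simp add: inner_add_left)
  next
    fix i show "Ck k (\<lambda>x. (grad \<phi> x + grad \<psi> x) $ i)"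
      using Suc.IH[OF Ck_SucD(2)[OF Suc.prems(1), of i] Ck_SucD(2)[OF Suc.prems(2), of i]] by simp
  qed
qed

lemma Ck_mult: "Ck k \<phi> \<Longrightarrow> Ck k \<psi> \<Longrightarrow> Ck k (\<lambda>x. \<phi> x * \<psi> x)"
proof (induction k arbitrary: \<phi> \<psi>)
  case 0
  then show ?case by (auto intro: continuous_intros)
next
  case (Suc k)
  show ?case
  proof (rule Ck_SucI[where g = "\<lambda>x. \<phi> x *\<^sub>R grad \<psi> x + \<psi> x *\<^sub>R grad \<phi> x"])
    fix x
    show "((\<lambda>x. \<phi> x * \<psi> x) has_derivative (\<lambda>h. (\<phi> x *\<^sub>R grad \<psi> x + \<psi> x *\<^sub>R grad \<phi> x) \<bullet> h)) (at x)"
      using has_derivative_mult[OF Ck_SucD(1)[OF Suc.prems(1)] Ck_SucD(1)[OF Suc.prems(2)]]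
      by (simp add: inner_add_left mult.commute)
  next
    fix i show "Ck k (\<lambda>x. (\<phi> x *\<^sub>R grad \<psi> x + \<psi> x *\<^sub>R grad \<phi> x) $ i)"
      using Ck_add[OF Suc.IH[OF Ck_Suc_imp[OF Suc.prems(1)] Ck_SucD(2)[OF Suc.prems(2), of i]]
          Suc.IH[OF Ck_Suc_imp[OF Suc.prems(2)] Ck_SucD(2)[OF Suc.prems(1), of i]]] by simp
  qed
qed

lemma has_derivative_affine:
  assumes "(\<phi> has_derivative (\<lambda>h. v \<bullet> h)) (at (t + c *\<^sub>R x))"
  shows "((\<lambda>x. \<phi> (t + c *\<^sub>R x)) has_derivative (\<lambda>h. (c *\<^sub>R v) \<bullet> h)) (at (x::plane))"
proof -
  have "((\<lambda>x. t + c *\<^sub>R x) has_derivative (\<lambda>h. c *\<^sub>R h)) (at x)"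
    by (auto intro!: derivative_eq_intros)
  from has_derivative_compose[OF this assms] show ?thesis by simp
qed

lemma Ck_affine: "Ck k \<phi> \<Longrightarrow> Ck k (\<lambda>x. \<phi> (t + c *\<^sub>R x))"
proof (induction k arbitrary: \<phi>)
  case 0
  then have c: "continuous_on UNIV \<phi>" by simp
  have "continuous_on UNIV (\<lambda>x::plane. t + c *\<^sub>R x)" by (intro continuous_intros)
  from continuous_on_compose2[OF c this] show ?case by simp
next
  case (Suc k)
  show ?case
  proof (rule Ck_SucI[where g = "\<lambda>x. c *\<^sub>R grad \<phi> (t + c *\<^sub>R x)"])
    fix x
    show "((\<lambda>x. \<phi> (t + c *\<^sub>R x)) has_derivative (\<lambda>h. (c *\<^sub>R grad \<phi> (t + c *\<^sub>R x)) \<bullet> h)) (at x)"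
      by (rule has_derivative_affine[OF Ck_SucD(1)[OF Suc.prems]])
  next
    fix i show "Ck k (\<lambda>x. (c *\<^sub>R grad \<phi> (t + c *\<^sub>R x)) $ i)"
      using Ck_mult[OF Ck_const[of k c] Suc.IH[OF Ck_SucD(2)[OF Suc.prems, of i]]] by simp
  qed
qed

text \<open>The outer function is given with its whole chain of derivatives, since the chain rule
  replaces \<open>F n\<close> by \<open>F (Suc n)\<close>; the induction therefore needs
  \<open>n\<close> arbitrary.\<close>

lemma Ck_compose_real:
  assumes F: "\<And>n t. (F n has_real_derivative F (Suc n) t) (at t)"
  shows "Ck k q \<Longrightarrow> Ck k (\<lambda>x. F n (q x))"
proof (induction k arbitrary: n)
  case 0
  have "continuous_on UNIV (F n)"
    by (intro continuous_at_imp_continuous_on ballI DERIV_isCont[OF F])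
  from continuous_on_compose2[OF this, of UNIV q] 0 show ?case by simp
next
  case (Suc k)
  show ?case
  proof (rule Ck_SucI[where g = "\<lambda>x. F (Suc n) (q x) *\<^sub>R grad q x"])
    fix x
    have "(F n has_derivative (\<lambda>h. F (Suc n) (q x) * h)) (at (q x))"
      using F[of n "q x"] by (simp add: has_field_derivative_def)
    from has_derivative_compose[OF Ck_SucD(1)[OF Suc.prems] this]
    show "((\<lambda>x. F n (q x)) has_derivative (\<lambda>h. (F (Suc n) (q x) *\<^sub>R grad q x) \<bullet> h)) (at x)"
      by simp
  next
    fix i show "Ck k (\<lambda>x. (F (Suc n) (q x) *\<^sub>R grad q x) $ i)"
      using Ck_mult[OF Suc.IH[OF Ck_Suc_imp[OF Suc.prems]] Ck_SucD(2)[OF Suc.prems, of i]] by simp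
  qed
qed

lemma smooth_const: "smooth (\<lambda>x. c)" by (simp add: smooth_def Ck_const)

lemma smooth_coord: "smooth (\<lambda>x. x $ i)" by (simp add: smooth_def Ck_coord)

lemma smooth_add: "smooth \<phi> \<Longrightarrow> smooth \<psi> \<Longrightarrow> smooth (\<lambda>x. \<phi> x + \<psi> x)" by (simp add: smooth_def Ck_add)

lemma smooth_mult: "smooth \<phi> \<Longrightarrow> smooth \<psi> \<Longrightarrow> smooth (\<lambda>x. \<phi> x * \<psi> x)" by (simp add: smooth_def Ck_mult)

lemma smooth_affine: "smooth \<phi> \<Longrightarrow> smooth (\<lambda>x. \<phi> (t + c *\<^sub>R x))" by (simp add: smooth_def Ck_affine)

lemma smooth_uminus: "smooth \<phi> \<Longrightarrow> smooth (\<lambda>x. - \<phi> x)"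
  using smooth_mult[OF smooth_const[of "-1"]] by simp

lemma smooth_diff: "smooth \<phi> \<Longrightarrow> smooth \<psi> \<Longrightarrow> smooth (\<lambda>x. \<phi> x - \<psi> x)"
  using smooth_add[OF _ smooth_uminus] by simp

lemma smooth_linear: "smooth (\<lambda>x. v \<bullet> x)"
  unfolding inner_vec2 by (intro smooth_add smooth_mult smooth_const smooth_coord)

lemma smooth_has_derivative: "smooth \<phi> \<Longrightarrow> (\<phi> has_derivative (\<lambda>h. grad \<phi> x \<bullet> h)) (at x)"
  unfolding smooth_def using Ck_SucD(1)[of 0] by blast

lemma smooth_grad: "smooth \<phi> \<Longrightarrow> smooth (\<lambda>x. grad \<phi> x $ i)"
  unfolding smooth_def using Ck_SucD(2) by blast

lemma smooth_continuous: "smooth \<phi> \<Longrightarrow> continuous_on S \<phi>"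
  unfolding smooth_def using Ck.simps(1) continuous_on_subset by blast

lemma smooth_continuous_grad: "smooth \<phi> \<Longrightarrow> continuous_on S (grad \<phi>)"
  by (rule continuous_on_vec_lambda[where f = "\<lambda>i x. grad \<phi> x $ i", unfolded vec_lambda_eta, simplified])
    (auto intro: smooth_continuous smooth_grad)

lemma smooth_borel [measurable]: "smooth \<phi> \<Longrightarrow> \<phi> \<in> borel_measurable borel"
  by (intro borel_measurable_continuous_onI smooth_continuous)

lemma smooth_grad_borel [measurable]: "smooth \<phi> \<Longrightarrow> grad \<phi> \<in> borel_measurable borel"
  by (intro borel_measurable_continuous_onI smooth_continuous_grad)

lemma grad_const [simp]: "grad (\<lambda>x. c) x = 0"
  by (rule grad_eqI) simp

lemma grad_linear: "grad (\<lambda>x. \<alpha> + v \<bullet> x) x = v"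
  by (rule grad_eqI) (auto intro!: derivative_eq_intros)

lemma grad_mult: "smooth \<phi> \<Longrightarrow> smooth \<psi> \<Longrightarrow> grad (\<lambda>x. \<phi> x * \<psi> x) x = \<phi> x *\<^sub>R grad \<psi> x + \<psi> x *\<^sub>R grad \<phi> x"
  by (rule grad_eqI, rule has_derivative_eq_rhs[OF has_derivative_mult[OF smooth_has_derivative smooth_has_derivative]])
    (auto simp: inner_add_left algebra_simps)

lemma grad_affine: "smooth \<phi> \<Longrightarrow> grad (\<lambda>x. \<phi> (t + c *\<^sub>R x)) x = c *\<^sub>R grad \<phi> (t + c *\<^sub>R x)"
  by (rule grad_eqI, rule has_derivative_affine) (rule smooth_has_derivative)

subsection \<open>Test functions\<close>

lemma test_functionsD:
  assumes "\<phi> \<in> test_functions G"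
  shows "smooth \<phi>" "\<exists>K. compact K \<and> K \<subseteq> G \<and> (\<forall>x. x \<notin> K \<longrightarrow> \<phi> x = 0)"
  using assms by (auto simp: test_functions_def)

lemma test_functionsI:
  "smooth \<phi> \<Longrightarrow> compact K \<Longrightarrow> K \<subseteq> G \<Longrightarrow> (\<And>x. x \<notin> K \<Longrightarrow> \<phi> x = 0) \<Longrightarrow> \<phi> \<in> test_functions G"
  by (auto simp: test_functions_def)

lemma test_functions_mono: "\<phi> \<in> test_functions G \<Longrightarrow> G \<subseteq> G' \<Longrightarrow> \<phi> \<in> test_functions G'"
  unfolding test_functions_def by blast

lemma test_functions_outside: "\<phi> \<in> test_functions G \<Longrightarrow> x \<notin> G \<Longrightarrow> \<phi> x = 0"
  by (auto simp: test_functions_def)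

lemma grad_zero_outside:
  assumes K: "closed K" "\<And>x. x \<notin> K \<Longrightarrow> \<phi> x = 0" and x: "x \<notin> K"
  shows "grad \<phi> x = 0"
proof (rule grad_eqI)
  have "((\<lambda>x. 0::real) has_derivative (\<lambda>h. 0 \<bullet> h)) (at x)" by simp
  then show "(\<phi> has_derivative (\<lambda>h. 0 \<bullet> h)) (at x)"
    by (rule has_derivative_transform_within_open[of _ _ _ _ "- K"]) (use K x in auto)
qed

lemma test_functions_grad:
  assumes "\<phi> \<in> test_functions G"
  shows "(\<lambda>x. grad \<phi> x $ i) \<in> test_functions G"
proof -
  obtain K where K: "compact K" "K \<subseteq> G" "\<And>x. x \<notin> K \<Longrightarrow> \<phi> x = 0" using test_functionsD(2)[OF assms] by blast
  show ?thesis
    by (rule test_functionsI[OF smooth_grad[OF test_functionsD(1)[OF assms]] K(1,2)])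
      (use grad_zero_outside[OF compact_imp_closed[OF K(1)] K(3)] in auto)
qed

lemma test_functions_grad_outside: "\<phi> \<in> test_functions G \<Longrightarrow> x \<notin> G \<Longrightarrow> grad \<phi> x = 0"
  using test_functions_outside[OF test_functions_grad] by (auto simp: vec_eq_iff)

lemma test_functions_mult:
  assumes "smooth f" and "\<phi> \<in> test_functions G"
  shows "(\<lambda>x. f x * \<phi> x) \<in> test_functions G"
proof -
  obtain K where K: "compact K" "K \<subseteq> G" "\<And>x. x \<notin> K \<Longrightarrow> \<phi> x = 0" using test_functionsD(2)[OF assms(2)] by blast
  show ?thesis
    by (rule test_functionsI[OF smooth_mult[OF assms(1) test_functionsD(1)[OF assms(2)]] K(1,2)]) (use K in auto)
qed

lemma test_functions_bounded:
  assumes "\<phi> \<in> test_functions G"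
  obtains B where "B > 0" "\<And>x. \<bar>\<phi> x\<bar> \<le> B"
proof -
  obtain K where K: "compact K" "\<And>x. x \<notin> K \<Longrightarrow> \<phi> x = 0" using test_functionsD(2)[OF assms] by blast
  have "compact (\<phi> ` K)"
    using K(1) smooth_continuous[OF test_functionsD(1)[OF assms]] by (rule compact_continuous_image[rotated])
  then obtain B where B: "\<And>x. x \<in> K \<Longrightarrow> norm (\<phi> x) \<le> B" by (metis compact_imp_bounded bounded_iff imageI)
  have "\<bar>\<phi> x\<bar> \<le> \<bar>B\<bar> + 1" for x
    using B[of x] K(2)[of x] by (cases "x \<in> K") auto
  then show ?thesis by (intro that[of "\<bar>B\<bar> + 1"]) auto
qed

lemma test_functions_grad_bounded:
  assumes "\<phi> \<in> test_functions G"
  obtains B where "B > 0" "\<And>x. norm (grad \<phi> x) \<le> B"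
proof -
  obtain B1 where B1: "B1 > 0" "\<And>x. \<bar>grad \<phi> x $ 1\<bar> \<le> B1" using test_functions_bounded[OF test_functions_grad[OF assms]] by blast
  obtain B2 where B2: "B2 > 0" "\<And>x. \<bar>grad \<phi> x $ 2\<bar> \<le> B2" using test_functions_bounded[OF test_functions_grad[OF assms]] by blast
  have "norm (grad \<phi> x) \<le> B1 + B2" for x
    using norm_le_l1_cart[of "grad \<phi> x"] B1(2)[of x] B2(2)[of x] by (simp add: sum_2)
  with B1 B2 show ?thesis by (intro that[of "B1 + B2"]) auto
qed

lemma onorm_inner_le: "onorm (\<lambda>h. v \<bullet> h) \<le> norm (v::plane)"
  by (rule onorm_le) (simp add: Cauchy_Schwarz_ineq2)

lemma test_functions_lipschitz:
  assumes "\<phi> \<in> test_functions G"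
  obtains L where "L > 0" "\<And>x y. \<bar>\<phi> x - \<phi> y\<bar> \<le> L * norm (x - y)"
proof -
  obtain B where B: "B > 0" "\<And>x. norm (grad \<phi> x) \<le> B" using test_functions_grad_bounded[OF assms] by blast
  have "norm (\<phi> x - \<phi> y) \<le> B * norm (x - y)" for x y
    by (rule differentiable_bound[of UNIV \<phi> "\<lambda>x h. grad \<phi> x \<bullet> h"])
      (auto intro: smooth_has_derivative[OF test_functionsD(1)[OF assms]] order_trans[OF onorm_inner_le B(2)])
  with B show ?thesis by (intro that[of B]) auto
qed

text \<open>The mean value inequality for \<open>\<phi> y - grad \<phi> x \<bullet> y\<close> on the
  segment, with the Lipschitz constant of the gradient. The bound does not depend on
  \<open>x\<close>, so it can be integrated when a convolution is differentiated.\<close>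

lemma test_functions_taylor:
  assumes "\<phi> \<in> test_functions G"
  obtains L where "L > 0" "\<And>x h. \<bar>\<phi> (x + h) - \<phi> x - grad \<phi> x \<bullet> h\<bar> \<le> L * (norm h)\<^sup>2"
proof -
  obtain L1 where L1: "L1 > 0" "\<And>x y. \<bar>grad \<phi> x $ 1 - grad \<phi> y $ 1\<bar> \<le> L1 * norm (x - y)"
    using test_functions_lipschitz[OF test_functions_grad[OF assms]] by blast
  obtain L2 where L2: "L2 > 0" "\<And>x y. \<bar>grad \<phi> x $ 2 - grad \<phi> y $ 2\<bar> \<le> L2 * norm (x - y)"
    using test_functions_lipschitz[OF test_functions_grad[OF assms]] by blast
  define L where "L = L1 + L2"
  have gl: "norm (grad \<phi> x - grad \<phi> y) \<le> L * norm (x - y)" for x y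
    using norm_le_l1_cart[of "grad \<phi> x - grad \<phi> y"] L1(2)[of x y] L2(2)[of x y] by (simp add: sum_2 L_def algebra_simps)
  have "\<bar>\<phi> (x + h) - \<phi> x - grad \<phi> x \<bullet> h\<bar> \<le> L * (norm h)\<^sup>2" for x h
  proof -
    have "norm ((\<phi> (x + h) - grad \<phi> x \<bullet> (x + h)) - (\<phi> x - grad \<phi> x \<bullet> x)) \<le> (L * norm h) * norm ((x + h) - x)"
    proof (rule differentiable_bound[of "closed_segment x (x + h)" "\<lambda>y. \<phi> y - grad \<phi> x \<bullet> y" "\<lambda>y k. (grad \<phi> y - grad \<phi> x) \<bullet> k"])
      fix y assume y: "y \<in> closed_segment x (x + h)"
      have "((\<lambda>y. \<phi> y - grad \<phi> x \<bullet> y) has_derivative (\<lambda>k. (grad \<phi> y - grad \<phi> x) \<bullet> k)) (at y)"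
        by (auto simp: inner_diff_left intro!: derivative_eq_intros smooth_has_derivative[OF test_functionsD(1)[OF assms]])
      then show "((\<lambda>y. \<phi> y - grad \<phi> x \<bullet> y) has_derivative (\<lambda>k. (grad \<phi> y - grad \<phi> x) \<bullet> k)) (at y within closed_segment x (x + h))"
        by (rule has_derivative_at_withinI)
      have "norm (y - x) \<le> norm h" using segment_bound1[OF y] by simp
      then have "L * norm (y - x) \<le> L * norm h" using L1(1) L2(1) by (intro mult_left_mono) (auto simp: L_def)
      then show "onorm (\<lambda>k. (grad \<phi> y - grad \<phi> x) \<bullet> k) \<le> L * norm h"
        using onorm_inner_le[of "grad \<phi> y - grad \<phi> x"] gl[of y x] by linarith
    qed auto
    then show ?thesis by (simp add: inner_add_right power2_eq_square algebra_simps)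
  qed
  then show ?thesis using L1(1) L2(1) by (intro that[of L]) (auto simp: L_def)
qed

subsection \<open>A bump function\<close>

text \<open>The functions \<open>p(1/t) exp(-1/t)\<close>, extended by zero, are closed under differentiation.\<close>

definition flat_fun :: "real poly \<Rightarrow> real \<Rightarrow> real" where
  "flat_fun p t = (if t \<le> 0 then 0 else poly p (inverse t) * exp (- inverse t))"

lemma poly_exp_tendsto_0: "((\<lambda>s. poly p s * exp (- s)) \<longlongrightarrow> 0) (at_top :: real filter)"
proof -
  have "((\<lambda>s. \<Sum>i\<le>degree p. coeff p i * (s ^ i / exp s)) \<longlongrightarrow> (\<Sum>i\<le>degree p. coeff p i * 0)) at_top"
    by (intro tendsto_sum tendsto_mult tendsto_const tendsto_power_div_exp_0)
  moreover have "(\<Sum>i\<le>degree p. coeff p i * (s ^ i / exp s)) = poly p s * exp (- s)" for s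
    by (simp add: poly_altdef sum_distrib_right exp_minus divide_inverse mult.assoc)
  ultimately show ?thesis by simp
qed

text \<open>With \<open>s = 1/t\<close>, the derivative of \<open>p(s) exp(-s)\<close> in
  \<open>s\<close> is \<open>(p' - p)(s) exp(-s)\<close> and \<open>ds/dt = - s^2\<close>; hence the
  factor \<open>monom 1 2\<close> and the order of the difference.\<close>

lemma flat_fun_deriv:
  "(flat_fun p has_real_derivative flat_fun (monom 1 2 * (p - pderiv p)) t) (at t)"
proof (cases "t = 0")
  case False
  show ?thesis
  proof (cases "t < 0")
    case True
    have "((\<lambda>t. 0) has_real_derivative 0) (at t)" by simp
    then have "(flat_fun p has_real_derivative 0) (at t)"
      by (rule has_field_derivative_transform_within_open[where S = "{..<0}"]) (use True in \<open>auto simp: flat_fun_def\<close>)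
    then show ?thesis using True by (simp add: flat_fun_def)
  next
    case f2: False
    with False have t: "t > 0" by simp
    have "((\<lambda>t. poly p (inverse t) * exp (- inverse t)) has_real_derivative
        poly (monom 1 2 * (p - pderiv p)) (inverse t) * exp (- inverse t)) (at t)"
      using t by (auto intro!: derivative_eq_intros DERIV_chain'[OF _ poly_DERIV] simp: poly_monom power2_eq_square field_simps)
    then have "(flat_fun p has_real_derivative poly (monom 1 2 * (p - pderiv p)) (inverse t) * exp (- inverse t)) (at t)"
      by (rule has_field_derivative_transform_within_open[where S = "{0<..}"]) (use t in \<open>auto simp: flat_fun_def\<close>)
    then show ?thesis using t by (simp add: flat_fun_def)
  qed
next
  case True
  \<comment> \<open>\<open>pCons 0 p\<close> is the polynomial \<open>s p(s)\<close>; its extra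
    factor \<open>s = 1/h\<close> is the division by \<open>h\<close> in the difference quotient at
    zero.\<close>
  have "((\<lambda>s. poly (pCons 0 p) s * exp (- s)) \<longlongrightarrow> 0) at_top" by (rule poly_exp_tendsto_0)
  then have "((\<lambda>h. poly (pCons 0 p) (inverse h) * exp (- inverse h)) \<longlongrightarrow> 0) (at_right (0::real))"
    by (rule filterlim_compose) (rule filterlim_inverse_at_top_right)
  then have r: "((\<lambda>h. flat_fun p h / h) \<longlongrightarrow> 0) (at_right 0)"
    by (rule Lim_transform_eventually)
      (auto simp: eventually_at_right_field flat_fun_def field_simps intro!: exI[of _ 1])
  have l: "((\<lambda>h. flat_fun p h / h) \<longlongrightarrow> 0) (at_left 0)"
    by (rule Lim_transform_eventually[OF tendsto_const])
      (auto simp: eventually_at_left_field flat_fun_def intro!: exI[of _ "-1"])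
  have "((\<lambda>h. flat_fun p h / h) \<longlongrightarrow> 0) (at 0)"
    using r l by (simp add: filterlim_split_at)
  then show ?thesis using True by (simp add: DERIV_def flat_fun_def)
qed

lemma smooth_flat:
  assumes "smooth q"
  shows "smooth (\<lambda>x. flat_fun p (q x))"
proof -
  define P where "P = rec_nat p (\<lambda>_ p. monom 1 2 * (p - pderiv p))"
  have "Ck k (\<lambda>x. flat_fun (P 0) (q x))" for k
    by (rule Ck_compose_real[where F = "\<lambda>n. flat_fun (P n)"])
      (use flat_fun_deriv assms in \<open>auto simp: P_def smooth_def\<close>)
  then show ?thesis by (simp add: P_def smooth_def)
qed

text \<open>The usual kernel \<open>exp(-1/(1 - |x|^2))\<close> on the unit disc, not
  normalised.\<close>

definition bump :: "plane \<Rightarrow> real" where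
  "bump x = flat_fun 1 (1 - (norm x)\<^sup>2)"

lemma smooth_bump: "smooth bump"
proof -
  have "smooth (\<lambda>x. 1 - (x $ 1 * x $ 1 + x $ 2 * x $ 2))"
    by (intro smooth_diff smooth_const smooth_add smooth_mult smooth_coord)
  then have "smooth (\<lambda>x. 1 - (norm x)\<^sup>2)"
    unfolding norm_vec2_sq by (simp add: power2_eq_square)
  from smooth_flat[OF this, of 1] show ?thesis by (simp add: bump_def[abs_def])
qed

lemma bump_nonneg: "0 \<le> bump x"
  by (simp add: bump_def flat_fun_def)

lemma bump_le_1: "bump x \<le> 1"
  by (simp add: bump_def flat_fun_def)

lemma bump_pos: "norm x < 1 \<Longrightarrow> 0 < bump x"
  using power_strict_mono[of "norm x" 1 2] by (simp add: bump_def flat_fun_def)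

lemma bump_outside: "1 \<le> norm x \<Longrightarrow> bump x = 0"
  using power_mono[of 1 "norm x" 2] by (simp add: bump_def flat_fun_def)

lemma bump_test: "bump \<in> test_functions UNIV"
  by (rule test_functionsI[OF smooth_bump compact_cball[of 0 1]]) (auto intro: bump_outside)

lemma bump_scaled_test:
  assumes "r > 0" and "cball c r \<subseteq> G"
  shows "(\<lambda>x. bump ((x - c) /\<^sub>R r)) \<in> test_functions G"
proof (rule test_functionsI[OF _ compact_cball[of c r] assms(2)])
  have "(\<lambda>x. bump ((x - c) /\<^sub>R r)) = (\<lambda>x. bump (- (c /\<^sub>R r) + inverse r *\<^sub>R x))"
    by (simp add: fun_eq_iff algebra_simps)
  then show "smooth (\<lambda>x. bump ((x - c) /\<^sub>R r))"
    using smooth_affine[OF smooth_bump, of "- (c /\<^sub>R r)" "inverse r"] by argo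
  fix x assume "x \<notin> cball c r"
  then have "r \<le> norm (x - c)" by (simp add: dist_norm norm_minus_commute)
  then have "1 \<le> norm (x - c) / r" using assms(1) by simp
  also have "\<dots> = norm ((x - c) /\<^sub>R r)" using assms(1) by (simp add: divide_inverse_commute)
  finally have "1 \<le> norm ((x - c) /\<^sub>R r)" .
  then show "bump ((x - c) /\<^sub>R r) = 0" by (rule bump_outside)
qed

lemma bump_measurable [measurable]: "bump \<in> borel_measurable borel"
  by (rule smooth_borel[OF smooth_bump])

section \<open>Mollification\<close>

lemma lebesgue_integral_borel:
  fixes f :: "plane \<Rightarrow> 'a::euclidean_space"
  assumes "f \<in> borel_measurable borel"
  shows "integral\<^sup>L lebesgue f = integral\<^sup>L lborel f" "integrable lebesgue f \<longleftrightarrow> integrable lborel f"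
  using assms by (simp_all add: integral_completion integrable_completion)

lemma nn_integral_lborel_affine:
  fixes f :: "plane \<Rightarrow> ennreal"
  assumes [measurable]: "f \<in> borel_measurable borel" and c: "c \<noteq> 0"
  shows "(\<integral>\<^sup>+x. f x \<partial>lborel) = ennreal (c\<^sup>2) * (\<integral>\<^sup>+x. f (t + c *\<^sub>R x) \<partial>lborel)"
proof -
  have "(\<integral>\<^sup>+x. f x \<partial>lborel) = (\<integral>\<^sup>+x. f x \<partial>density (distr lborel borel (\<lambda>x. t + c *\<^sub>R x)) (\<lambda>_. \<bar>c\<bar>^DIM(plane)))"
    using lborel_affine[OF c, of t] by simp
  also have "\<dots> = (\<integral>\<^sup>+x. ennreal (\<bar>c\<bar>^DIM(plane)) * f x \<partial>distr lborel borel (\<lambda>x. t + c *\<^sub>R x))"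
    by (rule nn_integral_density) auto
  also have "\<dots> = (\<integral>\<^sup>+x. ennreal (\<bar>c\<bar>^DIM(plane)) * f (t + c *\<^sub>R x) \<partial>lborel)"
    by (rule nn_integral_distr) auto
  also have "\<dots> = ennreal (c\<^sup>2) * (\<integral>\<^sup>+x. f (t + c *\<^sub>R x) \<partial>lborel)"
    by (subst nn_integral_cmult) auto
  finally show ?thesis .
qed

lemma integral_lborel_affine:
  fixes f :: "plane \<Rightarrow> real"
  assumes [measurable]: "f \<in> borel_measurable borel" and c: "c \<noteq> 0"
  shows "(LINT x|lborel. f x) = c\<^sup>2 * (LINT x|lborel. f (t + c *\<^sub>R x))"
proof -
  have "(LINT x|lborel. f x) = (LINT x|density (distr lborel borel (\<lambda>x. t + c *\<^sub>R x)) (\<lambda>_. \<bar>c\<bar>^DIM(plane)). f x)"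
    using lborel_affine[OF c, of t] by simp
  also have "\<dots> = (LINT x|distr lborel borel (\<lambda>x. t + c *\<^sub>R x). (\<bar>c\<bar>^DIM(plane)) *\<^sub>R f x)"
    by (rule integral_density) auto
  also have "\<dots> = (LINT x|lborel. (\<bar>c\<bar>^DIM(plane)) *\<^sub>R f (t + c *\<^sub>R x))"
    by (rule integral_distr) auto
  finally show ?thesis by simp
qed

text \<open>By translation invariance every difference quotient of \<phi> has integral zero. The
  Lipschitz constant on a bounded set dominates the quotients, so the integral of the limit vanishes
  as well.\<close>

lemma integral_grad_test:
  assumes "\<phi> \<in> test_functions G"
  shows "(LINT x|lebesgue. grad \<phi> x $ i) = 0"
proof -
  have sm: "smooth \<phi>" by (rule test_functionsD(1)[OF assms])
  have [measurable]: "\<phi> \<in> borel_measurable borel" by (rule smooth_borel[OF sm])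
  have [measurable]: "(\<lambda>x. grad \<phi> x $ i) \<in> borel_measurable borel" by (rule smooth_borel[OF smooth_grad[OF sm]])
  obtain K where K: "compact K" "\<And>x. x \<notin> K \<Longrightarrow> \<phi> x = 0" using test_functionsD(2)[OF assms] by blast
  obtain R where R: "K \<subseteq> cball 0 R"
    using bounded_subset_ballD[OF compact_imp_bounded[OF K(1)], of 0] ball_subset_cball by blast
  obtain L where L: "L > 0" "\<And>x y. \<bar>\<phi> x - \<phi> y\<bar> \<le> L * norm (x - y)" using test_functions_lipschitz[OF assms] by blast
  \<comment> \<open>The steps are at most one, so all quotients vanish outside the ball of radius
    \<open>R + 1\<close>.\<close>
  define t where "t n = inverse (real (Suc n))" for n
  have t: "t n > 0" "t n \<le> 1" for n by (auto simp: t_def field_simps)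
  define e where "e = (axis i 1 :: plane)"
  have e: "norm e = 1" by (simp add: e_def norm_axis_1)
  define q where "q n x = (\<phi> (x + t n *\<^sub>R e) - \<phi> x) / t n" for n x
  have [measurable]: "q n \<in> borel_measurable borel" for n unfolding q_def by measurable
  have int: "integrable lborel \<phi>"
  proof -
    obtain B where B: "B > 0" "\<And>x. \<bar>\<phi> x\<bar> \<le> B" using test_functions_bounded[OF assms] by blast
    show ?thesis
    proof (rule Bochner_Integration.integrable_bound)
    have "\<phi> x = 0" if "x \<notin> cball 0 R" for x using K(2) R that by blast
    with B show "AE x in lborel. norm (\<phi> x) \<le> norm (B * indicator (cball 0 R) x)"
      by (intro AE_I2) (auto simp: indicator_def)
    show "integrable lborel (\<lambda>x. B * indicator (cball 0 R) (x::plane))"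
      using emeasure_bounded_finite[of "cball (0::plane) R"] by (simp add: less_top)
    qed simp
  qed
  have sh: "(LINT x|lborel. \<phi> (x + t n *\<^sub>R e)) = (LINT x|lborel. \<phi> x)" for n
    using integral_lborel_affine[of \<phi> 1 "t n *\<^sub>R e"] by (simp add: add.commute)
  have ish: "integrable lborel (\<lambda>x. \<phi> (x + t n *\<^sub>R e))" for n
  proof -
    have "integrable (distr lborel borel ((+) (t n *\<^sub>R e))) \<phi>" using int by (simp add: lborel_distr_plus)
    then show ?thesis by (simp add: integrable_distr_eq add.commute)
  qed
  have q0: "(LINT x|lborel. q n x) = 0" for n
    unfolding q_def using int ish sh by simp
  have "(\<lambda>n. LINT x|lborel. q n x) \<longlonglongrightarrow> (LINT x|lborel. grad \<phi> x $ i)"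
  proof (rule integral_dominated_convergence)
    show "integrable lborel (\<lambda>x. L * indicator (cball 0 (R + 1)) (x::plane))"
      using emeasure_bounded_finite[of "cball (0::plane) (R + 1)"] by (simp add: less_top)
    show "AE x in lborel. (\<lambda>n. q n x) \<longlonglongrightarrow> grad \<phi> x $ i"
    proof (rule AE_I2)
      fix x
      have "((\<lambda>s. x + s *\<^sub>R e) has_derivative (\<lambda>s. s *\<^sub>R e)) (at 0)" by (auto intro!: derivative_eq_intros)
      from has_derivative_compose[OF this, of \<phi> "\<lambda>h. grad \<phi> x \<bullet> h"] smooth_has_derivative[OF sm]
      have "((\<lambda>s. \<phi> (x + s *\<^sub>R e)) has_derivative (\<lambda>s. grad \<phi> x $ i * s)) (at 0)"
        by (simp add: e_def inner_axis mult.commute)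
      then have "((\<lambda>s. \<phi> (x + s *\<^sub>R e)) has_real_derivative grad \<phi> x $ i) (at 0)"
        by (simp add: has_field_derivative_def)
      then have "((\<lambda>h. (\<phi> (x + h *\<^sub>R e) - \<phi> x) / h) \<longlongrightarrow> grad \<phi> x $ i) (at 0)"
        by (simp add: DERIV_def)
      moreover have "filterlim t (at 0) sequentially"
        unfolding filterlim_at using LIMSEQ_inverse_real_of_nat t by (auto simp: t_def[abs_def] eventually_sequentially)
      ultimately show "(\<lambda>n. q n x) \<longlonglongrightarrow> grad \<phi> x $ i"
        unfolding q_def by (rule filterlim_compose)
    qed
    show "AE x in lborel. norm (q n x) \<le> L * indicator (cball 0 (R + 1)) x" for n
    proof (rule AE_I2)
      fix x
      have b: "\<bar>q n x\<bar> \<le> L"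
        using L(2)[of "x + t n *\<^sub>R e" x] t(1)[of n] e by (simp add: q_def field_simps)
      moreover have "q n x = 0" if "x \<notin> cball 0 (R + 1)"
      proof -
        have "x \<notin> K" using that R by auto
        moreover have "x + t n *\<^sub>R e \<notin> K"
        proof
          assume "x + t n *\<^sub>R e \<in> K"
          then have "norm (x + t n *\<^sub>R e) \<le> R" using R by auto
          then have "norm x \<le> R + t n" using norm_triangle_ineq4[of "x + t n *\<^sub>R e" "t n *\<^sub>R e"] e t(1)[of n] by simp
          then show False using that t(2)[of n] by simp
        qed
        ultimately show ?thesis using K(2) by (simp add: q_def)
      qed
      ultimately show "norm (q n x) \<le> L * indicator (cball 0 (R + 1)) x" by (auto simp: indicator_def)
    qed
  qed simp_all
  then have "(LINT x|lborel. grad \<phi> x $ i) = 0" using q0 by (simp add: LIMSEQ_const_iff)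
  then show ?thesis by (simp add: lebesgue_integral_borel)
qed

lemma lebesgue_on_support:
  fixes f :: "plane \<Rightarrow> real"
  assumes "G \<in> sets lebesgue" and "\<And>x. x \<notin> G \<Longrightarrow> f x = 0"
  shows "integral\<^sup>L (lebesgue_on G) f = integral\<^sup>L lebesgue f"
proof -
  have "(\<lambda>x. indicator G x *\<^sub>R f x) = f" using assms(2) by (auto simp: indicator_def fun_eq_iff)
  then show ?thesis using assms(1) integral_restrict_space[of G lebesgue f] by simp
qed

text \<open>The product with a test function is again a test function, and its gradient integrates
  to zero; no boundary enters.\<close>

lemma integration_by_parts:
  assumes f: "smooth f" and \<phi>: "\<phi> \<in> test_functions G" and G: "open G" "bounded G"
  shows "(LINT x|lebesgue_on G. f x * grad \<phi> x $ i) = - (LINT x|lebesgue_on G. grad f x $ i * \<phi> x)"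
proof -
  have Gs: "G \<in> sets lebesgue" using G by simp
  have 1: "(LINT x|lebesgue_on G. grad (\<lambda>x. f x * \<phi> x) x $ i) = 0"
    using integral_grad_test[OF test_functions_mult[OF f \<phi>]]
      lebesgue_on_support[OF Gs, of "\<lambda>x. grad (\<lambda>x. f x * \<phi> x) x $ i"]
      test_functions_outside[OF test_functions_grad[OF test_functions_mult[OF f \<phi>]]] by simp
  have i: "integrable (lebesgue_on G) (\<lambda>x. f x * grad \<phi> x $ i)" "integrable (lebesgue_on G) (\<lambda>x. grad f x $ i * \<phi> x)"
    by (intro L2_mult_integrable L2_continuous smooth_continuous smooth_grad f test_functionsD(1)[OF \<phi>] G Gs)+
  have "grad (\<lambda>x. f x * \<phi> x) x $ i = f x * grad \<phi> x $ i + grad f x $ i * \<phi> x" for x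
    by (simp add: grad_mult[OF f test_functionsD(1)[OF \<phi>]])
  with 1 i show ?thesis by simp
qed

subsection \<open>Convolution\<close>

text \<open>Integrating over \<open>G\<close> only amounts to extending \<open>v\<close> by zero, so
  the values of \<open>v\<close> outside \<open>G\<close> do not matter.\<close>

definition convol :: "plane set \<Rightarrow> (plane \<Rightarrow> real) \<Rightarrow> (plane \<Rightarrow> real) \<Rightarrow> plane \<Rightarrow> real" where
  "convol G v \<kappa> x = (LINT y|lebesgue_on G. v y * \<kappa> (x - y))"

lemma convol_integrable:
  assumes v: "integrable (lebesgue_on G) v" and G: "G \<in> sets lebesgue" and \<kappa>: "\<kappa> \<in> test_functions H"
  shows "integrable (lebesgue_on G) (\<lambda>y. v y * \<kappa> (x - y))"
proof -
  obtain B where B: "B > 0" "\<And>x. \<bar>\<kappa> x\<bar> \<le> B" using test_functions_bounded[OF \<kappa>] by blast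
  have [measurable]: "v \<in> borel_measurable (lebesgue_on G)" using v by simp
  have "continuous_on G (\<lambda>y. \<kappa> (x - y))"
    by (rule continuous_on_compose2[OF smooth_continuous[OF test_functionsD(1)[OF \<kappa>], of UNIV]]) (auto intro: continuous_intros)
  then have [measurable]: "(\<lambda>y. \<kappa> (x - y)) \<in> borel_measurable (lebesgue_on G)"
    by (rule continuous_imp_measurable_on_sets_lebesgue) (rule G)
  show ?thesis
  proof (rule Bochner_Integration.integrable_bound)
    show "integrable (lebesgue_on G) (\<lambda>y. B * v y)" using v by simp
    show "AE y in lebesgue_on G. norm (v y * \<kappa> (x - y)) \<le> norm (B * v y)"
      using B mult_right_mono[OF B(2) abs_ge_zero] by (intro AE_I2) (simp add: abs_mult mult.commute[of "\<bar>v _\<bar>"])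
  qed measurable
qed

lemma has_derivative_quadratic_remainder:
  fixes f :: "plane \<Rightarrow> real"
  assumes "\<And>h. \<bar>f (x + h) - f x - v \<bullet> h\<bar> \<le> C * (norm h)\<^sup>2"
  shows "(f has_derivative (\<lambda>h. v \<bullet> h)) (at x)"
  unfolding has_derivative_at
proof
  show "bounded_linear ((\<bullet>) v)" by (rule bounded_linear_inner_right)
  have "((\<lambda>h::plane. C * norm h) \<longlongrightarrow> C * norm (0::plane)) (at 0)" by (intro tendsto_intros)
  then have l: "((\<lambda>h::plane. C * norm h) \<longlongrightarrow> 0) (at 0)" by simp
  show "(\<lambda>h. norm (f (x + h) - f x - v \<bullet> h) / norm h) \<midarrow>0\<rightarrow> 0"
  proof (rule tendsto_sandwich[OF _ _ tendsto_const l])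
    show "\<forall>\<^sub>F h in at 0. norm (f (x + h) - f x - v \<bullet> h) / norm h \<le> C * norm h"
      unfolding eventually_at_filter using assms
      by (intro always_eventually allI impI) (simp add: field_simps power2_eq_square)
  qed (auto intro: always_eventually)
qed

text \<open>The uniform Taylor bound of the kernel integrates against \<open>|v|\<close> and leaves
  a quadratic remainder. All derivatives fall on the kernel, so the statement can be
  iterated.\<close>

lemma convol_has_derivative:
  assumes v: "integrable (lebesgue_on G) v" and G: "G \<in> sets lebesgue" and \<kappa>: "\<kappa> \<in> test_functions H"
  shows "(convol G v \<kappa> has_derivative (\<lambda>h. (\<chi> i. convol G v (\<lambda>x. grad \<kappa> x $ i) x) \<bullet> h)) (at x)"
proof -
  obtain L where L: "L > 0" "\<And>x h. \<bar>\<kappa> (x + h) - \<kappa> x - grad \<kappa> x \<bullet> h\<bar> \<le> L * (norm h)\<^sup>2"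
    using test_functions_taylor[OF \<kappa>] by blast
  show ?thesis
  proof (rule has_derivative_quadratic_remainder[where C = "L * (LINT y|lebesgue_on G. \<bar>v y\<bar>)"])
    fix h
    note i = convol_integrable[OF v G]
    have ix: "integrable (lebesgue_on G) (\<lambda>y. v y * grad \<kappa> (x - y) $ j)" for j
      by (rule i[OF test_functions_grad[OF \<kappa>]])
    have "convol G v \<kappa> (x + h) - convol G v \<kappa> x - (\<chi> i. convol G v (\<lambda>x. grad \<kappa> x $ i) x) \<bullet> h
      = (LINT y|lebesgue_on G. v y * (\<kappa> ((x - y) + h) - \<kappa> (x - y) - grad \<kappa> (x - y) \<bullet> h))"
    proof -
      have "v y * (\<kappa> ((x - y) + h) - \<kappa> (x - y) - grad \<kappa> (x - y) \<bullet> h)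
        = v y * \<kappa> ((x + h) - y) - v y * \<kappa> (x - y) - ((v y * grad \<kappa> (x - y) $ 1) * h $ 1 + (v y * grad \<kappa> (x - y) $ 2) * h $ 2)" for y
        by (simp add: inner_vec2 algebra_simps)
      then show ?thesis
        using i[OF \<kappa>, of "x + h"] i[OF \<kappa>, of x] ix[of 1] ix[of 2]
        by (simp add: convol_def inner_vec2)
    qed
    also have "\<bar>\<dots>\<bar> \<le> (LINT y|lebesgue_on G. L * (norm h)\<^sup>2 * \<bar>v y\<bar>)"
    proof (rule integral_abs_bound_integral)
      have "integrable (lebesgue_on G) (\<lambda>y. v y * \<kappa> ((x + h) - y) - v y * \<kappa> (x - y) - ((v y * grad \<kappa> (x - y) $ 1) * h $ 1 + (v y * grad \<kappa> (x - y) $ 2) * h $ 2))"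
        using i[OF \<kappa>, of "x + h"] i[OF \<kappa>, of x] ix[of 1] ix[of 2] by simp
      then show "integrable (lebesgue_on G) (\<lambda>y. v y * (\<kappa> ((x - y) + h) - \<kappa> (x - y) - grad \<kappa> (x - y) \<bullet> h))"
        by (rule back_subst[where P = "integrable (lebesgue_on G)"]) (simp add: fun_eq_iff inner_vec2 algebra_simps)
      show "integrable (lebesgue_on G) (\<lambda>y. L * (norm h)\<^sup>2 * \<bar>v y\<bar>)" using v by simp
      fix y
      show "\<bar>v y * (\<kappa> ((x - y) + h) - \<kappa> (x - y) - grad \<kappa> (x - y) \<bullet> h)\<bar> \<le> L * (norm h)\<^sup>2 * \<bar>v y\<bar>"
        using mult_left_mono[OF L(2)[of "x - y" h] abs_ge_zero[of "v y"]] by (simp add: abs_mult mult.commute)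
    qed
    finally show "\<bar>convol G v \<kappa> (x + h) - convol G v \<kappa> x - (\<chi> i. convol G v (\<lambda>x. grad \<kappa> x $ i) x) \<bullet> h\<bar>
      \<le> L * (LINT y|lebesgue_on G. \<bar>v y\<bar>) * (norm h)\<^sup>2" by (simp add: mult_ac)
  qed
qed

lemma grad_convol:
  assumes v: "integrable (lebesgue_on G) v" and G: "G \<in> sets lebesgue" and \<kappa>: "\<kappa> \<in> test_functions H"
  shows "grad (convol G v \<kappa>) x $ i = convol G v (\<lambda>x. grad \<kappa> x $ i) x"
  using grad_eqI[OF convol_has_derivative[OF assms]] by simp

lemma smooth_convol:
  assumes v: "integrable (lebesgue_on G) v" and G: "G \<in> sets lebesgue" and \<kappa>: "\<kappa> \<in> test_functions H"
  shows "smooth (convol G v \<kappa>)"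
proof -
  have "\<kappa> \<in> test_functions H \<Longrightarrow> Ck k (convol G v \<kappa>)" for k \<kappa>
  proof (induction k arbitrary: \<kappa>)
    case 0
    have "continuous_on UNIV (convol G v \<kappa>)"
      by (intro continuous_at_imp_continuous_on ballI has_derivative_continuous[OF convol_has_derivative[OF v G 0]])
    then show ?case by simp
  next
    case (Suc k)
    show ?case
      by (rule Ck_SucI[OF convol_has_derivative[OF v G Suc.prems]])
        (use Suc.IH[OF test_functions_grad[OF Suc.prems]] in simp)
  qed
  then show ?thesis using \<kappa> by (simp add: smooth_def)
qed

section \<open>Continuous approximation in L2 and continuity under affine maps\<close>

lemma three_squares: "(a + b + c)\<^sup>2 \<le> 3 * a\<^sup>2 + 3 * b\<^sup>2 + 3 * (c::real)\<^sup>2"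
proof -
  have "0 \<le> (a - b)\<^sup>2 + (b - c)\<^sup>2 + (a - c)\<^sup>2" by simp
  then show ?thesis by (simp add: power2_eq_square algebra_simps)
qed

lemma two_squares: "(a + b)\<^sup>2 \<le> 2 * a\<^sup>2 + 2 * (b::real)\<^sup>2"
proof -
  have "0 \<le> (a - b)\<^sup>2" by simp
  then show ?thesis by (simp add: power2_eq_square algebra_simps)
qed

lemma L2_approx_bounded:
  fixes F :: "plane \<Rightarrow> real"
  assumes [measurable]: "F \<in> borel_measurable borel" and fin: "(\<integral>\<^sup>+x. ennreal ((F x)\<^sup>2) \<partial>lborel) < \<infinity>"
    and e: "e > 0"
  shows "\<exists>K>0. (\<integral>\<^sup>+x. ennreal ((F x - max (-K) (min K (F x)))\<^sup>2) \<partial>lborel) < ennreal e"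
proof -
  let ?T = "\<lambda>n x. max (- real (Suc n)) (min (real (Suc n)) (F x))"
  have "(\<lambda>n. \<integral>\<^sup>+x. ennreal ((F x - ?T n x)\<^sup>2) \<partial>lborel) \<longlonglongrightarrow> (\<integral>\<^sup>+x. 0 \<partial>(lborel :: plane measure))"
  proof (rule nn_integral_dominated_convergence[where w = "\<lambda>x. ennreal ((F x)\<^sup>2)"])
    show "AE x in lborel. ennreal ((F x - ?T n x)\<^sup>2) \<le> ennreal ((F x)\<^sup>2)" for n
    proof (intro AE_I2 ennreal_leI)
      fix x have "\<bar>F x - ?T n x\<bar> \<le> \<bar>F x\<bar>" by linarith
      then show "(F x - ?T n x)\<^sup>2 \<le> (F x)\<^sup>2" by (rule abs_le_square_iff[THEN iffD1])
    qed
    show "AE x in lborel. (\<lambda>n. ennreal ((F x - ?T n x)\<^sup>2)) \<longlonglongrightarrow> 0"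
    proof (rule AE_I2)
      fix x
      obtain N where N: "\<bar>F x\<bar> \<le> real N" using real_arch_simple by blast
      have "ennreal ((F x - ?T n x)\<^sup>2) = 0" if "n \<ge> N" for n
      proof -
        have "?T n x = F x" using N that by (simp add: max_def min_def) linarith
        then show ?thesis by simp
      qed
      then show "(\<lambda>n. ennreal ((F x - ?T n x)\<^sup>2)) \<longlonglongrightarrow> 0"
        by (intro tendsto_eventually) (auto simp: eventually_sequentially)
    qed
  qed (use fin in auto)
  then have "(\<lambda>n. \<integral>\<^sup>+x. ennreal ((F x - ?T n x)\<^sup>2) \<partial>lborel) \<longlonglongrightarrow> 0" by simp
  then have "\<forall>\<^sub>F n in sequentially. (\<integral>\<^sup>+x. ennreal ((F x - ?T n x)\<^sup>2) \<partial>lborel) < ennreal e"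
    by (rule order_tendstoD(2)) (use e in simp)
  then obtain n where "(\<integral>\<^sup>+x. ennreal ((F x - ?T n x)\<^sup>2) \<partial>lborel) < ennreal e"
    using eventually_happens'[OF sequentially_bot] by blast
  then show ?thesis by (intro exI[of _ "real (Suc n)"]) simp
qed

text \<open>Lebesgue measurability provides continuous functions converging almost everywhere to
  \<open>F\<close> on the ball. Clipping them at the bound \<open>K\<close> of \<open>F\<close>
  preserves continuity and the limit and makes dominated convergence applicable.\<close>

lemma L2_approx_continuous_bounded:
  fixes F :: "plane \<Rightarrow> real"
  assumes [measurable]: "F \<in> borel_measurable borel" and K: "K > 0" "\<And>x. \<bar>F x\<bar> \<le> K" and e: "e > 0"
  shows "\<exists>c. continuous_on UNIV c \<and> (\<integral>\<^sup>+x. indicator (ball 0 R) x * ennreal ((F x - c x)\<^sup>2) \<partial>lborel) < ennreal e"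
proof -
  let ?S = "ball (0::plane) R"
  have [measurable]: "?S \<in> sets borel" by simp
  have "F \<in> borel_measurable (lebesgue_on ?S)"
    using assms(1) by (intro measurable_restrict_space1 measurable_completion) simp
  then have "F measurable_on ?S" by (simp add: measurable_on_iff_borel_measurable)
  then obtain N g where N: "negligible N" and g: "\<And>n. continuous_on UNIV (g n)"
    and lim: "\<And>x. x \<notin> N \<Longrightarrow> (\<lambda>n. g n x) \<longlonglongrightarrow> (if x \<in> ?S then F x else 0)"
    unfolding measurable_on_def by blast
  let ?c = "\<lambda>n x. max (-K) (min K (g n x))"
  have cc: "continuous_on UNIV (?c n)" for n by (intro continuous_intros g)
  then have [measurable]: "?c n \<in> borel_measurable borel" for n by (intro borel_measurable_continuous_onI)
  have ae: "AE x in lborel. x \<notin> N"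
  proof -
    have "AE x in lebesgue. x \<notin> N" using N unfolding negligible_iff_null_sets by (rule AE_not_in)
    then show ?thesis by (simp add: AE_completion_iff)
  qed
  have "(\<lambda>n. \<integral>\<^sup>+x. indicator ?S x * ennreal ((F x - ?c n x)\<^sup>2) \<partial>lborel) \<longlonglongrightarrow> (\<integral>\<^sup>+x. 0 \<partial>(lborel :: plane measure))"
  proof (rule nn_integral_dominated_convergence[where w = "\<lambda>x. ennreal ((2 * K)\<^sup>2) * indicator ?S x"])
    show "AE x in lborel. indicator ?S x * ennreal ((F x - ?c n x)\<^sup>2) \<le> ennreal ((2 * K)\<^sup>2) * indicator ?S x" for n
    proof (intro AE_I2)
      fix x have "\<bar>F x - ?c n x\<bar> \<le> \<bar>2 * K\<bar>" using K(1) K(2)[of x] by linarith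
      then have "(F x - ?c n x)\<^sup>2 \<le> (2 * K)\<^sup>2" by (rule abs_le_square_iff[THEN iffD1])
      then show "indicator ?S x * ennreal ((F x - ?c n x)\<^sup>2) \<le> ennreal ((2 * K)\<^sup>2) * indicator ?S x"
        by (auto simp: indicator_def intro: ennreal_leI)
    qed
    show "(\<integral>\<^sup>+x. ennreal ((2 * K)\<^sup>2) * indicator ?S x \<partial>lborel) < \<infinity>"
      using emeasure_bounded_finite[of ?S] by (simp add: nn_integral_cmult_indicator ennreal_mult_less_top)
    show "AE x in lborel. (\<lambda>n. indicator ?S x * ennreal ((F x - ?c n x)\<^sup>2)) \<longlonglongrightarrow> 0"
      using ae
    proof eventually_elim
      fix x assume x: "x \<notin> N"
      show "(\<lambda>n. indicator ?S x * ennreal ((F x - ?c n x)\<^sup>2)) \<longlonglongrightarrow> 0"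
      proof (cases "x \<in> ?S")
        case True
        then have "(\<lambda>n. g n x) \<longlonglongrightarrow> F x" using lim[OF x] by simp
        then have "(\<lambda>n. ennreal ((F x - ?c n x)\<^sup>2)) \<longlonglongrightarrow> ennreal ((F x - max (-K) (min K (F x)))\<^sup>2)"
          by (intro tendsto_intros)
        moreover have "max (-K) (min K (F x)) = F x" using K(2)[of x] by linarith
        ultimately show ?thesis using True by simp
      qed simp
    qed
  qed (auto)
  then have "(\<lambda>n. \<integral>\<^sup>+x. indicator ?S x * ennreal ((F x - ?c n x)\<^sup>2) \<partial>lborel) \<longlonglongrightarrow> 0" by simp
  then have "\<forall>\<^sub>F n in sequentially. (\<integral>\<^sup>+x. indicator ?S x * ennreal ((F x - ?c n x)\<^sup>2) \<partial>lborel) < ennreal e"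
    by (rule order_tendstoD(2)) (use e in simp)
  then obtain n where "(\<integral>\<^sup>+x. indicator ?S x * ennreal ((F x - ?c n x)\<^sup>2) \<partial>lborel) < ennreal e"
    using eventually_happens'[OF sequentially_bot] by blast
  with cc[of n] show ?thesis by blast
qed

lemma L2_approx_continuous:
  fixes F :: "plane \<Rightarrow> real"
  assumes m[measurable]: "F \<in> borel_measurable borel" and fin: "(\<integral>\<^sup>+x. ennreal ((F x)\<^sup>2) \<partial>lborel) < \<infinity>"
    and e: "e > 0"
  shows "\<exists>c. continuous_on UNIV c \<and> (\<integral>\<^sup>+x. indicator (ball 0 R) x * ennreal ((F x - c x)\<^sup>2) \<partial>lborel) < ennreal e"
proof -
  obtain K where K: "K > 0" "(\<integral>\<^sup>+x. ennreal ((F x - max (-K) (min K (F x)))\<^sup>2) \<partial>lborel) < ennreal (e / 8)"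
    using L2_approx_bounded[OF m fin, of "e / 8"] e by auto
  let ?T = "\<lambda>x. max (-K) (min K (F x))"
  have "\<exists>c. continuous_on UNIV c \<and> (\<integral>\<^sup>+x. indicator (ball 0 R) x * ennreal ((?T x - c x)\<^sup>2) \<partial>lborel) < ennreal (e / 8)"
    by (rule L2_approx_continuous_bounded[OF _ K(1)]) (use K(1) e in \<open>auto simp: max_def min_def\<close>)
  then obtain c where c: "continuous_on UNIV c"
    and c2: "(\<integral>\<^sup>+x. indicator (ball 0 R) x * ennreal ((?T x - c x)\<^sup>2) \<partial>lborel) < ennreal (e / 8)" by blast
  have [measurable]: "c \<in> borel_measurable borel" using c by (rule borel_measurable_continuous_onI)
  have [measurable]: "ball (0::plane) R \<in> sets borel" by simp
  have "(\<integral>\<^sup>+x. indicator (ball 0 R) x * ennreal ((F x - c x)\<^sup>2) \<partial>lborel)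
    \<le> (\<integral>\<^sup>+x. 2 * ennreal ((F x - ?T x)\<^sup>2) + 2 * (indicator (ball 0 R) x * ennreal ((?T x - c x)\<^sup>2)) \<partial>lborel)"
  proof (rule nn_integral_mono)
    fix x
    have "(F x - c x)\<^sup>2 \<le> 2 * (F x - ?T x)\<^sup>2 + 2 * (?T x - c x)\<^sup>2"
      using two_squares[of "F x - ?T x" "?T x - c x"] by simp
    then have "ennreal ((F x - c x)\<^sup>2) \<le> ennreal (2 * (F x - ?T x)\<^sup>2 + 2 * (?T x - c x)\<^sup>2)"
      by (rule ennreal_leI)
    also have "\<dots> = 2 * ennreal ((F x - ?T x)\<^sup>2) + 2 * ennreal ((?T x - c x)\<^sup>2)"
      by (simp add: ennreal_plus ennreal_mult)
    finally show "indicator (ball 0 R) x * ennreal ((F x - c x)\<^sup>2) \<le> 2 * ennreal ((F x - ?T x)\<^sup>2) + 2 * (indicator (ball 0 R) x * ennreal ((?T x - c x)\<^sup>2))"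
      by (auto simp: indicator_def)
  qed
  also have "\<dots> = 2 * (\<integral>\<^sup>+x. ennreal ((F x - ?T x)\<^sup>2) \<partial>lborel) + 2 * (\<integral>\<^sup>+x. indicator (ball 0 R) x * ennreal ((?T x - c x)\<^sup>2) \<partial>lborel)"
    by (subst nn_integral_add) (auto simp: nn_integral_cmult)
  also have "\<dots> \<le> 2 * ennreal (e / 8) + 2 * ennreal (e / 8)"
    by (intro add_mono mult_left_mono less_imp_le[OF K(2)] less_imp_le[OF c2]) auto
  also have "\<dots> = ennreal (e / 2)" using e by (simp flip: ennreal_plus ennreal_numeral ennreal_mult)
  also have "\<dots> < ennreal e" using e by (intro ennreal_lessI) auto
  finally show ?thesis using c by blast
qed

text \<open>Continuity of translation in L2, extended to \<open>x \<mapsto> t + l x\<close> because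
  the density proof also contracts the domain. \<open>F\<close> is exchanged for a uniformly
  continuous function at both points; \<open>1/2 \<le> l\<close> limits the cost of the change of
  variables to a factor 4.\<close>

lemma L2_affine_continuity:
  fixes F :: "plane \<Rightarrow> real"
  assumes m[measurable]: "F \<in> borel_measurable borel" and fin: "(\<integral>\<^sup>+x. ennreal ((F x)\<^sup>2) \<partial>lborel) < \<infinity>"
    and G: "open G" "bounded G" and e: "e > 0"
  shows "\<exists>d>0. \<forall>l t. 1/2 \<le> l \<longrightarrow> (\<forall>x\<in>G. norm (t + l *\<^sub>R x - x) < d) \<longrightarrow>
    (\<integral>\<^sup>+x. indicator G x * ennreal ((F (t + l *\<^sub>R x) - F x)\<^sup>2) \<partial>lborel) \<le> ennreal e"
proof -
  obtain R0 where R0: "G \<subseteq> ball 0 R0" using bounded_subset_ballD[OF G(2), of 0] by blast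
  \<comment> \<open>The displacement will be less than \<open>d \<le> 1\<close>, so displaced points
    of \<open>G\<close> stay in this ball.\<close>
  define R where "R = R0 + 1"
  \<comment> \<open>The three terms contribute at most \<open>12 \<delta>\<close>,
    \<open>3 \<delta>\<close> and \<open>3 \<delta>\<close>; the first carries the factor 4 of the
    substitution.\<close>
  define \<delta> where "\<delta> = e / 24"
  have \<delta>: "\<delta> > 0" using e by (simp add: \<delta>_def)
  have [measurable]: "G \<in> sets borel" using G by simp
  obtain c where c: "continuous_on UNIV c" and c2: "(\<integral>\<^sup>+x. indicator (ball 0 R) x * ennreal ((F x - c x)\<^sup>2) \<partial>lborel) < ennreal \<delta>"
    using L2_approx_continuous[OF m fin \<delta>] by blast
  have [measurable]: "c \<in> borel_measurable borel" using c by (rule borel_measurable_continuous_onI)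
  have [measurable]: "ball (0::plane) R \<in> sets borel" by simp
  define m where "m = measure lborel G + 1"
  have m: "m > 0" by (simp add: m_def add_nonneg_pos)
  have em: "emeasure lborel G \<le> ennreal m"
    using emeasure_bounded_finite[OF G(2)] by (simp add: emeasure_eq_ennreal_measure m_def ennreal_leI)
  define \<epsilon> where "\<epsilon> = sqrt (\<delta> / m)"
  have \<epsilon>: "\<epsilon> > 0" "\<epsilon>\<^sup>2 = \<delta> / m" using \<delta> m by (auto simp: \<epsilon>_def)
  have "uniformly_continuous_on (cball 0 R) c"
    by (rule compact_uniformly_continuous) (auto intro: continuous_on_subset[OF c])
  then obtain d0 where d0: "d0 > 0" "\<And>x y. x \<in> cball 0 R \<Longrightarrow> y \<in> cball 0 R \<Longrightarrow> dist y x < d0 \<Longrightarrow> dist (c y) (c x) < \<epsilon>"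
    unfolding uniformly_continuous_on_def using \<epsilon>(1) by meson
  define d where "d = min d0 1"
  have "(\<integral>\<^sup>+x. indicator G x * ennreal ((F (t + l *\<^sub>R x) - F x)\<^sup>2) \<partial>lborel) \<le> ennreal e"
    if l: "1/2 \<le> l" and close: "\<forall>x\<in>G. norm (t + l *\<^sub>R x - x) < d" for l t
  proof -
    let ?y = "\<lambda>x. t + l *\<^sub>R x"
    let ?I = "indicator (ball 0 R) :: plane \<Rightarrow> ennreal"
    have "(\<integral>\<^sup>+x. indicator G x * ennreal ((F (?y x) - F x)\<^sup>2) \<partial>lborel)
      \<le> (\<integral>\<^sup>+x. 3 * (?I (?y x) * ennreal ((F (?y x) - c (?y x))\<^sup>2)) + ennreal (3 * \<epsilon>\<^sup>2) * indicator G x + 3 * (?I x * ennreal ((F x - c x)\<^sup>2)) \<partial>lborel)"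
    proof (rule nn_integral_mono)
      fix x
      show "indicator G x * ennreal ((F (?y x) - F x)\<^sup>2) \<le> 3 * (?I (?y x) * ennreal ((F (?y x) - c (?y x))\<^sup>2)) + ennreal (3 * \<epsilon>\<^sup>2) * indicator G x + 3 * (?I x * ennreal ((F x - c x)\<^sup>2))"
      proof (cases "x \<in> G")
        case True
        then have n: "norm (?y x - x) < d" using close by blast
        have x: "norm x < R0" using True R0 by auto
        have "norm (?y x) \<le> norm x + norm (?y x - x)" using norm_triangle_ineq[of x "?y x - x"] by simp
        then have y: "norm (?y x) < R" using n x by (simp add: R_def d_def)
        have xR: "norm x < R" using x by (simp add: R_def)
        have "dist (c (?y x)) (c x) < \<epsilon>" by (rule d0; (simp only: mem_cball_0)?) (use n y xR in \<open>auto simp: d_def dist_norm\<close>)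
        then have "\<bar>c (?y x) - c x\<bar> \<le> \<bar>\<epsilon>\<bar>" by (simp add: dist_real_def)
        then have cc: "(c (?y x) - c x)\<^sup>2 \<le> \<epsilon>\<^sup>2" by (rule abs_le_square_iff[THEN iffD1])
        have "(F (?y x) - F x)\<^sup>2 \<le> 3 * (F (?y x) - c (?y x))\<^sup>2 + 3 * (c (?y x) - c x)\<^sup>2 + 3 * (c x - F x)\<^sup>2"
          using three_squares[of "F (?y x) - c (?y x)" "c (?y x) - c x" "c x - F x"] by simp
        also have "\<dots> \<le> 3 * (F (?y x) - c (?y x))\<^sup>2 + 3 * \<epsilon>\<^sup>2 + 3 * (F x - c x)\<^sup>2"
          using cc by (simp add: power2_commute)
        finally have "ennreal ((F (?y x) - F x)\<^sup>2) \<le> ennreal (3 * (F (?y x) - c (?y x))\<^sup>2 + 3 * \<epsilon>\<^sup>2 + 3 * (F x - c x)\<^sup>2)"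
          by (rule ennreal_leI)
        also have "\<dots> = 3 * ennreal ((F (?y x) - c (?y x))\<^sup>2) + ennreal (3 * \<epsilon>\<^sup>2) + 3 * ennreal ((F x - c x)\<^sup>2)"
          by (simp add: ennreal_plus ennreal_mult)
        finally show ?thesis using True y xR by simp
      qed simp
    qed
    also have "\<dots> = 3 * (\<integral>\<^sup>+x. ?I (?y x) * ennreal ((F (?y x) - c (?y x))\<^sup>2) \<partial>lborel) + ennreal (3 * \<epsilon>\<^sup>2) * emeasure lborel G
        + 3 * (\<integral>\<^sup>+x. ?I x * ennreal ((F x - c x)\<^sup>2) \<partial>lborel)"
      by (simp add: nn_integral_add nn_integral_cmult nn_integral_cmult_indicator)
    also have "\<dots> \<le> 3 * ennreal (4 * \<delta>) + ennreal (3 * \<delta>) + 3 * ennreal \<delta>"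
    proof (intro add_mono mult_left_mono)
      let ?J = "\<integral>\<^sup>+x. ?I (?y x) * ennreal ((F (?y x) - c (?y x))\<^sup>2) \<partial>lborel"
      have "?J \<le> ennreal 4 * (ennreal (l\<^sup>2) * ?J)"
      proof -
        have "(1/2)\<^sup>2 \<le> l\<^sup>2" using l by (intro power_mono) auto
        then have "1 \<le> 4 * l\<^sup>2" by (simp add: power2_eq_square)
        then have "1 * ?J \<le> ennreal (4 * l\<^sup>2) * ?J" by (intro mult_right_mono) auto
        then show ?thesis by (simp add: ennreal_mult mult.assoc)
      qed
      also have "ennreal (l\<^sup>2) * ?J = (\<integral>\<^sup>+x. ?I x * ennreal ((F x - c x)\<^sup>2) \<partial>lborel)"
        using l by (intro nn_integral_lborel_affine[symmetric]) auto
      also have "ennreal 4 * \<dots> \<le> ennreal 4 * ennreal \<delta>" using c2 by (intro mult_left_mono) auto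
      finally show "?J \<le> ennreal (4 * \<delta>)" using \<delta> by (simp add: ennreal_mult)
      show "ennreal (3 * \<epsilon>\<^sup>2) * emeasure lborel G \<le> ennreal (3 * \<delta>)"
      proof -
        have "ennreal (3 * \<epsilon>\<^sup>2) * emeasure lborel G \<le> ennreal (3 * \<epsilon>\<^sup>2) * ennreal m" using em by (intro mult_left_mono) auto
        also have "\<dots> = ennreal (3 * \<delta>)" using \<epsilon>(2) m \<delta> by (simp flip: ennreal_mult)
        finally show ?thesis .
      qed
    qed (use c2 in auto)
    also have "\<dots> \<le> ennreal e"
    proof -
      have "3 * ennreal (4 * \<delta>) + ennreal (3 * \<delta>) + 3 * ennreal \<delta> = ennreal (18 * \<delta>)"
        using \<delta> by (simp flip: ennreal_plus ennreal_numeral ennreal_mult)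
      also have "\<dots> \<le> ennreal e" using e by (intro ennreal_leI) (simp add: \<delta>_def)
      finally show ?thesis .
    qed
    finally show ?thesis .
  qed
  then show ?thesis using d0(1) by (intro exI[of _ d]) (auto simp: d_def)
qed

section \<open>The mollifier and its convergence in L2\<close>

definition bump_mass :: real where
  "bump_mass = (LINT x|lborel. bump x)"

definition mollifier :: "real \<Rightarrow> plane \<Rightarrow> real" where
  "mollifier \<epsilon> x = bump (x /\<^sub>R \<epsilon>) / (bump_mass * \<epsilon>\<^sup>2)"

lemma bump_integrable: "integrable lborel bump"
proof (rule Bochner_Integration.integrable_bound)
  show "integrable lborel (indicator (cball 0 1) :: plane \<Rightarrow> real)"
    using emeasure_bounded_finite[of "cball (0::plane) 1"] by (simp add: less_top)
  show "AE x in lborel. norm (bump x) \<le> norm (indicator (cball 0 1) x :: real)"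
    using bump_nonneg bump_le_1 bump_outside by (auto simp: indicator_def)
qed simp

lemma bump_mass_pos: "bump_mass > 0"
proof -
  have "bump_mass \<ge> 0" unfolding bump_mass_def by (simp add: bump_nonneg)
  moreover have "bump_mass \<noteq> 0"
  proof
    assume "bump_mass = 0"
    then have "AE x in lborel. bump x = 0"
      unfolding bump_mass_def using bump_integrable bump_nonneg
      by (subst (asm) integral_nonneg_eq_0_iff_AE) auto
    then have "AE x in lborel. x \<notin> ball (0::plane) 1"
    proof eventually_elim
      fix x :: plane assume "bump x = 0"
      then show "x \<notin> ball 0 1" using bump_pos[of x] by auto
    qed
    then have "emeasure lborel (ball (0::plane) 1) = 0"
      by (subst (asm) AE_iff_measurable[where N = "ball 0 1"]) auto
    then have "negligible (ball (0::plane) 1)"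
      by (simp add: negligible_iff_null_sets null_sets_completionI null_sets_def)
    then show False using open_not_negligible[of "ball (0::plane) 1"] by simp
  qed
  ultimately show ?thesis by simp
qed

lemma mollifier_test:
  assumes "\<epsilon> > 0"
  shows "mollifier \<epsilon> \<in> test_functions UNIV"
  using test_functions_mult[OF smooth_const bump_scaled_test[OF assms, of 0 UNIV], of "1 / (bump_mass * \<epsilon>\<^sup>2)"]
  by (simp add: mollifier_def[abs_def])

text \<open>Convolution at \<open>x\<close> is testing against the reflected kernel, provided the
  ball around \<open>x\<close> stays in \<open>G\<close>; the minus sign of its gradient cancels the
  one in the definition of the weak gradient.\<close>

lemma mollifier_reflected:
  assumes "\<epsilon> > 0" and "cball x \<epsilon> \<subseteq> G"
  shows "(\<lambda>y. mollifier \<epsilon> (x - y)) \<in> test_functions G"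
    and "grad (\<lambda>y. mollifier \<epsilon> (x - y)) y = - grad (mollifier \<epsilon>) (x - y)"
proof -
  have sm: "smooth (\<lambda>y. mollifier \<epsilon> (x - y))"
    using smooth_affine[OF test_functionsD(1)[OF mollifier_test[OF assms(1)]], of x "-1"] by simp
  show "(\<lambda>y. mollifier \<epsilon> (x - y)) \<in> test_functions G"
  proof (rule test_functionsI[OF sm compact_cball assms(2)])
    fix y assume "y \<notin> cball x \<epsilon>"
    then have "1 \<le> norm (x - y) / \<epsilon>" using assms(1) by (simp add: dist_norm)
    also have "\<dots> = norm ((x - y) /\<^sub>R \<epsilon>)" using assms(1) by (simp add: divide_inverse_commute)
    finally show "mollifier \<epsilon> (x - y) = 0" by (simp add: mollifier_def bump_outside)
  qed
  show "grad (\<lambda>y. mollifier \<epsilon> (x - y)) y = - grad (mollifier \<epsilon>) (x - y)"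
    using grad_affine[OF test_functionsD(1)[OF mollifier_test[OF assms(1)]], of x "-1" y] by simp
qed

text \<open>Jensen's inequality for the probability density \<open>bump / bump_mass\<close>:
  Cauchy-Schwarz with the density split into two square roots. If the right side is infinite there
  is nothing to show.\<close>

lemma jensen_bump:
  fixes h :: "plane \<Rightarrow> real"
  assumes [measurable]: "h \<in> borel_measurable borel"
  shows "ennreal ((LINT w|lborel. h w * (bump w / bump_mass))\<^sup>2) \<le> (\<integral>\<^sup>+w. ennreal ((h w)\<^sup>2 * (bump w / bump_mass)) \<partial>lborel)"
proof (cases "integrable lborel (\<lambda>w. (h w)\<^sup>2 * (bump w / bump_mass))")
  case False
  then have "(\<integral>\<^sup>+w. ennreal ((h w)\<^sup>2 * (bump w / bump_mass)) \<partial>lborel) = \<infinity>"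
    using bump_nonneg bump_mass_pos
    by (auto simp: integrable_iff_bounded less_top[symmetric] abs_of_nonneg)
  then show ?thesis by simp
next
  case True
  define k where "k w = sqrt (bump w / bump_mass)" for w
  have k2: "k w * k w = bump w / bump_mass" for w
    using bump_nonneg bump_mass_pos by (simp add: k_def)
  have [measurable]: "k \<in> borel_measurable borel" unfolding k_def by measurable
  have k: "k \<in> L2 lborel" using bump_integrable by (simp add: L2_def power2_eq_square k2)
  have hk: "(\<lambda>w. h w * k w) \<in> L2 lborel"
    using True by (simp add: L2_def power_mult_distrib) (simp add: power2_eq_square k2)
  have "\<bar>L2_inner lborel (\<lambda>w. h w * k w) k\<bar> \<le> L2_norm lborel (\<lambda>w. h w * k w) * L2_norm lborel k"
    by (rule L2_Cauchy_Schwarz[OF hk k])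
  moreover have "L2_norm lborel k = 1"
    using bump_mass_pos by (simp add: L2_norm_def power2_eq_square k2) (simp add: bump_mass_def)
  moreover have "L2_inner lborel (\<lambda>w. h w * k w) k = (LINT w|lborel. h w * (bump w / bump_mass))"
    by (simp add: L2_inner_def mult.assoc k2)
  ultimately have "\<bar>LINT w|lborel. h w * (bump w / bump_mass)\<bar> \<le> \<bar>L2_norm lborel (\<lambda>w. h w * k w)\<bar>" by simp
  then have "(LINT w|lborel. h w * (bump w / bump_mass))\<^sup>2 \<le> (L2_norm lborel (\<lambda>w. h w * k w))\<^sup>2"
    by (rule abs_le_square_iff[THEN iffD1])
  also have "\<dots> = (LINT w|lborel. (h w)\<^sup>2 * (bump w / bump_mass))"
    by (simp add: L2_norm_power2 power_mult_distrib) (simp add: power2_eq_square k2)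
  finally have "ennreal ((LINT w|lborel. h w * (bump w / bump_mass))\<^sup>2) \<le> ennreal (LINT w|lborel. (h w)\<^sup>2 * (bump w / bump_mass))"
    by (rule ennreal_leI)
  also have "\<dots> = (\<integral>\<^sup>+w. ennreal ((h w)\<^sup>2 * (bump w / bump_mass)) \<partial>lborel)"
    by (rule nn_integral_eq_integral[symmetric, OF True]) (use bump_nonneg bump_mass_pos in \<open>auto intro!: AE_I2\<close>)
  finally show ?thesis .
qed

text \<open>Fubini and affine substitutions are carried out for \<open>lborel\<close>, where a Borel
  function stays measurable after composition with the affine maps; \<open>v\<close> extended by
  zero is therefore replaced by a Borel function almost everywhere equal to it.\<close>

lemma borel_representative:
  fixes v :: "plane \<Rightarrow> real"
  assumes v: "v \<in> borel_measurable (lebesgue_on G)" and G: "G \<in> sets lebesgue"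
  obtains F where "F \<in> borel_measurable borel" "AE x in lebesgue. F x = (if x \<in> G then v x else 0)"
proof -
  have "(\<lambda>x. if x \<in> G then v x else 0) \<in> borel_measurable lebesgue"
    using v G by (simp add: borel_measurable_if)
  from completion_ex_borel_measurable_real[OF this]
  obtain F where F: "F \<in> borel_measurable lborel" "AE x in lborel. (if x \<in> G then v x else 0) = F x" by blast
  from AE_completion[OF F(2)] have "AE x in lebesgue. F x = (if x \<in> G then v x else 0)"
    by eventually_elim simp
  with F(1) show ?thesis by (intro that) auto
qed

text \<open>The substitution \<open>y = x - \<epsilon> w\<close>; its Jacobian \<epsilon>^2 cancels
  the normalisation of the mollifier, leaving an average over the unit disc with fixed
  weight.\<close>

lemma convol_mollifier:
  fixes v :: "plane \<Rightarrow> real"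
  assumes G: "G \<in> sets lebesgue" and [measurable]: "F \<in> borel_measurable borel"
    and ae: "AE x in lebesgue. F x = (if x \<in> G then v x else 0)" and \<epsilon>: "\<epsilon> > 0"
  shows "convol G v (mollifier \<epsilon>) x = (LINT w|lborel. F (x - \<epsilon> *\<^sub>R w) * (bump w / bump_mass))"
proof -
  have [measurable]: "mollifier \<epsilon> \<in> borel_measurable borel"
    unfolding mollifier_def[abs_def] by measurable
  have "convol G v (mollifier \<epsilon>) x = (LINT y|lebesgue. indicator G y *\<^sub>R (v y * mollifier \<epsilon> (x - y)))"
    unfolding convol_def using G by (simp add: integral_restrict_space)
  also have "\<dots> = (LINT y|lebesgue_on UNIV. indicator G y *\<^sub>R (v y * mollifier \<epsilon> (x - y)))"
    by (simp add: lebesgue_on_UNIV_eq)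
  also have "\<dots> = (LINT y|lebesgue_on UNIV. F y * mollifier \<epsilon> (x - y))"
  proof (rule integral_lebesgue_on_cong_AE)
    show "AE y in lebesgue_on UNIV. indicator G y *\<^sub>R (v y * mollifier \<epsilon> (x - y)) = F y * mollifier \<epsilon> (x - y)"
      unfolding lebesgue_on_UNIV_eq using ae by eventually_elim (auto simp: indicator_def)
  qed simp
  also have "\<dots> = (LINT y|lborel. F y * mollifier \<epsilon> (x - y))"
    unfolding lebesgue_on_UNIV_eq by (rule lebesgue_integral_borel) measurable
  also have "\<dots> = (- \<epsilon>)\<^sup>2 * (LINT w|lborel. F (x + (- \<epsilon>) *\<^sub>R w) * mollifier \<epsilon> (x - (x + (- \<epsilon>) *\<^sub>R w)))"
    using \<epsilon> by (intro integral_lborel_affine) auto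
  also have "\<dots> = (LINT w|lborel. \<epsilon>\<^sup>2 * (F (x - \<epsilon> *\<^sub>R w) * mollifier \<epsilon> (\<epsilon> *\<^sub>R w)))" by simp
  also have "\<dots> = (LINT w|lborel. F (x - \<epsilon> *\<^sub>R w) * (bump w / bump_mass))"
    using \<epsilon> by (intro Bochner_Integration.integral_cong) (auto simp: mollifier_def)
  finally show ?thesis .
qed

lemma L2_square_finite:
  assumes v: "v \<in> L2 (lebesgue_on G)" and G: "G \<in> sets lebesgue" and F: "F \<in> borel_measurable borel"
    and ae: "AE x in lebesgue. F x = (if x \<in> G then v x else (0::real))"
  shows "(\<integral>\<^sup>+x. ennreal ((F x)\<^sup>2) \<partial>lborel) < \<infinity>"
proof -
  have "integrable lebesgue (\<lambda>x. indicator G x *\<^sub>R (norm (v x))\<^sup>2)"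
    using L2D(2)[OF v] G by (simp add: integrable_restrict_space)
  then have "integrable lebesgue (\<lambda>x. (F x)\<^sup>2)"
  proof (subst integrable_cong_AE)
    show "AE x in lebesgue. (F x)\<^sup>2 = indicator G x *\<^sub>R (norm (v x))\<^sup>2"
      using ae by eventually_elim (auto simp: indicator_def)
    show "(\<lambda>x. (F x)\<^sup>2) \<in> borel_measurable lebesgue" using F by (intro measurable_completion) simp
  qed auto
  then have "integrable lborel (\<lambda>x. (F x)\<^sup>2)" using F by (subst (asm) lebesgue_integral_borel) auto
  then show ?thesis by (simp add: integrable_iff_bounded)
qed

text \<open>By Jensen and Fubini the squared error is at most an average, over \<open>w\<close> in
  the unit disc, of the squared errors of \<open>F\<close> under the affine maps with shift
  \<open>t - \<epsilon> w\<close>. Convolution and affine map are treated together for the sake of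
  the density proof; \<open>t = 0\<close>, \<open>l = 1\<close> is plain mollification.\<close>

theorem mollify_converges:
  assumes v: "v \<in> L2 (lebesgue_on G)" and G: "open G" "bounded G" and e: "e > 0"
  shows "\<exists>d>0. \<forall>l t \<epsilon>. 1/2 \<le> l \<longrightarrow> 0 < \<epsilon> \<longrightarrow> (\<forall>x\<in>G. norm (t + l *\<^sub>R x - x) + \<epsilon> < d) \<longrightarrow>
    (L2_norm (lebesgue_on G) (\<lambda>x. convol G v (mollifier \<epsilon>) (t + l *\<^sub>R x) - v x))\<^sup>2 \<le> e"
proof -
  have Gl: "G \<in> sets lebesgue" and [measurable]: "G \<in> sets borel" using G by auto
  obtain F where F [measurable]: "F \<in> borel_measurable borel" and ae: "AE x in lebesgue. F x = (if x \<in> G then v x else 0)"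
    using borel_representative[OF L2D(1)[OF v] Gl] by blast
  have fin: "(\<integral>\<^sup>+x. ennreal ((F x)\<^sup>2) \<partial>lborel) < \<infinity>" by (rule L2_square_finite[OF v Gl F ae])
  obtain d where d: "d > 0" and D: "\<And>l t. 1/2 \<le> l \<Longrightarrow> (\<forall>x\<in>G. norm (t + l *\<^sub>R x - x) < d) \<Longrightarrow>
    (\<integral>\<^sup>+x. indicator G x * ennreal ((F (t + l *\<^sub>R x) - F x)\<^sup>2) \<partial>lborel) \<le> ennreal e"
    using L2_affine_continuity[OF F fin G e] by blast
  have "(L2_norm (lebesgue_on G) (\<lambda>x. convol G v (mollifier \<epsilon>) (t + l *\<^sub>R x) - v x))\<^sup>2 \<le> e"
    if l: "1/2 \<le> l" and \<epsilon>: "0 < \<epsilon>" and cl: "\<forall>x\<in>G. norm (t + l *\<^sub>R x - x) + \<epsilon> < d" for l t \<epsilon>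
  proof -
    define C where "C x = (LINT w|lborel. F (t + l *\<^sub>R x - \<epsilon> *\<^sub>R w) * (bump w / bump_mass))" for x
    have C: "convol G v (mollifier \<epsilon>) (t + l *\<^sub>R x) = C x" for x
      unfolding C_def by (rule convol_mollifier[OF Gl F ae \<epsilon>])
    have [measurable]: "C \<in> borel_measurable borel"
      unfolding C_def by measurable
    have nn: "(\<integral>\<^sup>+x. indicator G x * ennreal ((C x - F x)\<^sup>2) \<partial>lborel) \<le> ennreal e"
    proof -
      have pt: "ennreal ((C x - F x)\<^sup>2) \<le> (\<integral>\<^sup>+w. ennreal ((F (t + l *\<^sub>R x - \<epsilon> *\<^sub>R w) - F x)\<^sup>2 * (bump w / bump_mass)) \<partial>lborel)"
        if ix: "integrable lborel (\<lambda>w. F (t + l *\<^sub>R x - \<epsilon> *\<^sub>R w) * (bump w / bump_mass))" for x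
      proof -
        have "C x - F x = (LINT w|lborel. (F (t + l *\<^sub>R x - \<epsilon> *\<^sub>R w) - F x) * (bump w / bump_mass))"
        proof -
          have "(LINT w|lborel. F x * (bump w / bump_mass)) = F x"
            using bump_mass_pos by (simp add: bump_mass_def)
          moreover have "integrable lborel (\<lambda>w. F x * (bump w / bump_mass))" using bump_integrable by simp
          ultimately show ?thesis using ix unfolding C_def left_diff_distrib by simp
        qed
        then show ?thesis using jensen_bump[of "\<lambda>w. F (t + l *\<^sub>R x - \<epsilon> *\<^sub>R w) - F x"] by simp
      qed
      have ix: "integrable lborel (\<lambda>w. F (t + l *\<^sub>R x - \<epsilon> *\<^sub>R w) * (bump w / bump_mass))" for x
      proof -
        have b2: "(bump w / bump_mass) \<in> {0..1/bump_mass}" for w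
          using bump_nonneg bump_le_1 bump_mass_pos by (auto simp: divide_right_mono)
        have "(\<integral>\<^sup>+w. ennreal ((F (t + l *\<^sub>R x + (- \<epsilon>) *\<^sub>R w))\<^sup>2) \<partial>lborel) < \<infinity>"
          using nn_integral_lborel_affine[of "\<lambda>y. ennreal ((F y)\<^sup>2)" "- \<epsilon>" "t + l *\<^sub>R x"] fin \<epsilon>
          by (auto simp: ennreal_mult_less_top)
        then have "(\<lambda>w. F (t + l *\<^sub>R x - \<epsilon> *\<^sub>R w)) \<in> L2 lborel"
          by (simp add: L2_def integrable_iff_bounded)
        moreover have "(\<lambda>w. bump w / bump_mass) \<in> L2 lborel"
        proof -
          have "integrable lborel (\<lambda>w. (bump w)\<^sup>2)"
          proof (rule Bochner_Integration.integrable_bound[OF bump_integrable])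
            show "AE w in lborel. norm ((bump w)\<^sup>2) \<le> norm (bump w)"
              using bump_nonneg bump_le_1 by (intro AE_I2) (auto simp: power2_eq_square intro: mult_left_le)
          qed simp
          then show ?thesis by (simp add: L2_def power_divide)
        qed
        ultimately show ?thesis by (rule L2_mult_integrable)
      qed
      have "(\<integral>\<^sup>+x. indicator G x * ennreal ((C x - F x)\<^sup>2) \<partial>lborel)
        \<le> (\<integral>\<^sup>+x. (\<integral>\<^sup>+w. indicator G x * ennreal ((F (t + l *\<^sub>R x - \<epsilon> *\<^sub>R w) - F x)\<^sup>2 * (bump w / bump_mass)) \<partial>lborel) \<partial>lborel)"
        using pt[OF ix] by (intro nn_integral_mono) (auto simp: indicator_def)
      also have "\<dots> = (\<integral>\<^sup>+w. (\<integral>\<^sup>+x. indicator G x * ennreal ((F (t + l *\<^sub>R x - \<epsilon> *\<^sub>R w) - F x)\<^sup>2 * (bump w / bump_mass)) \<partial>lborel) \<partial>lborel)"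
        by (rule lborel_pair.Fubini') measurable
      also have "\<dots> \<le> (\<integral>\<^sup>+w. ennreal (bump w / bump_mass) * ennreal e \<partial>lborel)"
      proof (rule nn_integral_mono)
        fix w :: plane
        have bn: "0 \<le> bump w / bump_mass" using bump_nonneg bump_mass_pos by simp
        have "(\<integral>\<^sup>+x. indicator G x * ennreal ((F (t + l *\<^sub>R x - \<epsilon> *\<^sub>R w) - F x)\<^sup>2 * (bump w / bump_mass)) \<partial>lborel)
          = (\<integral>\<^sup>+x. ennreal (bump w / bump_mass) * (indicator G x * ennreal ((F ((t - \<epsilon> *\<^sub>R w) + l *\<^sub>R x) - F x)\<^sup>2)) \<partial>lborel)"
        proof (rule nn_integral_cong)
          fix x
          have "(t - \<epsilon> *\<^sub>R w) + l *\<^sub>R x = t + l *\<^sub>R x - \<epsilon> *\<^sub>R w" by simp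
          then show "indicator G x * ennreal ((F (t + l *\<^sub>R x - \<epsilon> *\<^sub>R w) - F x)\<^sup>2 * (bump w / bump_mass))
            = ennreal (bump w / bump_mass) * (indicator G x * ennreal ((F ((t - \<epsilon> *\<^sub>R w) + l *\<^sub>R x) - F x)\<^sup>2))"
            using bn by (simp only: ennreal_mult[OF zero_le_power2 bn]) (simp add: mult_ac)
        qed
        also have "\<dots> = ennreal (bump w / bump_mass) * (\<integral>\<^sup>+x. indicator G x * ennreal ((F ((t - \<epsilon> *\<^sub>R w) + l *\<^sub>R x) - F x)\<^sup>2) \<partial>lborel)"
          by (rule nn_integral_cmult) measurable
        also have "\<dots> \<le> ennreal (bump w / bump_mass) * ennreal e"
        proof (cases "norm w < 1")
          case True
          have "norm ((t - \<epsilon> *\<^sub>R w) + l *\<^sub>R x - x) < d" if "x \<in> G" for x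
          proof -
            have "norm ((t - \<epsilon> *\<^sub>R w) + l *\<^sub>R x - x) \<le> norm (t + l *\<^sub>R x - x) + norm (\<epsilon> *\<^sub>R w)"
              using norm_triangle_ineq4[of "t + l *\<^sub>R x - x" "\<epsilon> *\<^sub>R w"] by (simp add: algebra_simps)
            moreover have "norm (\<epsilon> *\<^sub>R w) \<le> \<epsilon>" using True \<epsilon> by simp
            ultimately show ?thesis using cl that by fastforce
          qed
          then show ?thesis by (intro mult_left_mono D l) auto
        next
          case False
          then show ?thesis by (simp add: bump_outside)
        qed
        finally show "(\<integral>\<^sup>+x. indicator G x * ennreal ((F (t + l *\<^sub>R x - \<epsilon> *\<^sub>R w) - F x)\<^sup>2 * (bump w / bump_mass)) \<partial>lborel)
          \<le> ennreal (bump w / bump_mass) * ennreal e" .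
      qed
      also have "\<dots> = (\<integral>\<^sup>+w. ennreal (bump w / bump_mass) \<partial>lborel) * ennreal e"
        by (rule nn_integral_multc) measurable
      also have "(\<integral>\<^sup>+w. ennreal (bump w / bump_mass) \<partial>lborel) = 1"
        using bump_integrable bump_nonneg bump_mass_pos
        by (subst nn_integral_eq_integral) (auto simp: bump_mass_def)
      finally show ?thesis by simp
    qed
    have "(L2_norm (lebesgue_on G) (\<lambda>x. convol G v (mollifier \<epsilon>) (t + l *\<^sub>R x) - v x))\<^sup>2
      = (LINT x|lebesgue_on G. (C x - v x)\<^sup>2)" by (simp add: L2_norm_power2 C)
    also have "\<dots> = (LINT x|lebesgue_on UNIV. indicator G x *\<^sub>R (C x - v x)\<^sup>2)"
      using Gl by (simp add: integral_restrict_space lebesgue_on_UNIV_eq)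
    also have "\<dots> = (LINT x|lebesgue_on UNIV. indicator G x * (C x - F x)\<^sup>2)"
    proof (rule integral_lebesgue_on_cong_AE)
      show "AE x in lebesgue_on UNIV. indicator G x *\<^sub>R (C x - v x)\<^sup>2 = indicator G x * (C x - F x)\<^sup>2"
        unfolding lebesgue_on_UNIV_eq using ae by eventually_elim (auto simp: indicator_def)
    qed simp
    also have "\<dots> = (LINT x|lborel. indicator G x * (C x - F x)\<^sup>2)"
      unfolding lebesgue_on_UNIV_eq by (rule lebesgue_integral_borel) measurable
    also have "\<dots> = enn2real (\<integral>\<^sup>+x. ennreal (indicator G x * (C x - F x)\<^sup>2) \<partial>lborel)"
      by (rule integral_eq_nn_integral) auto
    also have "\<dots> = enn2real (\<integral>\<^sup>+x. indicator G x * ennreal ((C x - F x)\<^sup>2) \<partial>lborel)"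
      by (intro arg_cong[where f = enn2real] nn_integral_cong) (auto simp: indicator_def)
    also have "\<dots> \<le> e"
      using nn e by (simp add: enn2real_leI)
    finally show ?thesis .
  qed
  with d show ?thesis by blast
qed

section \<open>Weak gradients\<close>

text \<open>At points whose distance from the complement exceeds \<epsilon> the mollified function
  is an integral of \<open>v\<close> against a test function, hence zero. So \<open>v\<close>
  vanishes almost everywhere on each inner set \<open>A n\<close>, and these exhaust the open set
  \<open>G\<close>.\<close>

lemma fundamental_lemma:
  fixes v :: "plane \<Rightarrow> real"
  assumes v: "v \<in> L2 (lebesgue_on G)" and G: "open G" "bounded G"
    and orth: "\<And>\<phi>. \<phi> \<in> test_functions G \<Longrightarrow> (LINT x|lebesgue_on G. v x * \<phi> x) = 0"
  shows "AE x in lebesgue_on G. v x = 0"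
proof -
  let ?M = "lebesgue_on G"
  have Gl: "G \<in> sets lebesgue" using G by simp
  define A where "A n = {x. \<forall>y. y \<notin> G \<longrightarrow> 1 / real (Suc n) \<le> dist x y}" for n
  have A_eq: "A n = (\<Inter>y\<in>-G. - ball y (1 / real (Suc n)))" for n
    by (auto simp: A_def dist_commute not_less)
  have cA: "closed (A n)" for n unfolding A_eq by (intro closed_INT ballI closed_Compl open_ball)
  have Am: "A n \<in> sets lebesgue" for n using cA by (simp add: borel_closed)
  define w where "w n x = indicator (A n) x * v x" for n x
  have wm: "w n \<in> borel_measurable ?M" for n
    unfolding w_def using Am L2D(1)[OF v]
    by (intro borel_measurable_times borel_measurable_indicator') (auto simp: sets_restrict_space space_restrict_space)
  have w0: "AE x in ?M. w n x = 0" for n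
  proof -
    have "w n \<in> L2 ?M" by (rule L2_dominated(1)[OF v wm, of 1]) (auto simp: w_def indicator_def)
    moreover have "(L2_norm ?M (w n))\<^sup>2 \<le> e" if e: "e > 0" for e
    proof -
      obtain d where d: "d > 0" and D: "\<And>l t \<epsilon>. 1/2 \<le> l \<Longrightarrow> 0 < \<epsilon> \<Longrightarrow> (\<forall>x\<in>G. norm (t + l *\<^sub>R x - x) + \<epsilon> < d) \<Longrightarrow>
        (L2_norm ?M (\<lambda>x. convol G v (mollifier \<epsilon>) (t + l *\<^sub>R x) - v x))\<^sup>2 \<le> e"
        using mollify_converges[OF v G e] by blast
      \<comment> \<open>Taking \<open>1/(n+2)\<close> makes \<epsilon> strictly smaller than
        \<open>1/(n+1)\<close>, so the closed ball of radius \<epsilon> around a point of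
        \<open>A n\<close> lies in \<open>G\<close>.\<close>
      define \<epsilon> where "\<epsilon> = min (d / 2) (1 / real (Suc (Suc n)))"
      have \<epsilon>: "\<epsilon> > 0" "\<epsilon> < d" "\<epsilon> < 1 / real (Suc n)"
        using d by (auto simp: \<epsilon>_def min_def field_simps)
      let ?C = "convol G v (mollifier \<epsilon>)"
      have "(L2_norm ?M (\<lambda>x. ?C (0 + 1 *\<^sub>R x) - v x))\<^sup>2 \<le> e"
        by (rule D) (use \<epsilon> in auto)
      then have le: "(L2_norm ?M (\<lambda>x. ?C x - v x))\<^sup>2 \<le> e" by simp
      have C0: "?C x = 0" if "x \<in> A n" for x
      proof -
        have "cball x \<epsilon> \<subseteq> G"
        proof
          fix y assume "y \<in> cball x \<epsilon>"
          then have "dist x y < 1 / real (Suc n)" using \<epsilon>(3) by simp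
          then show "y \<in> G" using that by (force simp: A_def)
        qed
        from orth[OF mollifier_reflected(1)[OF \<epsilon>(1) this]] show ?thesis by (simp add: convol_def)
      qed
      have "v x = w n x" if "x \<in> A n" for x using that by (simp add: w_def)
      have "smooth ?C"
        by (rule smooth_convol[OF L2_integrable[OF v finite_measure_lebesgue_on_bounded[OF G(2) Gl]] Gl mollifier_test[OF \<epsilon>(1)]])
      then have "?C \<in> L2 ?M" using L2_continuous[OF smooth_continuous _ Gl] G by blast
      from L2_dominated(2)[OF L2_diff[OF this v] wm[of n], of 1]
      have "L2_norm ?M (w n) \<le> L2_norm ?M (\<lambda>x. ?C x - v x)"
        using C0 by (fastforce simp: w_def indicator_def)
      then have "(L2_norm ?M (w n))\<^sup>2 \<le> (L2_norm ?M (\<lambda>x. ?C x - v x))\<^sup>2" by (rule power_mono) simp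
      with le show ?thesis by linarith
    qed
    then have "(L2_norm ?M (w n))\<^sup>2 \<le> 0" by (rule field_le_epsilon[of _ 0, simplified])
    ultimately show ?thesis by (simp add: L2_norm_eq_0_iff)
  qed
  then have "AE x in ?M. \<forall>n. w n x = 0" by (simp add: AE_all_countable)
  moreover have "AE x in ?M. x \<in> G" using Gl by (intro AE_I2) (simp add: space_restrict_space)
  ultimately show ?thesis
  proof eventually_elim
    case (elim x)
    obtain r where r: "r > 0" "ball x r \<subseteq> G" using elim(2) G(1) openE by blast
    obtain n where n: "1 / real (Suc n) < r" using r(1) nat_approx_posE by blast
    have "x \<in> A n" unfolding A_def using r n by (force simp: not_less)
    then show ?case using elim(1) by (auto simp: w_def dest: spec[of _ n])
  qed
qed

lemma weak_gradient_unique: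
  assumes G: "open G" "bounded G" and g: "g \<in> L2 (lebesgue_on G)" "is_weak_gradient G v g"
    and h: "h \<in> L2 (lebesgue_on G)" "is_weak_gradient G v h"
  shows "AE x in lebesgue_on G. g x = h x"
proof -
  have Gl: "G \<in> sets lebesgue" using G by simp
  have "AE x in lebesgue_on G. g x $ i - h x $ i = 0" for i
  proof (rule fundamental_lemma[OF _ G])
    have gi: "(\<lambda>x. g x $ i) \<in> L2 (lebesgue_on G)" and hi: "(\<lambda>x. h x $ i) \<in> L2 (lebesgue_on G)"
      using g(1) h(1) L2_vec_iff by blast+
    then show "(\<lambda>x. g x $ i - h x $ i) \<in> L2 (lebesgue_on G)" by (rule L2_diff)
    fix \<phi> assume \<phi>: "\<phi> \<in> test_functions G"
    have p: "\<phi> \<in> L2 (lebesgue_on G)"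
      by (rule L2_continuous[OF smooth_continuous[OF test_functionsD(1)[OF \<phi>]] G(2) Gl])
    have "(LINT x|lebesgue_on G. g x $ i * \<phi> x) = (LINT x|lebesgue_on G. h x $ i * \<phi> x)"
      using bspec[OF g(2)[unfolded is_weak_gradient_def] \<phi>, rule_format, of i]
        bspec[OF h(2)[unfolded is_weak_gradient_def] \<phi>, rule_format, of i] by linarith
    then show "(LINT x|lebesgue_on G. (g x $ i - h x $ i) * \<phi> x) = 0"
      using L2_mult_integrable[OF gi p] L2_mult_integrable[OF hi p] by (simp add: left_diff_distrib)
  qed
  from AE_conjI[OF this[of 1] this[of 2]] show ?thesis
    by eventually_elim (simp add: vec_eq_iff forall_2)
qed

lemma H1D:
  assumes "v \<in> H1 G"
  shows "v \<in> L2 (lebesgue_on G)" "wgrad G v \<in> L2 (lebesgue_on G)" "is_weak_gradient G v (wgrad G v)"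
proof -
  show "v \<in> L2 (lebesgue_on G)" using assms by (simp add: H1_def)
  have "\<exists>g. g \<in> L2 (lebesgue_on G) \<and> is_weak_gradient G v g" using assms by (simp add: H1_def)
  from someI_ex[OF this] show "wgrad G v \<in> L2 (lebesgue_on G)" "is_weak_gradient G v (wgrad G v)"
    by (auto simp: wgrad_def)
qed

text \<open>The way to compute \<open>wgrad\<close>, which is only a choice: exhibit some weak
  gradient, and the chosen one agrees with it almost everywhere by uniqueness.\<close>

lemma H1I:
  assumes "open G" "bounded G" "v \<in> L2 (lebesgue_on G)" "g \<in> L2 (lebesgue_on G)" "is_weak_gradient G v g"
  shows "v \<in> H1 G" "AE x in lebesgue_on G. wgrad G v x = g x"
proof -
  show v: "v \<in> H1 G" using assms by (auto simp: H1_def)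
  show "AE x in lebesgue_on G. wgrad G v x = g x"
    by (rule weak_gradient_unique[OF assms(1,2) H1D(2,3)[OF v] assms(4,5)])
qed

lemma H1_lincomb:
  assumes G: "open G" "bounded G" and v: "v \<in> H1 G" and w: "w \<in> H1 G"
  shows "(\<lambda>x. a * v x + b * w x) \<in> H1 G"
    and "AE x in lebesgue_on G. wgrad G (\<lambda>x. a * v x + b * w x) x = a *\<^sub>R wgrad G v x + b *\<^sub>R wgrad G w x"
proof -
  have Gl: "G \<in> sets lebesgue" using G by simp
  have l: "(\<lambda>x. a * v x + b * w x) \<in> L2 (lebesgue_on G)" by (intro L2_add L2_mult H1D v w)
  have g: "(\<lambda>x. a *\<^sub>R wgrad G v x + b *\<^sub>R wgrad G w x) \<in> L2 (lebesgue_on G)" by (intro L2_add L2_scaleR H1D v w)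
  have "is_weak_gradient G (\<lambda>x. a * v x + b * w x) (\<lambda>x. a *\<^sub>R wgrad G v x + b *\<^sub>R wgrad G w x)"
    unfolding is_weak_gradient_def
  proof (intro ballI allI)
    fix \<phi> and i assume \<phi>: "\<phi> \<in> test_functions G"
    have p: "\<phi> \<in> L2 (lebesgue_on G)" and q: "(\<lambda>x. grad \<phi> x $ i) \<in> L2 (lebesgue_on G)"
      using L2_continuous[OF smooth_continuous[OF test_functionsD(1)] G(2) Gl] \<phi> test_functions_grad by blast+
    have 1: "(LINT x|lebesgue_on G. v x * grad \<phi> x $ i) = - (LINT x|lebesgue_on G. wgrad G v x $ i * \<phi> x)"
      "(LINT x|lebesgue_on G. w x * grad \<phi> x $ i) = - (LINT x|lebesgue_on G. wgrad G w x $ i * \<phi> x)"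
      using H1D(3)[OF v] H1D(3)[OF w] \<phi> by (simp_all add: is_weak_gradient_def)
    have 2: "integrable (lebesgue_on G) (\<lambda>x. v x * grad \<phi> x $ i)" "integrable (lebesgue_on G) (\<lambda>x. w x * grad \<phi> x $ i)"
      "integrable (lebesgue_on G) (\<lambda>x. wgrad G v x $ i * \<phi> x)" "integrable (lebesgue_on G) (\<lambda>x. wgrad G w x $ i * \<phi> x)"
      using L2_mult_integrable p q H1D(1,2)[OF v] H1D(1,2)[OF w] L2_vec_iff by blast+
    from 1 2 show "(LINT x|lebesgue_on G. (a * v x + b * w x) * grad \<phi> x $ i)
      = - (LINT x|lebesgue_on G. (a *\<^sub>R wgrad G v x + b *\<^sub>R wgrad G w x) $ i * \<phi> x)"
      by (simp add: distrib_right mult.assoc)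
  qed
  from H1I[OF G l g this] show "(\<lambda>x. a * v x + b * w x) \<in> H1 G"
    "AE x in lebesgue_on G. wgrad G (\<lambda>x. a * v x + b * w x) x = a *\<^sub>R wgrad G v x + b *\<^sub>R wgrad G w x" by auto
qed

lemma H1_diff:
  assumes "open G" "bounded G" "v \<in> H1 G" "w \<in> H1 G"
  shows "(\<lambda>x. v x - w x) \<in> H1 G" "AE x in lebesgue_on G. wgrad G (\<lambda>x. v x - w x) x = wgrad G v x - wgrad G w x"
  using H1_lincomb[OF assms, of 1 "-1"] by simp_all

lemma H1_smooth:
  assumes G: "open G" "bounded G" and \<phi>: "smooth \<phi>"
  shows "\<phi> \<in> H1 G" "AE x in lebesgue_on G. wgrad G \<phi> x = grad \<phi> x"
proof -
  have Gl: "G \<in> sets lebesgue" using G by simp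
  have "is_weak_gradient G \<phi> (grad \<phi>)"
    unfolding is_weak_gradient_def using integration_by_parts[OF \<phi> _ G] by blast
  from H1I[OF G L2_continuous[OF smooth_continuous[OF \<phi>] G(2) Gl] L2_continuous[OF smooth_continuous_grad[OF \<phi>] G(2) Gl] this]
  show "\<phi> \<in> H1 G" "AE x in lebesgue_on G. wgrad G \<phi> x = grad \<phi> x" by auto
qed

lemma L2_subset:
  fixes f :: "plane \<Rightarrow> 'b::euclidean_space"
  assumes f: "f \<in> L2 (lebesgue_on U)" and sub: "G \<subseteq> U" and sets: "G \<in> sets lebesgue" "U \<in> sets lebesgue"
  shows "f \<in> L2 (lebesgue_on G)"
proof -
  have GU: "lebesgue_on G = restrict_space (lebesgue_on U) G"
    using sets sub by (simp add: restrict_restrict_space Int_absorb1)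
  have Gs: "G \<in> sets (lebesgue_on U)" "G \<inter> space (lebesgue_on U) \<in> sets (lebesgue_on U)"
    using sets sub by (auto simp: sets_restrict_space space_restrict_space Int_absorb1 Int_absorb2 image_iff)
  have "integrable (lebesgue_on U) (\<lambda>x. indicator G x *\<^sub>R (norm (f x))\<^sup>2)"
    by (rule integrable_mult_indicator[OF Gs(1) L2D(2)[OF f]])
  then show ?thesis using L2D(1)[OF f] Gs(2) unfolding GU
    by (simp add: L2_def integrable_restrict_space measurable_restrict_space1)
qed

text \<open>Test functions live on the whole plane, so one for \<open>G\<close> is one for
  \<open>U\<close> without extension, and the integrals over both sets equal the integral over the
  plane.\<close>

lemma H1_restrict:
  assumes U: "open U" "bounded U" and G: "open G" "G \<subseteq> U" and v: "v \<in> H1 U"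
  shows "v \<in> H1 G" "AE x in lebesgue_on G. wgrad G v x = wgrad U v x"
proof -
  have bG: "bounded G" using U(2) G(2) bounded_subset by blast
  have sets: "G \<in> sets lebesgue" "U \<in> sets lebesgue" using G U by auto
  have "is_weak_gradient G v (wgrad U v)"
    unfolding is_weak_gradient_def
  proof (intro ballI allI)
    fix \<phi> and i assume \<phi>: "\<phi> \<in> test_functions G"
    have out: "\<phi> x = 0" "grad \<phi> x = 0" if "x \<notin> G" for x
      using test_functions_outside[OF \<phi> that] test_functions_grad_outside[OF \<phi> that] by auto
    have outU: "\<phi> x = 0" "grad \<phi> x = 0" if "x \<notin> U" for x
      using out[of x] that G(2) by auto
    have "(LINT x|lebesgue_on U. v x * grad \<phi> x $ i) = - (LINT x|lebesgue_on U. wgrad U v x $ i * \<phi> x)"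
      using H1D(3)[OF v] test_functions_mono[OF \<phi> G(2)] by (simp add: is_weak_gradient_def)
    moreover have "(LINT x|lebesgue_on U. v x * grad \<phi> x $ i) = (LINT x|lebesgue. v x * grad \<phi> x $ i)"
      "(LINT x|lebesgue_on G. v x * grad \<phi> x $ i) = (LINT x|lebesgue. v x * grad \<phi> x $ i)"
      "(LINT x|lebesgue_on U. wgrad U v x $ i * \<phi> x) = (LINT x|lebesgue. wgrad U v x $ i * \<phi> x)"
      "(LINT x|lebesgue_on G. wgrad U v x $ i * \<phi> x) = (LINT x|lebesgue. wgrad U v x $ i * \<phi> x)"
      using sets by (auto intro!: lebesgue_on_support simp: out outU)
    ultimately show "(LINT x|lebesgue_on G. v x * grad \<phi> x $ i) = - (LINT x|lebesgue_on G. wgrad U v x $ i * \<phi> x)"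
      by simp
  qed
  from H1I[OF G(1) bG L2_subset[OF H1D(1)[OF v] G(2) sets] L2_subset[OF H1D(2)[OF v] G(2) sets] this]
  show "v \<in> H1 G" "AE x in lebesgue_on G. wgrad G v x = wgrad U v x" by auto
qed

section \<open>Norm inequalities in H^1\<close>

lemma H1_norm_power2: "(H1_norm G v)\<^sup>2 = (L2_norm (lebesgue_on G) v)\<^sup>2 + (H1_seminorm G v)\<^sup>2"
  by (simp add: H1_norm_def)

lemma H1_norm_nonneg [simp]: "0 \<le> H1_norm G v" "0 \<le> H1_seminorm G v"
  by (simp_all add: H1_norm_def H1_seminorm_def)

lemma L2_le_H1_norm: "L2_norm (lebesgue_on G) v \<le> H1_norm G v"
  and H1_seminorm_le_norm: "H1_seminorm G v \<le> H1_norm G v"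
  by (rule power2_le_imp_le; simp add: H1_norm_power2)+

lemma H1_norm_le: "H1_norm G v \<le> L2_norm (lebesgue_on G) v + H1_seminorm G v"
  by (rule power2_le_imp_le) (simp_all add: H1_norm_power2 power2_sum)

lemma H1_seminorm_triangle_diff:
  assumes G: "open G" "bounded G" and v: "v \<in> H1 G" and w: "w \<in> H1 G"
  shows "H1_seminorm G (\<lambda>x. v x - w x) \<le> H1_seminorm G v + H1_seminorm G w"
proof -
  have Gl: "G \<in> sets lebesgue" using G by simp
  have "H1_seminorm G (\<lambda>x. v x - w x) = L2_norm (lebesgue_on G) (\<lambda>x. wgrad G v x - wgrad G w x)"
    unfolding H1_seminorm_def by (rule L2_norm_cong_AE[OF Gl H1_diff(2)[OF G v w]])
  also have "\<dots> \<le> H1_seminorm G v + H1_seminorm G w"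
    unfolding H1_seminorm_def by (rule L2_norm_triangle_diff[OF H1D(2)[OF v] H1D(2)[OF w]])
  finally show ?thesis .
qed

text \<open>The factor 2 results from bounding the Euclidean combination of the two parts by their
  sum. The lemma serves only limits, where the constant is immaterial.\<close>

lemma H1_norm_triangle_diff:
  assumes G: "open G" "bounded G" and v: "v \<in> H1 G" and w: "w \<in> H1 G"
  shows "H1_norm G (\<lambda>x. v x - w x) \<le> 2 * H1_norm G v + 2 * H1_norm G w"
  using H1_norm_le[of G "\<lambda>x. v x - w x"] H1_seminorm_triangle_diff[OF assms]
    L2_norm_triangle_diff[OF H1D(1)[OF v] H1D(1)[OF w]]
    L2_le_H1_norm[of G v] L2_le_H1_norm[of G w] H1_seminorm_le_norm[of G v] H1_seminorm_le_norm[of G w] by linarith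

section \<open>Domains that are star-shaped with respect to a ball\<close>

definition mean :: "plane set \<Rightarrow> (plane \<Rightarrow> real) \<Rightarrow> real" where
  "mean G v = (LINT x|lebesgue_on G. v x) / measure lebesgue G"

text \<open>\<open>h\<close> is any bound on the distances between points of \<open>G\<close>; for
  polygons it becomes the diameter of the closed polygon.\<close>

locale star_domain =
  fixes G :: "plane set" and z :: plane and r h :: real
  assumes G_open: "open G" and r_pos: "r > 0" and ball_G: "ball z r \<subseteq> G"
    and G_diam: "\<And>x y. x \<in> G \<Longrightarrow> y \<in> G \<Longrightarrow> norm (x - y) \<le> h"
    and star: "\<And>x y. y \<in> ball z r \<Longrightarrow> x \<in> G \<Longrightarrow> closed_segment y x \<subseteq> G"
begin

lemma z_in: "z \<in> G" using ball_G r_pos by auto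

lemma G_cball: "G \<subseteq> cball z h" using G_diam[OF _ z_in] by (auto simp: dist_norm norm_minus_commute)

lemma G_bounded: "bounded G" using G_cball bounded_cball bounded_subset by blast

lemma G_sets [simp]: "G \<in> sets lebesgue" using G_open by simp

lemma G_finite: "finite_measure (lebesgue_on G)"
  by (rule finite_measure_lebesgue_on_bounded[OF G_bounded G_sets])

lemma r_le_h: "r \<le> h"
proof (rule field_le_epsilon)
  fix e :: real assume e: "e > 0"
  define s where "s = max 0 (r - e)"
  have s: "0 \<le> s" "s < r" "r - e \<le> s" using e r_pos by (auto simp: s_def)
  have "z + s *\<^sub>R axis 1 1 \<in> ball z r" using s by (simp add: dist_norm norm_axis_1)
  then have "norm ((z + s *\<^sub>R axis 1 1) - z) \<le> h" using ball_G z_in by (intro G_diam) auto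
  then show "r \<le> h + e" using s by (simp add: norm_axis_1)
qed

lemma h_pos: "h > 0" using r_le_h r_pos by simp

text \<open>Moving the convex combination by less than \<open>s * r\<close> is the same as moving
  the centre \<open>z\<close> by less than \<open>r\<close>, hence within the ball from which
  \<open>G\<close> is star-shaped.\<close>

lemma cball_contracted:
  assumes x: "x \<in> G" and s: "0 < s" "s \<le> 1" and \<epsilon>: "\<epsilon> < s * r"
  shows "cball (s *\<^sub>R z + (1 - s) *\<^sub>R x) \<epsilon> \<subseteq> G"
proof
  fix y assume y: "y \<in> cball (s *\<^sub>R z + (1 - s) *\<^sub>R x) \<epsilon>"
  define p where "p = z + (y - (s *\<^sub>R z + (1 - s) *\<^sub>R x)) /\<^sub>R s"
  have "norm (y - (s *\<^sub>R z + (1 - s) *\<^sub>R x)) \<le> \<epsilon>" using y by (simp add: dist_norm norm_minus_commute)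
  then have "norm (y - (s *\<^sub>R z + (1 - s) *\<^sub>R x)) / s < r" using \<epsilon> s by (simp add: divide_less_eq mult.commute)
  then have "norm (p - z) < r" using s by (simp add: p_def divide_inverse_commute)
  then have p: "p \<in> ball z r" by (simp add: dist_norm norm_minus_commute)
  have "y = s *\<^sub>R p + (1 - s) *\<^sub>R x" using s by (simp add: p_def algebra_simps)
  then have "y \<in> closed_segment p x" using s
    by (auto simp: closed_segment_def intro!: exI[of _ "1 - s"])
  with star[OF p x] show "y \<in> G" by blast
qed

lemma smooth_approx:
  assumes v: "v \<in> H1 G" and e: "e > 0"
  shows "\<exists>\<phi>. smooth \<phi> \<and> H1_norm G (\<lambda>x. v x - \<phi> x) < e"
proof -
  let ?M = "lebesgue_on G"
  note GG = G_open G_bounded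
  \<comment> \<open>The squared norm of the error will be at most
    \<open>\<delta>\<^sup>2 + 8 * \<delta>\<^sup>2\<close>, which is less than
    \<open>(4 * \<delta>)\<^sup>2\<close>.\<close>
  define \<delta> where "\<delta> = e / 4"
  have \<delta>: "\<delta> > 0" "\<delta>\<^sup>2 > 0" using e by (auto simp: \<delta>_def)
  let ?g = "\<lambda>i x. wgrad G v x $ i"
  have gL: "?g i \<in> L2 ?M" for i using H1D(2)[OF v] L2_vec_iff by blast
  have vi: "integrable ?M v" and gi: "integrable ?M (?g i)" for i
    using L2_integrable[OF H1D(1)[OF v] G_finite] L2_integrable[OF gL G_finite] .
  have ex: "\<exists>d>0. \<forall>l t \<epsilon>. 1/2 \<le> l \<longrightarrow> 0 < \<epsilon> \<longrightarrow> (\<forall>x\<in>G. norm (t + l *\<^sub>R x - x) + \<epsilon> < d) \<longrightarrow>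
      L2_norm ?M (\<lambda>x. convol G w (mollifier \<epsilon>) (t + l *\<^sub>R x) - w x) \<le> \<delta>" if "w \<in> L2 ?M" for w
    using mollify_converges[OF that GG \<delta>(2)] \<delta>(1) by (simp add: power2_le_iff_abs_le abs_of_nonneg)
  obtain d0 where d0: "d0 > 0" "\<And>l t \<epsilon>. 1/2 \<le> l \<Longrightarrow> 0 < \<epsilon> \<Longrightarrow> (\<forall>x\<in>G. norm (t + l *\<^sub>R x - x) + \<epsilon> < d0) \<Longrightarrow>
      L2_norm ?M (\<lambda>x. convol G v (mollifier \<epsilon>) (t + l *\<^sub>R x) - v x) \<le> \<delta>" using ex[OF H1D(1)[OF v]] by blast
  obtain d1 where d1: "d1 > 0" "\<And>l t \<epsilon>. 1/2 \<le> l \<Longrightarrow> 0 < \<epsilon> \<Longrightarrow> (\<forall>x\<in>G. norm (t + l *\<^sub>R x - x) + \<epsilon> < d1) \<Longrightarrow>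
      L2_norm ?M (\<lambda>x. convol G (?g 1) (mollifier \<epsilon>) (t + l *\<^sub>R x) - ?g 1 x) \<le> \<delta>" using ex[OF gL] by blast
  obtain d2 where d2: "d2 > 0" "\<And>l t \<epsilon>. 1/2 \<le> l \<Longrightarrow> 0 < \<epsilon> \<Longrightarrow> (\<forall>x\<in>G. norm (t + l *\<^sub>R x - x) + \<epsilon> < d2) \<Longrightarrow>
      L2_norm ?M (\<lambda>x. convol G (?g 2) (mollifier \<epsilon>) (t + l *\<^sub>R x) - ?g 2 x) \<le> \<delta>" using ex[OF gL] by blast
  define d where "d = min d0 (min d1 d2)"
  define N where "N = 1 + L2_norm ?M (?g 1) + L2_norm ?M (?g 2)"
  have N: "N \<ge> 1" by (simp add: N_def)
  \<comment> \<open>The three bounds keep the contraction factor above 1/2, the total displacement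
    below \<open>d\<close>, and the error from the factor \<open>1 - s\<close> in the gradient below
    \<delta>.\<close>
  define s where "s = min (1/2) (min (d / (2 * (h + r))) (\<delta> / N))"
  have dpos: "d > 0" using d0(1) d1(1) d2(1) by (simp add: d_def)
  have s: "s > 0" "s \<le> 1/2" "s * (h + r) < d" "s * N \<le> \<delta>"
  proof -
    show "s > 0" using dpos h_pos r_pos \<delta> N by (auto simp: s_def)
    show "s \<le> 1/2" unfolding s_def by (rule min.cobounded1)
    have "s \<le> d / (2 * (h + r))" by (simp add: s_def)
    then have "s * (h + r) \<le> d / 2" using h_pos r_pos by (simp add: field_simps)
    then show "s * (h + r) < d" using dpos by simp
    have "s \<le> \<delta> / N" by (simp add: s_def)
    then show "s * N \<le> \<delta>" using N by (simp add: field_simps)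
  qed
  define \<epsilon> where "\<epsilon> = s * r / 2"
  have \<epsilon>: "\<epsilon> > 0" "\<epsilon> < s * r" using s(1) r_pos by (auto simp: \<epsilon>_def)
  let ?l = "1 - s" and ?t = "s *\<^sub>R z"
  have l: "1/2 \<le> ?l" using s by simp
  have cl: "norm (?t + ?l *\<^sub>R x - x) + \<epsilon> < d" if "x \<in> G" for x
  proof -
    have "?t + ?l *\<^sub>R x - x = s *\<^sub>R (z - x)" by (simp add: algebra_simps)
    then have "norm (?t + ?l *\<^sub>R x - x) \<le> s * h" using s(1) G_diam[OF z_in that] by simp
    then show ?thesis using s(3) \<epsilon>(2) by (simp add: algebra_simps)
  qed
  have cld: "\<forall>x\<in>G. norm (?t + ?l *\<^sub>R x - x) + \<epsilon> < d0" "\<forall>x\<in>G. norm (?t + ?l *\<^sub>R x - x) + \<epsilon> < d1"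
    "\<forall>x\<in>G. norm (?t + ?l *\<^sub>R x - x) + \<epsilon> < d2"
    using cl by (auto simp: d_def)
  let ?m = "mollifier \<epsilon>"
  have mt: "?m \<in> test_functions UNIV" by (rule mollifier_test[OF \<epsilon>(1)])
  define \<phi> where "\<phi> x = convol G v ?m (?t + ?l *\<^sub>R x)" for x
  have sc: "smooth (convol G v ?m)" by (rule smooth_convol[OF vi G_sets mt])
  have sm: "smooth \<phi>" unfolding \<phi>_def by (rule smooth_affine[OF sc])
  have gr: "grad \<phi> x $ i = ?l * convol G (?g i) ?m (?t + ?l *\<^sub>R x)" if x: "x \<in> G" for x i
  proof -
    let ?\<xi> = "?t + ?l *\<^sub>R x"
    have cb: "cball ?\<xi> \<epsilon> \<subseteq> G" by (rule cball_contracted[OF x]) (use s \<epsilon> in auto)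
    note mr = mollifier_reflected[OF \<epsilon>(1) cb]
    have "grad \<phi> x $ i = ?l * convol G v (\<lambda>x. grad ?m x $ i) ?\<xi>"
      unfolding \<phi>_def by (simp add: grad_affine[OF sc] grad_convol[OF vi G_sets mt])
    also have "convol G v (\<lambda>x. grad ?m x $ i) ?\<xi> = - (LINT y|?M. v y * grad (\<lambda>y. ?m (?\<xi> - y)) y $ i)"
      by (simp add: convol_def mr(2))
    also have "\<dots> = (LINT y|?M. ?g i y * ?m (?\<xi> - y))"
      using bspec[OF H1D(3)[OF v, unfolded is_weak_gradient_def] mr(1), rule_format, of i] by simp
    finally show ?thesis by (simp add: convol_def)
  qed
  have sM: "smooth (convol G (?g i) ?m)" for i by (rule smooth_convol[OF gi G_sets mt])
  have comp: "L2_norm ?M (\<lambda>x. ?g i x - grad \<phi> x $ i) \<le> 2 * \<delta>"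
    if a: "L2_norm ?M (\<lambda>x. convol G (?g i) ?m (?t + ?l *\<^sub>R x) - ?g i x) \<le> \<delta>" and b: "L2_norm ?M (?g i) \<le> N" for i
  proof -
    let ?c = "\<lambda>x. convol G (?g i) ?m (?t + ?l *\<^sub>R x)"
    have cL: "?c \<in> L2 ?M" by (rule L2_continuous[OF smooth_continuous[OF smooth_affine[OF sM]] G_bounded G_sets])
    \<comment> \<open>With the gradient equal to \<open>(1 - s) c\<close>, the identity
      \<open>g - (1 - s) c = s g - (1 - s) (c - g)\<close> separates the contraction error from the
      mollification error.\<close>
    have "L2_norm ?M (\<lambda>x. ?g i x - grad \<phi> x $ i) = L2_norm ?M (\<lambda>x. s * ?g i x - ?l * (?c x - ?g i x))"
      unfolding L2_norm_def by (intro arg_cong[where f = sqrt] Bochner_Integration.integral_cong refl)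
        (simp add: gr space_restrict_space algebra_simps)
    also have "\<dots> \<le> L2_norm ?M (\<lambda>x. s * ?g i x) + L2_norm ?M (\<lambda>x. ?l * (?c x - ?g i x))"
      by (intro L2_norm_triangle_diff L2_mult L2_diff gL cL)
    also have "\<dots> = s * L2_norm ?M (?g i) + ?l * L2_norm ?M (\<lambda>x. ?c x - ?g i x)"
      using s by (simp add: L2_norm_mult)
    also have "\<dots> \<le> s * N + 1 * \<delta>"
      by (intro add_mono mult_mono) (use s a b in auto)
    finally show ?thesis using s(4) by simp
  qed
  have "L2_norm ?M (?g 1) \<le> N" "L2_norm ?M (?g 2) \<le> N" by (auto simp: N_def)
  then have g12: "L2_norm ?M (\<lambda>x. ?g 1 x - grad \<phi> x $ 1) \<le> 2 * \<delta>" "L2_norm ?M (\<lambda>x. ?g 2 x - grad \<phi> x $ 2) \<le> 2 * \<delta>"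
    by (auto intro!: comp d1(2)[OF l \<epsilon>(1) cld(2)] d2(2)[OF l \<epsilon>(1) cld(3)])
  have gp: "grad \<phi> \<in> L2 ?M" by (rule L2_continuous[OF smooth_continuous_grad[OF sm] G_bounded G_sets])
  have "AE x in ?M. wgrad G (\<lambda>x. v x - \<phi> x) x = wgrad G v x - grad \<phi> x"
    using H1_diff(2)[OF GG v H1_smooth(1)[OF GG sm]] H1_smooth(2)[OF GG sm] by eventually_elim simp
  then have "(H1_seminorm G (\<lambda>x. v x - \<phi> x))\<^sup>2 = (L2_norm ?M (\<lambda>x. wgrad G v x - grad \<phi> x))\<^sup>2"
    unfolding H1_seminorm_def by (subst L2_norm_cong_AE[OF G_sets]) auto
  also have "\<dots> = (L2_norm ?M (\<lambda>x. ?g 1 x - grad \<phi> x $ 1))\<^sup>2 + (L2_norm ?M (\<lambda>x. ?g 2 x - grad \<phi> x $ 2))\<^sup>2"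
    using L2_norm_vec[OF L2_diff[OF H1D(2)[OF v] gp]] by simp
  also have "\<dots> \<le> (2 * \<delta>)\<^sup>2 + (2 * \<delta>)\<^sup>2"
    by (intro add_mono power_mono g12) auto
  finally have 1: "(H1_seminorm G (\<lambda>x. v x - \<phi> x))\<^sup>2 \<le> 8 * \<delta>\<^sup>2" by (simp add: power_mult_distrib)
  have "L2_norm ?M (\<lambda>x. v x - \<phi> x) \<le> \<delta>"
    using d0(2)[OF l \<epsilon>(1) cld(1)] by (simp add: \<phi>_def L2_norm_minus_commute)
  then have "(L2_norm ?M (\<lambda>x. v x - \<phi> x))\<^sup>2 \<le> \<delta>\<^sup>2" by (intro power_mono) auto
  with 1 have "(H1_norm G (\<lambda>x. v x - \<phi> x))\<^sup>2 \<le> 9 * \<delta>\<^sup>2" by (simp add: H1_norm_power2)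
  also have "\<dots> < e\<^sup>2" using e by (simp add: \<delta>_def power2_eq_square)
  finally have "H1_norm G (\<lambda>x. v x - \<phi> x) < e" using e by (intro power2_less_imp_less[of _ e]) auto
  with sm show ?thesis by blast
qed

lemma smooth_dense:
  assumes v: "v \<in> H1 G"
  obtains \<phi> :: "nat \<Rightarrow> plane \<Rightarrow> real" where "\<And>n. smooth (\<phi> n)" "(\<lambda>n. H1_norm G (\<lambda>x. v x - \<phi> n x)) \<longlonglongrightarrow> 0"
proof -
  have "\<exists>\<phi>. smooth \<phi> \<and> H1_norm G (\<lambda>x. v x - \<phi> x) < inverse (real (Suc n))" for n
    by (rule smooth_approx[OF v]) simp
  then obtain \<phi> where \<phi>: "\<And>n. smooth (\<phi> n)" "\<And>n. H1_norm G (\<lambda>x. v x - \<phi> n x) < inverse (real (Suc n))"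
    by metis
  have "(\<lambda>n. H1_norm G (\<lambda>x. v x - \<phi> n x)) \<longlonglongrightarrow> 0"
    by (rule tendsto_sandwich[OF _ _ tendsto_const LIMSEQ_inverse_real_of_nat])
      (use \<phi>(2) in \<open>auto intro!: always_eventually simp: less_imp_le\<close>)
  with \<phi>(1) that show ?thesis by blast
qed

end

subsection \<open>The Poincare inequality\<close>

text \<open>Jensen's inequality along the segment, from the nonnegative integral of
  \<open>(f t - m)\<^sup>2\<close>, where \<open>m\<close> is the mean of the derivative
  \<open>f\<close>. The form in \<open>ennreal\<close> allows the order of integration to be changed
  freely afterwards.\<close>

lemma segment_energy:
  fixes \<phi> :: "plane \<Rightarrow> real"
  assumes sm: "smooth \<phi>"
  shows "ennreal ((\<phi> y - \<phi> x)\<^sup>2) \<le> ennreal ((norm (y - x))\<^sup>2) *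
    (\<integral>\<^sup>+t. indicator {0..1} t * ennreal ((norm (grad \<phi> (x + t *\<^sub>R (y - x))))\<^sup>2) \<partial>lborel)"
proof -
  let ?p = "\<lambda>t. x + t *\<^sub>R (y - x)"
  define f where "f t = grad \<phi> (?p t) \<bullet> (y - x)" for t
  define q where "q t = (norm (grad \<phi> (?p t)))\<^sup>2" for t
  define m where "m = \<phi> y - \<phi> x"
  have gc: "continuous_on {0..1} (\<lambda>t. grad \<phi> (?p t))"
    by (rule continuous_on_compose2[OF smooth_continuous_grad[OF sm, of UNIV]]) (auto intro!: continuous_intros)
  have fc: "continuous_on {0..1} f" and qc: "continuous_on {0..1} q"
    unfolding f_def q_def by (intro continuous_intros gc)+
  have der: "((\<lambda>t. \<phi> (?p t)) has_vector_derivative f t) (at t within {0..1})" for t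
  proof -
    have "(?p has_derivative (\<lambda>s. s *\<^sub>R (y - x))) (at t)" by (auto intro!: derivative_eq_intros)
    from has_derivative_compose[OF this smooth_has_derivative[OF sm]]
    have "((\<lambda>t. \<phi> (?p t)) has_derivative (\<lambda>s. s *\<^sub>R f t)) (at t)" by (simp add: f_def)
    then show ?thesis
      unfolding has_vector_derivative_def by (rule has_derivative_at_withinI)
  qed
  have If: "(f has_integral m) {0..1}"
    using fundamental_theorem_of_calculus[of 0 1 "\<lambda>t. \<phi> (?p t)" f] der by (simp add: m_def)
  define I2 where "I2 = integral {0..1} (\<lambda>t. (f t)\<^sup>2)"
  have If2: "((\<lambda>t. (f t)\<^sup>2) has_integral I2) {0..1}"
    unfolding I2_def by (intro integrable_integral integrable_continuous_real continuous_intros fc)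
  define Iq where "Iq = integral {0..1} q"
  have Iq: "(q has_integral Iq) {0..1}"
    unfolding Iq_def by (intro integrable_integral integrable_continuous_real qc)
  have "((\<lambda>t. (f t)\<^sup>2 - 2 * m * f t + m\<^sup>2) has_integral (I2 - 2 * m * m + m\<^sup>2)) {0..1}"
  proof (intro has_integral_add has_integral_diff If2 has_integral_mult_right If)
    show "((\<lambda>t. m\<^sup>2) has_integral m\<^sup>2) {0..1::real}" using has_integral_const_real[of "m\<^sup>2" 0 1] by simp
  qed
  then have "0 \<le> I2 - 2 * m * m + m\<^sup>2"
  proof (rule has_integral_nonneg)
    fix t show "0 \<le> (f t)\<^sup>2 - 2 * m * f t + m\<^sup>2"
      using zero_le_power2[of "f t - m"] by (simp add: power2_eq_square algebra_simps)
  qed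
  then have m2: "m\<^sup>2 \<le> I2" by (simp add: power2_eq_square)
  have "I2 \<le> (norm (y - x))\<^sup>2 * Iq"
  proof (rule has_integral_le[OF If2 has_integral_mult_right[OF Iq]])
    fix t
    have "\<bar>f t\<bar> \<le> norm (grad \<phi> (?p t)) * norm (y - x)" unfolding f_def by (rule Cauchy_Schwarz_ineq2)
    then have "\<bar>f t\<bar>\<^sup>2 \<le> (norm (grad \<phi> (?p t)) * norm (y - x))\<^sup>2" by (rule power_mono) simp
    then show "(f t)\<^sup>2 \<le> (norm (y - x))\<^sup>2 * q t" by (simp add: q_def power_mult_distrib mult.commute)
  qed
  with m2 have "m\<^sup>2 \<le> (norm (y - x))\<^sup>2 * Iq" by simp
  moreover have "(\<integral>\<^sup>+t. indicator {0..1} t * ennreal (q t) \<partial>lborel) = ennreal Iq"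
    using nn_integral_has_integral_lebesgue[OF _ Iq] by (simp add: q_def ennreal_indicator ennreal_mult')
  ultimately show ?thesis
    unfolding q_def m_def by (simp add: ennreal_mult'[symmetric] ennreal_leI)
qed

lemma L2_norm_nn_integral:
  fixes f :: "plane \<Rightarrow> 'a::euclidean_space"
  assumes G: "G \<in> sets borel" and f: "f \<in> L2 (lebesgue_on G)" and fb: "f \<in> borel_measurable borel"
  shows "ennreal ((L2_norm (lebesgue_on G) f)\<^sup>2) = (\<integral>\<^sup>+x. indicator G x * ennreal ((norm (f x))\<^sup>2) \<partial>lborel)"
proof -
  have "ennreal ((L2_norm (lebesgue_on G) f)\<^sup>2) = (\<integral>\<^sup>+x. ennreal ((norm (f x))\<^sup>2) \<partial>lebesgue_on G)"
    unfolding L2_norm_power2 by (rule nn_integral_eq_integral[symmetric]) (use L2D(2)[OF f] in auto)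
  also have "\<dots> = (\<integral>\<^sup>+x. ennreal ((norm (f x))\<^sup>2) * indicator G x \<partial>lebesgue)"
    using G by (intro nn_integral_restrict_space) simp
  also have "\<dots> = (\<integral>\<^sup>+x. ennreal ((norm (f x))\<^sup>2) * indicator G x \<partial>lborel)"
    by (rule nn_integral_completion) (use G fb in measurable)
  finally show ?thesis by (simp add: mult.commute)
qed

lemma nn_integral_affine_le:
  fixes f :: "plane \<Rightarrow> ennreal"
  assumes [measurable]: "f \<in> borel_measurable borel" and l: "1/2 \<le> l"
  shows "(\<integral>\<^sup>+x. f (t + l *\<^sub>R x) \<partial>lborel) \<le> 4 * (\<integral>\<^sup>+x. f x \<partial>lborel)"
proof -
  let ?J = "\<integral>\<^sup>+x. f (t + l *\<^sub>R x) \<partial>lborel"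
  have "(1/2)\<^sup>2 \<le> l\<^sup>2" using l by (intro power_mono) auto
  then have "1 \<le> 4 * l\<^sup>2" by (simp add: power2_eq_square)
  then have "1 * ?J \<le> ennreal (4 * l\<^sup>2) * ?J" by (intro mult_right_mono) auto
  also have "\<dots> = 4 * (ennreal (l\<^sup>2) * ?J)" by (simp add: ennreal_mult mult.assoc)
  also have "ennreal (l\<^sup>2) * ?J = (\<integral>\<^sup>+x. f x \<partial>lborel)"
    using l by (intro nn_integral_lborel_affine[symmetric]) auto
  finally show ?thesis by simp
qed

text \<open>The deviation from the mean is orthogonal to constants, so Pythagoras applies.\<close>

lemma L2_norm_mean_le:
  assumes G: "bounded G" "G \<in> sets lebesgue" "measure lebesgue G > 0" and v: "v \<in> L2 (lebesgue_on G)"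
  shows "L2_norm (lebesgue_on G) (\<lambda>x. v x - mean G v) \<le> L2_norm (lebesgue_on G) (\<lambda>x. v x - c)"
proof (rule power2_le_imp_le)
  let ?M = "lebesgue_on G"
  have fin: "finite_measure ?M" by (rule finite_measure_lebesgue_on_bounded[OF G(1,2)])
  have vm: "(\<lambda>x. v x - mean G v) \<in> L2 ?M" by (intro L2_diff v L2_const[OF fin])
  have "(LINT x|?M. v x - mean G v) = 0"
    using L2_integrable[OF v fin] G by (simp add: finite_measure.integrable_const[OF fin] measure_restrict_space mean_def)
  then have "L2_inner ?M (\<lambda>x. v x - mean G v) (\<lambda>x. 1) = 0" by (simp add: L2_inner_def)
  moreover have "(L2_norm ?M (\<lambda>x. (v x - mean G v) + (mean G v - c) *\<^sub>R 1))\<^sup>2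
    = (L2_norm ?M (\<lambda>x. v x - mean G v))\<^sup>2 + 2 * (mean G v - c) * L2_inner ?M (\<lambda>x. v x - mean G v) (\<lambda>x. 1)
      + (mean G v - c)\<^sup>2 * (L2_norm ?M (\<lambda>x. 1::real))\<^sup>2"
    by (rule L2_norm_add_scaleR_sq[OF vm L2_const[OF fin]])
  ultimately show "(L2_norm ?M (\<lambda>x. v x - mean G v))\<^sup>2 \<le> (L2_norm ?M (\<lambda>x. v x - c))\<^sup>2" by simp
qed simp

context star_domain
begin

lemma G_borel [measurable]: "G \<in> sets borel"
  using G_open by simp

lemma measure_G: "measure lebesgue G > 0" "measure lebesgue G \<le> (h / r)\<^sup>2 * measure lebesgue (ball z r)"
proof -
  have b: "measure lebesgue (ball z r) = unit_ball_vol 2 * r\<^sup>2"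
    using content_ball[of r z] r_pos by (simp add: measure_completion)
  have "measure lebesgue (ball z r) \<le> measure lebesgue G"
    by (rule measure_mono_fmeasurable) (use ball_G bounded_set_imp_lmeasurable[OF G_bounded G_sets] in auto)
  moreover have "unit_ball_vol 2 > 0" by simp
  ultimately show "measure lebesgue G > 0" using b r_pos by (smt (verit) mult_pos_pos zero_less_power)
  have "measure lebesgue G \<le> measure lebesgue (cball z h)"
    by (rule measure_mono_fmeasurable) (use G_cball in auto)
  also have "\<dots> = unit_ball_vol 2 * h\<^sup>2"
    using content_cball[of h z] h_pos by (simp add: measure_completion)
  finally show "measure lebesgue G \<le> (h / r)\<^sup>2 * measure lebesgue (ball z r)"
    using r_pos unfolding b by (simp add: field_simps)
qed

text \<open>The segment estimate is integrated over \<open>x\<close> in \<open>G\<close> and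
  \<open>y\<close> in the ball. The segment parameter \<open>t\<close> is moved outermost, so that
  for each fixed \<open>t\<close> the inner double integral can be bounded by a change of
  variables.\<close>

lemma double_energy:
  assumes sm: "smooth \<phi>"
  shows "(\<integral>\<^sup>+y. indicator (ball z r) y * (\<integral>\<^sup>+x. indicator G x * ennreal ((\<phi> x - \<phi> y)\<^sup>2) \<partial>lborel) \<partial>lborel)
    \<le> ennreal (h\<^sup>2) * (4 * emeasure lborel G * (\<integral>\<^sup>+x. indicator G x * ennreal ((norm (grad \<phi> x))\<^sup>2) \<partial>lborel))"
proof -
  let ?B = "ball z r"
  have [measurable]: "?B \<in> sets borel" by simp
  have [measurable]: "\<phi> \<in> borel_measurable borel" "grad \<phi> \<in> borel_measurable borel"
    using smooth_borel[OF sm] smooth_grad_borel[OF sm] .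
  define q where "q x = indicator G x * ennreal ((norm (grad \<phi> x))\<^sup>2)" for x
  have [measurable]: "q \<in> borel_measurable borel" unfolding q_def by measurable
  define Q where "Q = (\<integral>\<^sup>+x. q x \<partial>lborel)"
  define J where "J t = (\<integral>\<^sup>+y. (\<integral>\<^sup>+x. indicator ?B y * indicator G x * q (x + t *\<^sub>R (y - x)) \<partial>lborel) \<partial>lborel)" for t
  have J: "J t \<le> 4 * emeasure lborel G * Q" if t: "t \<in> {0..1}" for t
  \<comment> \<open>The point \<open>x + t (y - x)\<close> has coefficient \<open>1 - t\<close> in
    \<open>x\<close> and \<open>t\<close> in \<open>y\<close>. Substituting in the variable with
    coefficient at least 1/2 avoids the degeneration at both ends.\<close>
  proof (cases "t \<le> 1/2")
    case True
    have "J t \<le> (\<integral>\<^sup>+y. indicator ?B y * (4 * Q) \<partial>lborel)"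
      unfolding J_def
    proof (rule nn_integral_mono)
      fix y
      have "(\<integral>\<^sup>+x. indicator ?B y * indicator G x * q (x + t *\<^sub>R (y - x)) \<partial>lborel)
        \<le> (\<integral>\<^sup>+x. indicator ?B y * q (t *\<^sub>R y + (1 - t) *\<^sub>R x) \<partial>lborel)"
        by (intro nn_integral_mono) (auto simp: indicator_def algebra_simps)
      also have "\<dots> = indicator ?B y * (\<integral>\<^sup>+x. q (t *\<^sub>R y + (1 - t) *\<^sub>R x) \<partial>lborel)"
        by (rule nn_integral_cmult) measurable
      also have "\<dots> \<le> indicator ?B y * (4 * Q)"
        unfolding Q_def by (intro mult_left_mono nn_integral_affine_le) (use True in auto)
      finally show "(\<integral>\<^sup>+x. indicator ?B y * indicator G x * q (x + t *\<^sub>R (y - x)) \<partial>lborel) \<le> indicator ?B y * (4 * Q)" .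
    qed
    also have "\<dots> = emeasure lborel ?B * (4 * Q)" by (simp add: nn_integral_multc)
    also have "\<dots> \<le> emeasure lborel G * (4 * Q)" by (intro mult_right_mono emeasure_mono ball_G) auto
    finally show ?thesis by (simp add: mult_ac)
  next
    case False
    have "J t = (\<integral>\<^sup>+x. (\<integral>\<^sup>+y. indicator ?B y * indicator G x * q (x + t *\<^sub>R (y - x)) \<partial>lborel) \<partial>lborel)"
      unfolding J_def by (rule lborel_pair.Fubini') measurable
    also have "\<dots> \<le> (\<integral>\<^sup>+x. indicator G x * (4 * Q) \<partial>lborel)"
    proof (rule nn_integral_mono)
      fix x
      have "(\<integral>\<^sup>+y. indicator ?B y * indicator G x * q (x + t *\<^sub>R (y - x)) \<partial>lborel)
        \<le> (\<integral>\<^sup>+y. indicator G x * q ((1 - t) *\<^sub>R x + t *\<^sub>R y) \<partial>lborel)"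
        by (intro nn_integral_mono) (auto simp: indicator_def algebra_simps)
      also have "\<dots> = indicator G x * (\<integral>\<^sup>+y. q ((1 - t) *\<^sub>R x + t *\<^sub>R y) \<partial>lborel)"
        by (rule nn_integral_cmult) measurable
      also have "\<dots> \<le> indicator G x * (4 * Q)"
        unfolding Q_def by (intro mult_left_mono nn_integral_affine_le) (use False in auto)
      finally show "(\<integral>\<^sup>+y. indicator ?B y * indicator G x * q (x + t *\<^sub>R (y - x)) \<partial>lborel) \<le> indicator G x * (4 * Q)" .
    qed
    also have "\<dots> = emeasure lborel G * (4 * Q)" by (simp add: nn_integral_multc)
    finally show ?thesis by (simp add: mult_ac)
  qed
  have pt: "indicator ?B y * (indicator G x * ennreal ((\<phi> x - \<phi> y)\<^sup>2))
    \<le> ennreal (h\<^sup>2) * (\<integral>\<^sup>+t. indicator {0..1} t * (indicator ?B y * indicator G x * q (x + t *\<^sub>R (y - x))) \<partial>lborel)" for x y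
  proof (cases "y \<in> ?B \<and> x \<in> G")
    case True
    have "(norm (y - x))\<^sup>2 \<le> h\<^sup>2" using True ball_G by (intro power_mono G_diam) auto
    moreover have "x + t *\<^sub>R (y - x) \<in> G" if "t \<in> {0..1}" for t
    proof -
      have "x + t *\<^sub>R (y - x) \<in> closed_segment y x"
        unfolding closed_segment_def using that by (auto intro!: exI[of _ "1 - t"] simp: algebra_simps)
      then show ?thesis using star True by blast
    qed
    then have "(\<integral>\<^sup>+t. indicator {0..1} t * (indicator ?B y * indicator G x * q (x + t *\<^sub>R (y - x))) \<partial>lborel)
      = (\<integral>\<^sup>+t. indicator {0..1} t * ennreal ((norm (grad \<phi> (x + t *\<^sub>R (y - x))))\<^sup>2) \<partial>lborel)"
      using True by (intro nn_integral_cong) (auto simp: q_def indicator_def)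
    ultimately show ?thesis
      using True segment_energy[OF sm, of y x]
      by (simp add: power2_commute[of "\<phi> x"]) (meson ennreal_leI mult_right_mono order_trans zero_le)
  qed auto
  have "(\<integral>\<^sup>+y. indicator ?B y * (\<integral>\<^sup>+x. indicator G x * ennreal ((\<phi> x - \<phi> y)\<^sup>2) \<partial>lborel) \<partial>lborel)
    = (\<integral>\<^sup>+y. (\<integral>\<^sup>+x. indicator ?B y * (indicator G x * ennreal ((\<phi> x - \<phi> y)\<^sup>2)) \<partial>lborel) \<partial>lborel)"
    by (intro nn_integral_cong nn_integral_cmult[symmetric]) measurable
  also have "\<dots> \<le> (\<integral>\<^sup>+y. (\<integral>\<^sup>+x. ennreal (h\<^sup>2) * (\<integral>\<^sup>+t. indicator {0..1} t * (indicator ?B y * indicator G x * q (x + t *\<^sub>R (y - x))) \<partial>lborel) \<partial>lborel) \<partial>lborel)"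
    by (intro nn_integral_mono pt)
  also have "\<dots> = ennreal (h\<^sup>2) * (\<integral>\<^sup>+y. (\<integral>\<^sup>+x. (\<integral>\<^sup>+t. indicator {0..1} t * (indicator ?B y * indicator G x * q (x + t *\<^sub>R (y - x))) \<partial>lborel) \<partial>lborel) \<partial>lborel)"
    by (simp add: nn_integral_cmult)
  also have "(\<integral>\<^sup>+y. (\<integral>\<^sup>+x. (\<integral>\<^sup>+t. indicator {0..1} t * (indicator ?B y * indicator G x * q (x + t *\<^sub>R (y - x))) \<partial>lborel) \<partial>lborel) \<partial>lborel)
    = (\<integral>\<^sup>+y. (\<integral>\<^sup>+t. (\<integral>\<^sup>+x. indicator {0..1::real} t * (indicator ?B y * indicator G x * q (x + t *\<^sub>R (y - x))) \<partial>lborel) \<partial>lborel) \<partial>lborel)"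
    by (intro nn_integral_cong lborel_pair.Fubini') measurable
  also have "\<dots> = (\<integral>\<^sup>+t. (\<integral>\<^sup>+y. (\<integral>\<^sup>+x. indicator {0..1::real} t * (indicator ?B y * indicator G x * q (x + t *\<^sub>R (y - x))) \<partial>lborel) \<partial>lborel) \<partial>lborel)"
    by (rule lborel_pair.Fubini') measurable
  also have "\<dots> = (\<integral>\<^sup>+t. indicator {0..1} t * J t \<partial>lborel)"
    unfolding J_def by (simp add: nn_integral_cmult)
  also have "\<dots> \<le> (\<integral>\<^sup>+t. indicator {0..1::real} t * (4 * emeasure lborel G * Q) \<partial>lborel)"
    using J by (intro nn_integral_mono) (auto simp: indicator_def)
  also have "\<dots> = 4 * emeasure lborel G * Q" by (simp add: nn_integral_multc)
  finally show ?thesis unfolding Q_def q_def by (simp add: mult_left_mono)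
qed

text \<open>For every \<open>y\<close> in the ball the mean approximates \<phi> at least as well as
  the constant \<open>\<phi> y\<close>; averaging over \<open>y\<close> gives the double integral.
  The constant is \<open>h^2 * 4 * (h/r)^2\<close>, with \<open>(h/r)^2\<close> bounding the ratio
  of the areas of \<open>G\<close> and the ball.\<close>

lemma poincare_smooth:
  assumes sm: "smooth \<phi>"
  shows "(L2_norm (lebesgue_on G) (\<lambda>x. \<phi> x - mean G \<phi>))\<^sup>2 \<le> (2 * h\<^sup>2 / r * L2_norm (lebesgue_on G) (grad \<phi>))\<^sup>2"
proof -
  let ?M = "lebesgue_on G" and ?B = "ball z r"
  have [measurable]: "?B \<in> sets borel" by simp
  have [measurable]: "\<phi> \<in> borel_measurable borel" "grad \<phi> \<in> borel_measurable borel"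
    using smooth_borel[OF sm] smooth_grad_borel[OF sm] .
  define K where "K = (2 * h\<^sup>2 / r * L2_norm ?M (grad \<phi>))\<^sup>2"
  have pL: "\<phi> \<in> L2 ?M" "grad \<phi> \<in> L2 ?M"
    by (intro L2_continuous smooth_continuous smooth_continuous_grad sm G_bounded G_sets)+
  define H where "H y = (\<integral>\<^sup>+x. indicator G x * ennreal ((\<phi> x - \<phi> y)\<^sup>2) \<partial>lborel)" for y
  have H: "H y = ennreal ((L2_norm ?M (\<lambda>x. \<phi> x - \<phi> y))\<^sup>2)" for y
    unfolding H_def by (subst L2_norm_nn_integral) (auto intro!: L2_diff pL L2_const G_finite)
  have le: "(L2_norm ?M (\<lambda>x. \<phi> x - mean G \<phi>))\<^sup>2 \<le> (L2_norm ?M (\<lambda>x. \<phi> x - \<phi> y))\<^sup>2" for y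
    by (intro power_mono L2_norm_mean_le G_bounded G_sets measure_G pL) simp
  define b where "b = measure lebesgue ?B"
  have eB: "emeasure lborel ?B = ennreal b"
    unfolding b_def using emeasure_bounded_finite[of ?B] by (simp add: emeasure_eq_ennreal_measure measure_completion)
  have eG: "emeasure lborel G = ennreal (measure lebesgue G)"
    using emeasure_bounded_finite[OF G_bounded] by (simp add: emeasure_eq_ennreal_measure measure_completion)
  have b: "b > 0" using measure_G r_pos h_pos unfolding b_def
    by (smt (verit) mult_nonneg_nonpos zero_le_power2)
  let ?m = "(L2_norm ?M (\<lambda>x. \<phi> x - mean G \<phi>))\<^sup>2"
  have "ennreal b * ennreal ?m = (\<integral>\<^sup>+y. indicator ?B y * ennreal ?m \<partial>lborel)"
    by (simp add: nn_integral_multc eB)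
  also have "\<dots> \<le> (\<integral>\<^sup>+y. indicator ?B y * H y \<partial>lborel)"
    unfolding H by (intro nn_integral_mono mult_left_mono ennreal_leI le) auto
  also have "\<dots> \<le> ennreal (h\<^sup>2) * (4 * emeasure lborel G * (\<integral>\<^sup>+x. indicator G x * ennreal ((norm (grad \<phi> x))\<^sup>2) \<partial>lborel))"
    unfolding H_def by (rule double_energy[OF sm])
  also have "\<dots> = ennreal (h\<^sup>2) * (4 * ennreal (measure lebesgue G) * ennreal ((L2_norm ?M (grad \<phi>))\<^sup>2))"
    by (subst L2_norm_nn_integral) (auto simp: eG pL)
  also have "\<dots> = ennreal (h\<^sup>2 * (4 * measure lebesgue G * (L2_norm ?M (grad \<phi>))\<^sup>2))"
    by (simp add: ennreal_mult)
  finally have "b * ?m \<le> h\<^sup>2 * (4 * measure lebesgue G * (L2_norm ?M (grad \<phi>))\<^sup>2)"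
    using b by (simp flip: ennreal_mult)
  also have "\<dots> \<le> h\<^sup>2 * (4 * ((h / r)\<^sup>2 * b) * (L2_norm ?M (grad \<phi>))\<^sup>2)"
    unfolding b_def by (intro mult_left_mono mult_right_mono measure_G) auto
  also have "\<dots> = b * K" by (simp add: K_def power_mult_distrib power_divide)
  finally show ?thesis using b by (simp add: K_def)
qed

theorem poincare:
  assumes v: "v \<in> H1 G"
  shows "L2_norm (lebesgue_on G) (\<lambda>x. v x - mean G v) \<le> 2 * h\<^sup>2 / r * H1_seminorm G v"
proof -
  let ?M = "lebesgue_on G"
  note GG = G_open G_bounded
  define K where "K = 2 * h\<^sup>2 / r"
  have K: "K \<ge> 0" using r_pos by (simp add: K_def)
  obtain \<phi> where sm: "\<And>n. smooth (\<phi> n)" and lim: "(\<lambda>n. H1_norm G (\<lambda>x. v x - \<phi> n x)) \<longlonglongrightarrow> 0"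
    using smooth_dense[OF v] by blast
  let ?\<delta> = "\<lambda>n. H1_norm G (\<lambda>x. v x - \<phi> n x)"
  have "L2_norm ?M (\<lambda>x. v x - mean G v) \<le> ?\<delta> n + K * (H1_seminorm G v + ?\<delta> n)" for n
  proof -
    have p1: "\<phi> n \<in> H1 G" by (rule H1_smooth(1)[OF GG sm])
    note L = H1D(1)[OF v] H1D(1)[OF p1] L2_const[OF G_finite]
    \<comment> \<open>The mean of \<open>v\<close> is its best constant, so it may be exchanged for
      the mean of the approximant.\<close>
    have "L2_norm ?M (\<lambda>x. v x - mean G v) \<le> L2_norm ?M (\<lambda>x. v x - mean G (\<phi> n))"
      by (rule L2_norm_mean_le[OF G_bounded G_sets measure_G(1) H1D(1)[OF v]])
    also have "\<dots> \<le> L2_norm ?M (\<lambda>x. v x - \<phi> n x) + L2_norm ?M (\<lambda>x. \<phi> n x - mean G (\<phi> n))"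
      by (rule L2_norm_triangle3[OF L(1,2,3)])
    also have "L2_norm ?M (\<lambda>x. v x - \<phi> n x) \<le> ?\<delta> n" by (rule L2_le_H1_norm)
    also have "L2_norm ?M (\<lambda>x. \<phi> n x - mean G (\<phi> n)) \<le> K * L2_norm ?M (grad (\<phi> n))"
      by (rule power2_le_imp_le[OF poincare_smooth[OF sm, of n, folded K_def]]) (simp add: K)
    also have "L2_norm ?M (grad (\<phi> n)) = H1_seminorm G (\<phi> n)"
      unfolding H1_seminorm_def using L2_norm_cong_AE[OF G_sets H1_smooth(2)[OF GG sm]] by simp
    also have "\<dots> \<le> H1_seminorm G v + ?\<delta> n"
    proof -
      have "H1_seminorm G (\<lambda>x. v x - (v x - \<phi> n x)) \<le> H1_seminorm G v + H1_seminorm G (\<lambda>x. v x - \<phi> n x)"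
        by (rule H1_seminorm_triangle_diff[OF GG v H1_diff(1)[OF GG v p1]])
      then show ?thesis using H1_seminorm_le_norm[of G "\<lambda>x. v x - \<phi> n x"] by simp
    qed
    finally show ?thesis using K by (simp add: mult_left_mono)
  qed
  moreover have "(\<lambda>n. ?\<delta> n + K * (H1_seminorm G v + ?\<delta> n)) \<longlonglongrightarrow> 0 + K * (H1_seminorm G v + 0)"
    by (intro tendsto_intros lim)
  ultimately show ?thesis unfolding K_def by (auto intro: LIMSEQ_le_const)
qed

end

section \<open>Polygons\<close>

lemma pathstart_polypath: "2 \<le> length zs \<Longrightarrow> pathstart (polypath zs) = hd zs"
  by (induction zs rule: polypath.induct) auto

lemma path_image_polypath:
  "2 \<le> length zs \<Longrightarrow> path_image (polypath zs) = (\<Union>i<length zs - 1. closed_segment (zs ! i) (zs ! Suc i))"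
proof (induction zs rule: polypath.induct)
  case (4 a b c zs)
  have "path_image (polypath (a # b # c # zs)) = closed_segment a b \<union> path_image (polypath (b # c # zs))"
    using pathstart_polypath[of "b # c # zs"] by (simp add: path_image_join)
  also have "path_image (polypath (b # c # zs)) = (\<Union>i<Suc (length zs). closed_segment ((b # c # zs) ! i) ((b # c # zs) ! Suc i))"
    using "4.IH" by simp
  also have "closed_segment a b \<union> \<dots> = (\<Union>i<Suc (Suc (length zs)). closed_segment ((a # b # c # zs) ! i) ((a # b # c # zs) ! Suc i))"
    unfolding lessThan_Suc_eq_insert_0[of "Suc (length zs)"] by (simp add: image_image)
  finally show ?case by simp
qed auto

text \<open>When the first segment is split off, simplicity of the joined path confines its
  intersection with the rest to two points and makes the rest an arc, to which the induction
  applies.\<close>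

lemma simple_polypath_inter:
  "simple_path (polypath zs) \<Longrightarrow> 2 \<le> length zs \<Longrightarrow> i < j \<Longrightarrow> j < length zs - 1 \<Longrightarrow>
    finite (closed_segment (zs ! i) (zs ! Suc i) \<inter> closed_segment (zs ! j) (zs ! Suc j))"
proof (induction zs arbitrary: i j rule: polypath.induct)
  case (4 a b c zs)
  have "pathfinish (linepath a b) = pathstart (polypath (b # c # zs))"
    using pathstart_polypath[of "b # c # zs"] by simp
  with "4.prems"(1) obtain ar: "arc (polypath (b # c # zs))"
    and int: "path_image (linepath a b) \<inter> path_image (polypath (b # c # zs)) \<subseteq> {pathstart (linepath a b), pathstart (polypath (b # c # zs))}"
    by (auto elim: simple_path_joinE)
  obtain j' where j': "j = Suc j'" using "4.prems"(3) by (cases j) auto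
  show ?case
  proof (cases i)
    case 0
    have "closed_segment ((b # c # zs) ! j') ((b # c # zs) ! Suc j') \<subseteq> path_image (polypath (b # c # zs))"
      using "4.prems"(4) j' path_image_polypath[of "b # c # zs"] by auto
    then have "closed_segment a b \<inter> closed_segment ((b # c # zs) ! j') ((b # c # zs) ! Suc j') \<subseteq> {pathstart (linepath a b), pathstart (polypath (b # c # zs))}"
      using int by auto
    then have "finite (closed_segment a b \<inter> closed_segment ((b # c # zs) ! j') ((b # c # zs) ! Suc j'))"
      by (rule finite_subset) simp
    then show ?thesis using 0 j' by simp
  next
    case (Suc i')
    have "finite (closed_segment ((b # c # zs) ! i') ((b # c # zs) ! Suc i') \<inter> closed_segment ((b # c # zs) ! j') ((b # c # zs) ! Suc j'))"
      by (rule "4.IH") (use ar arc_imp_simple_path "4.prems" Suc j' in auto)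
    then show ?thesis using Suc j' by simp
  qed
qed auto

context
  fixes P :: polygon
  assumes P: "polygonal_domain P"
begin

lemma polygonal_domain_nodes: "length (nodes P) \<ge> 3" "distinct (nodes P)"
  using P by (auto simp: polygonal_domain_def)

text \<open>Appending the first node turns the cyclic successor into the next list entry, the form
  in which the boundary path describes its segments.\<close>

lemma edges_polypath:
  "edges P = (\<lambda>i. closed_segment ((nodes P @ [hd (nodes P)]) ! i) ((nodes P @ [hd (nodes P)]) ! Suc i)) ` {..<length (nodes P)}"
  unfolding edges_def
proof (rule image_cong[OF refl])
  fix i assume "i \<in> {..<length (nodes P)}"
  then have i: "i < length (nodes P)" by simp
  have ne: "nodes P \<noteq> []" using i by auto
  have "(nodes P @ [hd (nodes P)]) ! Suc i = nodes P ! (Suc i mod length (nodes P))"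
  proof (cases "Suc i < length (nodes P)")
    case True then show ?thesis by (simp add: nth_append)
  next
    case False
    then have "Suc i = length (nodes P)" using i by simp
    then show ?thesis using ne by (simp add: nth_append hd_conv_nth)
  qed
  then show "closed_segment (nodes P ! i) (nodes P ! (Suc i mod length (nodes P)))
    = closed_segment ((nodes P @ [hd (nodes P)]) ! i) ((nodes P @ [hd (nodes P)]) ! Suc i)"
    using i by (simp add: nth_append)
qed

lemma finite_edges: "finite (edges P)"
  by (simp add: edges_def)

lemma frontier_edges: "frontier (pts P) = \<Union>(edges P)"
proof -
  have "frontier (pts P) = path_image (polypath (nodes P @ [hd (nodes P)]))"
    using P by (simp add: polygonal_domain_def)
  also have "\<dots> = \<Union>(edges P)"
    unfolding edges_polypath using polygonal_domain_nodes by (subst path_image_polypath) auto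
  finally show ?thesis .
qed

lemma edges_inter_finite:
  assumes "E \<in> edges P" "E' \<in> edges P" "E \<noteq> E'"
  shows "finite (E \<inter> E')"
proof -
  let ?zs = "nodes P @ [hd (nodes P)]"
  let ?s = "\<lambda>i. closed_segment (?zs ! i) (?zs ! Suc i)"
  obtain i j where ij: "i < length (nodes P)" "j < length (nodes P)" "E = ?s i" "E' = ?s j"
    using assms(1,2) unfolding edges_polypath by auto
  have sp: "simple_path (polypath ?zs)" using P by (simp add: polygonal_domain_def)
  have "i \<noteq> j" using assms(3) ij by auto
  then consider "i < j" | "j < i" by linarith
  then show ?thesis
  proof cases
    case 1 from simple_polypath_inter[OF sp _ 1] ij polygonal_domain_nodes show ?thesis by simp
  next
    case 2 from simple_polypath_inter[OF sp _ 2] ij polygonal_domain_nodes show ?thesis by (simp add: Int_commute)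
  qed
qed

lemma edge_nodes:
  assumes "E \<in> edges P"
  obtains a b where "a \<noteq> b" "E = closed_segment a b"
proof -
  obtain i where i: "i < length (nodes P)" "E = closed_segment (nodes P ! i) (nodes P ! (Suc i mod length (nodes P)))"
    using assms by (auto simp: edges_def)
  have "Suc i mod length (nodes P) \<noteq> i" "Suc i mod length (nodes P) < length (nodes P)"
    using i(1) polygonal_domain_nodes(1) by (auto simp: mod_Suc)
  then have "nodes P ! i \<noteq> nodes P ! (Suc i mod length (nodes P))"
    using polygonal_domain_nodes(2) i(1) by (metis nth_eq_iff_index_eq)
  with i(2) that show ?thesis by blast
qed

end

text \<open>The endpoints of a segment in the order chosen by \<open>edge_measure\<close>.\<close>

definition ends :: "plane set \<Rightarrow> plane \<times> plane" where
  "ends E = (SOME (a, b). E = closed_segment a b)"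

lemma ends_segment: "E = closed_segment a b \<Longrightarrow> E = closed_segment (fst (ends E)) (snd (ends E))"
  unfolding ends_def by (rule someI2[of "\<lambda>(a, b). E = closed_segment a b" "(a, b)" "\<lambda>p. E = closed_segment (fst p) (snd p)"]; simp add: case_prod_beta)

lemma edge_endsE:
  assumes "polygonal_domain P" "E \<in> edges P"
  obtains a b where "ends E = (a, b)" "a \<noteq> b" "E = closed_segment a b"
proof -
  obtain a b where ab: "a \<noteq> b" "E = closed_segment a b" by (rule edge_nodes[OF assms])
  have e: "E = closed_segment (fst (ends E)) (snd (ends E))" by (rule ends_segment[OF ab(2)])
  have "fst (ends E) \<noteq> snd (ends E)"
    using ab e by (metis closed_segment_idem closed_segment_eq doubleton_eq_iff)
  with e that[of "fst (ends E)" "snd (ends E)"] show ?thesis by simp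
qed

section \<open>Integration along an edge\<close>

lemma edge_measure_ends:
  "ends E = (a, b) \<Longrightarrow> edge_measure E = scale_measure (ennreal (dist a b)) (distr (lebesgue_on {0..1}) borel (linepath a b))"
  unfolding edge_measure_def ends_def by simp

lemma sets_edge_measure [simp, measurable_cong]: "sets (edge_measure E) = sets borel"
  by (cases "ends E") (simp add: edge_measure_ends)

lemma space_edge_measure [simp]: "space (edge_measure E) = UNIV"
  by (cases "ends E") (simp add: edge_measure_ends space_scale_measure)

lemma linepath_measurable [measurable]: "linepath a (b::plane) \<in> lebesgue_on {0..1} \<rightarrow>\<^sub>M borel"
proof -
  have "continuous_on UNIV (linepath a b)" unfolding linepath_def by (intro continuous_intros)
  then have "linepath a b \<in> borel_measurable borel" by (rule borel_measurable_continuous_onI)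
  then show ?thesis by (intro measurable_restrict_space1 measurable_completion) simp
qed

lemma emeasure_edge_measure:
  assumes E: "ends E = (a, b)" and A: "A \<in> sets borel"
  shows "emeasure (edge_measure E) A = ennreal (dist a b) * emeasure (lebesgue_on {0..1}) (linepath a b -` A \<inter> {0..1})"
  using A by (simp add: edge_measure_ends[OF E] emeasure_distr)

lemma finite_edge_measure: "finite_measure (edge_measure E)"
proof
  obtain a b where E: "ends E = (a, b)" by (cases "ends E")
  have "emeasure (edge_measure E) UNIV = ennreal (dist a b)"
    using emeasure_edge_measure[OF E, of UNIV] by (simp add: emeasure_restrict_space)
  then show "emeasure (edge_measure E) (space (edge_measure E)) \<noteq> \<infinity>" by simp
qed

lemma edge_measure_UNIV: "ends E = (a, b) \<Longrightarrow> measure (edge_measure E) UNIV = dist a b"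
  using emeasure_edge_measure[of E a b UNIV] by (simp add: emeasure_restrict_space measure_def)

lemma edge_integral:
  fixes f :: "plane \<Rightarrow> real"
  assumes E: "ends E = (a, b)" and [measurable]: "f \<in> borel_measurable borel"
  shows "(LINT x|edge_measure E. f x) = dist a b * (LINT s|lebesgue_on {0..1}. f (linepath a b s))"
proof -
  let ?D = "distr (lebesgue_on {0..1}) borel (linepath a b)"
  have "edge_measure E = density ?D (\<lambda>_. ennreal (dist a b))"
    unfolding edge_measure_ends[OF E]
    by (rule measure_eqI) (auto simp: emeasure_density nn_integral_cmult_indicator)
  then have "(LINT x|edge_measure E. f x) = (LINT x|?D. dist a b *\<^sub>R f x)"
    by (simp add: integral_density)
  also have "\<dots> = (LINT s|lebesgue_on {0..1}. dist a b *\<^sub>R f (linepath a b s))"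
    by (rule integral_distr) measurable
  finally show ?thesis by simp
qed

text \<open>The arc length measure lives on the whole plane; this expresses that it is concentrated
  on the segment.\<close>

lemma AE_edge_measure:
  assumes E: "ends E = (a, b)" and p: "\<And>x. x \<in> closed_segment a b \<Longrightarrow> Q x"
  shows "AE x in edge_measure E. Q x"
proof (rule AE_I[where N = "- closed_segment a b"])
  show "{x \<in> space (edge_measure E). \<not> Q x} \<subseteq> - closed_segment a b" using p by auto
  have s: "- closed_segment a b \<in> sets borel" by (simp add: closed_segment borel_closed)
  then show "- closed_segment a b \<in> sets (edge_measure E)" by simp
  have "linepath a b -` (- closed_segment a b) \<inter> {0..1} = {}"
    using linepath_in_path[of _ a b] by blast
  then show "emeasure (edge_measure E) (- closed_segment a b) = 0"
    by (simp add: emeasure_edge_measure[OF E s])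
qed

lemma L2_edge_continuous:
  assumes E: "ends E = (a, b)" and f: "continuous_on UNIV (f :: plane \<Rightarrow> real)"
  shows "f \<in> L2 (edge_measure E)"
proof -
  have "compact (f ` closed_segment a b)"
    by (intro compact_continuous_image continuous_on_subset[OF f]) auto
  then obtain B where B: "\<And>x. x \<in> closed_segment a b \<Longrightarrow> norm (f x) \<le> B"
    by (metis compact_imp_bounded bounded_iff imageI)
  have m: "f \<in> borel_measurable (edge_measure E)"
    using borel_measurable_continuous_onI[OF f] by simp
  have "AE x in edge_measure E. norm (f x) \<le> \<bar>B\<bar> * norm (1::real)"
    by (rule AE_edge_measure[OF E]) (use B in force)
  from L2_dominated(1)[OF L2_const[OF finite_edge_measure] m _ this] show ?thesis by simp
qed

subsection \<open>Integration over triangles\<close>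

text \<open>The signed area of a parallelogram: \<open>cross (a - y) (b - a)\<close> is, up to sign,
  twice the area of the triangle \<open>y\<close>, \<open>a\<close>, \<open>b\<close>.\<close>

definition cross :: "plane \<Rightarrow> plane \<Rightarrow> real" where
  "cross u v = u $ 1 * v $ 2 - u $ 2 * v $ 1"

text \<open>Iterated integrals are available on pairs of reals, while the plane is a vector type;
  this map transports them.\<close>

definition vec2 :: "real \<times> real \<Rightarrow> plane" where
  "vec2 p = fst p *\<^sub>R axis 1 1 + snd p *\<^sub>R axis 2 1"

lemma vec2_nth [simp]: "vec2 p $ 1 = fst p" "vec2 p $ 2 = snd p"
  by (simp_all add: vec2_def axis_def)

lemma continuous_vec2: "continuous_on S vec2"
  unfolding vec2_def by (intro continuous_intros)

lemma vec2_measurable [measurable]: "vec2 \<in> borel_measurable borel"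
  by (rule borel_measurable_continuous_onI[OF continuous_vec2])

lemma Basis_plane: "(Basis :: plane set) = {axis 1 1, axis 2 1}"
  by (auto simp: Basis_vec_def UNIV_2)

lemma lborel_vec2: "distr lborel borel vec2 = lborel"
proof (rule lborel_eqI[symmetric])
  fix l u :: plane assume le: "\<And>b. b \<in> Basis \<Longrightarrow> l \<bullet> b \<le> u \<bullet> b"
  have ne: "(axis 1 1 :: plane) \<noteq> axis 2 1" by (simp add: axis_eq_axis)
  have pre: "vec2 -` box l u = box (l $ 1, l $ 2) (u $ 1, u $ 2)"
    by (auto simp: box_def Basis_plane Basis_prod_def inner_axis)
  have "emeasure (distr lborel borel vec2) (box l u) = emeasure lborel (box (l $ 1, l $ 2) (u $ 1, u $ 2))"
    by (simp add: emeasure_distr pre)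
  also have "\<dots> = ennreal ((u $ 1 - l $ 1) * (u $ 2 - l $ 2))"
    using le[of "axis 1 1"] le[of "axis 2 1"]
    by (subst emeasure_lborel_box) (auto simp: Basis_plane Basis_prod_def inner_axis prod.union_disjoint)
  finally show "emeasure (distr lborel borel vec2) (box l u) = ennreal (\<Prod>b\<in>Basis. (u - l) \<bullet> b)"
    using ne by (simp add: Basis_plane inner_axis)
qed simp

lemma integral_unit_square:
  fixes K :: "plane \<Rightarrow> real"
  assumes K: "continuous_on UNIV K"
  shows "integral (cbox 0 1) K = integral {0..1} (\<lambda>s. integral {0..1} (\<lambda>t. K (vec2 (s, t))))"
proof -
  have [measurable]: "K \<in> borel_measurable borel" using K by (rule borel_measurable_continuous_onI)
  have pre: "vec2 p \<in> cbox 0 1 \<longleftrightarrow> p \<in> cbox (0, 0) (1, 1)" for p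
    by (auto simp: mem_box Basis_plane Basis_prod_def inner_axis inner_Pair_0)
  have Kc: "continuous_on UNIV (\<lambda>p. K (vec2 p))"
    by (rule continuous_on_compose2[OF K continuous_vec2]) simp
  have "integral (cbox 0 1) K = (LINT x:cbox 0 1|lborel. K x)"
    by (rule set_borel_integral_eq_integral(2)[symmetric], unfold set_integrable_def, rule borel_integrable_compact)
      (auto intro: continuous_on_subset[OF K])
  also have "\<dots> = (LINT x|distr lborel borel vec2. indicator (cbox 0 1) x *\<^sub>R K x)"
    by (simp add: lborel_vec2 set_lebesgue_integral_def)
  also have "\<dots> = (LINT p|lborel. indicator (cbox 0 1) (vec2 p) *\<^sub>R K (vec2 p))"
    by (rule integral_distr) measurable
  also have "\<dots> = (LINT p:cbox (0,0) (1,1)|lborel. K (vec2 p))"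
    unfolding set_lebesgue_integral_def by (intro Bochner_Integration.integral_cong) (auto simp: indicator_def pre)
  also have "\<dots> = integral (cbox (0,0) (1,1)) (\<lambda>p. K (vec2 p))"
    by (rule set_borel_integral_eq_integral(2), unfold set_integrable_def, rule borel_integrable_compact)
      (auto intro: continuous_on_subset[OF Kc])
  also have "\<dots> = integral (cbox 0 1) (\<lambda>s. integral (cbox 0 1) (\<lambda>t. K (vec2 (s, t))))"
    by (rule integral_prod_continuous) (auto intro: continuous_on_subset[OF Kc])
  finally show ?thesis by simp
qed

text \<open>The triangle without its vertex \<open>y\<close>: excluding \<open>t = 0\<close> makes
  the coordinates \<open>(s, t)\<close> injective.\<close>

definition cone :: "plane \<Rightarrow> plane \<Rightarrow> plane \<Rightarrow> plane set" where
  "cone y a b = {y + t *\<^sub>R (linepath a b s - y) |s t. 0 < t \<and> t \<le> 1 \<and> 0 \<le> s \<and> s \<le> 1}"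

text \<open>The coordinates have Jacobian determinant \<open>t * cross (a - y) (b - a)\<close> up to
  sign. They are injective because the cross product with \<open>b - a\<close> recovers
  \<open>t\<close>, and then \<open>s\<close> follows.\<close>

lemma cone_change_of_variables:
  fixes k :: "plane \<Rightarrow> real"
  assumes k: "continuous_on UNIV k" and D: "cross (a - y) (b - a) \<noteq> 0"
  shows "(k has_integral integral {0..1} (\<lambda>s. integral {0..1} (\<lambda>t. \<bar>cross (a - y) (b - a)\<bar> * (t * k (y + t *\<^sub>R (linepath a b s - y)))))) (cone y a b)"
proof -
  let ?D = "cross (a - y) (b - a)"
  let ?c = "\<lambda>u::plane. (a - y) + u $ 1 *\<^sub>R (b - a)"
  define \<Phi> where "\<Phi> u = y + u $ 2 *\<^sub>R ?c u" for u :: plane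
  define \<Phi>' where "\<Phi>' u w = w $ 2 *\<^sub>R ?c u + (u $ 2 * w $ 1) *\<^sub>R (b - a)" for u w :: plane
  define S where "S = {u::plane. 0 \<le> u $ 1 \<and> u $ 1 \<le> 1 \<and> 0 < u $ 2 \<and> u $ 2 \<le> 1}"
  have lp: "linepath a b s - y = (a - y) + s *\<^sub>R (b - a)" for s by (simp add: linepath_def algebra_simps)
  have img: "\<Phi> ` S = cone y a b"
  proof
    show "\<Phi> ` S \<subseteq> cone y a b" unfolding cone_def lp \<Phi>_def S_def by blast
    show "cone y a b \<subseteq> \<Phi> ` S"
    proof
      fix x assume "x \<in> cone y a b"
      then obtain s t where "x = y + t *\<^sub>R ((a - y) + s *\<^sub>R (b - a))" "0 < t" "t \<le> 1" "0 \<le> s" "s \<le> 1"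
        unfolding cone_def lp by blast
      then show "x \<in> \<Phi> ` S" by (intro image_eqI[of _ _ "vec2 (s, t)"]) (auto simp: \<Phi>_def S_def)
    qed
  qed
  have "{u::plane. 0 < u $ 2} \<in> sets borel" "{u::plane. u $ 1 \<le> 1 } \<in> sets borel" "{u::plane. 0 \<le> u $ 1} \<in> sets borel" "{u::plane. u $ 2 \<le> 1 } \<in> sets borel"
    by measurable
  then have "{u::plane. 0 < u $ 2} \<inter> {u::plane. u $ 1 \<le> 1 } \<inter> {u::plane. 0 \<le> u $ 1} \<inter> {u::plane. u $ 2 \<le> 1 } \<in> sets borel"
    by blast
  then have "S \<in> sets borel" by (rule back_subst[where P = "\<lambda>S. S \<in> sets borel"]) (auto simp: S_def)
  then have S: "S \<in> sets lebesgue" by simp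
  have bS: "bounded S"
  proof (rule bounded_subset[OF bounded_cbox])
    show "S \<subseteq> cbox 0 1" by (auto simp: S_def mem_box Basis_plane inner_axis)
  qed
  have der: "(\<Phi> has_derivative \<Phi>' u) (at u within S)" for u
  proof -
    have n: "((\<lambda>u. u $ i) has_derivative (\<lambda>w. w $ i)) (at u within S)" for i
      by (rule bounded_linear_imp_has_derivative[OF bounded_linear_vec_nth])
    show ?thesis unfolding \<Phi>_def
      by (rule has_derivative_eq_rhs)
        (rule derivative_intros n | simp add: fun_eq_iff \<Phi>'_def algebra_simps)+
  qed
  have inj: "inj_on \<Phi> S"
  proof (rule inj_onI)
    fix u w assume uw: "u \<in> S" "w \<in> S" "\<Phi> u = \<Phi> w"
    then have e: "u $ 2 *\<^sub>R ?c u = w $ 2 *\<^sub>R ?c w" by (simp add: \<Phi>_def)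
    have c: "cross (?c u) (b - a) = ?D" for u by (simp add: cross_def algebra_simps)
    have "u $ 2 * ?D = w $ 2 * ?D"
      using arg_cong[OF e, of "\<lambda>v. cross v (b - a)"] c[of u] c[of w] by (simp add: cross_def algebra_simps)
    then have 2: "u $ 2 = w $ 2" using D by simp
    then have "?c u = ?c w" using e uw(1) by (simp add: S_def)
    then have "u $ 1 *\<^sub>R (b - a) = w $ 1 *\<^sub>R (b - a)" by simp
    moreover have "b - a \<noteq> 0" using D by (auto simp: cross_def)
    ultimately have "u $ 1 = w $ 1" by simp
    with 2 show "u = w" by (simp add: vec_eq_iff forall_2)
  qed
  have det: "det (matrix (\<Phi>' u)) = - (u $ 2 * ?D)" for u
    by (simp add: det_2 matrix_def \<Phi>'_def cross_def axis_def algebra_simps)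
  \<comment> \<open>The factor \<open>\<bar>u $ 2\<bar>\<close> makes \<open>K\<close> vanish for
    \<open>t = 0\<close>, so \<open>S\<close> may be completed to the closed unit square without
    changing the integral.\<close>
  define K where "K u = \<bar>?D\<bar> * (\<bar>u $ 2\<bar> * k (\<Phi> u))" for u
  have Kc: "continuous_on UNIV K"
  proof -
    have "continuous_on UNIV (\<lambda>u. k (\<Phi> u))"
      by (rule continuous_on_compose2[OF k]) (auto simp: \<Phi>_def intro!: continuous_intros)
    then show ?thesis unfolding K_def by (intro continuous_intros)
  qed
  \<comment> \<open>The change of variables is applied to a vector-valued integrand; the scalar one
    is placed on the first axis and read off again by an inner product.\<close>
  let ?e = "axis 1 1 :: plane"
  have Ki: "integrable (lebesgue_on S) K"
    by (rule L2_integrable[OF L2_continuous[OF Kc bS S] finite_measure_lebesgue_on_bounded[OF bS S]])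
  have eqK: "\<bar>det (matrix (\<Phi>' u))\<bar> *\<^sub>R (k (\<Phi> u) *\<^sub>R ?e) = K u *\<^sub>R ?e" for u
    by (simp add: det K_def abs_mult)
  have "(\<lambda>u. K u *\<^sub>R ?e) absolutely_integrable_on S"
    using Ki S unfolding set_integrable_def by (subst integrable_restrict_space[symmetric]) auto
  moreover have "integral S (\<lambda>u. K u *\<^sub>R ?e) = integral S K *\<^sub>R ?e"
    using integral_linear[OF integrable_on_lebesgue_on[OF Ki S] bounded_linear_scaleR_left, of ?e] by (simp add: o_def)
  ultimately have "(\<lambda>x. k x *\<^sub>R ?e) absolutely_integrable_on (\<Phi> ` S) \<and> integral (\<Phi> ` S) (\<lambda>x. k x *\<^sub>R ?e) = integral S K *\<^sub>R ?e"
    using has_absolute_integral_change_of_variables[OF S der inj, of "\<lambda>x. k x *\<^sub>R ?e" "integral S K *\<^sub>R ?e"] unfolding eqK by blast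
  then have "((\<lambda>x. k x *\<^sub>R ?e) has_integral integral S K *\<^sub>R ?e) (cone y a b)"
    unfolding img by (metis absolutely_integrable_on_def integrable_integral)
  from has_integral_linear[OF this bounded_linear_inner_left, of ?e]
  have hi: "(k has_integral integral S K) (cone y a b)" by (simp add: o_def inner_axis)
  have "integral S K = integral (cbox 0 1) K"
  proof -
    have "(if u \<in> S then K u else 0) = (if u \<in> cbox 0 1 then K u else 0)" for u
      by (auto simp: S_def mem_box Basis_plane inner_axis K_def)
    then show ?thesis
      unfolding integral_restrict_UNIV[symmetric, of S] integral_restrict_UNIV[symmetric, of "cbox 0 1"] by simp
  qed
  also have "\<dots> = integral {0..1} (\<lambda>s. integral {0..1} (\<lambda>t. K (vec2 (s, t))))"
    by (rule integral_unit_square[OF Kc])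
  also have "\<dots> = integral {0..1} (\<lambda>s. integral {0..1} (\<lambda>t. \<bar>?D\<bar> * (t * k (y + t *\<^sub>R (linepath a b s - y)))))"
    by (intro integral_cong) (simp add: K_def \<Phi>_def lp)
  finally show ?thesis using hi by simp
qed

text \<open>The integrand is the derivative of \<open>t\<^sup>2 F(y + t (x - y))\<close> in the radial variable.\<close>

lemma cone_formula:
  assumes F: "smooth F" and D: "cross (a - y) (b - a) \<noteq> 0" and E: "ends E = (a, b)"
  shows "((\<lambda>x. 2 * F x + grad F x \<bullet> (x - y)) has_integral
    \<bar>cross (a - y) (b - a)\<bar> / dist a b * (LINT x|edge_measure E. F x)) (cone y a b)"
proof -
  let ?D = "cross (a - y) (b - a)"
  have ab: "dist a b \<noteq> 0" using D by (auto simp: cross_def)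
  have kc: "continuous_on UNIV (\<lambda>x. 2 * F x + grad F x \<bullet> (x - y))"
    by (intro continuous_intros smooth_continuous[OF F] smooth_continuous_grad[OF F])
  have inner: "integral {0..1} (\<lambda>t. \<bar>?D\<bar> * (t * (2 * F (y + t *\<^sub>R (p - y)) + grad F (y + t *\<^sub>R (p - y)) \<bullet> ((y + t *\<^sub>R (p - y)) - y)))) = \<bar>?D\<bar> * F p" for p
  proof -
    have "((\<lambda>t. t * (2 * F (y + t *\<^sub>R (p - y)) + grad F (y + t *\<^sub>R (p - y)) \<bullet> ((y + t *\<^sub>R (p - y)) - y))) has_integral
      1\<^sup>2 * F (y + 1 *\<^sub>R (p - y)) - 0\<^sup>2 * F (y + 0 *\<^sub>R (p - y))) {0..1}"
    proof (rule fundamental_theorem_of_calculus)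
      fix t :: real
      have "((\<lambda>t. y + t *\<^sub>R (p - y)) has_derivative (\<lambda>s. s *\<^sub>R (p - y))) (at t)" by (auto intro!: derivative_eq_intros)
      from has_derivative_compose[OF this smooth_has_derivative[OF F]]
      have "((\<lambda>t. F (y + t *\<^sub>R (p - y))) has_real_derivative grad F (y + t *\<^sub>R (p - y)) \<bullet> (p - y)) (at t)"
        by (simp add: has_field_derivative_def mult.commute[of _ "grad F (y + t *\<^sub>R (p - y)) \<bullet> (p - y)"] fun_eq_iff)
      then have "((\<lambda>t. t\<^sup>2 * F (y + t *\<^sub>R (p - y))) has_real_derivative
        t * (2 * F (y + t *\<^sub>R (p - y)) + grad F (y + t *\<^sub>R (p - y)) \<bullet> ((y + t *\<^sub>R (p - y)) - y))) (at t)"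
        by (auto intro!: derivative_eq_intros simp: power2_eq_square algebra_simps)
      then show "((\<lambda>t. t\<^sup>2 * F (y + t *\<^sub>R (p - y))) has_vector_derivative
        t * (2 * F (y + t *\<^sub>R (p - y)) + grad F (y + t *\<^sub>R (p - y)) \<bullet> ((y + t *\<^sub>R (p - y)) - y))) (at t within {0..1})"
        unfolding has_real_derivative_iff_has_vector_derivative by (rule has_vector_derivative_at_within)
    qed simp
    moreover have "1\<^sup>2 * F (y + 1 *\<^sub>R (p - y)) - 0\<^sup>2 * F (y + 0 *\<^sub>R (p - y)) = F p" by simp
    ultimately show ?thesis by (simp only:) (rule integral_unique[OF has_integral_mult_right])
  qed
  have Fl: "continuous_on {0..1} (\<lambda>s. F (linepath a b s))"
    by (rule continuous_on_compose2[OF smooth_continuous[OF F, of UNIV]]) auto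
  have "(LINT x|edge_measure E. F x) = dist a b * (LINT s|lebesgue_on {0..1}. F (linepath a b s))"
    by (rule edge_integral[OF E smooth_borel[OF F]])
  also have "(LINT s|lebesgue_on {0..1}. F (linepath a b s)) = integral {0..1} (\<lambda>s. F (linepath a b s))"
  proof (rule lebesgue_integral_eq_integral)
    show "integrable (lebesgue_on {0..1}) (\<lambda>s. F (linepath a b s))"
      by (rule continuous_imp_integrable_real[OF Fl])
  qed simp
  finally have "\<bar>?D\<bar> / dist a b * (LINT x|edge_measure E. F x) = integral {0..1} (\<lambda>s. \<bar>?D\<bar> * F (linepath a b s))"
    using ab by simp
  with cone_change_of_variables[OF kc D] show ?thesis unfolding inner by simp
qed

section \<open>Star-shaped polygons\<close>

lemma cross_zero_parallel:
  assumes "cross u v = 0" "v \<noteq> 0"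
  shows "\<exists>s. u = s *\<^sub>R v"
proof -
  have "v $ 1 \<noteq> 0 \<or> v $ 2 \<noteq> 0" using assms(2) by (auto simp: vec_eq_iff forall_2)
  then show ?thesis
  proof
    assume n: "v $ 1 \<noteq> 0"
    show ?thesis by (rule exI[of _ "u $ 1 / v $ 1"])
        (use n assms(1) in \<open>auto simp: vec_eq_iff forall_2 cross_def field_simps\<close>)
  next
    assume n: "v $ 2 \<noteq> 0"
    show ?thesis by (rule exI[of _ "u $ 2 / v $ 2"])
        (use n assms(1) in \<open>auto simp: vec_eq_iff forall_2 cross_def field_simps\<close>)
  qed
qed

locale star_polygon =
  fixes P :: polygon and z :: plane and r :: real
  assumes P: "polygonal_domain P" and r_pos: "r > 0" and ball_P: "ball z r \<subseteq> pts P"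
    and star_P: "\<And>x y. y \<in> ball z r \<Longrightarrow> x \<in> pts P \<Longrightarrow> closed_segment y x \<subseteq> pts P"
begin

abbreviation "G \<equiv> interior (pts P)"
abbreviation "h \<equiv> diameter (pts P)"

lemma P_compact: "compact (pts P)" using P by (simp add: polygonal_domain_def)

lemma ball_G: "ball z r \<subseteq> G"
  by (rule interior_maximal[OF ball_P open_ball])

text \<open>The homothety with centre \<open>x\<close> and ratio \<open>1 - t\<close> maps a ball
  around \<open>y\<close> onto a ball around the point in question, and star-shapedness keeps the
  image in \<open>P\<close>. Only the endpoint \<open>x\<close> itself can lie on the
  frontier.\<close>

lemma segment_interior:
  assumes y: "y \<in> ball z r" and x: "x \<in> pts P" and t: "0 \<le> t" "t < 1"
  shows "y + t *\<^sub>R (x - y) \<in> G"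
proof -
  obtain e where e: "e > 0" "ball y e \<subseteq> ball z r" using y open_ball openE by metis
  have "ball (y + t *\<^sub>R (x - y)) ((1 - t) * e) \<subseteq> pts P"
  proof
    fix w assume w: "w \<in> ball (y + t *\<^sub>R (x - y)) ((1 - t) * e)"
    define p where "p = y + (w - (y + t *\<^sub>R (x - y))) /\<^sub>R (1 - t)"
    have "norm (w - (y + t *\<^sub>R (x - y))) < (1 - t) * e" using w by (simp add: dist_norm norm_minus_commute)
    then have "norm (w - (y + t *\<^sub>R (x - y))) / (1 - t) < e" using t by (simp add: divide_less_eq mult.commute)
    then have "norm (p - y) < e" using t by (simp add: p_def divide_inverse_commute)
    then have "p \<in> ball y e" by (simp add: dist_norm norm_minus_commute)
    then have "p \<in> ball z r" using e(2) by blast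
    moreover have "w \<in> closed_segment p x"
      unfolding closed_segment_def
    proof (intro CollectI exI[of _ t] conjI)
      have "(1 - t) *\<^sub>R p = (1 - t) *\<^sub>R y + (w - (y + t *\<^sub>R (x - y)))"
        using t by (simp add: p_def scaleR_add_right)
      then show "w = (1 - t) *\<^sub>R p + t *\<^sub>R x" by (simp add: algebra_simps)
    qed (use t in auto)
    ultimately show "w \<in> pts P" using star_P x by blast
  qed
  moreover have "y + t *\<^sub>R (x - y) \<in> ball (y + t *\<^sub>R (x - y)) ((1 - t) * e)" using e(1) t by simp
  ultimately show ?thesis using interior_maximal[OF _ open_ball] by blast
qed

sublocale star_domain G z r h
proof
  show "norm (x - y) \<le> h" if "x \<in> G" "y \<in> G" for x y
    using diameter_bounded_bound[OF compact_imp_bounded[OF P_compact], of x y] that interior_subset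
    by (auto simp: dist_norm)
  show "closed_segment y x \<subseteq> G" if y: "y \<in> ball z r" and x: "x \<in> G" for x y
  proof
    fix w assume "w \<in> closed_segment y x"
    then obtain t where t: "0 \<le> t" "t \<le> 1" "w = (1 - t) *\<^sub>R y + t *\<^sub>R x" by (auto simp: closed_segment_def)
    then have w: "w = y + t *\<^sub>R (x - y)" by (simp add: algebra_simps)
    show "w \<in> G"
    proof (cases "t = 1")
      case True then show ?thesis using w x by simp
    next
      case False then show ?thesis unfolding w using segment_interior[OF y _ t(1)] t(2) x interior_subset by force
    qed
  qed
qed (use r_pos ball_G in auto)

lemma frontier_P: "frontier (pts P) = \<Union>(edges P)"
  by (rule frontier_edges[OF P])

lemma P_eq: "pts P = G \<union> frontier (pts P)"
  using compact_imp_closed[OF P_compact] interior_subset by (auto simp: frontier_def)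

lemma negligible_segment: "negligible (closed_segment a (b::plane))"
  using interior_closed_segment_ge2[of a b] by (simp add: negligible_convex_interior)

lemma negligible_frontier: "negligible (frontier (pts P))"
  unfolding frontier_P
proof (rule negligible_Union[OF finite_edges[OF P]])
  fix E assume "E \<in> edges P"
  then obtain a b where "E = closed_segment a b" using edge_nodes[OF P] by metis
  then show "negligible E" using negligible_segment by simp
qed

lemma P_sets: "pts P \<in> sets lebesgue" using P_compact by (simp add: borel_compact)

lemma negligible_P_diff: "negligible (pts P - G)"
  using negligible_frontier by (rule negligible_subset) (use P_eq in auto)

lemmas integral_P_eq_G = integral_lebesgue_on_null_difference[OF P_sets G_sets interior_subset negligible_P_diff]

lemma Leb_L2_norm: "L2_norm (Leb P) f = L2_norm (lebesgue_on G) (f :: plane \<Rightarrow> 'b::euclidean_space)"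
  by (simp add: L2_norm_def integral_P_eq_G)

lemma Leb_L2_inner: "L2_inner (Leb P) f g = L2_inner (lebesgue_on G) f (g :: plane \<Rightarrow> 'b::euclidean_space)"
  by (simp add: L2_inner_def integral_P_eq_G)

lemma frontier_not_G: "x \<in> frontier (pts P) \<Longrightarrow> x \<notin> G"
  by (simp add: frontier_def)

lemma edge_subset: "E \<in> edges P \<Longrightarrow> E \<subseteq> frontier (pts P)"
  using frontier_P by auto

lemma frontier_subset_P: "frontier (pts P) \<subseteq> pts P"
  using P_eq by auto

text \<open>If \<open>y\<close> were on the line through the edge, the midpoint would lie on the
  segment from \<open>y\<close> to one endpoint, strictly before that endpoint, and would therefore
  be interior although it is a frontier point.\<close>

lemma cross_nonzero:
  assumes E: "closed_segment a b \<subseteq> frontier (pts P)" "a \<noteq> b" and y: "y \<in> ball z r"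
  shows "cross (a - y) (b - a) \<noteq> 0"
proof
  assume c: "cross (a - y) (b - a) = 0"
  obtain s' where "a - y = s' *\<^sub>R (b - a)" using cross_zero_parallel[OF c] E(2) by auto
  then have s: "y = a + (- s') *\<^sub>R (b - a)" by (simp add: algebra_simps)
  let ?s = "- s'"
  have aux: False if "y = a' + s' *\<^sub>R (b' - a')" "s' \<le> 1/2" "midpoint a' b' = midpoint a b" "b' \<in> pts P" for s' a' b'
  proof -
    \<comment> \<open>Chosen so that the point at fraction \<open>t\<close> on the way from
      \<open>y\<close> to \<open>b'\<close> is the midpoint. The condition
      \<open>s' \<le> 1/2\<close> is reached by naming the endpoints suitably.\<close>
    define t where "t = (1/2 - s') / (1 - s')"
    have t: "0 \<le> t" "t < 1" "t * (1 - s') = 1/2 - s'" using that(2) by (auto simp: t_def field_simps)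
    have "y + t *\<^sub>R (b' - y) \<in> G" by (rule segment_interior[OF y that(4) t(1,2)])
    also have "y + t *\<^sub>R (b' - y) = a' + (s' + t * (1 - s')) *\<^sub>R (b' - a')"
      by (simp add: that(1) algebra_simps)
    also have "\<dots> = midpoint a' b'" unfolding t(3) by (simp add: midpoint_def vec_eq_iff field_simps)
    finally have "midpoint a b \<in> G" using that(3) by simp
    moreover have "midpoint a b \<in> frontier (pts P)" using E(1) midpoint_in_closed_segment by blast
    ultimately show False using frontier_not_G by blast
  qed
  have "a \<in> pts P" "b \<in> pts P" using E(1) frontier_subset_P by auto
  then show False
    using aux[OF s] aux[of b "1 - ?s" a] s by (cases "?s \<le> 1/2") (auto simp: midpoint_sym algebra_simps)
qed

text \<open>Otherwise the foot of the perpendicular from \<open>z\<close> to the line through the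
  edge would lie in the ball, against \<open>cross_nonzero\<close>. \<open>J\<close> is the edge
  vector turned by a right angle.\<close>

lemma cross_lower_bound:
  assumes E: "closed_segment a b \<subseteq> frontier (pts P)" "a \<noteq> b"
  shows "r * dist a b \<le> \<bar>cross (a - z) (b - a)\<bar>"
proof (rule ccontr)
  assume "\<not> ?thesis"
  then have lt: "\<bar>cross (a - z) (b - a)\<bar> < r * norm (b - a)" by (simp add: dist_norm norm_minus_commute)
  let ?d = "b - a"
  define J where "J = vec2 (- ?d $ 2, ?d $ 1)"
  have n: "norm ?d > 0" using E(2) by simp
  have J: "(norm J)\<^sup>2 = (norm ?d)\<^sup>2" by (simp add: norm_vec2_sq J_def power2_commute)
  then have nJ: "norm J = norm ?d" by simp
  have cJ: "cross J ?d = - (norm ?d)\<^sup>2" unfolding norm_vec2_sq by (simp add: cross_def J_def power2_eq_square algebra_simps)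
  define \<alpha> where "\<alpha> = cross (a - z) ?d / (norm ?d)\<^sup>2"
  define y where "y = z - \<alpha> *\<^sub>R J"
  have "norm (\<alpha> *\<^sub>R J) = \<bar>cross (a - z) ?d\<bar> / norm ?d"
    using n by (simp add: \<alpha>_def nJ power2_eq_square)
  also have "\<dots> < r" using lt n by (simp add: divide_less_eq)
  finally have "y \<in> ball z r" by (simp add: y_def dist_norm)
  moreover have "cross (a - y) ?d = cross (a - z) ?d + \<alpha> * cross J ?d"
    by (simp add: y_def cross_def algebra_simps)
  then have "cross (a - y) ?d = 0" using n by (simp add: cJ \<alpha>_def)
  ultimately show False using cross_nonzero[OF E] by blast
qed

subsection \<open>Decomposition into triangles\<close>

definition tri :: "plane \<Rightarrow> plane set \<Rightarrow> plane set" where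
  "tri y E = cone y (fst (ends E)) (snd (ends E))"

lemma tri_eq:
  assumes "E \<in> edges P"
  shows "tri y E = {y + t *\<^sub>R (p - y) |p t. p \<in> E \<and> 0 < t \<and> t \<le> 1}"
proof -
  obtain a b where ab: "ends E = (a, b)" "E = closed_segment a b" by (rule edge_endsE[OF P assms])
  have E: "E = {linepath a b s |s. 0 \<le> s \<and> s \<le> 1}"
    unfolding ab(2) by (auto simp: closed_segment_def linepath_def)
  show ?thesis unfolding tri_def cone_def ab(1) fst_conv snd_conv by (subst E) blast
qed

text \<open>Of two distinct frontier points on one ray from \<open>y\<close>, the nearer would be
  interior by \<open>segment_interior\<close>.\<close>

lemma frontier_ray_unique:
  assumes y: "y \<in> ball z r" and p: "p \<in> frontier (pts P)" and q: "q \<in> frontier (pts P)"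
    and t: "0 < t" "0 < s" "y + t *\<^sub>R (p - y) = y + s *\<^sub>R (q - y)"
  shows "p = q"
proof -
  have aux: "\<not> t < s" if p: "p \<in> frontier (pts P)" and q: "q \<in> frontier (pts P)"
    and "0 < t" "0 < s" "t *\<^sub>R (p - y) = s *\<^sub>R (q - y)" for p q t s
  proof
    assume "t < s"
    have "(t / s) *\<^sub>R (p - y) = (1 / s) *\<^sub>R (t *\<^sub>R (p - y))" by simp
    also have "\<dots> = q - y" using that by simp
    finally have "q = y + (t / s) *\<^sub>R (p - y)" by simp
    moreover have "y + (t / s) *\<^sub>R (p - y) \<in> G"
      using \<open>t < s\<close> that p frontier_subset_P by (intro segment_interior[OF y]) auto
    ultimately show False using q frontier_not_G by blast
  qed
  have "t = s" using aux[OF p q t(1,2)] aux[OF q p t(2,1)] t(3) by auto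
  with t show ?thesis by simp
qed

text \<open>The ray from \<open>y\<close> through a point \<open>x\<close> of \<open>P\<close> meets
  the frontier at some \<open>y + d (x - y)\<close>. It cannot do so with \<open>d < 1\<close>,
  where it is still interior, so \<open>x\<close> lies in the triangle over the edge that is
  hit.\<close>

lemma tri_cover:
  assumes y: "y \<in> ball z r"
  shows "(\<Union>E\<in>edges P. tri y E) = pts P - {y}"
proof (rule set_eqI)
  fix x
  have yG: "y \<in> G" using y ball_G by blast
  have "(\<exists>E\<in>edges P. x \<in> tri y E) \<longleftrightarrow> (\<exists>p\<in>frontier (pts P). \<exists>t. 0 < t \<and> t \<le> 1 \<and> x = y + t *\<^sub>R (p - y))"
    unfolding frontier_P using tri_eq by auto
  also have "\<dots> \<longleftrightarrow> x \<in> pts P - {y}"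
  proof
    assume "\<exists>p\<in>frontier (pts P). \<exists>t. 0 < t \<and> t \<le> 1 \<and> x = y + t *\<^sub>R (p - y)"
    then obtain p t where p: "p \<in> frontier (pts P)" "0 < t" "t \<le> 1" "x = y + t *\<^sub>R (p - y)" by blast
    have "x \<in> closed_segment y p" unfolding closed_segment_def using p
      by (auto intro!: exI[of _ t] simp: algebra_simps)
    then have "x \<in> pts P" using star_P[OF y] p(1) frontier_subset_P by blast
    moreover have "x \<noteq> y" using p frontier_not_G yG by auto
    ultimately show "x \<in> pts P - {y}" by blast
  next
    assume x: "x \<in> pts P - {y}"
    then have "x - y \<noteq> 0" by simp
    from ray_to_frontier[OF compact_imp_bounded[OF P_compact] yG this]
    obtain d where d: "0 < d" "y + d *\<^sub>R (x - y) \<in> frontier (pts P)" by metis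
    have "1 \<le> d"
    proof (rule ccontr)
      assume "\<not> 1 \<le> d"
      then have "y + d *\<^sub>R (x - y) \<in> G" using segment_interior[OF y, of x d] x d(1) by auto
      then show False using d(2) frontier_not_G by blast
    qed
    with d show "\<exists>p\<in>frontier (pts P). \<exists>t. 0 < t \<and> t \<le> 1 \<and> x = y + t *\<^sub>R (p - y)"
      by (intro bexI[of _ "y + d *\<^sub>R (x - y)"] exI[of _ "1 / d"]) auto
  qed
  finally show "x \<in> (\<Union>E\<in>edges P. tri y E) \<longleftrightarrow> x \<in> pts P - {y}" by simp
qed

text \<open>By uniqueness of the frontier point on a ray, a common point of two triangles lies on
  the segment from \<open>y\<close> to a common point of the two edges, of which there are finitely
  many.\<close>

lemma tri_overlap:
  assumes y: "y \<in> ball z r" and E: "E \<in> edges P" "E' \<in> edges P" "E \<noteq> E'"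
  shows "negligible (tri y E \<inter> tri y E')"
proof (rule negligible_subset)
  show "negligible (\<Union>p\<in>E \<inter> E'. closed_segment y p)"
    using edges_inter_finite[OF P E] by (intro negligible_Union) (auto intro: negligible_segment)
  show "tri y E \<inter> tri y E' \<subseteq> (\<Union>p\<in>E \<inter> E'. closed_segment y p)"
  proof
    fix x assume "x \<in> tri y E \<inter> tri y E'"
    then have x: "x \<in> tri y E" "x \<in> tri y E'" by auto
    obtain p t where p: "p \<in> E" "0 < t" "t \<le> 1" "x = y + t *\<^sub>R (p - y)" using x(1) tri_eq[OF E(1), of y] by auto
    obtain q s where q: "q \<in> E'" "0 < s" "s \<le> 1" "x = y + s *\<^sub>R (q - y)" using x(2) tri_eq[OF E(2), of y] by auto
    have "p = q" by (rule frontier_ray_unique[OF y _ _ p(2) q(2)]) (use p q E edge_subset in auto)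
    moreover have "x \<in> closed_segment y p" unfolding closed_segment_def using p
      by (auto intro!: exI[of _ t] simp: algebra_simps)
    ultimately show "x \<in> (\<Union>p\<in>E \<inter> E'. closed_segment y p)" using p q by blast
  qed
qed

text \<open>The distance from \<open>y\<close> to the line through the edge.\<close>

definition dist_edge :: "plane \<Rightarrow> plane set \<Rightarrow> real" where
  "dist_edge y E = (case ends E of (a, b) \<Rightarrow> \<bar>cross (a - y) (b - a)\<bar> / dist a b)"

lemma dist_edge_ge:
  assumes "E \<in> edges P" shows "r \<le> dist_edge z E"
proof -
  obtain a b where ab: "ends E = (a, b)" "a \<noteq> b" "E = closed_segment a b" by (rule edge_endsE[OF P assms])
  have "r * dist a b \<le> \<bar>cross (a - z) (b - a)\<bar>"
    using cross_lower_bound ab edge_subset[OF assms] by blast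
  then show ?thesis using ab by (simp add: dist_edge_def field_simps)
qed

text \<open>The integrand is the divergence of \<open>F(x) (x - y)\<close>, whose normal component
  on an edge is \<open>F\<close> times the constant distance of \<open>y\<close> from the edge line.
  For \<open>F = 1\<close> this is the area as a sum of triangles.\<close>

theorem star_formula:
  assumes y: "y \<in> ball z r" and F: "smooth F"
  shows "(LINT x|lebesgue_on G. 2 * F x + grad F x \<bullet> (x - y)) = (\<Sum>E\<in>edges P. dist_edge y E * (LINT x|edge_measure E. F x))"
proof -
  let ?k = "\<lambda>x. 2 * F x + grad F x \<bullet> (x - y)"
  have "(?k has_integral (\<Sum>E\<in>edges P. dist_edge y E * (LINT x|edge_measure E. F x))) (\<Union>E\<in>edges P. tri y E)"
  proof (rule has_integral_UN[OF finite_edges[OF P]])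
    fix E assume E: "E \<in> edges P"
    obtain a b where ab: "ends E = (a, b)" "a \<noteq> b" "E = closed_segment a b" by (rule edge_endsE[OF P E])
    have "cross (a - y) (b - a) \<noteq> 0" using cross_nonzero[OF _ ab(2) y] edge_subset[OF E] ab(3) by blast
    from cone_formula[OF F this ab(1)]
    show "(?k has_integral dist_edge y E * (LINT x|edge_measure E. F x)) (tri y E)"
      by (simp add: dist_edge_def tri_def ab(1))
  next
    show "pairwise (\<lambda>E E'. negligible (tri y E \<inter> tri y E')) (edges P)"
      using tri_overlap[OF y] by (simp add: pairwise_def)
  qed
  then have hi: "(?k has_integral (\<Sum>E\<in>edges P. dist_edge y E * (LINT x|edge_measure E. F x))) (pts P - {y})"
    by (simp add: tri_cover[OF y])
  have "integral G ?k = integral (pts P - {y}) ?k"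
  proof (rule integral_spike_set)
    show "negligible {x \<in> G - (pts P - {y}). ?k x \<noteq> 0}"
      by (rule negligible_subset[of "{y}"]) (use interior_subset in auto)
    show "negligible {x \<in> pts P - {y} - G. ?k x \<noteq> 0}"
      by (rule negligible_subset[OF negligible_P_diff]) auto
  qed
  moreover have "(LINT x|lebesgue_on G. ?k x) = integral G ?k"
  proof (rule lebesgue_integral_eq_integral)
    have "continuous_on UNIV ?k"
      by (intro continuous_intros smooth_continuous[OF F] smooth_continuous_grad[OF F])
    then show "integrable (lebesgue_on G) ?k"
      by (rule L2_integrable[OF L2_continuous[OF _ G_bounded G_sets] G_finite])
  qed simp
  ultimately show ?thesis using integral_unique[OF hi] by simp
qed

text \<open>Subtracting the formulas for two centres gives the divergence theorem; the constants are the
  components of the outer normal in the direction \<open>c\<close>.\<close>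

lemma divergence_theorem:
  "\<exists>\<nu>. \<forall>F. smooth F \<longrightarrow> (LINT x|lebesgue_on G. c \<bullet> grad F x) = (\<Sum>E\<in>edges P. \<nu> E * (LINT x|edge_measure E. F x))"
proof -
  \<comment> \<open>Any direction \<open>c\<close>, including zero, is scaled so that the second
    centre stays in the ball.\<close>
  define \<epsilon> where "\<epsilon> = r / (2 * (norm c + 1))"
  have \<epsilon>: "\<epsilon> > 0" "\<epsilon> * norm c < r"
  proof -
    define N where "N = norm c"
    have "N \<ge> 0" by (simp add: N_def)
    then have "N / (2 * (N + 1)) < 1" by (simp add: divide_less_eq)
    then have "norm c / (2 * (norm c + 1)) < 1" by (simp add: N_def)
    then have "r * (norm c / (2 * (norm c + 1))) < r * 1" by (intro mult_strict_left_mono r_pos)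
    then show "\<epsilon> * norm c < r" by (simp add: \<epsilon>_def)
    show "\<epsilon> > 0" using r_pos by (simp add: \<epsilon>_def add_nonneg_pos)
  qed
  define y where "y = z + \<epsilon> *\<^sub>R c"
  have y: "y \<in> ball z r" using \<epsilon> by (simp add: y_def dist_norm)
  have z: "z \<in> ball z r" using r_pos by simp
  define \<nu> where "\<nu> E = (dist_edge z E - dist_edge y E) / \<epsilon>" for E
  have "(LINT x|lebesgue_on G. c \<bullet> grad F x) = (\<Sum>E\<in>edges P. \<nu> E * (LINT x|edge_measure E. F x))" if F: "smooth F" for F
  proof -
    have i: "integrable (lebesgue_on G) (\<lambda>x. 2 * F x + grad F x \<bullet> (x - y))" for y
      by (intro L2_integrable[OF L2_continuous[OF _ G_bounded G_sets] G_finite] continuous_intros smooth_continuous[OF F] smooth_continuous_grad[OF F])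
    have "(LINT x|lebesgue_on G. \<epsilon> * (c \<bullet> grad F x))
      = (LINT x|lebesgue_on G. (2 * F x + grad F x \<bullet> (x - z)) - (2 * F x + grad F x \<bullet> (x - y)))"
      by (intro Bochner_Integration.integral_cong) (simp_all add: y_def inner_diff_right inner_add_right inner_commute)
    also have "\<dots> = (\<Sum>E\<in>edges P. dist_edge z E * (LINT x|edge_measure E. F x)) - (\<Sum>E\<in>edges P. dist_edge y E * (LINT x|edge_measure E. F x))"
      by (simp only: Bochner_Integration.integral_diff[OF i i] star_formula[OF z F] star_formula[OF y F])
    also have "\<dots> = \<epsilon> * (\<Sum>E\<in>edges P. \<nu> E * (LINT x|edge_measure E. F x))"
      using \<epsilon>(1) by (simp add: sum_distrib_left \<nu>_def left_diff_distrib flip: sum_subtractf)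
    finally show ?thesis using \<epsilon>(1) by simp
  qed
  then show ?thesis by blast
qed

text \<open>The other edges may be dropped because all their weights are nonnegative, and the weight
  of \<open>E\<close> is at least \<open>r\<close>. The 3 is the 2 of the formula plus 1 from
  Young's inequality; \<open>h\<close> bounds the distance from \<open>z\<close>.\<close>

lemma trace_inequality_smooth:
  assumes \<phi>: "smooth \<phi>" and E: "E \<in> edges P"
  shows "(L2_norm (edge_measure E) \<phi>)\<^sup>2 \<le> (3 * (L2_norm (lebesgue_on G) \<phi>)\<^sup>2 + h\<^sup>2 * (L2_norm (lebesgue_on G) (grad \<phi>))\<^sup>2) / r"
proof -
  let ?M = "lebesgue_on G"
  let ?F = "\<lambda>x. \<phi> x * \<phi> x"
  have F: "smooth ?F" by (rule smooth_mult[OF \<phi> \<phi>])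
  have z: "z \<in> ball z r" using r_pos by simp
  have pL: "\<phi> \<in> L2 ?M" "grad \<phi> \<in> L2 ?M"
    by (intro L2_continuous smooth_continuous smooth_continuous_grad \<phi> G_bounded G_sets)+
  have sq: "(L2_norm (edge_measure E) \<phi>)\<^sup>2 = (LINT x|edge_measure E. ?F x)" for E
    by (simp only: L2_norm_power2 real_norm_def power2_abs) (simp only: power2_eq_square)
  have "r * (L2_norm (edge_measure E) \<phi>)\<^sup>2 \<le> dist_edge z E * (L2_norm (edge_measure E) \<phi>)\<^sup>2"
    by (intro mult_right_mono dist_edge_ge[OF E]) auto
  also have "\<dots> \<le> (\<Sum>E\<in>edges P. dist_edge z E * (L2_norm (edge_measure E) \<phi>)\<^sup>2)"
    using dist_edge_ge r_pos by (intro member_le_sum[OF E] mult_nonneg_nonneg finite_edges[OF P]) force+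
  also have "\<dots> = (LINT x|?M. 2 * ?F x + grad ?F x \<bullet> (x - z))"
    using star_formula[OF z F] by (simp add: sq)
  also have "\<dots> \<le> (LINT x|?M. 3 * (norm (\<phi> x))\<^sup>2 + h\<^sup>2 * (norm (grad \<phi> x))\<^sup>2)"
  proof (rule integral_mono)
    show "integrable ?M (\<lambda>x. 2 * ?F x + grad ?F x \<bullet> (x - z))"
      by (intro L2_integrable[OF L2_continuous[OF _ G_bounded G_sets] G_finite] continuous_intros smooth_continuous[OF \<phi>] smooth_continuous_grad[OF F])
    show "integrable ?M (\<lambda>x. 3 * (norm (\<phi> x))\<^sup>2 + h\<^sup>2 * (norm (grad \<phi> x))\<^sup>2)"
      using L2D(2)[OF pL(1)] L2D(2)[OF pL(2)] by simp
    fix x assume "x \<in> space ?M"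
    then have x: "norm (x - z) \<le> h" using G_diam[OF _ z_in] by (simp add: space_restrict_space)
    have "grad ?F x \<bullet> (x - z) = 2 * (\<phi> x * (grad \<phi> x \<bullet> (x - z)))"
      by (simp only: grad_mult[OF \<phi> \<phi>] inner_add_left inner_scaleR_left)
    also have "\<dots> \<le> 2 * (\<bar>\<phi> x\<bar> * (norm (grad \<phi> x) * h))"
    proof -
      have "\<phi> x * (grad \<phi> x \<bullet> (x - z)) \<le> \<bar>\<phi> x\<bar> * \<bar>grad \<phi> x \<bullet> (x - z)\<bar>" by (metis abs_ge_self abs_mult)
      also have "\<dots> \<le> \<bar>\<phi> x\<bar> * (norm (grad \<phi> x) * h)"
        by (intro mult_left_mono order_trans[OF Cauchy_Schwarz_ineq2] x) auto
      finally show ?thesis by simp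
    qed
    also have "\<dots> \<le> \<bar>\<phi> x\<bar>\<^sup>2 + (norm (grad \<phi> x) * h)\<^sup>2"
      using sum_squares_bound[of "\<bar>\<phi> x\<bar>" "norm (grad \<phi> x) * h"] by simp
    finally show "2 * ?F x + grad ?F x \<bullet> (x - z) \<le> 3 * (norm (\<phi> x))\<^sup>2 + h\<^sup>2 * (norm (grad \<phi> x))\<^sup>2"
      by (simp add: power_mult_distrib power2_eq_square mult_ac)
  qed
  also have "\<dots> = 3 * (L2_norm ?M \<phi>)\<^sup>2 + h\<^sup>2 * (L2_norm ?M (grad \<phi>))\<^sup>2"
    using L2D(2)[OF pL(1)] L2D(2)[OF pL(2)] by (simp add: L2_norm_power2)
  finally show ?thesis using r_pos by (simp add: field_simps)
qed

end

section \<open>Traces\<close>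

lemma tendsto_0_dominated:
  fixes f g :: "nat \<Rightarrow> real"
  assumes "\<And>n. 0 \<le> f n" "\<And>n. f n \<le> g n" "g \<longlonglongrightarrow> 0"
  shows "f \<longlonglongrightarrow> 0"
  by (rule tendsto_sandwich[OF always_eventually always_eventually tendsto_const assms(3)]) (use assms in auto)

lemma L2_inner_tendsto:
  fixes f :: "nat \<Rightarrow> plane \<Rightarrow> 'a::euclidean_space"
  assumes f: "\<And>n. f n \<in> L2 M" and g: "g \<in> L2 M" and k: "k \<in> L2 M"
    and lim: "(\<lambda>n. L2_norm M (\<lambda>x. g x - f n x)) \<longlonglongrightarrow> 0"
  shows "(\<lambda>n. L2_inner M k (f n)) \<longlonglongrightarrow> L2_inner M k g"
proof (rule LIM_zero_cancel, rule tendsto_rabs_zero_cancel, rule tendsto_sandwich[OF _ _ tendsto_const])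
  show "\<forall>\<^sub>F n in sequentially. \<bar>L2_inner M k (f n) - L2_inner M k g\<bar> \<le> L2_norm M k * L2_norm M (\<lambda>x. g x - f n x)"
  proof (intro always_eventually allI)
    fix n
    have "\<bar>L2_inner M k (\<lambda>x. g x - f n x)\<bar> \<le> L2_norm M k * L2_norm M (\<lambda>x. g x - f n x)"
      by (rule L2_Cauchy_Schwarz[OF k L2_diff[OF g f]])
    then show "\<bar>L2_inner M k (f n) - L2_inner M k g\<bar> \<le> L2_norm M k * L2_norm M (\<lambda>x. g x - f n x)"
      by (simp add: L2_inner_diff_right[OF g f k] abs_minus_commute)
  qed
  show "(\<lambda>n. L2_norm M k * L2_norm M (\<lambda>x. g x - f n x)) \<longlonglongrightarrow> 0"
    using tendsto_mult_right_zero[OF lim] by simp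
qed simp

lemma L2_norm_tendsto:
  fixes f :: "nat \<Rightarrow> plane \<Rightarrow> 'a::euclidean_space"
  assumes f: "\<And>n. f n \<in> L2 M" and g: "g \<in> L2 M"
    and lim: "(\<lambda>n. L2_norm M (\<lambda>x. g x - f n x)) \<longlonglongrightarrow> 0"
  shows "(\<lambda>n. L2_norm M (f n)) \<longlonglongrightarrow> L2_norm M g"
proof (rule LIM_zero_cancel, rule tendsto_rabs_zero_cancel, rule tendsto_sandwich[OF _ _ tendsto_const lim])
  show "\<forall>\<^sub>F n in sequentially. \<bar>L2_norm M (f n) - L2_norm M g\<bar> \<le> L2_norm M (\<lambda>x. g x - f n x)"
  proof (intro always_eventually allI)
    fix n
    have "L2_norm M (\<lambda>x. f n x - 0) \<le> L2_norm M (\<lambda>x. f n x - g x) + L2_norm M (\<lambda>x. g x - 0)"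
      "L2_norm M (\<lambda>x. g x - 0) \<le> L2_norm M (\<lambda>x. g x - f n x) + L2_norm M (\<lambda>x. f n x - 0)"
      by (intro L2_norm_triangle3 f g L2_zero)+
    then show "\<bar>L2_norm M (f n) - L2_norm M g\<bar> \<le> L2_norm M (\<lambda>x. g x - f n x)"
      using L2_norm_minus_commute[of M g "f n"] by simp
  qed
qed simp

lemma L2_one_edge: "(\<lambda>x. c) \<in> L2 (edge_measure E)"
  by (rule L2_const[OF finite_edge_measure])

lemma H1_norm_zero:
  assumes "open G" "bounded G"
  shows "H1_norm G (\<lambda>x. 0) = 0"
proof -
  have Gl: "G \<in> sets lebesgue" using assms by simp
  have "L2_norm (lebesgue_on G) (wgrad G (\<lambda>x. 0)) = L2_norm (lebesgue_on G) (\<lambda>x. 0 :: plane)"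
    by (rule L2_norm_cong_AE[OF Gl]) (use H1_smooth(2)[OF assms smooth_const[of 0]] in simp)
  then show ?thesis by (simp add: H1_norm_def H1_seminorm_def)
qed

lemma H1_convergence:
  assumes G: "open G" "bounded G" and v: "v \<in> H1 G" and \<phi>: "\<And>n. smooth (\<phi> n)"
    and lim: "(\<lambda>n. H1_norm G (\<lambda>x. v x - \<phi> n x)) \<longlonglongrightarrow> 0"
  shows "(\<lambda>n. L2_norm (lebesgue_on G) (\<lambda>x. v x - \<phi> n x)) \<longlonglongrightarrow> 0"
    and "(\<lambda>n. L2_norm (lebesgue_on G) (\<lambda>x. wgrad G v x - grad (\<phi> n) x)) \<longlonglongrightarrow> 0"
proof -
  have Gl: "G \<in> sets lebesgue" using G by simp
  show "(\<lambda>n. L2_norm (lebesgue_on G) (\<lambda>x. v x - \<phi> n x)) \<longlonglongrightarrow> 0"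
    by (rule tendsto_sandwich[OF _ _ tendsto_const lim]) (auto intro!: always_eventually L2_le_H1_norm)
  have "L2_norm (lebesgue_on G) (\<lambda>x. wgrad G v x - grad (\<phi> n) x) = H1_seminorm G (\<lambda>x. v x - \<phi> n x)" for n
    unfolding H1_seminorm_def
    by (rule L2_norm_cong_AE[OF Gl]) (use H1_diff(2)[OF G v H1_smooth(1)[OF G \<phi>[of n]]] H1_smooth(2)[OF G \<phi>[of n]] in eventually_elim, simp)
  then show "(\<lambda>n. L2_norm (lebesgue_on G) (\<lambda>x. wgrad G v x - grad (\<phi> n) x)) \<longlonglongrightarrow> 0"
    by (intro tendsto_sandwich[OF _ _ tendsto_const lim]) (auto intro!: always_eventually H1_seminorm_le_norm)
qed

context star_polygon
begin

lemmas GG = G_open G_bounded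

lemma smooth_L2_edge:
  assumes "smooth \<phi>" "E \<in> edges P" shows "\<phi> \<in> L2 (edge_measure E)"
  by (metis L2_edge_continuous edge_endsE[OF P assms(2)] smooth_continuous[OF assms(1)])

lemma smooth_seminorm: "smooth \<phi> \<Longrightarrow> H1_seminorm G \<phi> = L2_norm (lebesgue_on G) (grad \<phi>)"
  unfolding H1_seminorm_def by (rule L2_norm_cong_AE[OF G_sets H1_smooth(2)[OF GG]])

text \<open>A qualitative constant, not scaled with the size of the polygon. It serves existence,
  uniqueness and convergence of traces; the quantitative bound is
  \<open>trace_inequality\<close>.\<close>

definition "trace_const = sqrt ((3 + h\<^sup>2) / r)"

lemma trace_const_nonneg: "0 \<le> trace_const"
  using r_pos by (simp add: trace_const_def)

lemma trace_bound_smooth: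
  assumes \<phi>: "smooth \<phi>" and E: "E \<in> edges P"
  shows "L2_norm (edge_measure E) \<phi> \<le> trace_const * H1_norm G \<phi>"
proof (rule power2_le_imp_le)
  let ?a = "(L2_norm (lebesgue_on G) \<phi>)\<^sup>2" and ?b = "(H1_seminorm G \<phi>)\<^sup>2"
  have "(L2_norm (edge_measure E) \<phi>)\<^sup>2 \<le> (3 * ?a + h\<^sup>2 * ?b) / r"
    using trace_inequality_smooth[OF \<phi> E] by (simp add: smooth_seminorm[OF \<phi>])
  also have "\<dots> \<le> ((3 + h\<^sup>2) * ?a + (3 + h\<^sup>2) * ?b) / r"
    using r_pos by (intro divide_right_mono add_mono mult_right_mono) auto
  also have "\<dots> = (trace_const * H1_norm G \<phi>)\<^sup>2"
    using r_pos by (simp add: power_mult_distrib trace_const_def H1_norm_power2 add_divide_distrib distrib_left distrib_right)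
  finally show "(L2_norm (edge_measure E) \<phi>)\<^sup>2 \<le> (trace_const * H1_norm G \<phi>)\<^sup>2" .
qed (use trace_const_nonneg in simp)

lemma smooth_H1: "smooth \<phi> \<Longrightarrow> \<phi> \<in> H1 G"
  by (rule H1_smooth(1)[OF GG])

lemma H1_norm_between:
  assumes v: "v \<in> H1 G" and \<phi>: "smooth \<phi>" and \<psi>: "smooth \<psi>"
  shows "H1_norm G (\<lambda>x. \<phi> x - \<psi> x) \<le> 2 * H1_norm G (\<lambda>x. v x - \<phi> x) + 2 * H1_norm G (\<lambda>x. v x - \<psi> x)"
  using H1_norm_triangle_diff[OF GG H1_diff(1)[OF GG v smooth_H1[OF \<psi>]] H1_diff(1)[OF GG v smooth_H1[OF \<phi>]]] by simp

text \<open>Smooth approximants form a Cauchy sequence in H^1, hence on the edge by the bound for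
  smooth functions, and L2 of the edge is complete.\<close>

lemma is_trace_exists:
  assumes v: "v \<in> H1 G" and E: "E \<in> edges P"
  shows "\<exists>\<tau>. is_trace P E v \<tau>"
proof -
  obtain \<phi> where sm: "\<And>n. smooth (\<phi> n)" and lim: "(\<lambda>n. H1_norm G (\<lambda>x. v x - \<phi> n x)) \<longlonglongrightarrow> 0"
    using smooth_dense[OF v] by blast
  have "\<exists>g. g \<in> L2 (edge_measure E) \<and> (\<lambda>n. L2_norm (edge_measure E) (\<lambda>x. g x - \<phi> n x)) \<longlonglongrightarrow> 0"
  proof (rule L2_complete[OF finite_edge_measure smooth_L2_edge[OF sm E]])
    fix e :: real assume e: "e > 0"
    define \<delta> where "\<delta> = e / (4 * (trace_const + 1))"
    have c: "trace_const + 1 > 0" using trace_const_nonneg by simp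
    have \<delta>: "\<delta> > 0" using e c by (simp add: \<delta>_def)
    obtain N where N: "\<And>n. n \<ge> N \<Longrightarrow> H1_norm G (\<lambda>x. v x - \<phi> n x) < \<delta>"
      using LIMSEQ_D[OF lim \<delta>] by auto
    have "L2_norm (edge_measure E) (\<lambda>x. \<phi> m x - \<phi> n x) < e" if "m \<ge> N" "n \<ge> N" for m n
    proof -
      have "L2_norm (edge_measure E) (\<lambda>x. \<phi> m x - \<phi> n x) \<le> trace_const * H1_norm G (\<lambda>x. \<phi> m x - \<phi> n x)"
        by (rule trace_bound_smooth[OF smooth_diff[OF sm sm] E])
      also have "\<dots> \<le> (trace_const + 1) * H1_norm G (\<lambda>x. \<phi> m x - \<phi> n x)" by (intro mult_right_mono) auto
      also have "\<dots> < (trace_const + 1) * (4 * \<delta>)"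
        using H1_norm_between[OF v sm[of m] sm[of n]] N[OF that(1)] N[OF that(2)]
        by (intro mult_strict_left_mono c) linarith
      also have "\<dots> = e" using c by (simp add: \<delta>_def field_simps)
      finally show ?thesis .
    qed
    then show "\<exists>N. \<forall>m\<ge>N. \<forall>n\<ge>N. L2_norm (edge_measure E) (\<lambda>x. \<phi> m x - \<phi> n x) < e" by blast
  qed
  then show ?thesis unfolding is_trace_def using sm lim by blast
qed

lemma trace_is_trace: "v \<in> H1 G \<Longrightarrow> E \<in> edges P \<Longrightarrow> is_trace P E v (trace P E v)"
  unfolding trace_def by (rule someI_ex[OF is_trace_exists])

text \<open>Two approximating sequences of the same function approach each other in H^1, hence on
  the edge.\<close>

lemma is_trace_unique:
  assumes v: "v \<in> H1 G" and E: "E \<in> edges P" and t: "is_trace P E v \<tau>" "is_trace P E v \<tau>'"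
  shows "AE x in edge_measure E. \<tau> x = \<tau>' x"
proof -
  let ?N = "edge_measure E"
  obtain \<phi> where \<phi>: "\<And>n. smooth (\<phi> n)" "(\<lambda>n. H1_norm G (\<lambda>x. v x - \<phi> n x)) \<longlonglongrightarrow> 0"
    "(\<lambda>n. L2_norm ?N (\<lambda>x. \<tau> x - \<phi> n x)) \<longlonglongrightarrow> 0" and tL: "\<tau> \<in> L2 ?N"
    using t(1) unfolding is_trace_def by blast
  obtain \<psi> where \<psi>: "\<And>n. smooth (\<psi> n)" "(\<lambda>n. H1_norm G (\<lambda>x. v x - \<psi> n x)) \<longlonglongrightarrow> 0"
    "(\<lambda>n. L2_norm ?N (\<lambda>x. \<tau>' x - \<psi> n x)) \<longlonglongrightarrow> 0" and tL': "\<tau>' \<in> L2 ?N"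
    using t(2) unfolding is_trace_def by blast
  have le: "L2_norm ?N (\<lambda>x. \<tau> x - \<tau>' x) \<le> L2_norm ?N (\<lambda>x. \<tau> x - \<phi> n x)
      + (trace_const * (2 * H1_norm G (\<lambda>x. v x - \<phi> n x) + 2 * H1_norm G (\<lambda>x. v x - \<psi> n x)) + L2_norm ?N (\<lambda>x. \<tau>' x - \<psi> n x))" for n
  proof -
    note L = tL smooth_L2_edge[OF \<phi>(1) E, of n] smooth_L2_edge[OF \<psi>(1) E, of n] tL'
    have "L2_norm ?N (\<lambda>x. \<tau> x - \<tau>' x) \<le> L2_norm ?N (\<lambda>x. \<tau> x - \<phi> n x) + L2_norm ?N (\<lambda>x. \<phi> n x - \<tau>' x)"
      by (rule L2_norm_triangle3[OF L(1,2,4)])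
    moreover have "L2_norm ?N (\<lambda>x. \<phi> n x - \<tau>' x) \<le> L2_norm ?N (\<lambda>x. \<phi> n x - \<psi> n x) + L2_norm ?N (\<lambda>x. \<psi> n x - \<tau>' x)"
      by (rule L2_norm_triangle3[OF L(2,3,4)])
    moreover have "L2_norm ?N (\<lambda>x. \<phi> n x - \<psi> n x) \<le> trace_const * H1_norm G (\<lambda>x. \<phi> n x - \<psi> n x)"
      by (rule trace_bound_smooth[OF smooth_diff[OF \<phi>(1) \<psi>(1)] E])
    moreover have "\<dots> \<le> trace_const * (2 * H1_norm G (\<lambda>x. v x - \<phi> n x) + 2 * H1_norm G (\<lambda>x. v x - \<psi> n x))"
      by (intro mult_left_mono H1_norm_between v \<phi> \<psi> trace_const_nonneg)
    ultimately show ?thesis using L2_norm_minus_commute[of ?N "\<psi> n" \<tau>'] by linarith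
  qed
  have "(\<lambda>n. L2_norm ?N (\<lambda>x. \<tau> x - \<phi> n x)
      + (trace_const * (2 * H1_norm G (\<lambda>x. v x - \<phi> n x) + 2 * H1_norm G (\<lambda>x. v x - \<psi> n x)) + L2_norm ?N (\<lambda>x. \<tau>' x - \<psi> n x)))
      \<longlonglongrightarrow> 0 + (trace_const * (2 * 0 + 2 * 0) + 0)"
    by (intro tendsto_intros \<phi> \<psi>)
  then have "L2_norm ?N (\<lambda>x. \<tau> x - \<tau>' x) \<le> 0 + (trace_const * (2 * 0 + 2 * 0) + 0)"
    using le by (intro LIMSEQ_le_const) auto
  then have "L2_norm ?N (\<lambda>x. \<tau> x - \<tau>' x) = 0" using L2_norm_nonneg[of ?N "\<lambda>x. \<tau> x - \<tau>' x"] by simp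
  then show ?thesis using L2_norm_eq_0_iff[OF L2_diff[OF tL tL']] by simp
qed

lemma trace_L2: "v \<in> H1 G \<Longrightarrow> E \<in> edges P \<Longrightarrow> trace P E v \<in> L2 (edge_measure E)"
  using trace_is_trace by (auto simp: is_trace_def)

lemma trace_AE: "v \<in> H1 G \<Longrightarrow> E \<in> edges P \<Longrightarrow> is_trace P E v \<tau> \<Longrightarrow> AE x in edge_measure E. trace P E v x = \<tau> x"
  by (rule is_trace_unique[OF _ _ trace_is_trace])

lemma is_trace_lincomb:
  assumes v: "v \<in> H1 G" "is_trace P E v \<tau>" and w: "w \<in> H1 G" "is_trace P E w \<tau>'" and E: "E \<in> edges P"
  shows "is_trace P E (\<lambda>x. a * v x + b * w x) (\<lambda>x. a * \<tau> x + b * \<tau>' x)"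
proof -
  let ?N = "edge_measure E"
  obtain \<phi> where \<phi>: "\<And>n. smooth (\<phi> n)" "(\<lambda>n. H1_norm G (\<lambda>x. v x - \<phi> n x)) \<longlonglongrightarrow> 0"
    "(\<lambda>n. L2_norm ?N (\<lambda>x. \<tau> x - \<phi> n x)) \<longlonglongrightarrow> 0" and tL: "\<tau> \<in> L2 ?N"
    using v(2) unfolding is_trace_def by blast
  obtain \<psi> where \<psi>: "\<And>n. smooth (\<psi> n)" "(\<lambda>n. H1_norm G (\<lambda>x. w x - \<psi> n x)) \<longlonglongrightarrow> 0"
    "(\<lambda>n. L2_norm ?N (\<lambda>x. \<tau>' x - \<psi> n x)) \<longlonglongrightarrow> 0" and tL': "\<tau>' \<in> L2 ?N"
    using w(2) unfolding is_trace_def by blast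
  let ?\<chi> = "\<lambda>n x. a * \<phi> n x + b * \<psi> n x"
  have sm: "smooth (?\<chi> n)" for n by (intro smooth_add smooth_mult smooth_const \<phi> \<psi>)
  have H: "H1_norm G (\<lambda>x. (a * v x + b * w x) - ?\<chi> n x)
    \<le> (\<bar>a\<bar> * H1_norm G (\<lambda>x. v x - \<phi> n x) + \<bar>b\<bar> * H1_norm G (\<lambda>x. w x - \<psi> n x)) * 2" for n
  proof -
    have v': "(\<lambda>x. v x - \<phi> n x) \<in> H1 G" and w': "(\<lambda>x. w x - \<psi> n x) \<in> H1 G"
      using H1_diff(1)[OF GG] v(1) w(1) smooth_H1 \<phi>(1) \<psi>(1) by blast+
    have e: "(\<lambda>x. (a * v x + b * w x) - ?\<chi> n x) = (\<lambda>x. a * (v x - \<phi> n x) + b * (w x - \<psi> n x))"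
      by (simp add: algebra_simps)
    have "L2_norm (lebesgue_on G) (\<lambda>x. a * (v x - \<phi> n x) + b * (w x - \<psi> n x))
      \<le> \<bar>a\<bar> * L2_norm (lebesgue_on G) (\<lambda>x. v x - \<phi> n x) + \<bar>b\<bar> * L2_norm (lebesgue_on G) (\<lambda>x. w x - \<psi> n x)"
      using L2_norm_triangle[OF L2_mult[OF H1D(1)[OF v'], of a] L2_mult[OF H1D(1)[OF w'], of b]] by (simp add: L2_norm_mult)
    moreover have "H1_seminorm G (\<lambda>x. a * (v x - \<phi> n x) + b * (w x - \<psi> n x))
      \<le> \<bar>a\<bar> * H1_seminorm G (\<lambda>x. v x - \<phi> n x) + \<bar>b\<bar> * H1_seminorm G (\<lambda>x. w x - \<psi> n x)"
      unfolding H1_seminorm_def L2_norm_cong_AE[OF G_sets H1_lincomb(2)[OF GG v' w', of a b]]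
      using L2_norm_triangle[OF L2_scaleR[OF H1D(2)[OF v'], of a] L2_scaleR[OF H1D(2)[OF w'], of b]] by (simp add: L2_norm_scaleR)
    moreover have "\<bar>a\<bar> * L2_norm (lebesgue_on G) (\<lambda>x. v x - \<phi> n x) \<le> \<bar>a\<bar> * H1_norm G (\<lambda>x. v x - \<phi> n x)"
      "\<bar>b\<bar> * L2_norm (lebesgue_on G) (\<lambda>x. w x - \<psi> n x) \<le> \<bar>b\<bar> * H1_norm G (\<lambda>x. w x - \<psi> n x)"
      "\<bar>a\<bar> * H1_seminorm G (\<lambda>x. v x - \<phi> n x) \<le> \<bar>a\<bar> * H1_norm G (\<lambda>x. v x - \<phi> n x)"
      "\<bar>b\<bar> * H1_seminorm G (\<lambda>x. w x - \<psi> n x) \<le> \<bar>b\<bar> * H1_norm G (\<lambda>x. w x - \<psi> n x)"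
      by (simp_all add: mult_left_mono L2_le_H1_norm H1_seminorm_le_norm)
    ultimately show ?thesis
      unfolding e using H1_norm_le[of G "\<lambda>x. a * (v x - \<phi> n x) + b * (w x - \<psi> n x)"] by argo
  qed
  have T: "L2_norm ?N (\<lambda>x. (a * \<tau> x + b * \<tau>' x) - ?\<chi> n x)
    \<le> \<bar>a\<bar> * L2_norm ?N (\<lambda>x. \<tau> x - \<phi> n x) + \<bar>b\<bar> * L2_norm ?N (\<lambda>x. \<tau>' x - \<psi> n x)" for n
  proof -
    have e: "(\<lambda>x. (a * \<tau> x + b * \<tau>' x) - ?\<chi> n x) = (\<lambda>x. a * (\<tau> x - \<phi> n x) + b * (\<tau>' x - \<psi> n x))"
      by (simp add: algebra_simps)
    show ?thesis unfolding e
      using L2_norm_triangle[OF L2_mult[OF L2_diff[OF tL smooth_L2_edge[OF \<phi>(1) E]], of a] L2_mult[OF L2_diff[OF tL' smooth_L2_edge[OF \<psi>(1) E]], of b]]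
      by (simp add: L2_norm_mult)
  qed
  have "(\<lambda>n. (\<bar>a\<bar> * H1_norm G (\<lambda>x. v x - \<phi> n x) + \<bar>b\<bar> * H1_norm G (\<lambda>x. w x - \<psi> n x)) * 2) \<longlonglongrightarrow> (\<bar>a\<bar> * 0 + \<bar>b\<bar> * 0) * 2"
    by (intro tendsto_intros \<phi> \<psi>)
  then have H0: "(\<lambda>n. H1_norm G (\<lambda>x. (a * v x + b * w x) - ?\<chi> n x)) \<longlonglongrightarrow> 0"
    by (intro tendsto_0_dominated[OF _ H]) auto
  have "(\<lambda>n. \<bar>a\<bar> * L2_norm ?N (\<lambda>x. \<tau> x - \<phi> n x) + \<bar>b\<bar> * L2_norm ?N (\<lambda>x. \<tau>' x - \<psi> n x)) \<longlonglongrightarrow> \<bar>a\<bar> * 0 + \<bar>b\<bar> * 0"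
    by (intro tendsto_intros \<phi> \<psi>)
  then have T0: "(\<lambda>n. L2_norm ?N (\<lambda>x. (a * \<tau> x + b * \<tau>' x) - ?\<chi> n x)) \<longlonglongrightarrow> 0"
    by (intro tendsto_0_dominated[OF _ T]) auto
  show ?thesis unfolding is_trace_def
    by (intro conjI exI[of _ ?\<chi>] allI L2_add L2_mult tL tL' sm H0 T0)
qed

lemma trace_lincomb:
  assumes v: "v \<in> H1 G" and w: "w \<in> H1 G" and E: "E \<in> edges P"
  shows "AE x in edge_measure E. trace P E (\<lambda>x. a * v x + b * w x) x = a * trace P E v x + b * trace P E w x"
  by (rule trace_AE[OF H1_lincomb(1)[OF GG v w] E is_trace_lincomb[OF v trace_is_trace[OF v E] w trace_is_trace[OF w E] E]])

lemma trace_diff: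
  assumes v: "v \<in> H1 G" and w: "w \<in> H1 G" and E: "E \<in> edges P"
  shows "AE x in edge_measure E. trace P E (\<lambda>x. v x - w x) x = trace P E v x - trace P E w x"
  using trace_lincomb[OF assms, of 1 "-1"] by simp

lemma trace_smooth:
  assumes \<phi>: "smooth \<phi>" and E: "E \<in> edges P"
  shows "AE x in edge_measure E. trace P E \<phi> x = \<phi> x"
proof (rule trace_AE[OF smooth_H1[OF \<phi>] E])
  show "is_trace P E \<phi> \<phi>"
    unfolding is_trace_def using \<phi> smooth_L2_edge[OF \<phi> E] H1_norm_zero[OF GG]
    by (intro conjI exI[of _ "\<lambda>_. \<phi>"]) auto
qed

lemma trace_inequality:
  assumes v: "v \<in> H1 G" and E: "E \<in> edges P"
  shows "(L2_norm (edge_measure E) (trace P E v))\<^sup>2 \<le> (3 * (L2_norm (lebesgue_on G) v)\<^sup>2 + h\<^sup>2 * (H1_seminorm G v)\<^sup>2) / r"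
proof -
  let ?N = "edge_measure E"
  obtain \<phi> where \<phi>: "\<And>n. smooth (\<phi> n)" "(\<lambda>n. H1_norm G (\<lambda>x. v x - \<phi> n x)) \<longlonglongrightarrow> 0"
    "(\<lambda>n. L2_norm ?N (\<lambda>x. trace P E v x - \<phi> n x)) \<longlonglongrightarrow> 0"
    using trace_is_trace[OF v E] unfolding is_trace_def by blast
  note c = H1_convergence[OF GG v \<phi>(1,2)]
  have "\<phi> n \<in> L2 (lebesgue_on G)" "grad (\<phi> n) \<in> L2 (lebesgue_on G)" for n
    by (intro L2_continuous smooth_continuous smooth_continuous_grad \<phi> G_bounded G_sets)+
  then have 1: "(\<lambda>n. L2_norm (lebesgue_on G) (\<phi> n)) \<longlonglongrightarrow> L2_norm (lebesgue_on G) v"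
    "(\<lambda>n. L2_norm (lebesgue_on G) (grad (\<phi> n))) \<longlonglongrightarrow> H1_seminorm G v"
    unfolding H1_seminorm_def using L2_norm_tendsto[OF _ H1D(1)[OF v] c(1)] L2_norm_tendsto[OF _ H1D(2)[OF v] c(2)] by blast+
  have 2: "(\<lambda>n. L2_norm ?N (\<phi> n)) \<longlonglongrightarrow> L2_norm ?N (trace P E v)"
    by (rule L2_norm_tendsto[OF smooth_L2_edge[OF \<phi>(1) E] trace_L2[OF v E] \<phi>(3)])
  have r0: "r \<noteq> 0" using r_pos by simp
  show ?thesis
  proof (rule LIMSEQ_le)
    show "(\<lambda>n. (L2_norm ?N (\<phi> n))\<^sup>2) \<longlonglongrightarrow> (L2_norm ?N (trace P E v))\<^sup>2"
      by (intro tendsto_intros 2)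
    show "(\<lambda>n. (3 * (L2_norm (lebesgue_on G) (\<phi> n))\<^sup>2 + h\<^sup>2 * (L2_norm (lebesgue_on G) (grad (\<phi> n)))\<^sup>2) / r)
      \<longlonglongrightarrow> (3 * (L2_norm (lebesgue_on G) v)\<^sup>2 + h\<^sup>2 * (H1_seminorm G v)\<^sup>2) / r"
      by (intro tendsto_intros 1 r0)
    show "\<exists>N. \<forall>n\<ge>N. (L2_norm ?N (\<phi> n))\<^sup>2 \<le> (3 * (L2_norm (lebesgue_on G) (\<phi> n))\<^sup>2 + h\<^sup>2 * (L2_norm (lebesgue_on G) (grad (\<phi> n)))\<^sup>2) / r"
      using trace_inequality_smooth[OF \<phi>(1) E] by blast
  qed
qed

text \<open>The definition supplies one approximating sequence with convergent traces; here every
  smooth sequence converging in H^1 is seen to do. This is what permits test functions on \<Omega>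
  as approximants of \<open>u\<close>.\<close>

lemma trace_tendsto:
  assumes v: "v \<in> H1 G" and E: "E \<in> edges P" and \<phi>: "\<And>n. smooth (\<phi> n)"
    and lim: "(\<lambda>n. H1_norm G (\<lambda>x. v x - \<phi> n x)) \<longlonglongrightarrow> 0"
  shows "(\<lambda>n. L2_norm (edge_measure E) (\<lambda>x. trace P E v x - \<phi> n x)) \<longlonglongrightarrow> 0"
proof -
  let ?N = "edge_measure E"
  obtain \<psi> where \<psi>: "\<And>n. smooth (\<psi> n)" "(\<lambda>n. H1_norm G (\<lambda>x. v x - \<psi> n x)) \<longlonglongrightarrow> 0"
    "(\<lambda>n. L2_norm ?N (\<lambda>x. trace P E v x - \<psi> n x)) \<longlonglongrightarrow> 0"
    using trace_is_trace[OF v E] unfolding is_trace_def by blast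
  let ?b = "\<lambda>n. L2_norm ?N (\<lambda>x. trace P E v x - \<psi> n x) + trace_const * (2 * H1_norm G (\<lambda>x. v x - \<psi> n x) + 2 * H1_norm G (\<lambda>x. v x - \<phi> n x))"
  have le: "L2_norm ?N (\<lambda>x. trace P E v x - \<phi> n x) \<le> ?b n" for n
  proof -
    have "L2_norm ?N (\<lambda>x. trace P E v x - \<phi> n x) \<le> L2_norm ?N (\<lambda>x. trace P E v x - \<psi> n x) + L2_norm ?N (\<lambda>x. \<psi> n x - \<phi> n x)"
      by (rule L2_norm_triangle3[OF trace_L2[OF v E] smooth_L2_edge[OF \<psi>(1) E] smooth_L2_edge[OF \<phi> E]])
    also have "L2_norm ?N (\<lambda>x. \<psi> n x - \<phi> n x) \<le> trace_const * H1_norm G (\<lambda>x. \<psi> n x - \<phi> n x)"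
      by (rule trace_bound_smooth[OF smooth_diff[OF \<psi>(1) \<phi>] E])
    also have "\<dots> \<le> trace_const * (2 * H1_norm G (\<lambda>x. v x - \<psi> n x) + 2 * H1_norm G (\<lambda>x. v x - \<phi> n x))"
      by (intro mult_left_mono H1_norm_between v \<phi> \<psi> trace_const_nonneg)
    finally show ?thesis by simp
  qed
  have "?b \<longlonglongrightarrow> 0 + trace_const * (2 * 0 + 2 * 0)" by (intro tendsto_intros \<psi> lim)
  then show ?thesis by (intro tendsto_0_dominated[OF _ le]) auto
qed

text \<open>Green's formula for an affine function with gradient \<open>c\<close>. That the \<nu> do
  not depend on \<open>w\<close> says that its normal derivative is constant on each edge.\<close>

lemma green_affine:
  "\<exists>\<nu>. \<forall>w\<in>H1 G. L2_inner (lebesgue_on G) (\<lambda>x. c) (wgrad G w) = (\<Sum>E\<in>edges P. \<nu> E * (LINT x|edge_measure E. trace P E w x))"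
proof -
  obtain \<nu> where \<nu>: "\<And>F. smooth F \<Longrightarrow> (LINT x|lebesgue_on G. c \<bullet> grad F x) = (\<Sum>E\<in>edges P. \<nu> E * (LINT x|edge_measure E. F x))"
    using divergence_theorem[of c] by blast
  have "L2_inner (lebesgue_on G) (\<lambda>x. c) (wgrad G w) = (\<Sum>E\<in>edges P. \<nu> E * (LINT x|edge_measure E. trace P E w x))" if w: "w \<in> H1 G" for w
  proof -
    obtain \<phi> where \<phi>: "\<And>n. smooth (\<phi> n)" "(\<lambda>n. H1_norm G (\<lambda>x. w x - \<phi> n x)) \<longlonglongrightarrow> 0"
      using smooth_dense[OF w] by blast
    have "(\<lambda>n. L2_inner (lebesgue_on G) (\<lambda>x. c) (grad (\<phi> n))) \<longlonglongrightarrow> L2_inner (lebesgue_on G) (\<lambda>x. c) (wgrad G w)"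
      by (rule L2_inner_tendsto[OF _ H1D(2)[OF w] L2_const[OF G_finite] H1_convergence(2)[OF GG w \<phi>]])
        (intro L2_continuous smooth_continuous_grad \<phi> G_bounded G_sets)
    moreover have "L2_inner (lebesgue_on G) (\<lambda>x. c) (grad (\<phi> n)) = (\<Sum>E\<in>edges P. \<nu> E * L2_inner (edge_measure E) (\<lambda>x. 1) (\<phi> n))" for n
      using \<nu>[OF \<phi>(1)] by (simp add: L2_inner_def)
    moreover have "(\<lambda>n. \<Sum>E\<in>edges P. \<nu> E * L2_inner (edge_measure E) (\<lambda>x. 1) (\<phi> n))
      \<longlonglongrightarrow> (\<Sum>E\<in>edges P. \<nu> E * L2_inner (edge_measure E) (\<lambda>x. 1) (trace P E w))"
    proof (intro tendsto_sum tendsto_mult tendsto_const)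
      fix E assume E: "E \<in> edges P"
      show "(\<lambda>n. L2_inner (edge_measure E) (\<lambda>x. 1) (\<phi> n)) \<longlonglongrightarrow> L2_inner (edge_measure E) (\<lambda>x. 1) (trace P E w)"
        by (rule L2_inner_tendsto[OF smooth_L2_edge[OF \<phi>(1) E] trace_L2[OF w E] L2_one_edge trace_tendsto[OF w E \<phi>]])
    qed
    ultimately have "L2_inner (lebesgue_on G) (\<lambda>x. c) (wgrad G w) = (\<Sum>E\<in>edges P. \<nu> E * L2_inner (edge_measure E) (\<lambda>x. 1) (trace P E w))"
      using LIMSEQ_unique by simp
    then show ?thesis by (simp add: L2_inner_def)
  qed
  then show ?thesis by blast
qed

end

section \<open>Projections and the virtual element space\<close>

declare One_nat_def [simp del]

lemma polys_1: "polys 1 = {p. \<exists>\<alpha> \<beta>. p = (\<lambda>x. \<alpha> + \<beta> \<bullet> x)}"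
proof -
  have e: "(\<Sum>i\<le>1. \<Sum>j\<le>1 - i. c i j * x $ 1 ^ i * x $ 2 ^ j) = c 0 0 + vec2 (c 1 0, c 0 1) \<bullet> x" for c :: "nat \<Rightarrow> nat \<Rightarrow> real" and x :: plane
    by (simp add: inner_vec2 One_nat_def)
  show ?thesis
  proof (intro set_eqI iffI)
    fix p assume "p \<in> polys 1"
    then show "p \<in> {p. \<exists>\<alpha> \<beta>. p = (\<lambda>x. \<alpha> + \<beta> \<bullet> x)}" unfolding polys_def e by blast
  next
    fix p :: "plane \<Rightarrow> real" assume "p \<in> {p. \<exists>\<alpha> \<beta>. p = (\<lambda>x. \<alpha> + \<beta> \<bullet> x)}"
    then obtain \<alpha> \<beta> where p: "p = (\<lambda>x. \<alpha> + \<beta> \<bullet> x)" by blast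
    show "p \<in> polys 1" unfolding polys_def e
      by (rule CollectI, rule exI[of _ "\<lambda>i j. if i = 0 \<and> j = 0 then \<alpha> else if i = 0 then \<beta> $ 2 else \<beta> $ 1"])
        (simp add: p inner_vec2)
  qed
qed

lemma polys_0: "polys 0 = {p. \<exists>c. p = (\<lambda>x. c)}"
proof -
  have e: "(\<Sum>i\<le>0. \<Sum>j\<le>0 - i. c i j * x $ 1 ^ i * x $ 2 ^ j) = c 0 0" for c :: "nat \<Rightarrow> nat \<Rightarrow> real" and x :: plane
    by simp
  show ?thesis unfolding polys_def e by (auto intro: exI[of _ "\<lambda>_ _. _"])
qed

lemma polys_1I: "(\<lambda>x. \<alpha> + \<beta> \<bullet> x) \<in> polys 1"
  by (auto simp: polys_1)

lemma polys_1E: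
  assumes "p \<in> polys 1" obtains \<alpha> \<beta> where "p = (\<lambda>x. \<alpha> + \<beta> \<bullet> x)"
  using assms by (auto simp: polys_1)

lemma polys_1_smooth: "p \<in> polys 1 \<Longrightarrow> smooth p"
  by (auto elim!: polys_1E intro!: smooth_add smooth_const smooth_linear)

lemma polys_1_diff:
  assumes "p \<in> polys 1" "q \<in> polys 1" shows "(\<lambda>x. p x - q x) \<in> polys 1"
proof -
  obtain \<alpha> \<beta> \<alpha>' \<beta>' where "p = (\<lambda>x. \<alpha> + \<beta> \<bullet> x)" "q = (\<lambda>x. \<alpha>' + \<beta>' \<bullet> x)"
    using assms by (auto elim!: polys_1E)
  then have "(\<lambda>x. p x - q x) = (\<lambda>x. (\<alpha> - \<alpha>') + (\<beta> - \<beta>') \<bullet> x)" by (simp add: inner_diff_left fun_eq_iff)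
  then show ?thesis by (simp add: polys_1I)
qed

lemma continuous_AE_zero:
  fixes f :: "plane \<Rightarrow> real"
  assumes G: "open G" and f: "continuous_on UNIV f" and ae: "AE x in lebesgue_on G. f x = 0" and x: "x \<in> G"
  shows "f x = 0"
proof (rule ccontr)
  assume "f x \<noteq> 0"
  let ?U = "{x \<in> G. f x \<noteq> 0}"
  have "?U = G \<inter> f -` (- {0})" by auto
  then have "open ?U" using continuous_open_preimage[OF continuous_on_subset[OF f] G, of "- {0}"] by auto
  moreover have "negligible ?U"
  proof -
    have "AE x in lebesgue. x \<in> G \<longrightarrow> f x = 0" using ae G by (simp add: AE_restrict_space_iff)
    then obtain N where N: "N \<in> null_sets lebesgue" "{x. \<not> (x \<in> G \<longrightarrow> f x = 0)} \<subseteq> N"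
      by (auto simp: eventually_ae_filter)
    then have "negligible N" by (simp only: negligible_iff_null_sets)
    then show ?thesis by (rule negligible_subset) (use N(2) in blast)
  qed
  ultimately show False using open_not_negligible[of ?U] \<open>f x \<noteq> 0\<close> x by auto
qed

context star_polygon
begin

lemma continuous_L2: "continuous_on UNIV f \<Longrightarrow> f \<in> L2 (lebesgue_on G)" for f :: "plane \<Rightarrow> 'b::euclidean_space"
  by (rule L2_continuous[OF _ G_bounded G_sets])

lemma affine_L2: "(\<lambda>x. \<alpha> + \<beta> \<bullet> x) \<in> L2 (lebesgue_on G)"
  by (intro continuous_L2 continuous_intros)

lemma polys_1_L2: "p \<in> polys 1 \<Longrightarrow> p \<in> L2 (lebesgue_on G)"
  by (auto elim!: polys_1E simp: affine_L2)

lemma affine_zero: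
  assumes "L2_norm (lebesgue_on G) (\<lambda>x. \<alpha> + \<beta> \<bullet> x) = 0"
  shows "\<alpha> = 0 \<and> \<beta> = 0"
proof -
  have "AE x in lebesgue_on G. \<alpha> + \<beta> \<bullet> x = 0" using assms L2_norm_eq_0_iff[OF affine_L2] by blast
  then have 0: "\<alpha> + \<beta> \<bullet> x = 0" if "x \<in> G" for x
    by (rule continuous_AE_zero[OF G_open _ _ that, rotated]) (intro continuous_intros)
  have "\<beta> $ i = 0" for i
  proof -
    have "z + (r / 2) *\<^sub>R axis i 1 \<in> ball z r" using r_pos by (simp add: dist_norm norm_axis_1)
    then have "\<alpha> + \<beta> \<bullet> (z + (r / 2) *\<^sub>R axis i 1) = 0" using 0 ball_G by blast
    then have "\<alpha> + (\<beta> \<bullet> z + r / 2 * \<beta> $ i) = 0" by (simp add: inner_add_right inner_axis)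
    then have "r / 2 * \<beta> $ i = 0" using 0[OF z_in] by linarith
    then show ?thesis using r_pos by simp
  qed
  then have "\<beta> = 0" by (simp add: vec_eq_iff)
  with 0[OF z_in] show ?thesis by simp
qed

lemma polys_1_zero:
  assumes "p \<in> polys 1" "L2_norm (lebesgue_on G) p = 0" shows "p = (\<lambda>x. 0)"
proof -
  obtain \<alpha> \<beta> where p: "p = (\<lambda>x. \<alpha> + \<beta> \<bullet> x)" using assms(1) by (rule polys_1E)
  show ?thesis using affine_zero assms(2) unfolding p by fastforce
qed

section \<open>The L2 projections onto affine functions and constants\<close>

lemma proj1_eqI:
  assumes v: "v \<in> L2 (lebesgue_on G)" and p: "p \<in> polys 1"
    and orth: "\<And>q. q \<in> polys 1 \<Longrightarrow> L2_inner (lebesgue_on G) (\<lambda>x. v x - p x) q = 0"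
  shows "proj 1 P v = p"
  unfolding proj_def Leb_L2_inner
proof (rule the_equality)
  show "p \<in> polys 1 \<and> (\<forall>q\<in>polys 1. L2_inner (lebesgue_on G) (\<lambda>x. v x - p x) q = 0)" using p orth by blast
  fix p' assume p': "p' \<in> polys 1 \<and> (\<forall>q\<in>polys 1. L2_inner (lebesgue_on G) (\<lambda>x. v x - p' x) q = 0)"
  let ?q = "\<lambda>x. p' x - p x"
  have q: "?q \<in> polys 1" using p p' polys_1_diff by blast
  have L: "(\<lambda>x. v x - p x) \<in> L2 (lebesgue_on G)" "(\<lambda>x. v x - p' x) \<in> L2 (lebesgue_on G)"
    using L2_diff[OF v polys_1_L2] p p' by blast+
  have "L2_inner (lebesgue_on G) (\<lambda>x. (v x - p x) - (v x - p' x)) ?q = 0"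
    using L2_inner_diff_left[OF L polys_1_L2[OF q]] orth[OF q] p' q by simp
  then have "L2_norm (lebesgue_on G) ?q = 0" using L2_norm_eq_inner[of "lebesgue_on G" ?q] by simp
  from polys_1_zero[OF q this] show "p' = p" by (simp add: fun_eq_iff)
qed

text \<open>The functional that \<open>v\<close> induces on affine functions. The pair has the type
  of the coefficients of an affine function, so that testing becomes an inner product.\<close>

definition moments :: "(plane \<Rightarrow> real) \<Rightarrow> real \<times> plane" where
  "moments v = ((LINT x|lebesgue_on G. v x), (\<chi> i. LINT x|lebesgue_on G. v x * x $ i))"

lemma moment_integrable:
  assumes "v \<in> L2 (lebesgue_on G)"
  shows "integrable (lebesgue_on G) v" "integrable (lebesgue_on G) (\<lambda>x. v x * x $ i)"
  by (auto intro!: L2_integrable[OF assms G_finite] L2_mult_integrable[OF assms] continuous_L2 continuous_intros)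

lemma inner_moments:
  assumes v: "v \<in> L2 (lebesgue_on G)"
  shows "L2_inner (lebesgue_on G) v (\<lambda>x. \<alpha> + \<beta> \<bullet> x) = (\<alpha>, \<beta>) \<bullet> moments v"
proof -
  have "v x * (\<alpha> + \<beta> \<bullet> x) = \<alpha> * v x + (\<beta> $ 1 * (v x * x $ 1) + \<beta> $ 2 * (v x * x $ 2))" for x
    by (simp add: inner_vec2 algebra_simps)
  then show ?thesis using moment_integrable[OF v] by (simp add: L2_inner_def moments_def inner_vec2)
qed

lemma moments_add:
  assumes "v \<in> L2 (lebesgue_on G)" "w \<in> L2 (lebesgue_on G)"
  shows "moments (\<lambda>x. v x + w x) = moments v + moments w"
  using moment_integrable[OF assms(1)] moment_integrable[OF assms(2)]
  by (simp add: moments_def vec_eq_iff distrib_right)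

text \<open>\<Gamma> is the Gram map of \<open>1\<close>, \<open>x\<^sub>1\<close>,
  \<open>x\<^sub>2\<close>: its inner product with the coefficients is the squared L2 norm of the
  affine function. Hence it is injective and, by finite dimension, surjective.\<close>

lemma moments_surj:
  "\<exists>p\<in>polys 1. moments p = m"
proof -
  define \<Gamma> where "\<Gamma> w = moments (\<lambda>x. fst w + snd w \<bullet> x)" for w
  have lin: "linear \<Gamma>"
  proof (rule linearI)
    fix w w'
    have "fst (w + w') + snd (w + w') \<bullet> x = (fst w + snd w \<bullet> x) + (fst w' + snd w' \<bullet> x)" for x :: plane
      by (simp add: inner_add_left)
    then show "\<Gamma> (w + w') = \<Gamma> w + \<Gamma> w'"
      unfolding \<Gamma>_def using moments_add[OF affine_L2 affine_L2] by presburger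
  next
    fix c w
    have "fst (c *\<^sub>R w) + snd (c *\<^sub>R w) \<bullet> x = c * (fst w + snd w \<bullet> x)" for x :: plane
      by (simp add: distrib_left)
    then show "\<Gamma> (c *\<^sub>R w) = c *\<^sub>R \<Gamma> w"
      by (simp add: \<Gamma>_def moments_def vec_eq_iff mult.assoc)
  qed
  have "inj \<Gamma>"
    unfolding linear_injective_0[OF lin]
  proof (intro allI impI)
    fix w assume "\<Gamma> w = 0"
    then have "L2_inner (lebesgue_on G) (\<lambda>x. fst w + snd w \<bullet> x) (\<lambda>x. fst w + snd w \<bullet> x) = 0"
      using inner_moments[OF affine_L2, of "fst w" "snd w" "fst w" "snd w"] by (simp add: \<Gamma>_def)
    then have "L2_norm (lebesgue_on G) (\<lambda>x. fst w + snd w \<bullet> x) = 0"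
      using L2_norm_eq_inner[of "lebesgue_on G" "\<lambda>x. fst w + snd w \<bullet> x"] by simp
    from affine_zero[OF this] show "w = 0" by (simp add: prod_eq_iff)
  qed
  then have "surj \<Gamma>" using linear_injective_imp_surjective[OF lin] by simp
  then obtain w where "\<Gamma> w = m" by (metis surjD)
  then show ?thesis unfolding \<Gamma>_def using polys_1I by blast
qed

text \<open>The affine function with the same moments as \<open>v\<close> has the orthogonality
  property, and uniqueness makes the definite description refer to it.\<close>

lemma proj1:
  assumes v: "v \<in> L2 (lebesgue_on G)"
  shows "proj 1 P v \<in> polys 1"
    and "q \<in> polys 1 \<Longrightarrow> L2_inner (lebesgue_on G) (\<lambda>x. v x - proj 1 P v x) q = 0"
proof -
  obtain p where p: "p \<in> polys 1" "moments p = moments v" using moments_surj by blast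
  have orth: "L2_inner (lebesgue_on G) (\<lambda>x. v x - p x) q = 0" if q: "q \<in> polys 1" for q
  proof -
    obtain \<alpha> \<beta> where q': "q = (\<lambda>x. \<alpha> + \<beta> \<bullet> x)" using q by (rule polys_1E)
    show ?thesis
      using L2_inner_diff_left[OF v polys_1_L2[OF p(1)] polys_1_L2[OF q]] inner_moments[OF v] inner_moments[OF polys_1_L2[OF p(1)]] p(2)
      by (simp add: q')
  qed
  have "proj 1 P v = p" by (rule proj1_eqI[OF v p(1) orth])
  then show "proj 1 P v \<in> polys 1" "q \<in> polys 1 \<Longrightarrow> L2_inner (lebesgue_on G) (\<lambda>x. v x - proj 1 P v x) q = 0"
    using p(1) orth by auto
qed

lemma mean_orth:
  assumes v: "v \<in> L2 (lebesgue_on G)"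
  shows "(LINT x|lebesgue_on G. v x - c) = 0 \<longleftrightarrow> c = mean G v"
proof -
  have "(LINT x|lebesgue_on G. v x - c) = (LINT x|lebesgue_on G. v x) - c * measure lebesgue G"
    using L2_integrable[OF v G_finite] finite_measure.integrable_const[OF G_finite, of c]
    by (simp add: measure_restrict_space)
  then show ?thesis using measure_G(1) by (auto simp: mean_def field_simps)
qed

lemma proj0:
  assumes v: "v \<in> L2 (lebesgue_on G)"
  shows "proj 0 P v = (\<lambda>x. mean G v)"
  unfolding proj_def Leb_L2_inner
proof (rule the_equality)
  have "(LINT x|lebesgue_on G. v x - mean G v) = 0" using mean_orth[OF v] by blast
  then show "(\<lambda>x. mean G v) \<in> polys 0 \<and> (\<forall>q\<in>polys 0. L2_inner (lebesgue_on G) (\<lambda>x. v x - mean G v) q = 0)"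
    by (auto simp: polys_0 L2_inner_def)
next
  fix p assume p: "p \<in> polys 0 \<and> (\<forall>q\<in>polys 0. L2_inner (lebesgue_on G) (\<lambda>x. v x - p x) q = 0)"
  then obtain c where c: "p = (\<lambda>x. c)" by (auto simp: polys_0)
  have "(\<lambda>x. 1) \<in> polys 0" by (auto simp: polys_0)
  with p have "L2_inner (lebesgue_on G) (\<lambda>x. v x - p x) (\<lambda>x. 1) = 0" by blast
  then show "p = (\<lambda>x. mean G v)" using mean_orth[OF v] by (simp add: c L2_inner_def)
qed

lemma mean_minus_proj1:
  assumes v: "v \<in> L2 (lebesgue_on G)"
  shows "mean G (\<lambda>x. v x - proj 1 P v x) = 0"
proof -
  have "(\<lambda>x. 1) \<in> polys 1" using polys_1I[of 1 0] by simp
  from proj1(2)[OF v this] show ?thesis by (simp add: mean_def L2_inner_def)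
qed

lemma grad_affine_AE: "AE x in lebesgue_on G. wgrad G (\<lambda>x. \<alpha> + \<beta> \<bullet> x) x = \<beta>"
  using H1_smooth(2)[OF GG polys_1_smooth[OF polys_1I[of \<alpha> \<beta>]]] by (simp add: grad_linear)

lemma polys_1_H1: "p \<in> polys 1 \<Longrightarrow> p \<in> H1 G"
  by (rule smooth_H1[OF polys_1_smooth])

section \<open>The Ritz projection\<close>

lemma boundary_integral_lincomb:
  assumes v: "v \<in> H1 G" and w: "w \<in> H1 G"
  shows "boundary_integral P (\<lambda>x. a * v x + b * w x) = a * boundary_integral P v + b * boundary_integral P w"
proof -
  have "(LINT x|edge_measure E. trace P E (\<lambda>x. a * v x + b * w x) x)
    = a * (LINT x|edge_measure E. trace P E v x) + b * (LINT x|edge_measure E. trace P E w x)" if E: "E \<in> edges P" for E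
  proof -
    note i = L2_integrable[OF trace_L2[OF v E] finite_edge_measure] L2_integrable[OF trace_L2[OF w E] finite_edge_measure]
    have "(LINT x|edge_measure E. trace P E (\<lambda>x. a * v x + b * w x) x) = (LINT x|edge_measure E. a * trace P E v x + b * trace P E w x)"
      by (rule integral_cong_AE)
        (use L2D(1)[OF trace_L2[OF H1_lincomb(1)[OF GG v w] E]] L2D(1)[OF trace_L2[OF v E]] L2D(1)[OF trace_L2[OF w E]] trace_lincomb[OF v w E] in auto)
    then show ?thesis using i by simp
  qed
  then show ?thesis by (simp add: boundary_integral_def sum.distrib sum_distrib_left)
qed

lemma boundary_integral_diff:
  assumes v: "v \<in> H1 G" and w: "w \<in> H1 G"
  shows "boundary_integral P (\<lambda>x. v x - w x) = boundary_integral P v - boundary_integral P w"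
  using boundary_integral_lincomb[OF assms, of 1 "-1"] by simp

text \<open>\<open>L\<close> is the perimeter. Its positivity is what lets the boundary integral fix
  the additive constant of the Ritz projection.\<close>

lemma boundary_integral_const: "\<exists>L>0. \<forall>c. boundary_integral P (\<lambda>x. c) = c * L"
proof -
  define L where "L = (\<Sum>E\<in>edges P. measure (edge_measure E) UNIV)"
  have "(LINT x|edge_measure E. trace P E (\<lambda>x. c) x) = c * measure (edge_measure E) UNIV" if E: "E \<in> edges P" for E c
  proof -
    have "(LINT x|edge_measure E. trace P E (\<lambda>x. c) x) = (LINT x|edge_measure E. c)"
      by (rule integral_cong_AE)
        (use L2D(1)[OF trace_L2[OF smooth_H1[OF smooth_const] E]] trace_smooth[OF smooth_const E] in auto)
    then show ?thesis by simp
  qed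
  then have "boundary_integral P (\<lambda>x. c) = c * L" for c by (simp add: boundary_integral_def L_def sum_distrib_left)
  moreover have "L > 0"
    unfolding L_def
  proof (rule sum_pos[OF finite_edges[OF P]])
    show "edges P \<noteq> {}" using polygonal_domain_nodes(1)[OF P] by (force simp: edges_def)
    fix E assume "E \<in> edges P"
    then obtain a b where "ends E = (a, b)" "a \<noteq> b" by (rule edge_endsE[OF P])
    then show "0 < measure (edge_measure E) UNIV" by (simp add: edge_measure_UNIV)
  qed
  ultimately show ?thesis by blast
qed

definition is_ritz :: "(plane \<Rightarrow> real) \<Rightarrow> (plane \<Rightarrow> real) \<Rightarrow> bool" where
  "is_ritz v p \<longleftrightarrow> p \<in> polys 1 \<and>
     (\<forall>q\<in>polys 1. L2_inner (lebesgue_on G) (\<lambda>x. wgrad G p x - wgrad G v x) (wgrad G q) = 0) \<and>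
     boundary_integral P p = boundary_integral P v"

lemma ritz_is_ritz: "ritz P v = (THE p. is_ritz v p)"
  by (simp add: ritz_def is_ritz_def Leb_L2_inner)

lemma is_ritz_unique:
  assumes v: "v \<in> H1 G" and p: "is_ritz v p" and p': "is_ritz v p'"
  shows "p = p'"
proof -
  have q: "(\<lambda>x. p x - p' x) \<in> polys 1" using p p' polys_1_diff by (auto simp: is_ritz_def)
  then obtain \<alpha> \<beta> where ab: "(\<lambda>x. p x - p' x) = (\<lambda>x. \<alpha> + \<beta> \<bullet> x)" by (rule polys_1E)
  have pH: "p \<in> H1 G" "p' \<in> H1 G" using p p' polys_1_H1 by (auto simp: is_ritz_def)
  let ?g = "wgrad G (\<lambda>x. p x - p' x)"
  note gq = H1D(2)[OF polys_1_H1[OF q]]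
  have "L2_inner (lebesgue_on G) (\<lambda>x. (wgrad G p x - wgrad G v x) - (wgrad G p' x - wgrad G v x)) ?g = 0"
    using L2_inner_diff_left[OF L2_diff[OF H1D(2)[OF pH(1)] H1D(2)[OF v]] L2_diff[OF H1D(2)[OF pH(2)] H1D(2)[OF v]] gq] p p' q
    by (simp add: is_ritz_def)
  then have "L2_inner (lebesgue_on G) (\<lambda>x. wgrad G p x - wgrad G p' x) ?g = 0" by simp
  then have "L2_inner (lebesgue_on G) ?g ?g = 0"
    using L2_inner_cong_AE[OF G_sets H1_diff(2)[OF GG pH], of ?g] by simp
  then have "L2_norm (lebesgue_on G) ?g = 0" using L2_norm_eq_inner[of "lebesgue_on G" ?g] by simp
  moreover have "L2_norm (lebesgue_on G) ?g = norm \<beta> * sqrt (measure (lebesgue_on G) G)"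
    using L2_norm_cong_AE[OF G_sets grad_affine_AE[of \<alpha> \<beta>]] L2_norm_const[of "lebesgue_on G" \<beta>] by (simp add: ab)
  ultimately have \<beta>: "\<beta> = 0" using measure_G(1) by (simp add: measure_restrict_space)
  have "boundary_integral P (\<lambda>x. p x - p' x) = 0"
    using boundary_integral_diff[OF pH] p p' by (simp add: is_ritz_def)
  then have "\<alpha> = 0" using boundary_integral_const \<beta> by (auto simp: ab)
  with \<beta> ab show ?thesis by (simp add: fun_eq_iff)
qed

text \<open>The gradients of affine functions are the constants, so the gradient of the projection
  is the mean of the weak gradient; \<alpha> then adjusts the boundary integral.\<close>

lemma is_ritz_exists:
  assumes v: "v \<in> H1 G"
  shows "\<exists>p. is_ritz v p"
proof -
  define \<beta> where "\<beta> = (\<chi> i. mean G (\<lambda>x. wgrad G v x $ i))"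
  obtain L where L: "L > 0" "\<And>c. boundary_integral P (\<lambda>x. c) = c * L" using boundary_integral_const by blast
  define \<alpha> where "\<alpha> = (boundary_integral P v - boundary_integral P (\<lambda>x. \<beta> \<bullet> x)) / L"
  let ?p = "\<lambda>x. \<alpha> + \<beta> \<bullet> x"
  have pH: "?p \<in> H1 G" by (rule polys_1_H1[OF polys_1I])
  have gL: "(\<lambda>x. wgrad G v x $ i) \<in> L2 (lebesgue_on G)" for i using H1D(2)[OF v] L2_vec_iff by blast
  have "L2_inner (lebesgue_on G) (\<lambda>x. wgrad G ?p x - wgrad G v x) (wgrad G q) = 0" if q: "q \<in> polys 1" for q
  proof -
    obtain \<alpha>' \<beta>' where q': "q = (\<lambda>x. \<alpha>' + \<beta>' \<bullet> x)" using q by (rule polys_1E)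
    have ae: "AE x in lebesgue_on G. (wgrad G ?p x - wgrad G v x) \<bullet> wgrad G q x = (\<beta> - wgrad G v x) \<bullet> \<beta>'"
      using grad_affine_AE[of \<alpha> \<beta>] grad_affine_AE[of \<alpha>' \<beta>'] unfolding q' by eventually_elim simp
    have "L2_inner (lebesgue_on G) (\<lambda>x. wgrad G ?p x - wgrad G v x) (wgrad G q) = (LINT x|lebesgue_on G. (\<beta> - wgrad G v x) \<bullet> \<beta>')"
      unfolding L2_inner_def by (rule integral_lebesgue_on_cong_AE[OF G_sets ae])
    also have "\<dots> = (LINT x|lebesgue_on G. - \<beta>' $ 1 * (wgrad G v x $ 1 - \<beta> $ 1) + - \<beta>' $ 2 * (wgrad G v x $ 2 - \<beta> $ 2))"
      by (simp add: inner_vec2 algebra_simps)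
    also have "\<dots> = - \<beta>' $ 1 * (LINT x|lebesgue_on G. wgrad G v x $ 1 - \<beta> $ 1) + - \<beta>' $ 2 * (LINT x|lebesgue_on G. wgrad G v x $ 2 - \<beta> $ 2)"
    proof -
      have i: "integrable (lebesgue_on G) (\<lambda>x. wgrad G v x $ j - \<beta> $ j)" for j
        by (rule L2_integrable[OF L2_diff[OF gL L2_const[OF G_finite]] G_finite])
      show ?thesis using i[of 1] i[of 2] by (simp only: Bochner_Integration.integral_add integrable_mult_right integral_mult_right_zero)
    qed
    also have "\<dots> = 0"
    proof -
      have "(LINT x|lebesgue_on G. wgrad G v x $ i - \<beta> $ i) = 0" for i using mean_orth[OF gL] by (simp add: \<beta>_def)
      then show ?thesis by simp
    qed
    finally show ?thesis .
  qed
  moreover have "boundary_integral P ?p = boundary_integral P v"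
  proof -
    have "boundary_integral P (\<lambda>x. 1 * \<alpha> + 1 * (\<beta> \<bullet> x)) = 1 * boundary_integral P (\<lambda>x. \<alpha>) + 1 * boundary_integral P (\<lambda>x. \<beta> \<bullet> x)"
      by (rule boundary_integral_lincomb) (intro smooth_H1 smooth_const smooth_linear)+
    then show ?thesis using L by (simp add: \<alpha>_def)
  qed
  ultimately show ?thesis unfolding is_ritz_def using polys_1I by blast
qed

lemma ritz_eqI: "v \<in> H1 G \<Longrightarrow> is_ritz v p \<Longrightarrow> ritz P v = p"
  unfolding ritz_is_ritz using is_ritz_unique by blast

lemma ritz_spec: "v \<in> H1 G \<Longrightarrow> is_ritz v (ritz P v)"
  using is_ritz_exists ritz_eqI by metis

lemma ritz_minus_poly:
  assumes v: "v \<in> H1 G" and p: "p \<in> polys 1"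
  shows "ritz P (\<lambda>x. v x - p x) = (\<lambda>x. ritz P v x - p x)"
proof (rule ritz_eqI)
  have pH: "p \<in> H1 G" by (rule polys_1_H1[OF p])
  have R: "is_ritz v (ritz P v)" by (rule ritz_spec[OF v])
  then have Rp: "ritz P v \<in> polys 1" and RH: "ritz P v \<in> H1 G" using polys_1_H1 by (auto simp: is_ritz_def)
  show "(\<lambda>x. v x - p x) \<in> H1 G" by (rule H1_diff(1)[OF GG v pH])
  have ae: "AE x in lebesgue_on G. wgrad G (\<lambda>x. ritz P v x - p x) x - wgrad G (\<lambda>x. v x - p x) x = wgrad G (ritz P v) x - wgrad G v x"
    using H1_diff(2)[OF GG RH pH] H1_diff(2)[OF GG v pH] by eventually_elim simp
  show "is_ritz (\<lambda>x. v x - p x) (\<lambda>x. ritz P v x - p x)"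
    unfolding is_ritz_def L2_inner_cong_AE[OF G_sets ae] boundary_integral_diff[OF RH pH] boundary_integral_diff[OF v pH]
    using R polys_1_diff[OF Rp p] by (auto simp: is_ritz_def)
qed

text \<open>Subtracting an affine function leaves the Laplacian unchanged, shifts the normal
  derivative by a constant on each edge, and changes the Ritz projection by the same function. Hence
  the remainder of the projection of \<open>u\<^sub>h\<close> may be inserted into the
  stabilization.\<close>

lemma VP_minus_poly:
  assumes v: "v \<in> VP P" and p: "p \<in> polys 1"
  shows "(\<lambda>x. v x - p x) \<in> VP P"
proof -
  have vH: "v \<in> H1 G" using v by (simp add: VP_def Vhat_def)
  have pH: "p \<in> H1 G" by (rule polys_1_H1[OF p])
  have wH: "(\<lambda>x. v x - p x) \<in> H1 G" by (rule H1_diff(1)[OF GG vH pH])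
  obtain \<alpha> \<beta> where ab: "p = (\<lambda>x. \<alpha> + \<beta> \<bullet> x)" using p by (rule polys_1E)
  obtain q g where q: "q \<in> polys 1" "is_weak_laplacian P v q" "is_normal_derivative P v q g"
    and g: "\<And>E. E \<in> edges P \<Longrightarrow> \<exists>c\<in>polys 0. \<forall>x\<in>E. g E x = c x"
    using v unfolding VP_def Vhat_def by blast
  obtain \<nu> where \<nu>: "\<And>w. w \<in> H1 G \<Longrightarrow> L2_inner (lebesgue_on G) (\<lambda>x. \<beta>) (wgrad G w) = (\<Sum>E\<in>edges P. \<nu> E * (LINT x|edge_measure E. trace P E w x))"
    using green_affine[of \<beta>] by blast
  have ae: "AE x in lebesgue_on G. wgrad G (\<lambda>x. v x - p x) x = wgrad G v x - \<beta>"
    using H1_diff(2)[OF GG vH pH] grad_affine_AE[of \<alpha> \<beta>] unfolding ab by eventually_elim simp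
  have inn: "L2_inner (lebesgue_on G) (wgrad G (\<lambda>x. v x - p x)) k = L2_inner (lebesgue_on G) (wgrad G v) k - L2_inner (lebesgue_on G) (\<lambda>x. \<beta>) k"
    if "k \<in> L2 (lebesgue_on G)" for k
    unfolding L2_inner_cong_AE[OF G_sets ae] by (rule L2_inner_diff_left[OF H1D(2)[OF vH] L2_const[OF G_finite] that])
  have lap: "is_weak_laplacian P (\<lambda>x. v x - p x) q"
    unfolding is_weak_laplacian_def Leb_L2_inner
  proof
    fix \<phi> assume \<phi>: "\<phi> \<in> test_functions G"
    have gL: "grad \<phi> \<in> L2 (lebesgue_on G)" by (rule continuous_L2[OF smooth_continuous_grad[OF test_functionsD(1)[OF \<phi>]]])
    \<comment> \<open>Constants are orthogonal to gradients of test functions: the affine part is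
      harmonic in the weak sense.\<close>
    have "(LINT x|lebesgue_on G. grad \<phi> x $ i) = 0" for i
      using integral_grad_test[OF \<phi>] lebesgue_on_support[OF G_sets, of "\<lambda>x. grad \<phi> x $ i"] test_functions_grad_outside[OF \<phi>] by simp
    moreover have "integrable (lebesgue_on G) (\<lambda>x. grad \<phi> x $ i)" for i
      using L2_integrable[OF _ G_finite] gL L2_vec_iff by blast
    ultimately have "L2_inner (lebesgue_on G) (\<lambda>x. \<beta>) (grad \<phi>) = 0" by (simp add: L2_inner_def inner_vec2)
    then show "L2_inner (lebesgue_on G) (wgrad G (\<lambda>x. v x - p x)) (grad \<phi>) = - L2_inner (lebesgue_on G) q \<phi>"
      using inn[OF gL] q(2) \<phi> by (simp add: is_weak_laplacian_def Leb_L2_inner)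
  qed
  have nd: "is_normal_derivative P (\<lambda>x. v x - p x) q (\<lambda>E x. g E x - \<nu> E)"
    unfolding is_normal_derivative_def Leb_L2_inner
  proof (intro conjI ballI)
    fix E assume E: "E \<in> edges P"
    show "(\<lambda>x. g E x - \<nu> E) \<in> L2 (edge_measure E)"
      using q(3) E by (intro L2_diff L2_one_edge) (auto simp: is_normal_derivative_def)
  next
    fix w assume w: "w \<in> H1 G"
    have "(\<Sum>E\<in>edges P. L2_inner (edge_measure E) (\<lambda>x. g E x - \<nu> E) (trace P E w))
      = (\<Sum>E\<in>edges P. L2_inner (edge_measure E) (g E) (trace P E w) - \<nu> E * (LINT x|edge_measure E. trace P E w x))"
    proof (rule sum.cong[OF refl])
      fix E assume E: "E \<in> edges P"
      have "g E \<in> L2 (edge_measure E)" using q(3) E by (auto simp: is_normal_derivative_def)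
      from L2_inner_diff_left[OF this L2_one_edge trace_L2[OF w E], of "\<nu> E"]
      show "L2_inner (edge_measure E) (\<lambda>x. g E x - \<nu> E) (trace P E w) = L2_inner (edge_measure E) (g E) (trace P E w) - \<nu> E * (LINT x|edge_measure E. trace P E w x)"
        by (simp add: L2_inner_def)
    qed
    then show "L2_inner (lebesgue_on G) (wgrad G (\<lambda>x. v x - p x)) (wgrad G w) + L2_inner (lebesgue_on G) q w
      = (\<Sum>E\<in>edges P. L2_inner (edge_measure E) (\<lambda>x. g E x - \<nu> E) (trace P E w))"
      using inn[OF H1D(2)[OF w]] \<nu>[OF w] q(3) w by (simp add: is_normal_derivative_def Leb_L2_inner sum_subtractf)
  qed
  have "\<exists>c\<in>polys 0. \<forall>x\<in>E. g E x - \<nu> E = c x" if E: "E \<in> edges P" for E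
  proof -
    obtain c where "\<forall>x\<in>E. g E x = c" using g[OF E] by (auto simp: polys_0)
    then show ?thesis by (intro bexI[of _ "\<lambda>x. c - \<nu> E"]) (auto simp: polys_0)
  qed
  with lap nd q(1) wH have "(\<lambda>x. v x - p x) \<in> Vhat P" unfolding Vhat_def by blast
  moreover have "\<forall>k\<in>polys 1. L2_inner (Leb P) (\<lambda>x. (v x - p x) - ritz P (\<lambda>x. v x - p x) x) k = 0"
    using v by (simp add: ritz_minus_poly[OF vH p] VP_def)
  ultimately show ?thesis by (simp add: VP_def)
qed

text \<open>This is the condition under which the stabilization is bounded by the energy.\<close>

lemma proj1_remainder:
  assumes v: "v \<in> L2 (lebesgue_on G)"
  shows "proj 1 P (\<lambda>x. v x - proj 1 P v x) = (\<lambda>x. 0)"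
proof (rule proj1_eqI)
  show "(\<lambda>x. v x - proj 1 P v x) \<in> L2 (lebesgue_on G)" by (rule L2_diff[OF v polys_1_L2[OF proj1(1)[OF v]]])
  show "(\<lambda>x. 0) \<in> polys 1" using polys_1I[of 0 0] by simp
qed (simp add: proj1(2)[OF v])

end

section \<open>Bubble functions\<close>

text \<open>On the half disc radius \<open>1 - |x|^2\<close> is at least 3/4, whence the
  exponent.\<close>

lemma bump_lower: "norm x \<le> 1/2 \<Longrightarrow> exp (- (4/3)) \<le> bump x"
proof -
  assume "norm x \<le> 1/2"
  then have "(norm x)\<^sup>2 \<le> (1/2)\<^sup>2" by (intro power_mono) auto
  then have n: "3/4 \<le> 1 - (norm x)\<^sup>2" by (simp add: power2_eq_square)
  then have "inverse (1 - (norm x)\<^sup>2) \<le> inverse (3/4)" by (intro le_imp_inverse_le) auto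
  with n show ?thesis by (simp add: bump_def flat_fun_def)
qed

text \<open>A number fixed once and for all, independent of any polygon, so that it may enter the
  constant of the theorem.\<close>

definition bump_grad_bound :: real where
  "bump_grad_bound = (SOME B. B > 0 \<and> (\<forall>x. norm (grad bump x) \<le> B))"

lemma bump_grad_bound: "bump_grad_bound > 0" "norm (grad bump x) \<le> bump_grad_bound"
proof -
  obtain B where "B > 0 \<and> (\<forall>x. norm (grad bump x) \<le> B)"
    using test_functions_grad_bounded[OF bump_test] by metis
  then have "bump_grad_bound > 0 \<and> (\<forall>x. norm (grad bump x) \<le> bump_grad_bound)"
    unfolding bump_grad_bound_def by (rule someI)
  then show "bump_grad_bound > 0" "norm (grad bump x) \<le> bump_grad_bound" by auto
qed

context star_polygon
begin

text \<open>Radius \<open>r / 2\<close> puts the closed support inside the open ball; on the ball of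
  radius \<open>r / 4\<close> the bubble is at least \<open>exp (- (4/3))\<close>.\<close>

definition bubble :: "plane \<Rightarrow> real" where
  "bubble x = bump ((x - z) /\<^sub>R (r / 2))"

lemma bubble_test: "bubble \<in> test_functions G"
  unfolding bubble_def
proof (rule bump_scaled_test)
  have "cball z (r / 2) \<subseteq> ball z r" using r_pos by auto
  then show "cball z (r / 2) \<subseteq> G" using ball_G by blast
qed (use r_pos in simp)

lemma bubble_range: "0 \<le> bubble x" "bubble x \<le> 1"
  by (simp_all add: bubble_def bump_nonneg bump_le_1)

lemma grad_bubble: "norm (grad bubble x) \<le> 2 * bump_grad_bound / r"
proof -
  have "bubble = (\<lambda>x. bump (- ((2 / r) *\<^sub>R z) + (2 / r) *\<^sub>R x))"
    by (simp add: bubble_def fun_eq_iff algebra_simps)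
  then have "grad bubble x = (2 / r) *\<^sub>R grad bump (- ((2 / r) *\<^sub>R z) + (2 / r) *\<^sub>R x)"
    using grad_affine[OF smooth_bump] by metis
  then have "norm (grad bubble x) = (2 / r) * norm (grad bump (- ((2 / r) *\<^sub>R z) + (2 / r) *\<^sub>R x))"
    using r_pos by simp
  also have "\<dots> \<le> (2 / r) * bump_grad_bound" using r_pos by (intro mult_left_mono bump_grad_bound) auto
  finally show ?thesis by simp
qed

text \<open>Here \<open>N\<close> is the size of the coefficients of \<open>q\<close>, and \<open>m\<close> is the measure of a small ball, chosen on
  the side where \<open>q\<close> does not change sign.\<close>

lemma affine_size:
  assumes q: "q \<in> polys 1"
  obtains N \<beta> m where "N \<ge> 0" "m > 0" "grad q = (\<lambda>x. \<beta>)" "norm \<beta> * r \<le> 16 * N"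
    "sqrt m * N \<le> L2_norm (lebesgue_on G) q"
    "exp (- (4/3)) * (m * N\<^sup>2) \<le> L2_inner (lebesgue_on G) q (\<lambda>x. bubble x * q x)"
    "L2_norm (lebesgue_on G) q \<le> (16 * h / r) * (16 * h / r) * (sqrt m * N)"
    "sqrt (measure lebesgue G) \<le> (16 * h / r) * sqrt m"
proof -
  let ?M = "lebesgue_on G"
  obtain \<alpha>' \<beta> where q': "q = (\<lambda>x. \<alpha>' + \<beta> \<bullet> x)" using q by (rule polys_1E)
  define \<alpha> where "\<alpha> = \<alpha>' + \<beta> \<bullet> z"
  have qx: "q x = \<alpha> + \<beta> \<bullet> (x - z)" for x by (simp add: q' \<alpha>_def inner_diff_right)
  \<comment> \<open>\<open>\<bar>\<alpha>\<bar>\<close> is the size of the value at the centre and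
    \<open>norm \<beta> * r / 16\<close> the variation that survives on the small ball
    \<open>B\<close>.\<close>
  define N where "N = \<bar>\<alpha>\<bar> + norm \<beta> * r / 16"
  have N: "N \<ge> 0" using r_pos by (simp add: N_def)
  have g: "grad q = (\<lambda>x. \<beta>)" by (simp add: q' grad_linear fun_eq_iff)
  define \<sigma> :: real where "\<sigma> = (if \<alpha> < 0 then -1 else 1)"
  \<comment> \<open>Moving from \<open>z\<close> by \<open>r / 8\<close> along the gradient, in the
    direction in which \<open>q\<close> grows away from zero: on \<open>B\<close> the linear part
    then has the sign of \<alpha> and size at least \<open>norm \<beta> * (r/8 - r/16)\<close>. For
    \<open>\<beta> = 0\<close> the centre stays \<open>z\<close>.\<close>
  define c where "c = z + (\<sigma> * r / 8) *\<^sub>R sgn \<beta>"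
  define B where "B = ball c (r / 16)"
  have cz: "norm (c - z) \<le> r / 8" using r_pos by (simp add: c_def \<sigma>_def norm_sgn)
  have Bz: "norm (x - z) < r / 4" if "x \<in> B" for x
  proof -
    have "norm (x - c) < r / 16" using that by (simp add: B_def dist_norm norm_minus_commute)
    then show ?thesis using norm_triangle_ineq[of "x - c" "c - z"] cz r_pos by simp
  qed
  have BG: "B \<subseteq> G"
  proof
    fix x assume "x \<in> B"
    then have "x \<in> ball z r" using Bz[of x] r_pos by (simp add: dist_norm norm_minus_commute)
    then show "x \<in> G" using ball_G by blast
  qed
  have lower: "N \<le> \<bar>q x\<bar>" if x: "x \<in> B" for x
  proof -
    have xc: "norm (x - c) < r / 16" using x by (simp add: B_def dist_norm norm_minus_commute)
    have "\<beta> \<bullet> sgn \<beta> = norm \<beta>" by (cases "\<beta> = 0") (simp_all add: sgn_div_norm dot_square_norm power2_eq_square)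
    then have "\<sigma> * (\<beta> \<bullet> (c - z)) = norm \<beta> * r / 8" by (simp add: c_def \<sigma>_def)
    moreover have "\<bar>\<sigma> * (\<beta> \<bullet> (x - c))\<bar> \<le> norm \<beta> * (r / 16)"
    proof -
      have "\<bar>\<sigma> * (\<beta> \<bullet> (x - c))\<bar> = \<bar>\<beta> \<bullet> (x - c)\<bar>" by (simp add: \<sigma>_def abs_mult)
      also have "\<dots> \<le> norm \<beta> * norm (x - c)" by (rule Cauchy_Schwarz_ineq2)
      also have "\<dots> \<le> norm \<beta> * (r / 16)" using xc by (intro mult_left_mono) auto
      finally show ?thesis .
    qed
    moreover have "\<sigma> * (\<beta> \<bullet> (x - z)) = \<sigma> * (\<beta> \<bullet> (c - z)) + \<sigma> * (\<beta> \<bullet> (x - c))"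
      by (simp add: inner_diff_right algebra_simps)
    ultimately have 1: "norm \<beta> * r / 16 \<le> \<sigma> * (\<beta> \<bullet> (x - z))" by linarith
    have "\<sigma> * q x = \<bar>\<alpha>\<bar> + \<sigma> * (\<beta> \<bullet> (x - z))" by (simp add: qx \<sigma>_def distrib_left)
    with 1 have "N \<le> \<sigma> * q x" by (simp add: N_def)
    also have "\<dots> \<le> \<bar>q x\<bar>" by (auto simp: \<sigma>_def)
    finally show ?thesis .
  qed
  \<comment> \<open>With this \<open>k\<close> the bound \<open>norm \<beta> * h\<close> of the
    linear part on \<open>G\<close> equals \<open>k\<close> times its share in \<open>N\<close>, and
    \<open>h\<^sup>2 = k\<^sup>2 * (r / 16)\<^sup>2\<close> compares the areas.\<close>
  define k where "k = 16 * h / r"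
  have hr: "1 \<le> k" using r_le_h r_pos by (simp add: k_def field_simps)
  have upper: "\<bar>q x\<bar> \<le> k * N" if x: "x \<in> G" for x
  proof -
    have "\<bar>\<beta> \<bullet> (x - z)\<bar> \<le> norm \<beta> * h"
      by (rule order_trans[OF Cauchy_Schwarz_ineq2]) (intro mult_left_mono G_diam[OF x z_in], simp)
    then have "\<bar>q x\<bar> \<le> 1 * \<bar>\<alpha>\<bar> + norm \<beta> * h" unfolding qx by linarith
    also have "\<dots> \<le> k * \<bar>\<alpha>\<bar> + norm \<beta> * h" using hr by (intro add_right_mono mult_right_mono) auto
    also have "\<dots> = k * N" using r_pos by (simp add: k_def N_def field_simps)
    finally show ?thesis .
  qed
  define m where "m = measure lebesgue B"
  have mB: "m = unit_ball_vol 2 * (r / 16)\<^sup>2"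
    unfolding m_def B_def using content_ball[of "r / 16" c] r_pos by (simp add: measure_completion)
  have m: "m > 0" using r_pos by (simp add: mB)
  have mG: "measure lebesgue G \<le> k\<^sup>2 * m"
  proof -
    have "measure lebesgue G \<le> measure lebesgue (cball z h)"
      by (rule measure_mono_fmeasurable) (use G_cball in auto)
    also have "\<dots> = unit_ball_vol 2 * h\<^sup>2"
      using content_cball[of h z] h_pos by (simp add: measure_completion)
    also have "\<dots> = k\<^sup>2 * m" using r_pos by (simp add: k_def mB power_divide power_mult_distrib)
    finally show ?thesis .
  qed
  have Bs: "B \<in> sets lebesgue" by (simp add: B_def)
  have Bi: "(LINT x|?M. k * indicator B x) = k * m" for k :: real
  proof -
    have "B \<in> sets ?M" using BG Bs by (auto simp: sets_restrict_space image_iff)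
    then show ?thesis using BG by (simp add: m_def measure_restrict_space Int_absorb2 space_restrict_space)
  qed
  have Bint: "integrable ?M (\<lambda>x. k * indicator B x)" for k :: real
  proof -
    have "B \<in> sets ?M" using BG Bs by (auto simp: sets_restrict_space image_iff)
    then have "integrable ?M (indicator B :: plane \<Rightarrow> real)"
      using finite_measure.emeasure_finite[OF G_finite, of B] by (intro integrable_real_indicator) (auto simp: less_top)
    then show ?thesis by simp
  qed
  note qL = polys_1_L2[OF q]
  have bL: "(\<lambda>x. bubble x * q x) \<in> L2 ?M"
    by (intro continuous_L2 continuous_intros smooth_continuous[OF test_functionsD(1)[OF bubble_test]] smooth_continuous[OF polys_1_smooth[OF q]])
  have 1: "N\<^sup>2 * m \<le> (L2_norm ?M q)\<^sup>2"
    unfolding Bi[symmetric] L2_norm_power2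
  proof (rule integral_mono[OF Bint L2D(2)[OF qL]])
    fix x show "N\<^sup>2 * indicator B x \<le> (norm (q x))\<^sup>2"
      using power_mono[OF lower N, of x 2] by (auto simp: indicator_def)
  qed
  have 2: "exp (- (4/3)) * N\<^sup>2 * m \<le> L2_inner ?M q (\<lambda>x. bubble x * q x)"
    unfolding Bi[symmetric] L2_inner_def
  proof (rule integral_mono[OF Bint L2_inner_integrable[OF qL bL]])
    fix x show "exp (- (4/3)) * N\<^sup>2 * indicator B x \<le> q x \<bullet> (bubble x * q x)"
    proof (cases "x \<in> B")
      case True
      have "norm ((x - z) /\<^sub>R (r / 2)) = 2 * norm (x - z) / r" using r_pos by simp
      also have "\<dots> \<le> 1/2" using Bz[OF True] r_pos by (simp add: field_simps)
      finally have "norm ((x - z) /\<^sub>R (r / 2)) \<le> 1/2" .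
      then have "exp (- (4/3)) \<le> bubble x" unfolding bubble_def by (rule bump_lower)
      moreover have "N\<^sup>2 \<le> (q x)\<^sup>2" using power_mono[OF lower[OF True] N, of 2] by simp
      ultimately have "exp (- (4/3)) * N\<^sup>2 \<le> bubble x * (q x)\<^sup>2" by (intro mult_mono bubble_range) auto
      then show ?thesis using True by (simp add: power2_eq_square mult_ac)
    next
      case False
      then show ?thesis using bubble_range[of x] by (simp add: mult.left_commute[of "q x"])
    qed
  qed
  have 3: "L2_norm ?M q \<le> k * N * sqrt (measure lebesgue G)"
  proof -
    have "AE x in ?M. norm (q x) \<le> (k * N) * norm (1::real)"
      using upper by (intro AE_I2) (simp add: space_restrict_space)
    from L2_dominated(2)[OF L2_const[OF G_finite] L2D(1)[OF qL] _ this]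
    show ?thesis using hr N by (simp add: L2_norm_const measure_restrict_space)
  qed
  have 4: "sqrt (measure lebesgue G) \<le> k * sqrt m"
    using real_sqrt_le_mono[OF mG] hr by (simp add: real_sqrt_mult)
  show ?thesis
  proof (rule that[OF N m g _ _ _ _ 4[unfolded k_def]], unfold k_def[symmetric])
    show "norm \<beta> * r \<le> 16 * N" by (simp add: N_def)
    show "sqrt m * N \<le> L2_norm ?M q"
      using real_sqrt_le_mono[OF 1] N by (simp add: real_sqrt_mult mult.commute)
    show "exp (- (4/3)) * (m * N\<^sup>2) \<le> L2_inner ?M q (\<lambda>x. bubble x * q x)" using 2 by (simp add: mult_ac)
    have "k * N * sqrt (measure lebesgue G) \<le> k * N * (k * sqrt m)"
      using hr N by (intro mult_left_mono 4) auto
    with 3 show "L2_norm ?M q \<le> k * k * (sqrt m * N)" by (simp add: mult_ac)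
  qed
qed

text \<open>Both sides are comparable to \<open>m * N\<^sup>2\<close>. The fourth power arises from
  \<open>k\<^sup>2\<close> for the values of \<open>q\<close> on \<open>G\<close> and
  \<open>k\<^sup>2\<close> for the area of \<open>G\<close> relative to the small ball.\<close>

lemma bubble_norm:
  assumes q: "q \<in> polys 1"
  shows "(L2_norm (lebesgue_on G) q)\<^sup>2 \<le> (16 * h / r) ^ 4 * exp (4/3) * L2_inner (lebesgue_on G) q (\<lambda>x. bubble x * q x)"
proof -
  obtain N \<beta> m where N: "N \<ge> 0" "m > 0" and "grad q = (\<lambda>x. \<beta>)" "norm \<beta> * r \<le> 16 * N"
    "sqrt m * N \<le> L2_norm (lebesgue_on G) q"
    and 2: "exp (- (4/3)) * (m * N\<^sup>2) \<le> L2_inner (lebesgue_on G) q (\<lambda>x. bubble x * q x)"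
    and 3: "L2_norm (lebesgue_on G) q \<le> (16 * h / r) * (16 * h / r) * (sqrt m * N)"
    and "sqrt (measure lebesgue G) \<le> (16 * h / r) * sqrt m"
    by (rule affine_size[OF q])
  have "(L2_norm (lebesgue_on G) q)\<^sup>2 \<le> ((16 * h / r) * (16 * h / r) * (sqrt m * N))\<^sup>2"
    by (rule power_mono[OF 3]) simp
  also have "\<dots> = (16 * h / r) ^ 4 * (m * N\<^sup>2)"
  proof -
    have e: "(k * k * w)\<^sup>2 = k ^ 4 * w\<^sup>2" for k w :: real by (simp add: power2_eq_square power4_eq_xxxx mult_ac)
    have "(sqrt m * N)\<^sup>2 = m * N\<^sup>2" using N by (simp add: power_mult_distrib)
    then show ?thesis unfolding e by simp
  qed
  also have "\<dots> = (16 * h / r) ^ 4 * exp (4/3) * (exp (- (4/3)) * (m * N\<^sup>2))" by (simp add: exp_minus)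
  also have "\<dots> \<le> (16 * h / r) ^ 4 * exp (4/3) * L2_inner (lebesgue_on G) q (\<lambda>x. bubble x * q x)"
    using h_pos r_pos by (intro mult_left_mono 2) auto
  finally show ?thesis .
qed

text \<open>An inverse estimate in scaled form. The two summands belong to the product rule: the
  constant gradient of \<open>q\<close>, controlled by its size on the small ball, and the gradient
  of the bubble, of order \<open>1 / r\<close>.\<close>

lemma bubble_grad:
  assumes q: "q \<in> polys 1"
  shows "h * L2_norm (lebesgue_on G) (grad (\<lambda>x. bubble x * q x))
    \<le> ((16 * h / r)\<^sup>2 + 2 * bump_grad_bound * h / r) * L2_norm (lebesgue_on G) q"
proof -
  let ?M = "lebesgue_on G"
  obtain N \<beta> m where N: "N \<ge> 0" "m > 0" "grad q = (\<lambda>x. \<beta>)" "norm \<beta> * r \<le> 16 * N"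
    and 1: "sqrt m * N \<le> L2_norm ?M q"
    and "exp (- (4/3)) * (m * N\<^sup>2) \<le> L2_inner ?M q (\<lambda>x. bubble x * q x)"
    and "L2_norm ?M q \<le> (16 * h / r) * (16 * h / r) * (sqrt m * N)"
    and 4: "sqrt (measure lebesgue G) \<le> (16 * h / r) * sqrt m"
    by (rule affine_size[OF q])
  have sb: "smooth bubble" and sq: "smooth q" using test_functionsD(1)[OF bubble_test] polys_1_smooth[OF q] .
  note qL = polys_1_L2[OF q]
  have cg: "continuous_on UNIV (grad bubble)" by (rule smooth_continuous_grad[OF sb])
  have L: "(\<lambda>x. bubble x *\<^sub>R \<beta>) \<in> L2 ?M" "(\<lambda>x. q x *\<^sub>R grad bubble x) \<in> L2 ?M"
    by (intro continuous_L2 continuous_intros smooth_continuous[OF sb] smooth_continuous[OF sq] cg)+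
  have "grad (\<lambda>x. bubble x * q x) = (\<lambda>x. bubble x *\<^sub>R \<beta> + q x *\<^sub>R grad bubble x)"
    using grad_mult[OF sb sq] N(3) by (simp add: fun_eq_iff)
  then have "L2_norm ?M (grad (\<lambda>x. bubble x * q x)) \<le> L2_norm ?M (\<lambda>x. bubble x *\<^sub>R \<beta>) + L2_norm ?M (\<lambda>x. q x *\<^sub>R grad bubble x)"
    using L2_norm_triangle[OF L] by simp
  also have "L2_norm ?M (\<lambda>x. bubble x *\<^sub>R \<beta>) \<le> 1 * L2_norm ?M (\<lambda>x. \<beta>)"
    by (rule L2_dominated(2)[OF L2_const[OF G_finite] L2D(1)[OF L(1)]])
      (use bubble_range in \<open>auto intro!: AE_I2 mult_left_le_one_le\<close>)
  also have "1 * L2_norm ?M (\<lambda>x. \<beta>) = norm \<beta> * sqrt (measure lebesgue G)"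
    by (simp add: L2_norm_const measure_restrict_space)
  also have "\<dots> \<le> (16 * N / r) * ((16 * h / r) * sqrt m)"
    by (intro mult_mono 4) (use N r_pos h_pos in \<open>auto simp: field_simps\<close>)
  also have "\<dots> = (16 / r) * (16 * h / r) * (sqrt m * N)" by simp
  also have "\<dots> \<le> (16 / r) * (16 * h / r) * L2_norm ?M q"
    using r_pos h_pos by (intro mult_left_mono 1) auto
  also have "L2_norm ?M (\<lambda>x. q x *\<^sub>R grad bubble x) \<le> (2 * bump_grad_bound / r) * L2_norm ?M q"
  proof (rule L2_dominated(2)[OF qL L2D(1)[OF L(2)]])
    show "AE x in ?M. norm (q x *\<^sub>R grad bubble x) \<le> 2 * bump_grad_bound / r * norm (q x)"
      using mult_left_mono[OF grad_bubble abs_ge_zero] by (intro AE_I2) (simp add: mult.commute)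
  qed (use r_pos bump_grad_bound in simp)
  finally have "L2_norm ?M (grad (\<lambda>x. bubble x * q x)) \<le> ((16 / r) * (16 * h / r) + 2 * bump_grad_bound / r) * L2_norm ?M q"
    by (simp add: distrib_right)
  then have "h * L2_norm ?M (grad (\<lambda>x. bubble x * q x)) \<le> h * (((16 / r) * (16 * h / r) + 2 * bump_grad_bound / r) * L2_norm ?M q)"
    using h_pos by (intro mult_left_mono) auto
  also have "\<dots> = ((16 * h / r)\<^sup>2 + 2 * bump_grad_bound * h / r) * L2_norm ?M q"
    by (simp add: power2_eq_square distrib_left distrib_right mult_ac)
  finally show ?thesis .
qed

end

section \<open>Efficiency of the volume terms\<close>

text \<open>The norm of a matrix is here the Frobenius norm, so Cauchy-Schwarz in each row suffices;
  it connects the coefficient bound with the flux.\<close>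

lemma norm_matrix_vector_le: "norm ((A::real^2^2) *v x) \<le> norm A * norm x"
proof (rule power2_le_imp_le)
  have nA: "(norm A)\<^sup>2 = (norm (A $ 1))\<^sup>2 + (norm (A $ 2))\<^sup>2"
    by (simp add: norm_vec_def[of A] L2_set_def sum_2)
  have "((A *v x) $ i)\<^sup>2 \<le> (norm (A $ i))\<^sup>2 * (norm x)\<^sup>2" for i
  proof -
    have "\<bar>A $ i \<bullet> x\<bar>\<^sup>2 \<le> (norm (A $ i) * norm x)\<^sup>2" by (intro power_mono Cauchy_Schwarz_ineq2) simp
    then show ?thesis by (simp add: matrix_mult_dot power_mult_distrib)
  qed
  from this[of 1] this[of 2] show "(norm (A *v x))\<^sup>2 \<le> (norm A * norm x)\<^sup>2"
    unfolding norm_vec2_sq[of "A *v x"] power_mult_distrib nA by (simp add: distrib_right)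
qed simp

text \<open>The mesh covers the closure of \<Omega>, and the interiors of its polygons must lie in
  \<Omega> itself. A frontier point cannot be interior to the closure, since the open region above
  the local graph avoids \<Omega> and comes arbitrarily close to the point.\<close>

lemma lipschitz_domain_interior_closure:
  assumes "lipschitz_domain \<Omega>"
  shows "interior (closure \<Omega>) = \<Omega>"
proof
  have op: "open \<Omega>" using assms by (simp add: lipschitz_domain_def)
  show "\<Omega> \<subseteq> interior (closure \<Omega>)" by (rule interior_maximal[OF closure_subset op])
  show "interior (closure \<Omega>) \<subseteq> \<Omega>"
  proof (rule subsetI, rule ccontr)
    fix x assume x: "x \<in> interior (closure \<Omega>)" and nx: "x \<notin> \<Omega>"
    have "x \<in> frontier \<Omega>" using x nx op interior_subset by (auto simp: frontier_def interior_open)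
    from assms[unfolded lipschitz_domain_def, THEN conjunct2, THEN conjunct2, THEN conjunct2, THEN conjunct2, THEN bspec, OF this]
    obtain r L and Q :: "plane \<Rightarrow> plane" and \<psi> where r: "r > 0" and Q: "orthogonal_transformation Q"
      and \<psi>: "L-lipschitz_on UNIV \<psi>" and loc: "\<Omega> \<inter> ball x r = {y \<in> ball x r. Q (y - x) $ 2 < \<psi> (Q (y - x) $ 1)}"
      by (elim exE conjE) (rule that, assumption+)
    have lin: "linear Q" by (rule orthogonal_transformation_linear[OF Q])
    have "\<not> Q (x - x) $ 2 < \<psi> (Q (x - x) $ 1)"
    proof
      assume "Q (x - x) $ 2 < \<psi> (Q (x - x) $ 1)"
      then have "x \<in> \<Omega> \<inter> ball x r" unfolding loc using r by simp
      then show False using nx by blast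
    qed
    then have \<psi>0: "\<psi> 0 \<le> 0" using linear_0[OF lin] by simp
    \<comment> \<open>The vertical direction of the local coordinates: \<open>x + t w\<close> has
      first coordinate 0 and second coordinate \<open>t\<close>, which is positive while
      \<open>\<psi> 0 \<le> 0\<close>, so it lies strictly above the graph.\<close>
    obtain w where w: "Q w = axis 2 1" using orthogonal_transformation_surj[OF Q] by (metis surjD)
    have cQ: "continuous_on UNIV (\<lambda>y. Q (y - x))"
      by (rule continuous_on_compose2[OF linear_continuous_on[of Q UNIV]]) (auto simp: linear_conv_bounded_linear[symmetric] lin intro: continuous_intros)
    have c\<psi>: "continuous_on UNIV (\<lambda>y. \<psi> (Q (y - x) $ 1))"
      by (rule continuous_on_compose2[OF lipschitz_on_continuous_on[OF \<psi>]]) (auto intro!: continuous_intros cQ)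
    let ?U = "ball x r \<inter> {y. \<psi> (Q (y - x) $ 1) < Q (y - x) $ 2}"
    have U: "open ?U" by (intro open_Int open_ball open_Collect_less c\<psi> continuous_intros cQ)
    have "?U \<inter> \<Omega> = {}"
    proof (rule equals0I)
      fix y assume y: "y \<in> ?U \<inter> \<Omega>"
      then have "y \<in> \<Omega> \<inter> ball x r" by blast
      then have "Q (y - x) $ 2 < \<psi> (Q (y - x) $ 1)" unfolding loc by simp
      with y show False by simp
    qed
    then have U0: "?U \<inter> closure \<Omega> = {}" using open_Int_closure_eq_empty[OF U] by blast
    obtain d where d: "d > 0" "ball x d \<subseteq> closure \<Omega>" using x by (meson mem_interior)
    define t where "t = min d r / (2 * (norm w + 1))"
    have nw: "norm w + 1 > 0" by (simp add: add_nonneg_pos)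
    have t: "t > 0" using d r nw by (simp add: t_def)
    have "norm (t *\<^sub>R w) = t * norm w" using t by simp
    also have "\<dots> < t * (2 * (norm w + 1))" using t nw by (intro mult_strict_left_mono) (auto simp: add_nonneg_pos)
    also have "\<dots> = min d r" using nw by (simp add: t_def)
    finally have y: "x + t *\<^sub>R w \<in> ball x d" "x + t *\<^sub>R w \<in> ball x r" by (auto simp: dist_norm)
    have "Q ((x + t *\<^sub>R w) - x) = t *\<^sub>R axis 2 1" using linear_scale[OF lin, of t w] w by simp
    then have "x + t *\<^sub>R w \<in> ?U" using y(2) t \<psi>0 by (simp add: axis_def)
    then show False using U0 y(1) d(2) by blast
  qed
qed

lemma test_functions_H10:
  assumes G: "open G" "bounded G" and \<phi>: "\<phi> \<in> test_functions G"
  shows "\<phi> \<in> H10 G"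
  unfolding H10_def
  using H1_smooth(1)[OF G test_functionsD(1)[OF \<phi>]] \<phi> H1_norm_zero[OF G]
  by (intro CollectI conjI exI[of _ "\<lambda>_. \<phi>"]) auto

lemma AE_lebesgue_on_subset:
  assumes "AE x in lebesgue_on U. Q x" "G \<subseteq> U" "G \<in> sets lebesgue" "U \<in> sets lebesgue"
  shows "AE x in lebesgue_on G. Q x"
proof -
  have "AE x in lebesgue. x \<in> U \<longrightarrow> Q x" using assms by (simp add: AE_restrict_space_iff)
  then have "AE x in lebesgue. x \<in> G \<longrightarrow> Q x" by eventually_elim (use assms(2) in auto)
  then show ?thesis using assms by (simp add: AE_restrict_space_iff)
qed

section \<open>The mesh, the discrete setting and a single polygon\<close>

locale polygonal_mesh =
  fixes \<Omega> :: "plane set" and \<rho> :: real and \<T> :: "polygon set"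
  assumes Omega: "polygonal_lipschitz_domain \<Omega>" and rho_pos: "\<rho> > 0"
    and mesh: "mesh \<Omega> \<rho> \<T>" and hmax: "h_max \<T> \<le> 1"
begin

lemma Omega_open: "open \<Omega>" and Omega_bounded: "bounded \<Omega>"
  using Omega by (auto simp: polygonal_lipschitz_domain_def lipschitz_domain_def)

lemma Omega_sets: "\<Omega> \<in> sets lebesgue" using Omega_open by simp

lemma finite_mesh: "finite \<T>" and mesh_domain: "P \<in> \<T> \<Longrightarrow> polygonal_domain P"
  and mesh_cover: "(\<Union>P\<in>\<T>. pts P) = closure \<Omega>"
  using mesh by (auto simp: mesh_def)

lemma interior_subset_Omega: "P \<in> \<T> \<Longrightarrow> interior (pts P) \<subseteq> \<Omega>"
proof -
  assume "P \<in> \<T>"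
  then have "interior (pts P) \<subseteq> interior (closure \<Omega>)" using mesh_cover by (intro interior_mono) auto
  then show ?thesis
    using Omega lipschitz_domain_interior_closure by (auto simp: polygonal_lipschitz_domain_def)
qed

lemma mesh_diameter:
  assumes P: "P \<in> \<T>"
  shows "0 < diameter (pts P)" "diameter (pts P) \<le> 1"
proof -
  have d: "polygonal_domain P" by (rule mesh_domain[OF P])
  then have "interior (pts P) \<noteq> {}" and c: "compact (pts P)" by (auto simp: polygonal_domain_def lipschitz_domain_def)
  then obtain x e where x: "e > 0" "ball x e \<subseteq> pts P" by (metis ex_in_conv mem_interior)
  have "x \<in> pts P" "x + (e / 2) *\<^sub>R axis 1 1 \<in> pts P" using x by (auto simp: subset_iff dist_norm norm_axis_1)
  from diameter_bounded_bound[OF compact_imp_bounded[OF c] this]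
  show "0 < diameter (pts P)" using x(1) by (simp add: dist_norm norm_axis_1)
  have "diameter (pts P) \<le> h_max \<T>" unfolding h_max_def using finite_mesh P by (intro Max_ge) auto
  then show "diameter (pts P) \<le> 1" using hmax by simp
qed

lemma mesh_star:
  assumes P: "P \<in> \<T>"
  obtains z r where "star_polygon P z r" "\<rho> * diameter (pts P) \<le> r"
proof -
  obtain z r where zr: "r \<ge> \<rho> * diameter (pts P)" "ball z r \<subseteq> pts P"
    "\<forall>y\<in>ball z r. \<forall>x\<in>pts P. closed_segment y x \<subseteq> pts P"
    using mesh[unfolded mesh_def, THEN conjunct2, THEN conjunct2, THEN conjunct2, THEN conjunct2, THEN bspec, OF P, THEN conjunct1]
    by (elim exE conjE) (rule that, assumption+)
  have "r > 0" using zr(1) mesh_diameter(1)[OF P] rho_pos by (meson less_le_trans mult_pos_pos)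
  with zr mesh_domain[OF P] have "star_polygon P z r" by unfold_locales auto
  with zr(1) that show ?thesis by blast
qed

lemma edge_diameter: "P \<in> \<T> \<Longrightarrow> E \<in> edges P \<Longrightarrow> \<rho> * diameter (pts P) \<le> diameter E"
  using mesh by (auto simp: mesh_def)

end

locale vem = polygonal_mesh \<Omega> \<rho> \<T> for \<Omega> \<rho> \<T> +
  fixes A :: "plane \<Rightarrow> real^2^2" and b :: "plane \<Rightarrow> plane" and \<gamma> :: "plane \<Rightarrow> real"
    and C\<^sub>s a\<^sub>0 a\<^sub>1 M\<^sub>A M\<^sub>b M\<^sub>\<gamma> D\<^sub>A D\<^sub>b D\<^sub>\<gamma> :: real
    and S :: stabilization and f u u\<^sub>h :: "plane \<Rightarrow> real"
  assumes Cs_pos: "C\<^sub>s > 0" and coeffs: "bounded_coeffs \<Omega> A b \<gamma> M\<^sub>A M\<^sub>b M\<^sub>\<gamma>" and ell: "elliptic \<Omega> A a\<^sub>0 a\<^sub>1"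
    and A_lip: "\<And>j k. piecewise_lipschitz \<T> D\<^sub>A (\<lambda>x. A x $ j $ k)"
    and b_lip: "\<And>j. piecewise_lipschitz \<T> D\<^sub>b (\<lambda>x. b x $ j)"
    and \<gamma>_lip: "piecewise_lipschitz \<T> D\<^sub>\<gamma> \<gamma>"
    and stab: "admissible_stabilization A C\<^sub>s \<T> S"
    and f_L2: "f \<in> L2 (lebesgue_on \<Omega>)"
    and weak: "weak_solution \<Omega> A b \<gamma> f u"
    and discrete: "u\<^sub>h \<in> Vh \<Omega> \<T>"
begin

lemma u_H1: "u \<in> H1 \<Omega>" using weak by (simp add: weak_solution_def H10_def)

end

locale vem_polygon = vem + star_polygon +
  assumes P_mesh: "P \<in> \<T>" and r_rho: "\<rho> * h \<le> r"
begin

lemma h_le_1: "h \<le> 1" by (rule mesh_diameter(2)[OF P_mesh])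

lemma h_r_rho: "h / r \<le> 1 / \<rho>"
  using r_rho r_pos rho_pos by (simp add: field_simps)

lemma G_Omega: "G \<subseteq> \<Omega>" by (rule interior_subset_Omega[OF P_mesh])

lemma AE_G: "AE x in lebesgue_on \<Omega>. Q x \<Longrightarrow> AE x in lebesgue_on G. Q x"
  by (rule AE_lebesgue_on_subset[OF _ G_Omega G_sets Omega_sets])

lemma u_G: "u \<in> H1 G" "AE x in lebesgue_on G. wgrad G u x = wgrad \<Omega> u x"
  using H1_restrict[OF Omega_open Omega_bounded G_open G_Omega u_H1] by auto

lemma uh_G: "u\<^sub>h \<in> H1 G" and uh_VP: "u\<^sub>h \<in> VP P"
  using discrete P_mesh by (auto simp: Vh_def H1_broken_def)

abbreviation "p \<equiv> proj 1 P u\<^sub>h"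
abbreviation "err \<equiv> err_norm u u\<^sub>h P + err_proj u u\<^sub>h P"

lemma p_poly: "p \<in> polys 1" by (rule proj1(1)[OF H1D(1)[OF uh_G]])

lemma p_H1: "p \<in> H1 G" by (rule polys_1_H1[OF p_poly])

lemma err_nonneg: "0 \<le> err" by (simp add: add_nonneg_nonneg)

text \<open>The remainder is \<open>(u - p) - (u - u\<^sub>h)\<close>, so it is controlled by the
  two errors that the theorem allows on the right.\<close>

lemma remainder_seminorm: "H1_seminorm G (\<lambda>x. u\<^sub>h x - p x) \<le> err_semi u u\<^sub>h P + err_proj u u\<^sub>h P"
  using H1_seminorm_triangle_diff[OF GG H1_diff(1)[OF GG u_G(1) p_H1] H1_diff(1)[OF GG u_G(1) uh_G]] by simp

lemma poincare_rho:
  assumes v: "v \<in> H1 G"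
  shows "L2_norm (lebesgue_on G) (\<lambda>x. v x - mean G v) \<le> 2 / \<rho> * h * H1_seminorm G v"
proof -
  have "2 * h\<^sup>2 / r = 2 * h * (h / r)" by (simp add: power2_eq_square)
  also have "\<dots> \<le> 2 * h * (1 / \<rho>)" using h_pos by (intro mult_left_mono h_r_rho) auto
  finally have "2 * h\<^sup>2 / r * H1_seminorm G v \<le> 2 * h * (1 / \<rho>) * H1_seminorm G v" by (rule mult_right_mono) simp
  with poincare[OF v] show ?thesis by simp
qed

lemma remainder_L2: "L2_norm (lebesgue_on G) (\<lambda>x. u\<^sub>h x - p x) \<le> 2 / \<rho> * h * err"
proof -
  have "L2_norm (lebesgue_on G) (\<lambda>x. u\<^sub>h x - p x) \<le> 2 / \<rho> * h * H1_seminorm G (\<lambda>x. u\<^sub>h x - p x)"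
    using poincare_rho[OF H1_diff(1)[OF GG uh_G p_H1]] mean_minus_proj1[OF H1D(1)[OF uh_G]] by simp
  also have "\<dots> \<le> 2 / \<rho> * h * err"
    using remainder_seminorm H1_seminorm_le_norm[of G "\<lambda>x. u x - u\<^sub>h x"] rho_pos h_pos
    by (intro mult_left_mono) auto
  finally show ?thesis .
qed

text \<open>All lower order terms are measured by this norm, while only the seminorm of
  \<open>u - p\<close> is available on the right. The remainder supplies a factor \<open>h\<close>,
  which is at most one.\<close>

lemma u_minus_p: "L2_norm (lebesgue_on G) (\<lambda>x. u x - p x) \<le> (1 + 2 / \<rho>) * err"
proof -
  have "L2_norm (lebesgue_on G) (\<lambda>x. u x - p x) \<le> L2_norm (lebesgue_on G) (\<lambda>x. u x - u\<^sub>h x) + L2_norm (lebesgue_on G) (\<lambda>x. u\<^sub>h x - p x)"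
    by (rule L2_norm_triangle3[OF H1D(1)[OF u_G(1)] H1D(1)[OF uh_G] H1D(1)[OF p_H1]])
  moreover have "L2_norm (lebesgue_on G) (\<lambda>x. u x - u\<^sub>h x) \<le> err"
    using L2_le_H1_norm[of G "\<lambda>x. u x - u\<^sub>h x"] H1_norm_nonneg(2)[of G "\<lambda>x. u x - p x"] by linarith
  moreover have "2 / \<rho> * h * err \<le> 2 / \<rho> * 1 * err"
    using rho_pos h_le_1 err_nonneg by (intro mult_right_mono mult_left_mono) auto
  ultimately show ?thesis using remainder_L2 by (simp only: distrib_right mult_1)
qed

section \<open>The stabilization and flux terms\<close>

theorem zeta_efficiency:
  "(zeta S u\<^sub>h P)\<^sup>2 \<le> 2 * (C\<^sub>s * a\<^sub>1) * ((err_semi u u\<^sub>h P)\<^sup>2 + (err_proj u u\<^sub>h P)\<^sup>2)"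
proof -
  let ?w = "\<lambda>x. u\<^sub>h x - p x"
  have w: "?w \<in> VP P" by (rule VP_minus_poly[OF uh_VP p_poly])
  have wH: "?w \<in> H1 G" by (rule H1_diff(1)[OF GG uh_G p_H1])
  have spd: "0 \<le> S P ?w ?w" using stab P_mesh w by (auto simp: admissible_stabilization_def spd_form_def)
  have a1: "a\<^sub>1 > 0" using ell by (simp add: elliptic_def)
  have "S P ?w ?w \<le> C\<^sub>s * L2_inner (Leb P) (\<lambda>x. A x *v wgrad G ?w x) (wgrad G ?w)"
    using stab P_mesh w proj1_remainder[OF H1D(1)[OF uh_G]] by (simp add: admissible_stabilization_def)
  also have "L2_inner (Leb P) (\<lambda>x. A x *v wgrad G ?w x) (wgrad G ?w) \<le> a\<^sub>1 * (H1_seminorm G ?w)\<^sup>2"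
  proof -
    have "AE x in lebesgue_on G. \<forall>\<xi>. \<xi> \<bullet> (A x *v \<xi>) \<le> a\<^sub>1 * (norm \<xi>)\<^sup>2"
    proof (rule AE_G)
      have "AE x in lebesgue_on \<Omega>. transpose (A x) = A x \<and>
        (\<forall>\<xi>. a\<^sub>0 * (norm \<xi>)\<^sup>2 \<le> \<xi> \<bullet> (A x *v \<xi>) \<and> \<xi> \<bullet> (A x *v \<xi>) \<le> a\<^sub>1 * (norm \<xi>)\<^sup>2)"
        using ell unfolding elliptic_def by (elim conjE)
      then show "AE x in lebesgue_on \<Omega>. \<forall>\<xi>. \<xi> \<bullet> (A x *v \<xi>) \<le> a\<^sub>1 * (norm \<xi>)\<^sup>2"
        by (rule eventually_mono) blast
    qed
    then have ae: "AE x in lebesgue_on G. (A x *v wgrad G ?w x) \<bullet> wgrad G ?w x \<le> a\<^sub>1 * (norm (wgrad G ?w x))\<^sup>2"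
      by eventually_elim (simp add: inner_commute)
    have "(LINT x|lebesgue_on G. (A x *v wgrad G ?w x) \<bullet> wgrad G ?w x) \<le> (LINT x|lebesgue_on G. a\<^sub>1 * (norm (wgrad G ?w x))\<^sup>2)"
      by (rule integral_mono_AE'[OF _ ae]) (use L2D(2)[OF H1D(2)[OF wH]] a1 in auto)
    then show ?thesis unfolding Leb_L2_inner by (simp add: L2_inner_def H1_seminorm_def L2_norm_power2)
  qed
  finally have "S P ?w ?w \<le> C\<^sub>s * (a\<^sub>1 * (H1_seminorm G ?w)\<^sup>2)" using Cs_pos by simp
  also have "\<dots> \<le> C\<^sub>s * (a\<^sub>1 * (2 * (err_semi u u\<^sub>h P)\<^sup>2 + 2 * (err_proj u u\<^sub>h P)\<^sup>2))"
    by (intro mult_left_mono order_trans[OF power_mono[OF remainder_seminorm] two_squares]) (use Cs_pos a1 in auto)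
  also have "\<dots> = 2 * (C\<^sub>s * a\<^sub>1) * ((err_semi u u\<^sub>h P)\<^sup>2 + (err_proj u u\<^sub>h P)\<^sup>2)" by (simp add: algebra_simps)
  finally show ?thesis using spd by (simp add: zeta_def)
qed

lemma lipschitz_measurable:
  assumes "piecewise_lipschitz \<T> M c" shows "c \<in> borel_measurable (lebesgue_on G)"
proof -
  obtain L where "L-lipschitz_on G c" using assms P_mesh unfolding piecewise_lipschitz_def by blast
  then show ?thesis by (intro continuous_imp_measurable_on_sets_lebesgue lipschitz_on_continuous_on G_sets)
qed

lemma vector_measurable:
  fixes g :: "plane \<Rightarrow> plane"
  assumes "\<And>i. (\<lambda>x. g x $ i) \<in> borel_measurable M" shows "g \<in> borel_measurable M"
proof -
  have "g = (\<lambda>x. (g x $ 1) *\<^sub>R axis 1 1 + (g x $ 2) *\<^sub>R axis 2 1)"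
    by (auto simp: fun_eq_iff vec_eq_iff axis_def forall_2)
  moreover have "(\<lambda>x. (g x $ 1) *\<^sub>R axis 1 1 + (g x $ 2) *\<^sub>R (axis 2 1 :: plane)) \<in> borel_measurable M"
    using assms[of 1] assms[of 2] by measurable
  ultimately show ?thesis by simp
qed

lemma coeff_bounds: "AE x in lebesgue_on G. norm (A x) \<le> M\<^sub>A \<and> norm (b x) \<le> M\<^sub>b \<and> \<bar>\<gamma> x\<bar> \<le> M\<^sub>\<gamma>"
  by (rule AE_G) (use coeffs in \<open>simp add: bounded_coeffs_def\<close>)

text \<open>Measurability comes from Lipschitz continuity in the interior, the bound from the
  essential supremum. The absolute value appears because \<open>M\<^sub>A\<close> is not known to be
  nonnegative.\<close>

lemma A_mult:
  assumes g: "g \<in> L2 (lebesgue_on G)"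
  shows "(\<lambda>x. A x *v g x) \<in> L2 (lebesgue_on G)" "L2_norm (lebesgue_on G) (\<lambda>x. A x *v g x) \<le> \<bar>M\<^sub>A\<bar> * L2_norm (lebesgue_on G) g"
proof -
  have gm: "(\<lambda>x. g x $ k) \<in> borel_measurable (lebesgue_on G)" for k
    using g L2_vec_iff L2D(1) by blast
  have "(\<lambda>x. (A x *v g x) $ i) \<in> borel_measurable (lebesgue_on G)" for i
  proof -
    have "(\<lambda>x. A x $ i $ 1 * g x $ 1 + A x $ i $ 2 * g x $ 2) \<in> borel_measurable (lebesgue_on G)"
      using lipschitz_measurable[OF A_lip] gm by measurable
    then show ?thesis by (simp add: matrix_mult_dot inner_vec2)
  qed
  then have m: "(\<lambda>x. A x *v g x) \<in> borel_measurable (lebesgue_on G)" by (rule vector_measurable)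
  have ae: "AE x in lebesgue_on G. norm (A x *v g x) \<le> \<bar>M\<^sub>A\<bar> * norm (g x)"
    using coeff_bounds
  proof eventually_elim
    case (elim x)
    have "norm (A x *v g x) \<le> norm (A x) * norm (g x)" by (rule norm_matrix_vector_le)
    also have "\<dots> \<le> \<bar>M\<^sub>A\<bar> * norm (g x)" using elim by (intro mult_right_mono) auto
    finally show ?case .
  qed
  show "(\<lambda>x. A x *v g x) \<in> L2 (lebesgue_on G)" "L2_norm (lebesgue_on G) (\<lambda>x. A x *v g x) \<le> \<bar>M\<^sub>A\<bar> * L2_norm (lebesgue_on G) g"
    using L2_dominated[OF g m _ ae] by auto
qed

lemma b_mult:
  assumes v: "v \<in> L2 (lebesgue_on G)"
  shows "(\<lambda>x. v x *\<^sub>R b x) \<in> L2 (lebesgue_on G)" "L2_norm (lebesgue_on G) (\<lambda>x. v x *\<^sub>R b x) \<le> \<bar>M\<^sub>b\<bar> * L2_norm (lebesgue_on G) v"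
proof -
  have bm: "b \<in> borel_measurable (lebesgue_on G)"
    by (rule vector_measurable) (rule lipschitz_measurable[OF b_lip])
  have m: "(\<lambda>x. v x *\<^sub>R b x) \<in> borel_measurable (lebesgue_on G)" using bm L2D(1)[OF v] by measurable
  have ae: "AE x in lebesgue_on G. norm (v x *\<^sub>R b x) \<le> \<bar>M\<^sub>b\<bar> * norm (v x)"
    using coeff_bounds
  proof eventually_elim
    case (elim x)
    then have "\<bar>v x\<bar> * norm (b x) \<le> \<bar>v x\<bar> * \<bar>M\<^sub>b\<bar>" by (intro mult_left_mono) auto
    then show ?case by (simp add: mult.commute)
  qed
  show "(\<lambda>x. v x *\<^sub>R b x) \<in> L2 (lebesgue_on G)" "L2_norm (lebesgue_on G) (\<lambda>x. v x *\<^sub>R b x) \<le> \<bar>M\<^sub>b\<bar> * L2_norm (lebesgue_on G) v"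
    using L2_dominated[OF v m _ ae] by auto
qed

lemma \<gamma>_mult:
  assumes v: "v \<in> L2 (lebesgue_on G)"
  shows "(\<lambda>x. \<gamma> x * v x) \<in> L2 (lebesgue_on G)" "L2_norm (lebesgue_on G) (\<lambda>x. \<gamma> x * v x) \<le> \<bar>M\<^sub>\<gamma>\<bar> * L2_norm (lebesgue_on G) v"
proof -
  have m: "(\<lambda>x. \<gamma> x * v x) \<in> borel_measurable (lebesgue_on G)" using lipschitz_measurable[OF \<gamma>_lip] L2D(1)[OF v] by measurable
  have ae: "AE x in lebesgue_on G. norm (\<gamma> x * v x) \<le> \<bar>M\<^sub>\<gamma>\<bar> * norm (v x)"
    using coeff_bounds
  proof eventually_elim
    case (elim x)
    then have "\<bar>\<gamma> x\<bar> * \<bar>v x\<bar> \<le> \<bar>M\<^sub>\<gamma>\<bar> * \<bar>v x\<bar>" by (intro mult_right_mono) auto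
    then show ?case by (simp add: abs_mult)
  qed
  show "(\<lambda>x. \<gamma> x * v x) \<in> L2 (lebesgue_on G)" "L2_norm (lebesgue_on G) (\<lambda>x. \<gamma> x * v x) \<le> \<bar>M\<^sub>\<gamma>\<bar> * L2_norm (lebesgue_on G) v"
    using L2_dominated[OF v m _ ae] by auto
qed

lemma vproj0:
  assumes F: "F \<in> L2 (lebesgue_on G)"
  shows "vproj 0 P F = (\<lambda>x. \<chi> i. mean G (\<lambda>y. F y $ i))"
proof -
  have "(\<lambda>y. F y $ i) \<in> L2 (lebesgue_on G)" for i using F L2_vec_iff by blast
  then show ?thesis by (simp add: fun_eq_iff vproj_def proj0)
qed

lemma vproj0_best:
  assumes F: "F \<in> L2 (lebesgue_on G)"
  shows "L2_norm (lebesgue_on G) (\<lambda>x. F x - vproj 0 P F x) \<le> L2_norm (lebesgue_on G) (\<lambda>x. F x - c)"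
proof (rule power2_le_imp_le)
  have Fi: "(\<lambda>y. F y $ i) \<in> L2 (lebesgue_on G)" for i using F L2_vec_iff by blast
  have "L2_norm (lebesgue_on G) (\<lambda>x. F x $ i - mean G (\<lambda>y. F y $ i)) \<le> L2_norm (lebesgue_on G) (\<lambda>x. F x $ i - c $ i)" for i
    by (rule L2_norm_mean_le[OF G_bounded G_sets measure_G(1) Fi])
  then have "(L2_norm (lebesgue_on G) (\<lambda>x. F x $ i - mean G (\<lambda>y. F y $ i)))\<^sup>2 \<le> (L2_norm (lebesgue_on G) (\<lambda>x. F x $ i - c $ i))\<^sup>2" for i
    by (rule power_mono) simp
  from add_mono[OF this[of 1] this[of 2]]
  show "(L2_norm (lebesgue_on G) (\<lambda>x. F x - vproj 0 P F x))\<^sup>2 \<le> (L2_norm (lebesgue_on G) (\<lambda>x. F x - c))\<^sup>2"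
    unfolding vproj0[OF F] L2_norm_vec[OF L2_diff[OF F L2_const[OF G_finite]]]
    by (simp only: vector_minus_component vec_lambda_beta)
qed simp

abbreviation "\<sigma> \<equiv> flux \<Omega> A b u"

lemma flux_AE: "AE x in lebesgue_on G. A x *v wgrad G u x + u x *\<^sub>R b x = \<sigma> x"
  using u_G(2) by eventually_elim (simp add: flux_def)

lemma flux_L2: "\<sigma> \<in> L2 (lebesgue_on G)"
  using L2_add[OF A_mult(1)[OF H1D(2)[OF u_G(1)]] b_mult(1)[OF H1D(1)[OF u_G(1)]]] L2_cong_AE[OF G_sets flux_AE] by simp

text \<open>The discrete flux is compared with the constant that is the mean of the exact flux;
  their difference splits into \<open>A \<nabla>(p - u) + b (p - u)\<close> and the oscillation of
  the exact flux. Squaring twice gives the weights \<open>4 * K\<^sup>2\<close> and 2.\<close>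

theorem Lam_efficiency:
  "(Lam A b u\<^sub>h P)\<^sup>2 \<le> (2 + 4 * (\<bar>M\<^sub>A\<bar> + \<bar>M\<^sub>b\<bar> * (1 + 2 / \<rho>))\<^sup>2) *
    ((err_norm u u\<^sub>h P)\<^sup>2 + (err_proj u u\<^sub>h P)\<^sup>2 + (flux_osc \<sigma> P)\<^sup>2)"
proof -
  let ?M = "lebesgue_on G"
  define K where "K = \<bar>M\<^sub>A\<bar> + \<bar>M\<^sub>b\<bar> * (1 + 2 / \<rho>)"
  have K: "K \<ge> 0" using rho_pos by (simp add: K_def)
  let ?F = "\<lambda>x. A x *v wgrad G p x + p x *\<^sub>R b x"
  let ?U = "\<lambda>x. A x *v wgrad G u x + u x *\<^sub>R b x"
  have FL: "?F \<in> L2 ?M" by (intro L2_add A_mult b_mult H1D p_H1)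
  have diff: "L2_norm ?M (\<lambda>x. ?F x - \<sigma> x) \<le> K * err"
  proof -
    have g: "(\<lambda>x. wgrad G u x - wgrad G p x) \<in> L2 ?M" by (intro L2_diff H1D u_G p_H1)
    have d: "(\<lambda>x. u x - p x) \<in> L2 ?M" by (intro L2_diff H1D u_G p_H1)
    have ae: "AE x in ?M. ?F x - \<sigma> x = - (A x *v (wgrad G u x - wgrad G p x) + (u x - p x) *\<^sub>R b x)"
      using flux_AE by eventually_elim (simp add: algebra_simps matrix_vector_mult_diff_distrib)
    have "L2_norm ?M (\<lambda>x. ?F x - \<sigma> x) = L2_norm ?M (\<lambda>x. A x *v (wgrad G u x - wgrad G p x) + (u x - p x) *\<^sub>R b x)"
      using L2_norm_cong_AE[OF G_sets ae] by (simp only: L2_norm_minus)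
    also have "\<dots> \<le> L2_norm ?M (\<lambda>x. A x *v (wgrad G u x - wgrad G p x)) + L2_norm ?M (\<lambda>x. (u x - p x) *\<^sub>R b x)"
      by (rule L2_norm_triangle[OF A_mult(1)[OF g] b_mult(1)[OF d]])
    also have "\<dots> \<le> \<bar>M\<^sub>A\<bar> * L2_norm ?M (\<lambda>x. wgrad G u x - wgrad G p x) + \<bar>M\<^sub>b\<bar> * L2_norm ?M (\<lambda>x. u x - p x)"
      by (intro add_mono A_mult(2)[OF g] b_mult(2)[OF d])
    also have "L2_norm ?M (\<lambda>x. wgrad G u x - wgrad G p x) = err_proj u u\<^sub>h P"
      unfolding H1_seminorm_def using L2_norm_cong_AE[OF G_sets H1_diff(2)[OF GG u_G(1) p_H1]] by simp
    also have "\<bar>M\<^sub>A\<bar> * err_proj u u\<^sub>h P + \<bar>M\<^sub>b\<bar> * L2_norm ?M (\<lambda>x. u x - p x) \<le> \<bar>M\<^sub>A\<bar> * err + \<bar>M\<^sub>b\<bar> * ((1 + 2 / \<rho>) * err)"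
      by (intro add_mono mult_left_mono u_minus_p) auto
    also have "\<dots> = K * err" unfolding K_def by (simp only: distrib_right mult.assoc)
    finally show ?thesis .
  qed
  define c where "c = (\<chi> i. mean G (\<lambda>y. \<sigma> y $ i))"
  have "Lam A b u\<^sub>h P = L2_norm ?M (\<lambda>x. ?F x - vproj 0 P ?F x)" by (simp add: Lam_def Let_def Leb_L2_norm)
  also have "\<dots> \<le> L2_norm ?M (\<lambda>x. ?F x - c)" by (rule vproj0_best[OF FL])
  also have "\<dots> \<le> L2_norm ?M (\<lambda>x. ?F x - \<sigma> x) + L2_norm ?M (\<lambda>x. \<sigma> x - c)"
    by (rule L2_norm_triangle3[OF FL flux_L2 L2_const[OF G_finite]])
  also have "L2_norm ?M (\<lambda>x. \<sigma> x - c) = flux_osc \<sigma> P" by (simp add: Leb_L2_norm vproj0[OF flux_L2] c_def)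
  finally have "Lam A b u\<^sub>h P \<le> K * err + flux_osc \<sigma> P" using diff by simp
  then have "(Lam A b u\<^sub>h P)\<^sup>2 \<le> (K * err + flux_osc \<sigma> P)\<^sup>2"
    by (rule power_mono) (simp add: Lam_def Let_def)
  also have "\<dots> \<le> 2 * (K * err)\<^sup>2 + 2 * (flux_osc \<sigma> P)\<^sup>2" by (rule two_squares)
  also have "(K * err)\<^sup>2 \<le> K\<^sup>2 * (2 * (err_norm u u\<^sub>h P)\<^sup>2 + 2 * (err_proj u u\<^sub>h P)\<^sup>2)"
    unfolding power_mult_distrib by (intro mult_left_mono two_squares) simp
  finally have "(Lam A b u\<^sub>h P)\<^sup>2 \<le> 4 * K\<^sup>2 * ((err_norm u u\<^sub>h P)\<^sup>2 + (err_proj u u\<^sub>h P)\<^sup>2) + 2 * (flux_osc \<sigma> P)\<^sup>2"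
    by (simp add: algebra_simps)
  also have "\<dots> \<le> (2 + 4 * K\<^sup>2) * ((err_norm u u\<^sub>h P)\<^sup>2 + (err_proj u u\<^sub>h P)\<^sup>2) + (2 + 4 * K\<^sup>2) * (flux_osc \<sigma> P)\<^sup>2"
    by (intro add_mono mult_right_mono) auto
  finally show ?thesis unfolding K_def by (simp only: distrib_left)
qed

section \<open>The residual term\<close>

lemma local_integral:
  assumes "\<And>x. x \<notin> G \<Longrightarrow> k x = (0::real)"
  shows "(LINT x|lebesgue_on \<Omega>. k x) = (LINT x|lebesgue_on G. k x)"
proof -
  have "k x = 0" if "x \<notin> \<Omega>" for x using assms that G_Omega by blast
  from lebesgue_on_support[OF Omega_sets this] lebesgue_on_support[OF G_sets assms] show ?thesis by simp
qed

lemma f_G: "f \<in> L2 (lebesgue_on G)"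
  by (rule L2_subset[OF f_L2 G_Omega G_sets Omega_sets])

text \<open>A test function supported in one polygon is admissible in the global equation, and every
  integral reduces to that polygon; \<open>wgrad\<close> on \<Omega> and on the polygon agree almost
  everywhere there.\<close>

lemma local_weak_form:
  assumes \<phi>: "\<phi> \<in> test_functions G"
  shows "L2_inner (lebesgue_on G) (\<lambda>x. f x - \<gamma> x * u x) \<phi> = L2_inner (lebesgue_on G) \<sigma> (grad \<phi>)"
proof -
  let ?M = "lebesgue_on G"
  have \<phi>O: "\<phi> \<in> test_functions \<Omega>" by (rule test_functions_mono[OF \<phi> G_Omega])
  have sm: "smooth \<phi>" by (rule test_functionsD(1)[OF \<phi>])
  have out: "\<phi> x = 0" "grad \<phi> x = 0" if "x \<notin> G" for x
    using test_functions_outside[OF \<phi> that] test_functions_grad_outside[OF \<phi> that] by auto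
  have gr: "AE x in lebesgue_on \<Omega>. wgrad \<Omega> \<phi> x = grad \<phi> x" by (rule H1_smooth(2)[OF Omega_open Omega_bounded sm])
  have pL: "\<phi> \<in> L2 ?M" "grad \<phi> \<in> L2 ?M"
    by (intro continuous_L2 smooth_continuous[OF sm] smooth_continuous_grad[OF sm])+
  have fG: "f \<in> L2 ?M" by (rule f_G)
  have e: "weak_form \<Omega> A b \<gamma> u \<phi> = L2_inner (lebesgue_on \<Omega>) f \<phi>"
    using weak test_functions_H10[OF Omega_open Omega_bounded \<phi>O] by (simp add: weak_solution_def)
  have "L2_inner (lebesgue_on \<Omega>) (\<lambda>x. A x *v wgrad \<Omega> u x) (wgrad \<Omega> \<phi>) = L2_inner (lebesgue_on \<Omega>) (\<lambda>x. A x *v wgrad \<Omega> u x) (grad \<phi>)"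
    by (rule L2_inner_cong_AE_right[OF Omega_sets gr])
  also have "\<dots> = L2_inner ?M (\<lambda>x. A x *v wgrad \<Omega> u x) (grad \<phi>)"
    unfolding L2_inner_def by (rule local_integral) (simp add: out)
  also have "\<dots> = L2_inner ?M (\<lambda>x. A x *v wgrad G u x) (grad \<phi>)"
    by (rule L2_inner_cong_AE[OF G_sets]) (use u_G(2) in eventually_elim, simp)
  finally have 1: "L2_inner (lebesgue_on \<Omega>) (\<lambda>x. A x *v wgrad \<Omega> u x) (wgrad \<Omega> \<phi>) = L2_inner ?M (\<lambda>x. A x *v wgrad G u x) (grad \<phi>)" .
  have "L2_inner (lebesgue_on \<Omega>) u (\<lambda>x. b x \<bullet> wgrad \<Omega> \<phi> x) = L2_inner (lebesgue_on \<Omega>) u (\<lambda>x. b x \<bullet> grad \<phi> x)"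
    by (rule L2_inner_cong_AE_right[OF Omega_sets]) (use gr in eventually_elim, simp)
  also have "\<dots> = L2_inner ?M u (\<lambda>x. b x \<bullet> grad \<phi> x)"
    unfolding L2_inner_def by (rule local_integral) (simp add: out)
  also have "\<dots> = L2_inner ?M (\<lambda>x. u x *\<^sub>R b x) (grad \<phi>)" by (simp add: L2_inner_def)
  finally have 2: "L2_inner (lebesgue_on \<Omega>) u (\<lambda>x. b x \<bullet> wgrad \<Omega> \<phi> x) = L2_inner ?M (\<lambda>x. u x *\<^sub>R b x) (grad \<phi>)" .
  have 3: "L2_inner (lebesgue_on \<Omega>) (\<lambda>x. \<gamma> x * u x) \<phi> = L2_inner ?M (\<lambda>x. \<gamma> x * u x) \<phi>"
    "L2_inner (lebesgue_on \<Omega>) f \<phi> = L2_inner ?M f \<phi>"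
    unfolding L2_inner_def by (rule local_integral, simp add: out)+
  have 4: "L2_inner ?M (\<lambda>x. A x *v wgrad G u x) (grad \<phi>) + L2_inner ?M (\<lambda>x. u x *\<^sub>R b x) (grad \<phi>) = L2_inner ?M \<sigma> (grad \<phi>)"
    using L2_inner_add_left[OF A_mult(1)[OF H1D(2)[OF u_G(1)]] b_mult(1)[OF H1D(1)[OF u_G(1)]] pL(2)] L2_inner_cong_AE[OF G_sets flux_AE] by simp
  show ?thesis
    using e 4 L2_inner_diff_left[OF fG \<gamma>_mult(1)[OF H1D(1)[OF u_G(1)]] pL(1)] unfolding weak_form_def 1 2 3 by simp
qed

text \<open>The residual is split as \<open>(g - q) + q + \<gamma> (u - p)\<close> with
  \<open>g = f - \<gamma> u\<close> and \<open>q\<close> its affine projection. The first part is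
  the oscillation, the last is of lower order, and \<open>h\<close> times the norm of
  \<open>q\<close> is bounded by testing.\<close>

theorem eta_bound:
  "eta \<gamma> f u\<^sub>h P \<le> (1 + (16 / \<rho>) ^ 4 * exp (4/3)) * osc1 (\<lambda>x. f x - \<gamma> x * u x) P
    + (16 / \<rho>) ^ 4 * exp (4/3) * ((16 / \<rho>)\<^sup>2 + 2 * bump_grad_bound / \<rho>) * flux_osc \<sigma> P
    + \<bar>M\<^sub>\<gamma>\<bar> * (1 + 2 / \<rho>) * err"
proof -
  let ?M = "lebesgue_on G"
  \<comment> \<open>\<open>C1\<close> is the constant of \<open>bubble_norm\<close> and
    \<open>C2\<close> that of \<open>bubble_grad\<close>, with \<open>h / r\<close> replaced by
    \<open>1 / \<rho>\<close>.\<close>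
  define C1 where "C1 = (16 / \<rho>) ^ 4 * exp (4/3 :: real)"
  define C2 where "C2 = (16 / \<rho>)\<^sup>2 + 2 * bump_grad_bound / \<rho>"
  have C: "C1 \<ge> 0" "C2 \<ge> 0" using rho_pos bump_grad_bound by (auto simp: C1_def C2_def)
  define g where "g x = f x - \<gamma> x * u x" for x
  have gL: "g \<in> L2 ?M" unfolding g_def by (intro L2_diff f_G \<gamma>_mult H1D u_G)
  define q where "q = proj 1 P g"
  have q: "q \<in> polys 1" unfolding q_def by (rule proj1(1)[OF gL])
  note qL = polys_1_L2[OF q]
  have osc: "osc1 g P = h * L2_norm ?M (\<lambda>x. g x - q x)" by (simp add: osc1_def Leb_L2_norm q_def)
  let ?\<phi> = "\<lambda>x. bubble x * q x"
  have \<phi>: "?\<phi> \<in> test_functions G"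
    using test_functions_mult[OF polys_1_smooth[OF q] bubble_test] by (simp add: mult.commute)
  have \<phi>L: "?\<phi> \<in> L2 ?M" "grad ?\<phi> \<in> L2 ?M"
    by (intro continuous_L2 smooth_continuous smooth_continuous_grad test_functionsD(1)[OF \<phi>])+
  have n\<phi>: "L2_norm ?M ?\<phi> \<le> L2_norm ?M q"
    using L2_dominated(2)[OF qL L2D(1)[OF \<phi>L(1)], of 1] bubble_range
    by (simp add: abs_mult mult_left_le_one_le)
  have hr: "0 \<le> h / r" using h_pos r_pos by simp
  have k: "16 * h / r \<le> 16 / \<rho>" using h_r_rho by simp
  have ng: "h * L2_norm ?M (grad ?\<phi>) \<le> C2 * L2_norm ?M q"
  proof -
    have "(16 * h / r)\<^sup>2 + 2 * bump_grad_bound * h / r \<le> C2"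
    proof -
      have "(16 * h / r)\<^sup>2 \<le> (16 / \<rho>)\<^sup>2" using hr by (intro power_mono k) simp
      moreover have "2 * bump_grad_bound * (h / r) \<le> 2 * bump_grad_bound * (1 / \<rho>)"
        using bump_grad_bound by (intro mult_left_mono h_r_rho) simp
      ultimately show ?thesis by (simp add: C2_def)
    qed
    then show ?thesis using bubble_grad[OF q] by (meson L2_norm_nonneg mult_right_mono order_trans)
  qed
  define c where "c = (\<chi> i. mean G (\<lambda>y. \<sigma> y $ i))"
  have fo: "flux_osc \<sigma> P = L2_norm ?M (\<lambda>x. \<sigma> x - c)" by (simp add: Leb_L2_norm vproj0[OF flux_L2] c_def)
  \<comment> \<open>Because the test function has a gradient with mean zero, the mean of the exact
    flux can be subtracted, which leaves only its oscillation.\<close>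
  have "L2_inner ?M (\<lambda>x. c) (grad ?\<phi>) = 0"
  proof -
    have "(LINT x|?M. grad ?\<phi> x $ i) = 0" for i
      using integral_grad_test[OF \<phi>] lebesgue_on_support[OF G_sets, of "\<lambda>x. grad ?\<phi> x $ i"] test_functions_grad_outside[OF \<phi>] by simp
    moreover have "integrable ?M (\<lambda>x. grad ?\<phi> x $ i)" for i
      using L2_integrable[OF _ G_finite] \<phi>L(2) L2_vec_iff by blast
    ultimately show ?thesis by (simp add: L2_inner_def inner_vec2)
  qed
  then have "L2_inner ?M g ?\<phi> = L2_inner ?M (\<lambda>x. \<sigma> x - c) (grad ?\<phi>)"
    using local_weak_form[OF \<phi>] L2_inner_diff_left[OF flux_L2 L2_const[OF G_finite] \<phi>L(2), of c] by (simp add: g_def[abs_def])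
  also have "\<dots> \<le> flux_osc \<sigma> P * L2_norm ?M (grad ?\<phi>)"
    using L2_Cauchy_Schwarz[OF L2_diff[OF flux_L2 L2_const[OF G_finite, of c]] \<phi>L(2)] by (simp add: fo)
  finally have 1: "L2_inner ?M g ?\<phi> \<le> flux_osc \<sigma> P * L2_norm ?M (grad ?\<phi>)" .
  have 2: "- L2_inner ?M (\<lambda>x. g x - q x) ?\<phi> \<le> L2_norm ?M (\<lambda>x. g x - q x) * L2_norm ?M ?\<phi>"
    using L2_Cauchy_Schwarz[OF L2_diff[OF gL qL] \<phi>L(1)] by simp
  have "L2_inner ?M q ?\<phi> = L2_inner ?M g ?\<phi> - L2_inner ?M (\<lambda>x. g x - q x) ?\<phi>"
    using L2_inner_diff_left[OF gL qL \<phi>L(1)] by simp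
  with 1 2 have 3: "L2_inner ?M q ?\<phi> \<le> L2_norm ?M (\<lambda>x. g x - q x) * L2_norm ?M ?\<phi> + flux_osc \<sigma> P * L2_norm ?M (grad ?\<phi>)" by simp
  have fo0: "0 \<le> flux_osc \<sigma> P" by simp
  have "h * L2_inner ?M q ?\<phi> \<le> h * (L2_norm ?M (\<lambda>x. g x - q x) * L2_norm ?M ?\<phi> + flux_osc \<sigma> P * L2_norm ?M (grad ?\<phi>))"
    using h_pos by (intro mult_left_mono 3) auto
  also have "\<dots> = osc1 g P * L2_norm ?M ?\<phi> + flux_osc \<sigma> P * (h * L2_norm ?M (grad ?\<phi>))"
    by (simp add: osc distrib_left)
  also have "\<dots> \<le> osc1 g P * L2_norm ?M q + flux_osc \<sigma> P * (C2 * L2_norm ?M q)"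
    using h_pos by (intro add_mono mult_left_mono n\<phi> ng fo0) (simp add: osc)
  finally have 4: "h * L2_inner ?M q ?\<phi> \<le> (osc1 g P + C2 * flux_osc \<sigma> P) * L2_norm ?M q" by (simp add: algebra_simps)
  have ip: "0 \<le> L2_inner ?M q ?\<phi>"
    unfolding L2_inner_def
  proof (rule integral_nonneg_AE, rule AE_I2)
    fix x
    have "0 \<le> bubble x * (q x * q x)" by (rule mult_nonneg_nonneg[OF bubble_range(1)]) simp
    then show "0 \<le> q x \<bullet> (bubble x * q x)" by (simp add: mult_ac)
  qed
  have "(L2_norm ?M q)\<^sup>2 \<le> C1 * L2_inner ?M q ?\<phi>"
  proof -
    have "(16 * h / r) ^ 4 * exp (4/3) * L2_inner ?M q ?\<phi> \<le> C1 * L2_inner ?M q ?\<phi>"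
      unfolding C1_def using hr by (intro mult_right_mono power_mono k ip) auto
    with bubble_norm[OF q] show ?thesis by simp
  qed
  then have "h * (L2_norm ?M q)\<^sup>2 \<le> h * (C1 * L2_inner ?M q ?\<phi>)" using h_pos by (intro mult_left_mono) auto
  also have "\<dots> = C1 * (h * L2_inner ?M q ?\<phi>)" by simp
  also have "\<dots> \<le> C1 * ((osc1 g P + C2 * flux_osc \<sigma> P) * L2_norm ?M q)" using C by (intro mult_left_mono 4) auto
  finally have 5: "(h * L2_norm ?M q) * L2_norm ?M q \<le> (C1 * (osc1 g P + C2 * flux_osc \<sigma> P)) * L2_norm ?M q"
    by (simp add: power2_eq_square mult_ac)
  have osc0: "0 \<le> osc1 g P" using h_pos by (simp add: osc)
  \<comment> \<open>One factor of the norm of \<open>q\<close> is cancelled; if it is zero the bound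
    holds by nonnegativity of the right side.\<close>
  have 6: "h * L2_norm ?M q \<le> C1 * (osc1 g P + C2 * flux_osc \<sigma> P)"
  proof (cases "L2_norm ?M q = 0")
    case True
    then show ?thesis using C osc0 fo0 by (simp only:) simp
  next
    case False
    then have "0 < L2_norm ?M q" using L2_norm_nonneg[of ?M q] by linarith
    with 5 show ?thesis by (rule mult_right_le_imp_le)
  qed
  have d: "(\<lambda>x. u x - p x) \<in> L2 ?M" by (intro L2_diff H1D u_G p_H1)
  have e: "(\<lambda>x. f x - \<gamma> x * p x) = (\<lambda>x. ((g x - q x) + q x) + \<gamma> x * (u x - p x))"
    by (simp add: g_def fun_eq_iff algebra_simps)
  have "L2_norm ?M (\<lambda>x. f x - \<gamma> x * p x) \<le> L2_norm ?M (\<lambda>x. (g x - q x) + q x) + L2_norm ?M (\<lambda>x. \<gamma> x * (u x - p x))"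
    unfolding e by (intro L2_norm_triangle L2_add L2_diff gL qL \<gamma>_mult(1)[OF d])
  also have "L2_norm ?M (\<lambda>x. (g x - q x) + q x) \<le> L2_norm ?M (\<lambda>x. g x - q x) + L2_norm ?M q"
    by (intro L2_norm_triangle L2_diff gL qL)
  also have "L2_norm ?M (\<lambda>x. \<gamma> x * (u x - p x)) \<le> \<bar>M\<^sub>\<gamma>\<bar> * ((1 + 2 / \<rho>) * err)"
    by (rule order_trans[OF \<gamma>_mult(2)[OF d] mult_left_mono[OF u_minus_p abs_ge_zero]])
  finally have 7: "L2_norm ?M (\<lambda>x. f x - \<gamma> x * p x) \<le> L2_norm ?M (\<lambda>x. g x - q x) + L2_norm ?M q + \<bar>M\<^sub>\<gamma>\<bar> * ((1 + 2 / \<rho>) * err)" by simp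
  have "eta \<gamma> f u\<^sub>h P = h * L2_norm ?M (\<lambda>x. f x - \<gamma> x * p x)" by (simp add: eta_def Leb_L2_norm)
  also have "\<dots> \<le> h * (L2_norm ?M (\<lambda>x. g x - q x) + L2_norm ?M q + \<bar>M\<^sub>\<gamma>\<bar> * ((1 + 2 / \<rho>) * err))"
    using h_pos by (intro mult_left_mono 7) auto
  also have "\<dots> = osc1 g P + h * L2_norm ?M q + h * (\<bar>M\<^sub>\<gamma>\<bar> * ((1 + 2 / \<rho>) * err))" by (simp only: osc distrib_left)
  also have "\<dots> \<le> osc1 g P + C1 * (osc1 g P + C2 * flux_osc \<sigma> P) + 1 * (\<bar>M\<^sub>\<gamma>\<bar> * ((1 + 2 / \<rho>) * err))"
    using err_nonneg rho_pos h_le_1 by (intro add_mono mult_right_mono 6 mult_nonneg_nonneg order_refl) auto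
  also have "\<dots> = (1 + C1) * osc1 g P + C1 * C2 * flux_osc \<sigma> P + \<bar>M\<^sub>\<gamma>\<bar> * (1 + 2 / \<rho>) * err"
    by (simp only: distrib_left distrib_right mult_1 mult.assoc)
  finally show ?thesis unfolding C1_def C2_def g_def[abs_def] by (simp only: mult.assoc)
qed

end

section \<open>Edges of a mesh\<close>

lemma edge_infinite:
  assumes "polygonal_domain P" "E \<in> edges P" shows "infinite E"
  using edge_nodes[OF assms] by (metis finite_closed_segment)

lemma nodes_subset_frontier:
  assumes "polygonal_domain P" shows "set (nodes P) \<subseteq> frontier (pts P)"
proof
  fix x assume "x \<in> set (nodes P)"
  then obtain i where i: "i < length (nodes P)" "x = nodes P ! i" by (metis in_set_conv_nth)
  then have "x \<in> closed_segment (nodes P ! i) (nodes P ! (Suc i mod length (nodes P)))" by simp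
  moreover have "closed_segment (nodes P ! i) (nodes P ! (Suc i mod length (nodes P))) \<in> edges P"
    using i(1) by (auto simp: edges_def)
  ultimately show "x \<in> frontier (pts P)" unfolding frontier_edges[OF assms] by blast
qed

context polygonal_mesh
begin

lemma mesh_intersection:
  assumes "P \<in> \<T>" "P' \<in> \<T>" "P \<noteq> P'"
  obtains F N where "F \<subseteq> edges P \<inter> edges P'" "N \<subseteq> set (nodes P) \<inter> set (nodes P')" "pts P \<inter> pts P' = \<Union>F \<union> N"
  using mesh[unfolded mesh_def, THEN conjunct2, THEN conjunct2, THEN conjunct2, THEN conjunct1, THEN bspec, OF assms(1), THEN bspec, OF assms(2)] assms(3)
  by (elim impE exE conjE) (assumption, rule that, assumption+)

lemma mesh_intersection_frontier:
  assumes P: "P \<in> \<T>" "P' \<in> \<T>" "P \<noteq> P'"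
  shows "pts P \<inter> pts P' \<subseteq> frontier (pts P)"
proof -
  obtain F N where F: "F \<subseteq> edges P \<inter> edges P'" "N \<subseteq> set (nodes P) \<inter> set (nodes P')" "pts P \<inter> pts P' = \<Union>F \<union> N"
    by (rule mesh_intersection[OF P])
  have "\<Union>F \<subseteq> frontier (pts P)" unfolding frontier_edges[OF mesh_domain[OF P(1)]] using F(1) by blast
  then show ?thesis using F nodes_subset_frontier[OF mesh_domain[OF P(1)]] by blast
qed

lemma edge_subset_frontier: "P \<in> \<T> \<Longrightarrow> E \<in> edges P \<Longrightarrow> E \<subseteq> frontier (pts P)"
  unfolding frontier_edges[OF mesh_domain] by blast

lemma frontier_subset_pts: "P \<in> \<T> \<Longrightarrow> frontier (pts P) \<subseteq> pts P"
  using mesh_domain by (auto simp: polygonal_domain_def intro: frontier_subset_compact[THEN subsetD])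

text \<open>\<open>sharing\<close> asks only for inclusion in the frontier. The two polygons meet in
  common edges and nodes; an edge not among these common edges meets them in finitely many points,
  whereas \<open>E\<close> is infinite.\<close>

lemma sharing_edge:
  assumes P: "P \<in> \<T>" "E \<in> edges P" and P': "P' \<in> \<T>" "E \<subseteq> frontier (pts P')"
  shows "E \<in> edges P'"
proof (cases "P = P'")
  case True then show ?thesis using P by simp
next
  case False
  obtain F N where F: "F \<subseteq> edges P \<inter> edges P'" "N \<subseteq> set (nodes P) \<inter> set (nodes P')" "pts P \<inter> pts P' = \<Union>F \<union> N"
    by (rule mesh_intersection[OF P(1) P'(1) False])
  have "E \<subseteq> \<Union>F \<union> N"
    using F(3) edge_subset_frontier[OF P] frontier_subset_pts[OF P(1)] P'(2) frontier_subset_pts[OF P'(1)] by blast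
  then have sub: "E \<subseteq> (\<Union>E'\<in>F. E \<inter> E') \<union> N" by blast
  have "E \<in> F"
  proof (rule ccontr)
    assume nF: "E \<notin> F"
    have "finite (\<Union>E'\<in>F. E \<inter> E')"
    proof (rule finite_UN_I)
      show "finite F" using F(1) finite_edges[OF mesh_domain[OF P(1)]] finite_subset by blast
      show "finite (E \<inter> E')" if "E' \<in> F" for E'
        using edges_inter_finite[OF mesh_domain[OF P(1)] P(2), of E'] that F(1) nF by blast
    qed
    moreover have "finite N" using F(2) finite_subset by blast
    ultimately have "finite E" using finite_subset[OF sub] by simp
    then show False using edge_infinite[OF mesh_domain[OF P(1)] P(2)] by simp
  qed
  then show ?thesis using F(1) by blast
qed

lemma sharing_edges: "P \<in> \<T> \<Longrightarrow> E \<in> edges P \<Longrightarrow> P' \<in> sharing \<T> E \<Longrightarrow> P' \<in> \<T> \<and> E \<in> edges P'"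
  using sharing_edge by (auto simp: sharing_def)

lemma self_sharing: "P \<in> \<T> \<Longrightarrow> E \<in> edges P \<Longrightarrow> P \<in> sharing \<T> E"
  using edge_subset_frontier by (auto simp: sharing_def)

text \<open>Two polygons with a common edge lie on different sides of it, as otherwise the triangles spanned
  by the edge and the two centres would overlap.\<close>

lemma opposite_sides:
  assumes P: "P1 \<in> \<T>" "P2 \<in> \<T>" "P1 \<noteq> P2" and E: "closed_segment a b \<in> edges P1" "closed_segment a b \<in> edges P2" "a \<noteq> b"
    and s1: "star_polygon P1 z1 r1" and s2: "star_polygon P2 z2 r2"
  shows "cross (a - z1) (b - a) * cross (a - z2) (b - a) < 0"
proof (rule ccontr)
  interpret S1: star_polygon P1 z1 r1 by (rule s1)
  interpret S2: star_polygon P2 z2 r2 by (rule s2)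
  assume nl: "\<not> ?thesis"
  let ?d = "b - a"
  define m where "m = midpoint a b"
  define v where "v = z1 - m"
  define w where "w = z2 - m"
  have z12: "z1 \<in> ball z1 r1" "z2 \<in> ball z2 r2" using S1.r_pos S2.r_pos by auto
  have am: "cross (m - a) ?d = 0" by (simp add: m_def midpoint_def cross_def field_simps)
  have cv: "cross (a - z1) ?d = - cross v ?d" "cross (a - z2) ?d = - cross w ?d"
    using am by (simp_all add: v_def w_def cross_def algebra_simps)
  have nz: "cross v ?d \<noteq> 0" "cross w ?d \<noteq> 0"
    using S1.cross_nonzero[OF S1.edge_subset[OF E(1)] E(3) z12(1)] S2.cross_nonzero[OF S2.edge_subset[OF E(2)] E(3) z12(2)] cv by auto
  have pos: "cross v ?d * cross w ?d > 0" using nl nz unfolding cv by (simp add: zero_less_mult_iff mult_less_0_iff not_less) linarith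
  \<comment> \<open>If both centres are on the same side, their positions relative to the midpoint
    satisfy \<open>v = \<alpha> w + \<beta> (b - a)\<close> with
    \<open>\<alpha> > 0\<close>.\<close>
  define \<alpha> where "\<alpha> = cross v ?d / cross w ?d"
  have \<alpha>: "\<alpha> > 0" using pos by (auto simp: \<alpha>_def zero_less_divide_iff zero_less_mult_iff)
  have "cross (v - \<alpha> *\<^sub>R w) ?d = cross v ?d - \<alpha> * cross w ?d" by (simp add: cross_def algebra_simps)
  then have "cross (v - \<alpha> *\<^sub>R w) ?d = 0" using nz by (simp add: \<alpha>_def)
  then obtain \<beta> where \<beta>: "v - \<alpha> *\<^sub>R w = \<beta> *\<^sub>R ?d" using cross_zero_parallel E(3) by fastforce
  then have veq: "v = \<alpha> *\<^sub>R w + \<beta> *\<^sub>R ?d" by (simp add: algebra_simps)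
  define k where "k = 1 + \<alpha> + \<bar>\<beta>\<bar>"
  \<comment> \<open>Small enough that moving by \<epsilon> along \<open>v\<close> from the midpoint
    of the edge can be matched by a point of the second triangle whose base point is still on the
    edge.\<close>
  define \<epsilon> where "\<epsilon> = 1 / (4 * k)"
  have k: "k \<ge> 1" "\<alpha> \<le> k" "\<bar>\<beta>\<bar> \<le> k" using \<alpha> by (auto simp: k_def)
  have \<epsilon>: "0 < \<epsilon>" "\<epsilon> \<le> 1/4" "\<epsilon> * \<alpha> \<le> 1/4" "\<bar>\<epsilon> * \<beta>\<bar> \<le> 1/4"
    using k by (auto simp: \<epsilon>_def abs_mult field_simps)
  define y where "y = m + \<epsilon> *\<^sub>R v"
  have mE: "m \<in> closed_segment a b" by (simp add: m_def)
  have "y = z1 + (1 - \<epsilon>) *\<^sub>R (m - z1)" by (simp add: y_def v_def algebra_simps)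
  moreover have "m \<in> pts P1" using mE S1.edge_subset[OF E(1)] S1.frontier_subset_P by blast
  ultimately have y1: "y \<in> interior (pts P1)" using S1.segment_interior[OF z12(1), of m "1 - \<epsilon>"] \<epsilon> by simp
  \<comment> \<open>\<open>q\<close> is where the line from \<open>z2\<close> through
    \<open>y\<close> meets the edge line; solving
    \<open>y = (1 - \<epsilon> \<alpha>) q + \<epsilon> \<alpha> z2\<close> gives this
    \<open>t\<close>, and \<open>|t| \<le> 1/2\<close> puts \<open>q\<close> on the edge.\<close>
  define t where "t = \<epsilon> * \<beta> / (1 - \<epsilon> * \<alpha>)"
  have den: "1 - \<epsilon> * \<alpha> \<ge> 3/4" using \<epsilon>(3) by simp
  have t: "\<bar>t\<bar> \<le> 1/2"
  proof -
    have "\<bar>t\<bar> = \<bar>\<epsilon> * \<beta>\<bar> / (1 - \<epsilon> * \<alpha>)" using den by (simp add: t_def)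
    also have "\<dots> \<le> (1/4) / (3/4)" by (rule frac_le) (use den \<epsilon> in auto)
    finally show ?thesis by simp
  qed
  define q where "q = m + t *\<^sub>R ?d"
  have "q = (1 - (1/2 + t)) *\<^sub>R a + (1/2 + t) *\<^sub>R b"
    by (simp add: q_def m_def midpoint_def vec_eq_iff field_simps)
  then have "q \<in> closed_segment a b" using t by (auto simp: closed_segment_def intro!: exI[of _ "1/2 + t"])
  then have q2: "q \<in> pts P2" using S2.edge_subset[OF E(2)] S2.frontier_subset_P by blast
  have td: "(1 - \<epsilon> * \<alpha>) * t = \<epsilon> * \<beta>" using den by (simp add: t_def)
  have "(1 - \<epsilon> * \<alpha>) *\<^sub>R q + (\<epsilon> * \<alpha>) *\<^sub>R z2 = (1 - \<epsilon> * \<alpha>) *\<^sub>R m + ((1 - \<epsilon> * \<alpha>) * t) *\<^sub>R ?d + (\<epsilon> * \<alpha>) *\<^sub>R z2"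
    by (simp add: q_def scaleR_add_right)
  also have "\<dots> = y" unfolding td y_def veq by (simp add: w_def algebra_simps)
  finally have "y \<in> closed_segment q z2" using \<epsilon> \<alpha>
    by (auto simp: closed_segment_def intro!: exI[of _ "\<epsilon> * \<alpha>"])
  then have y2: "y \<in> pts P2" using S2.star_P[OF z12(2) q2] by (simp add: closed_segment_commute subset_iff)
  have "y \<in> frontier (pts P1)" using mesh_intersection_frontier[OF P] y1 y2 interior_subset by blast
  then show False using y1 by (simp add: frontier_def)
qed

text \<open>Three polygons at one edge would give three nonzero numbers that have pairwise opposite
  signs.\<close>

lemma at_most_two:
  assumes "P1 \<in> \<T>" "P2 \<in> \<T>" "P3 \<in> \<T>" "P1 \<noteq> P2" "P1 \<noteq> P3" "E \<in> edges P1" "E \<in> edges P2" "E \<in> edges P3"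
  shows "P2 = P3"
proof (rule ccontr)
  assume n: "P2 \<noteq> P3"
  obtain a b where E: "E = closed_segment a b" "a \<noteq> b" using edge_nodes[OF mesh_domain[OF assms(1)] assms(6)] by metis
  obtain z1 r1 where s1: "star_polygon P1 z1 r1" using mesh_star[OF assms(1)] by metis
  obtain z2 r2 where s2: "star_polygon P2 z2 r2" using mesh_star[OF assms(2)] by metis
  obtain z3 r3 where s3: "star_polygon P3 z3 r3" using mesh_star[OF assms(3)] by metis
  note o = opposite_sides[where a = a and b = b, OF _ _ _ _ _ E(2)]
  have "cross (a - z1) (b - a) * cross (a - z2) (b - a) < 0" by (rule o[OF assms(1,2,4) _ _ s1 s2]) (use assms E in auto)
  moreover have "cross (a - z1) (b - a) * cross (a - z3) (b - a) < 0" by (rule o[OF assms(1,3,5) _ _ s1 s3]) (use assms E in auto)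
  moreover have "cross (a - z2) (b - a) * cross (a - z3) (b - a) < 0" by (rule o[OF assms(2,3) n _ _ s2 s3]) (use assms E in auto)
  ultimately show False by (auto simp: mult_less_0_iff)
qed

text \<open>Guarantees that the choice of a pair in \<open>jump\<close> succeeds. A generic point of
  \<open>E\<close> inside \<Omega>, away from nodes and other edges, must belong to a second
  polygon, and the structure of intersections then forces that polygon to have the entire
  edge.\<close>

lemma interior_edge_sharing:
  assumes P: "P \<in> \<T>" and E: "E \<in> edges P" and nf: "\<not> E \<subseteq> frontier \<Omega>"
  shows "\<exists>Q Q'. Q \<noteq> Q' \<and> sharing \<T> E = {Q, Q'}"
proof -
  note dom = mesh_domain[OF P]
  obtain x0 where x0: "x0 \<in> E" "x0 \<notin> frontier \<Omega>" using nf by blast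
  have "E \<subseteq> closure \<Omega>" using edge_subset_frontier[OF P E] frontier_subset_pts[OF P] mesh_cover P by blast
  then have "x0 \<in> \<Omega>" using x0 Omega_open by (auto simp: frontier_def interior_open)
  then obtain e where e: "e > 0" "ball x0 e \<subseteq> \<Omega>" using Omega_open openE by blast
  obtain a b where ab: "a \<noteq> b" "E = closed_segment a b" by (rule edge_nodes[OF dom E])
  \<comment> \<open>A nondegenerate segment is perfect, so infinitely many of its points lie near
    \<open>x0\<close> in \<Omega>, and the finite exceptional set can be avoided.\<close>
  have "x0 islimpt E"
    by (rule connected_imp_perfect) (use x0 ab in \<open>auto simp: closed_segment_eq_sing\<close>)
  then have inf: "infinite (E \<inter> ball x0 e)" using e(1) islimpt_eq_infinite_ball by blast
  define B where "B = (\<Union>E'\<in>edges P - {E}. E \<inter> E') \<union> set (nodes P)"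
  have "finite B" unfolding B_def
    by (intro finite_UnI finite_UN_I) (use finite_edges[OF dom] edges_inter_finite[OF dom E] in auto)
  with inf have "\<not> E \<inter> ball x0 e \<subseteq> B" using finite_subset by blast
  then obtain x where x: "x \<in> E" "x \<in> \<Omega>" "x \<notin> B" using e(2) by blast
  have xP: "x \<in> frontier (pts P)" using x(1) edge_subset_frontier[OF P E] by blast
  \<comment> \<open>Otherwise \<Omega> minus the other polygons would be an open neighbourhood of
    \<open>x\<close> contained in \<open>P\<close>, but \<open>x\<close> is a frontier
    point.\<close>
  have "\<exists>P'\<in>\<T>. P' \<noteq> P \<and> x \<in> pts P'"
  proof (rule ccontr)
    assume no: "\<not> ?thesis"
    let ?C = "\<Union>P'\<in>\<T> - {P}. pts P'"
    have "closed ?C"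
      using finite_mesh mesh_domain by (intro closed_UN) (auto simp: polygonal_domain_def compact_imp_closed)
    then have "open (\<Omega> - ?C)" using Omega_open by (rule open_Diff[rotated])
    moreover have "\<Omega> - ?C \<subseteq> pts P" using mesh_cover closure_subset[of \<Omega>] by blast
    moreover have "x \<in> \<Omega> - ?C" using no x(2) by blast
    ultimately have "x \<in> interior (pts P)" using interior_maximal by blast
    then show False using xP by (simp add: frontier_def)
  qed
  then obtain P' where P': "P' \<in> \<T>" "P' \<noteq> P" "x \<in> pts P'" by blast
  obtain F N where F: "F \<subseteq> edges P \<inter> edges P'" "N \<subseteq> set (nodes P) \<inter> set (nodes P')" "pts P \<inter> pts P' = \<Union>F \<union> N"
    using mesh_intersection[OF P P'(1)] P'(2) by metis
  have "x \<in> \<Union>F \<union> N" using F(3) P'(3) xP frontier_subset_pts[OF P] by blast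
  moreover have "x \<notin> N" using x(3) F(2) by (auto simp: B_def)
  ultimately obtain E' where E': "E' \<in> F" "x \<in> E'" by blast
  have "E' = E" using E' F(1) x by (auto simp: B_def)
  then have EP': "E \<in> edges P'" using E' F(1) by blast
  have "sharing \<T> E = {P, P'}"
  proof (rule equalityI)
    show "{P, P'} \<subseteq> sharing \<T> E" using self_sharing[OF P E] self_sharing[OF P'(1) EP'] by blast
    show "sharing \<T> E \<subseteq> {P, P'}"
    proof
      fix Q assume "Q \<in> sharing \<T> E"
      then have Q: "Q \<in> \<T>" "E \<in> edges Q" using sharing_edges[OF P E] by auto
      show "Q \<in> {P, P'}"
        using at_most_two[OF P P'(1) Q(1) _ _ E EP' Q(2)] P'(2) by (cases "P = Q") auto
    qed
  qed
  then show ?thesis using P'(2) by metis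
qed

end

section \<open>Efficiency of the jumps\<close>

lemma L2_norm_subset:
  fixes f :: "plane \<Rightarrow> 'b::euclidean_space"
  assumes f: "f \<in> L2 (lebesgue_on U)" and sub: "G \<subseteq> U" and sets: "G \<in> sets lebesgue" "U \<in> sets lebesgue"
  shows "L2_norm (lebesgue_on G) f \<le> L2_norm (lebesgue_on U) f"
proof (rule power2_le_imp_le)
  have i: "integrable lebesgue (\<lambda>x. indicator U x *\<^sub>R (norm (f x))\<^sup>2)"
    using L2D(2)[OF f] sets by (simp add: integrable_restrict_space)
  have j: "integrable lebesgue (\<lambda>x. indicator G x *\<^sub>R (norm (f x))\<^sup>2)"
    using L2D(2)[OF L2_subset[OF assms]] sets by (simp add: integrable_restrict_space)
  have "(LINT x|lebesgue. indicator G x *\<^sub>R (norm (f x))\<^sup>2) \<le> (LINT x|lebesgue. indicator U x *\<^sub>R (norm (f x))\<^sup>2)"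
    by (rule integral_mono[OF j i]) (use sub in \<open>auto simp: indicator_def\<close>)
  then show "(L2_norm (lebesgue_on G) f)\<^sup>2 \<le> (L2_norm (lebesgue_on U) f)\<^sup>2"
    using sets by (simp add: L2_norm_power2 integral_restrict_space)
qed simp

lemma H1_norm_subset:
  assumes U: "open U" "bounded U" and G: "open G" "G \<subseteq> U" and v: "v \<in> H1 U"
  shows "H1_norm G v \<le> H1_norm U v"
proof -
  have s: "G \<in> sets lebesgue" "U \<in> sets lebesgue" using U G by auto
  have "H1_seminorm G v = L2_norm (lebesgue_on G) (wgrad U v)"
    unfolding H1_seminorm_def by (rule L2_norm_cong_AE[OF s(1) H1_restrict(2)[OF U G v]])
  also have "\<dots> \<le> H1_seminorm U v"
    unfolding H1_seminorm_def by (rule L2_norm_subset[OF H1D(2)[OF v] G(2) s])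
  finally have "(H1_seminorm G v)\<^sup>2 \<le> (H1_seminorm U v)\<^sup>2" by (rule power_mono) simp
  moreover have "(L2_norm (lebesgue_on G) v)\<^sup>2 \<le> (L2_norm (lebesgue_on U) v)\<^sup>2"
    by (rule power_mono[OF L2_norm_subset[OF H1D(1)[OF v] G(2) s]]) simp
  ultimately show ?thesis unfolding H1_norm_def by (intro real_sqrt_le_mono add_mono)
qed

context vem_polygon
begin

text \<open>The 12 is the 3 of the trace inequality times the squared Poincare constant
  \<open>2 / \<rho>\<close>. One factor \<open>h / r\<close> is absorbed into
  \<open>1 / \<rho>\<close>; the remaining \<open>h\<close> balances the weight of the jump.\<close>

lemma trace_poincare:
  assumes v: "v \<in> H1 G" and E: "E \<in> edges P"
  shows "L2_norm (edge_measure E) (\<lambda>x. trace P E v x - mean G v) \<le> sqrt ((12 / \<rho>\<^sup>2 + 1) / \<rho> * h) * H1_seminorm G v"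
proof (rule power2_le_imp_le)
  let ?N = "edge_measure E" and ?m = "mean G v"
  have c: "smooth (\<lambda>x. ?m)" by (rule smooth_const)
  have w: "(\<lambda>x. v x - ?m) \<in> H1 G" by (rule H1_diff(1)[OF GG v smooth_H1[OF c]])
  have ae: "AE x in ?N. trace P E (\<lambda>x. v x - ?m) x = trace P E v x - ?m"
    using trace_diff[OF v smooth_H1[OF c] E] trace_smooth[OF c E] by eventually_elim simp
  have sem: "H1_seminorm G (\<lambda>x. v x - ?m) = H1_seminorm G v"
    unfolding H1_seminorm_def
    by (rule L2_norm_cong_AE[OF G_sets]) (use H1_diff(2)[OF GG v smooth_H1[OF c]] H1_smooth(2)[OF GG c] in eventually_elim, simp)
  have e: "L2_norm ?N (\<lambda>x. trace P E v x - ?m) = L2_norm ?N (trace P E (\<lambda>x. v x - ?m))"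
    unfolding L2_norm_def
    by (intro arg_cong[where f = sqrt] integral_cong_AE)
      (use ae L2D(1)[OF trace_L2[OF v E]] L2D(1)[OF trace_L2[OF w E]] in auto)
  have "(L2_norm ?N (trace P E (\<lambda>x. v x - ?m)))\<^sup>2
    \<le> (3 * (L2_norm (lebesgue_on G) (\<lambda>x. v x - ?m))\<^sup>2 + h\<^sup>2 * (H1_seminorm G v)\<^sup>2) / r"
    using trace_inequality[OF w E] by (simp add: sem)
  also have "\<dots> \<le> (3 * (2 / \<rho> * h * H1_seminorm G v)\<^sup>2 + h\<^sup>2 * (H1_seminorm G v)\<^sup>2) / r"
    using r_pos by (intro divide_right_mono add_right_mono mult_left_mono power_mono poincare_rho[OF v]) auto
  also have "\<dots> = (12 / \<rho>\<^sup>2 + 1) * h * (h / r) * (H1_seminorm G v)\<^sup>2"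
    using r_pos rho_pos by (simp add: field_simps power2_eq_square)
  also have "\<dots> \<le> (12 / \<rho>\<^sup>2 + 1) * h * (1 / \<rho>) * (H1_seminorm G v)\<^sup>2"
    using h_pos by (intro mult_right_mono mult_left_mono h_r_rho) auto
  also have "\<dots> = (sqrt ((12 / \<rho>\<^sup>2 + 1) / \<rho> * h) * H1_seminorm G v)\<^sup>2"
    using h_pos rho_pos by (simp add: power_mult_distrib)
  finally show "(L2_norm ?N (\<lambda>x. trace P E v x - ?m))\<^sup>2 \<le> (sqrt ((12 / \<rho>\<^sup>2 + 1) / \<rho> * h) * H1_seminorm G v)\<^sup>2"
    unfolding e .
qed (use h_pos rho_pos in simp)

text \<open>Splits the trace of the projection into the trace of \<open>u\<close>, the trace \<open>t\<close> of \<open>u - u\<^sub>h\<close>, which has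
  vanishing jump in the mean, and a remainder \<open>s\<close> that is small by the Poincare inequality.\<close>

lemma edge_split:
  assumes E: "E \<in> edges P"
  obtains t s c a where "t \<in> L2 (edge_measure E)" "s \<in> L2 (edge_measure E)"
    "AE x in edge_measure E. trace P E p x = trace P E u x - t x - s x"
    "AE x in edge_measure E. trace P E u\<^sub>h x = trace P E u x - t x"
    "L2_norm (edge_measure E) (\<lambda>x. t x - c) \<le> a" "L2_norm (edge_measure E) s \<le> a"
    "a\<^sup>2 \<le> 2 * ((12 / \<rho>\<^sup>2 + 1) / \<rho>) * h * ((err_norm u u\<^sub>h P)\<^sup>2 + (err_proj u u\<^sub>h P)\<^sup>2)"
proof -
  let ?w = "\<lambda>x. u x - u\<^sub>h x" and ?e = "\<lambda>x. u\<^sub>h x - p x"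
  define K where "K = (12 / \<rho>\<^sup>2 + 1) / \<rho>"
  have K: "K \<ge> 0" using rho_pos by (simp add: K_def)
  have w: "?w \<in> H1 G" and e: "?e \<in> H1 G" using H1_diff(1)[OF GG] u_G(1) uh_G p_H1 by auto
  let ?a = "sqrt (K * h) * (err_semi u u\<^sub>h P + err_proj u u\<^sub>h P)"
  show ?thesis
  proof (rule that[of "trace P E ?w" "trace P E ?e" "mean G ?w" ?a])
    show "trace P E ?w \<in> L2 (edge_measure E)" "trace P E ?e \<in> L2 (edge_measure E)" using trace_L2[OF _ E] w e by auto
    show "AE x in edge_measure E. trace P E p x = trace P E u x - trace P E ?w x - trace P E ?e x"
      using trace_diff[OF u_G(1) uh_G E] trace_diff[OF uh_G p_H1 E] by eventually_elim simp
    show "AE x in edge_measure E. trace P E u\<^sub>h x = trace P E u x - trace P E ?w x"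
      using trace_diff[OF u_G(1) uh_G E] by eventually_elim simp
    have kh: "0 \<le> sqrt (K * h)" using K h_pos by simp
    have "L2_norm (edge_measure E) (\<lambda>x. trace P E ?w x - mean G ?w) \<le> sqrt (K * h) * H1_seminorm G ?w"
      unfolding K_def by (rule trace_poincare[OF w E])
    also have "\<dots> \<le> ?a" by (intro mult_left_mono kh) simp
    finally show "L2_norm (edge_measure E) (\<lambda>x. trace P E ?w x - mean G ?w) \<le> ?a" .
    have "L2_norm (edge_measure E) (trace P E ?e) \<le> sqrt (K * h) * H1_seminorm G ?e"
      using trace_poincare[OF e E] mean_minus_proj1[OF H1D(1)[OF uh_G]] by (simp add: K_def)
    also have "\<dots> \<le> ?a" by (intro mult_left_mono kh remainder_seminorm)
    finally show "L2_norm (edge_measure E) (trace P E ?e) \<le> ?a" .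
    have "?a\<^sup>2 = K * h * (err_semi u u\<^sub>h P + err_proj u u\<^sub>h P)\<^sup>2" using K h_pos by (simp add: power_mult_distrib)
    also have "\<dots> \<le> K * h * (2 * (err_norm u u\<^sub>h P)\<^sup>2 + 2 * (err_proj u u\<^sub>h P)\<^sup>2)"
    proof (rule mult_left_mono)
      have "(err_semi u u\<^sub>h P)\<^sup>2 \<le> (err_norm u u\<^sub>h P)\<^sup>2" by (intro power_mono H1_seminorm_le_norm) simp
      then show "(err_semi u u\<^sub>h P + err_proj u u\<^sub>h P)\<^sup>2 \<le> 2 * (err_norm u u\<^sub>h P)\<^sup>2 + 2 * (err_proj u u\<^sub>h P)\<^sup>2"
        using two_squares[of "err_semi u u\<^sub>h P" "err_proj u u\<^sub>h P"] by linarith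
    qed (use K h_pos in simp)
    finally show "?a\<^sup>2 \<le> 2 * ((12 / \<rho>\<^sup>2 + 1) / \<rho>) * h * ((err_norm u u\<^sub>h P)\<^sup>2 + (err_proj u u\<^sub>h P)\<^sup>2)"
      by (simp add: K_def algebra_simps)
  qed
qed

text \<open>The approximants depend on \<Omega> only, not on the polygon. They therefore identify
  the traces of \<open>u\<close> from both sides of an interior edge and show that the trace
  vanishes on the boundary.\<close>

lemma trace_u_tendsto:
  assumes E: "E \<in> edges P" and \<phi>: "\<And>n. \<phi> n \<in> test_functions \<Omega>"
    and lim: "(\<lambda>n. H1_norm \<Omega> (\<lambda>x. u x - \<phi> n x)) \<longlonglongrightarrow> 0"
  shows "(\<lambda>n. L2_norm (edge_measure E) (\<lambda>x. trace P E u x - \<phi> n x)) \<longlonglongrightarrow> 0"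
proof (rule trace_tendsto[OF u_G(1) E test_functionsD(1)[OF \<phi>]])
  note OO = Omega_open Omega_bounded
  have "H1_norm G (\<lambda>x. u x - \<phi> n x) \<le> H1_norm \<Omega> (\<lambda>x. u x - \<phi> n x)" for n
    by (rule H1_norm_subset[OF OO G_open G_Omega H1_diff(1)[OF OO u_H1 H1_smooth(1)[OF OO test_functionsD(1)[OF \<phi>]]]])
  then show "(\<lambda>n. H1_norm G (\<lambda>x. u x - \<phi> n x)) \<longlonglongrightarrow> 0"
    by (rule tendsto_0_dominated[OF H1_norm_nonneg(1) _ lim])
qed

end

text \<open>Zero is the best constant for a function with mean zero. This removes the constants,
  which are means over polygons and not over the edge.\<close>

lemma edge_mean_zero_le:
  fixes t :: "plane \<Rightarrow> real"
  assumes t: "t \<in> L2 (edge_measure E)" and 0: "(LINT x|edge_measure E. t x) = 0"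
  shows "L2_norm (edge_measure E) t \<le> L2_norm (edge_measure E) (\<lambda>x. t x - c)"
proof (rule power2_le_imp_le)
  have "(L2_norm (edge_measure E) (\<lambda>x. t x + (- c) *\<^sub>R 1))\<^sup>2
    = (L2_norm (edge_measure E) t)\<^sup>2 + 2 * (- c) * L2_inner (edge_measure E) t (\<lambda>x. 1) + (- c)\<^sup>2 * (L2_norm (edge_measure E) (\<lambda>x. 1::real))\<^sup>2"
    by (rule L2_norm_add_scaleR_sq[OF t L2_one_edge])
  then show "(L2_norm (edge_measure E) t)\<^sup>2 \<le> (L2_norm (edge_measure E) (\<lambda>x. t x - c))\<^sup>2" using 0 by (simp add: L2_inner_def)
qed simp

lemma L2_norm_cong_AE_measurable:
  fixes f g :: "plane \<Rightarrow> real"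
  assumes "f \<in> borel_measurable M" "g \<in> borel_measurable M" "AE x in M. f x = g x"
  shows "L2_norm M f = L2_norm M g"
  unfolding L2_norm_def by (intro arg_cong[where f = sqrt] integral_cong_AE) (use assms in auto)

context vem
begin

lemma vem_polygonE:
  assumes "P \<in> \<T>"
  obtains z r where "vem_polygon \<Omega> \<rho> \<T> A b \<gamma> C\<^sub>s a\<^sub>0 a\<^sub>1 M\<^sub>A M\<^sub>b M\<^sub>\<gamma> D\<^sub>A D\<^sub>b D\<^sub>\<gamma> S f u u\<^sub>h P z r"
proof -
  obtain z r where zr: "star_polygon P z r" "\<rho> * diameter (pts P) \<le> r" using mesh_star[OF assms] by metis
  have "vem_polygon \<Omega> \<rho> \<T> A b \<gamma> C\<^sub>s a\<^sub>0 a\<^sub>1 M\<^sub>A M\<^sub>b M\<^sub>\<gamma> D\<^sub>A D\<^sub>b D\<^sub>\<gamma> S f u u\<^sub>h P z r"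
    using zr assms by (intro vem_polygon.intro vem_axioms vem_polygon_axioms.intro)
  then show ?thesis by (rule that)
qed

definition local_error :: "polygon \<Rightarrow> real" where
  "local_error P = (err_norm u u\<^sub>h P)\<^sup>2 + (err_proj u u\<^sub>h P)\<^sup>2"

lemma local_error_nonneg: "0 \<le> local_error P" by (simp add: local_error_def)

text \<open>16 is 8 times 2: the 8 from squaring \<open>2 * (a + a')\<close> for two polygons, the 2
  from the bound for \<open>a\<^sup>2\<close> in \<open>edge_split\<close>.\<close>

definition jump_const :: real where "jump_const = 16 * ((12 / \<rho>\<^sup>2 + 1) / \<rho>)"

lemma jump_const_nonneg: "0 \<le> jump_const" using rho_pos by (simp add: jump_const_def)

lemma test_approximation:
  obtains \<phi> :: "nat \<Rightarrow> plane \<Rightarrow> real" where "\<And>n. \<phi> n \<in> test_functions \<Omega>" "(\<lambda>n. H1_norm \<Omega> (\<lambda>x. u x - \<phi> n x)) \<longlonglongrightarrow> 0"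
  using weak by (auto simp: weak_solution_def H10_def)

text \<open>Restated outside the setting of one fixed polygon, since an interior edge involves two
  polygons with different star centres at once.\<close>

lemma split_edge:
  assumes P: "P \<in> \<T>" "E \<in> edges P"
  obtains t s c a where "t \<in> L2 (edge_measure E)" "s \<in> L2 (edge_measure E)"
    "trace P E (proj 1 P u\<^sub>h) \<in> L2 (edge_measure E)" "trace P E u\<^sub>h \<in> L2 (edge_measure E)" "trace P E u \<in> L2 (edge_measure E)"
    "AE x in edge_measure E. trace P E (proj 1 P u\<^sub>h) x = trace P E u x - t x - s x"
    "AE x in edge_measure E. trace P E u\<^sub>h x = trace P E u x - t x"
    "L2_norm (edge_measure E) (\<lambda>x. t x - c) \<le> a" "L2_norm (edge_measure E) s \<le> a"
    "8 * a\<^sup>2 \<le> jump_const * diameter (pts P) * local_error P"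
proof -
  obtain z r where "vem_polygon \<Omega> \<rho> \<T> A b \<gamma> C\<^sub>s a\<^sub>0 a\<^sub>1 M\<^sub>A M\<^sub>b M\<^sub>\<gamma> D\<^sub>A D\<^sub>b D\<^sub>\<gamma> S f u u\<^sub>h P z r"
    by (rule vem_polygonE[OF P(1)])
  then interpret V: vem_polygon \<Omega> \<rho> \<T> A b \<gamma> C\<^sub>s a\<^sub>0 a\<^sub>1 M\<^sub>A M\<^sub>b M\<^sub>\<gamma> D\<^sub>A D\<^sub>b D\<^sub>\<gamma> S f u u\<^sub>h P z r .
  obtain t s c a where ts: "t \<in> L2 (edge_measure E)" "s \<in> L2 (edge_measure E)"
    "AE x in edge_measure E. trace P E (proj 1 P u\<^sub>h) x = trace P E u x - t x - s x"
    "AE x in edge_measure E. trace P E u\<^sub>h x = trace P E u x - t x"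
    "L2_norm (edge_measure E) (\<lambda>x. t x - c) \<le> a" "L2_norm (edge_measure E) s \<le> a"
    and a: "a\<^sup>2 \<le> 2 * ((12 / \<rho>\<^sup>2 + 1) / \<rho>) * diameter (pts P) * ((err_norm u u\<^sub>h P)\<^sup>2 + (err_proj u u\<^sub>h P)\<^sup>2)"
    by (rule V.edge_split[OF P(2)])
  from a have "8 * a\<^sup>2 \<le> jump_const * diameter (pts P) * local_error P"
    unfolding jump_const_def local_error_def by linarith
  with ts V.trace_L2[OF V.p_H1 P(2)] V.trace_L2[OF V.uh_G P(2)] V.trace_L2[OF V.u_G(1) P(2)] that
  show ?thesis by blast
qed

lemma trace_test_limit:
  assumes P: "P \<in> \<T>" "E \<in> edges P"
    and \<phi>: "\<And>n. \<phi> n \<in> test_functions \<Omega>" "(\<lambda>n. H1_norm \<Omega> (\<lambda>x. u x - \<phi> n x)) \<longlonglongrightarrow> 0"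
  shows "(\<lambda>n. L2_norm (edge_measure E) (\<lambda>x. trace P E u x - \<phi> n x)) \<longlonglongrightarrow> 0" "\<phi> n \<in> L2 (edge_measure E)"
proof -
  obtain z r where "vem_polygon \<Omega> \<rho> \<T> A b \<gamma> C\<^sub>s a\<^sub>0 a\<^sub>1 M\<^sub>A M\<^sub>b M\<^sub>\<gamma> D\<^sub>A D\<^sub>b D\<^sub>\<gamma> S f u u\<^sub>h P z r"
    by (rule vem_polygonE[OF P(1)])
  then interpret V: vem_polygon \<Omega> \<rho> \<T> A b \<gamma> C\<^sub>s a\<^sub>0 a\<^sub>1 M\<^sub>A M\<^sub>b M\<^sub>\<gamma> D\<^sub>A D\<^sub>b D\<^sub>\<gamma> S f u u\<^sub>h P z r .
  show "(\<lambda>n. L2_norm (edge_measure E) (\<lambda>x. trace P E u x - \<phi> n x)) \<longlonglongrightarrow> 0"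
    by (rule V.trace_u_tendsto[OF P(2) \<phi>])
  show "\<phi> n \<in> L2 (edge_measure E)" by (rule V.smooth_L2_edge[OF test_functionsD(1)[OF \<phi>(1)] P(2)])
qed

lemma jump_bound:
  assumes P: "P \<in> \<T>" and E: "E \<in> edges P"
  shows "(L2_norm (edge_measure E) (jump \<Omega> \<T> (\<lambda>P'. proj 1 P' u\<^sub>h) E))\<^sup>2
    \<le> (\<Sum>P'\<in>sharing \<T> E. jump_const * diameter (pts P') * local_error P')"
proof -
  let ?N = "edge_measure E"
  have jz: "(LINT x|?N. jump \<Omega> \<T> (\<lambda>_. u\<^sub>h) E x) = 0"
    using discrete P E by (auto simp: Vh_def mesh_edges_def)
  obtain \<phi> where \<phi>: "\<And>n. \<phi> n \<in> test_functions \<Omega>" "(\<lambda>n. H1_norm \<Omega> (\<lambda>x. u x - \<phi> n x)) \<longlonglongrightarrow> 0"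
    using test_approximation by blast
  have pos: "0 \<le> jump_const * diameter (pts P') * local_error P'" if "P' \<in> \<T>" for P'
    using jump_const_nonneg local_error_nonneg mesh_diameter(1)[OF that] by simp
  have fin: "finite (sharing \<T> E)" using finite_mesh by (simp add: sharing_def)
  show ?thesis
  proof (cases "E \<subseteq> frontier \<Omega>")
    case True
    \<comment> \<open>The polygon chosen inside \<open>jump\<close>; it is some member of
      \<open>sharing \<T> E\<close>, and the bound sums over all members.\<close>
    define Q where "Q = (SOME P. P \<in> sharing \<T> E)"
    have Qs: "Q \<in> sharing \<T> E" unfolding Q_def by (rule someI[where P = "\<lambda>P. P \<in> sharing \<T> E", OF self_sharing[OF P E]])
    then have Q: "Q \<in> \<T>" "E \<in> edges Q" using sharing_edges[OF P E] by auto
    have j: "jump \<Omega> \<T> w E = trace Q E (w Q)" for w by (simp add: jump_def True Q_def Let_def)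
    obtain t s c a where ts: "t \<in> L2 ?N" "s \<in> L2 ?N" and tr: "trace Q E (proj 1 Q u\<^sub>h) \<in> L2 ?N" "trace Q E u\<^sub>h \<in> L2 ?N" "trace Q E u \<in> L2 ?N"
      and ae: "AE x in ?N. trace Q E (proj 1 Q u\<^sub>h) x = trace Q E u x - t x - s x"
        "AE x in ?N. trace Q E u\<^sub>h x = trace Q E u x - t x"
      and a: "L2_norm ?N (\<lambda>x. t x - c) \<le> a" "L2_norm ?N s \<le> a"
      and a2: "8 * a\<^sup>2 \<le> jump_const * diameter (pts Q) * local_error Q"
      by (rule split_edge[OF Q])
    obtain x y where xy: "ends E = (x, y)" "x \<noteq> y" "E = closed_segment x y" by (rule edge_endsE[OF mesh_domain[OF P] E])
    \<comment> \<open>The test functions vanish on a boundary edge, so the distance of the trace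
      from them is the norm of the trace for every \<open>n\<close>, and its limit is zero.\<close>
    have "L2_norm ?N (\<lambda>x. trace Q E u x - \<phi> n x) = L2_norm ?N (trace Q E u)" for n
    proof (rule L2_norm_cong_AE_measurable)
      have "\<phi> n w = 0" if "w \<in> closed_segment x y" for w
      proof (rule test_functions_outside[OF \<phi>(1)])
        show "w \<notin> \<Omega>" using that True xy(3) Omega_open by (auto simp: frontier_def interior_open)
      qed
      then show "AE w in ?N. trace Q E u w - \<phi> n w = trace Q E u w" by (intro AE_edge_measure[OF xy(1)]) simp
    qed (use L2D(1)[OF tr(3)] L2D(1)[OF trace_test_limit(2)[OF Q \<phi>]] in auto)
    with trace_test_limit(1)[OF Q \<phi>] have "L2_norm ?N (trace Q E u) = 0" by (simp add: LIMSEQ_const_iff)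
    then have u0: "AE x in ?N. trace Q E u x = 0" using L2_norm_eq_0_iff[OF tr(3)] by simp
    have "(LINT x|?N. trace Q E u\<^sub>h x) = (LINT x|?N. - t x)"
    proof (rule integral_cong_AE)
      show "AE x in ?N. trace Q E u\<^sub>h x = - t x" using ae(2) u0 by eventually_elim simp
    qed (use L2D(1)[OF tr(2)] L2D(1)[OF ts(1)] in auto)
    then have t0: "(LINT x|?N. t x) = 0" using jz by (simp add: j)
    have "L2_norm ?N (jump \<Omega> \<T> (\<lambda>P'. proj 1 P' u\<^sub>h) E) = L2_norm ?N (\<lambda>x. - (t x + s x))"
      unfolding j
    proof (rule L2_norm_cong_AE_measurable)
      show "AE x in ?N. trace Q E (proj 1 Q u\<^sub>h) x = - (t x + s x)" using ae(1) u0 by eventually_elim simp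
    qed (use L2D(1)[OF tr(1)] L2D(1)[OF ts(1)] L2D(1)[OF ts(2)] in auto)
    also have "\<dots> = L2_norm ?N (\<lambda>x. t x + s x)" by (rule L2_norm_minus)
    also have "\<dots> \<le> L2_norm ?N t + L2_norm ?N s" by (rule L2_norm_triangle[OF ts])
    also have "\<dots> \<le> 2 * a" using edge_mean_zero_le[OF ts(1) t0, of c] a by simp
    finally have "(L2_norm ?N (jump \<Omega> \<T> (\<lambda>P'. proj 1 P' u\<^sub>h) E))\<^sup>2 \<le> (2 * a)\<^sup>2" by (rule power_mono) simp
    also have "\<dots> \<le> 8 * a\<^sup>2" by (simp add: power_mult_distrib)
    also have "\<dots> \<le> jump_const * diameter (pts Q) * local_error Q" by (rule a2)
    also have "\<dots> \<le> (\<Sum>P'\<in>sharing \<T> E. jump_const * diameter (pts P') * local_error P')"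
      using pos sharing_edges[OF P E] by (intro member_le_sum[OF Qs _ fin]) auto
    finally show ?thesis .
  next
    case False
    define QQ where "QQ = (SOME (P, P'). P \<noteq> P' \<and> sharing \<T> E = {P, P'})"
    obtain Q0 Q0' where "Q0 \<noteq> Q0'" "sharing \<T> E = {Q0, Q0'}" using interior_edge_sharing[OF P E False] by blast
    then have "case (Q0, Q0') of (P, P') \<Rightarrow> P \<noteq> P' \<and> sharing \<T> E = {P, P'}" by simp
    from someI[where P = "\<lambda>(P, P'). P \<noteq> P' \<and> sharing \<T> E = {P, P'}", OF this]
    obtain Q Q' where QQ: "QQ = (Q, Q')" "Q \<noteq> Q'" "sharing \<T> E = {Q, Q'}" unfolding QQ_def by (auto split: prod.splits)
    have j: "jump \<Omega> \<T> w E = (\<lambda>x. trace Q E (w Q) x - trace Q' E (w Q') x)" for w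
      using False QQ(1) by (simp add: jump_def QQ_def)
    have Q: "Q \<in> \<T>" "E \<in> edges Q" and Q': "Q' \<in> \<T>" "E \<in> edges Q'" using sharing_edges[OF P E] QQ(3) by auto
    obtain t s c a where ts: "t \<in> L2 ?N" "s \<in> L2 ?N" and tr: "trace Q E (proj 1 Q u\<^sub>h) \<in> L2 ?N" "trace Q E u\<^sub>h \<in> L2 ?N" "trace Q E u \<in> L2 ?N"
      and ae: "AE x in ?N. trace Q E (proj 1 Q u\<^sub>h) x = trace Q E u x - t x - s x"
        "AE x in ?N. trace Q E u\<^sub>h x = trace Q E u x - t x"
      and a: "L2_norm ?N (\<lambda>x. t x - c) \<le> a" "L2_norm ?N s \<le> a"
      and a2: "8 * a\<^sup>2 \<le> jump_const * diameter (pts Q) * local_error Q"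
      by (rule split_edge[OF Q])
    obtain t' s' c' a' where ts': "t' \<in> L2 ?N" "s' \<in> L2 ?N" and tr': "trace Q' E (proj 1 Q' u\<^sub>h) \<in> L2 ?N" "trace Q' E u\<^sub>h \<in> L2 ?N" "trace Q' E u \<in> L2 ?N"
      and ae': "AE x in ?N. trace Q' E (proj 1 Q' u\<^sub>h) x = trace Q' E u x - t' x - s' x"
        "AE x in ?N. trace Q' E u\<^sub>h x = trace Q' E u x - t' x"
      and a': "L2_norm ?N (\<lambda>x. t' x - c') \<le> a'" "L2_norm ?N s' \<le> a'"
      and a2': "8 * a'\<^sup>2 \<le> jump_const * diameter (pts Q') * local_error Q'"
      by (rule split_edge[OF Q'])
    \<comment> \<open>A constant sequence dominated by a null sequence: both traces of
      \<open>u\<close> are limits of the same test functions.\<close>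
    have "(\<lambda>n. L2_norm ?N (\<lambda>x. trace Q E u x - trace Q' E u x)) \<longlonglongrightarrow> 0"
    proof (rule tendsto_0_dominated)
      show "L2_norm ?N (\<lambda>x. trace Q E u x - trace Q' E u x)
        \<le> L2_norm ?N (\<lambda>x. trace Q E u x - \<phi> n x) + L2_norm ?N (\<lambda>x. trace Q' E u x - \<phi> n x)" for n
        using L2_norm_triangle3[OF tr(3) trace_test_limit(2)[OF Q \<phi>] tr'(3), of n]
          L2_norm_minus_commute[of ?N "\<phi> n" "trace Q' E u"] by simp
      show "(\<lambda>n. L2_norm ?N (\<lambda>x. trace Q E u x - \<phi> n x) + L2_norm ?N (\<lambda>x. trace Q' E u x - \<phi> n x)) \<longlonglongrightarrow> 0"
        using tendsto_add[OF trace_test_limit(1)[OF Q \<phi>] trace_test_limit(1)[OF Q' \<phi>]] by simp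
    qed simp
    then have "L2_norm ?N (\<lambda>x. trace Q E u x - trace Q' E u x) = 0" by (simp add: LIMSEQ_const_iff)
    then have uu: "AE x in ?N. trace Q E u x - trace Q' E u x = 0" using L2_norm_eq_0_iff[OF L2_diff[OF tr(3) tr'(3)]] by simp
    \<comment> \<open>Since the traces of \<open>u\<close> cancel, \<open>d\<close> is the jump of
      \<open>u\<^sub>h\<close>, which has mean zero by the definition of the discrete space.\<close>
    define d where "d x = t' x - t x" for x
    have dL: "d \<in> L2 ?N" unfolding d_def by (rule L2_diff[OF ts'(1) ts(1)])
    have eL: "(\<lambda>x. s' x - s x) \<in> L2 ?N" by (rule L2_diff[OF ts'(2) ts(2)])
    have "(LINT x|?N. trace Q E u\<^sub>h x - trace Q' E u\<^sub>h x) = (LINT x|?N. d x)"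
    proof (rule integral_cong_AE)
      show "AE x in ?N. trace Q E u\<^sub>h x - trace Q' E u\<^sub>h x = d x" using ae(2) ae'(2) uu by eventually_elim (simp add: d_def)
    qed (use L2D(1)[OF L2_diff[OF tr(2) tr'(2)]] L2D(1)[OF dL] in auto)
    then have d0: "(LINT x|?N. d x) = 0" using jz by (simp add: j)
    have "L2_norm ?N (jump \<Omega> \<T> (\<lambda>P'. proj 1 P' u\<^sub>h) E) = L2_norm ?N (\<lambda>x. d x + (s' x - s x))"
      unfolding j
    proof (rule L2_norm_cong_AE_measurable)
      show "AE x in ?N. trace Q E (proj 1 Q u\<^sub>h) x - trace Q' E (proj 1 Q' u\<^sub>h) x = d x + (s' x - s x)"
        using ae(1) ae'(1) uu by eventually_elim (simp add: d_def)
    qed (use L2D(1)[OF L2_diff[OF tr(1) tr'(1)]] L2D(1)[OF L2_add[OF dL eL]] in auto)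
    also have "\<dots> \<le> L2_norm ?N d + L2_norm ?N (\<lambda>x. s' x - s x)" by (rule L2_norm_triangle[OF dL eL])
    also have "L2_norm ?N (\<lambda>x. s' x - s x) \<le> L2_norm ?N s' + L2_norm ?N s" by (rule L2_norm_triangle_diff[OF ts'(2) ts(2)])
    \<comment> \<open>Subtracting the single constant \<open>c' - c\<close> from the jump subtracts
      a separate constant from each of the two traces.\<close>
    also have "L2_norm ?N d \<le> L2_norm ?N (\<lambda>x. d x - (c' - c))" by (rule edge_mean_zero_le[OF dL d0])
    also have "\<dots> = L2_norm ?N (\<lambda>x. (t' x - c') - (t x - c))" by (simp add: d_def algebra_simps)
    also have "\<dots> \<le> L2_norm ?N (\<lambda>x. t' x - c') + L2_norm ?N (\<lambda>x. t x - c)"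
      by (intro L2_norm_triangle_diff L2_diff ts ts' L2_one_edge)
    finally have "L2_norm ?N (jump \<Omega> \<T> (\<lambda>P'. proj 1 P' u\<^sub>h) E) \<le> 2 * (a + a')" using a a' by simp
    then have "(L2_norm ?N (jump \<Omega> \<T> (\<lambda>P'. proj 1 P' u\<^sub>h) E))\<^sup>2 \<le> (2 * (a + a'))\<^sup>2" by (rule power_mono) simp
    also have "\<dots> \<le> 8 * a\<^sup>2 + 8 * a'\<^sup>2" using two_squares[of a a'] by (simp only: power_mult_distrib) simp
    also have "\<dots> \<le> jump_const * diameter (pts Q) * local_error Q + jump_const * diameter (pts Q') * local_error Q'"
      by (rule add_mono[OF a2 a2'])
    also have "\<dots> = (\<Sum>P'\<in>sharing \<T> E. jump_const * diameter (pts P') * local_error P')" using QQ by simp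
    finally show ?thesis .
  qed
qed

text \<open>A shared edge is an edge of each of its polygons, so its length is at least \<rho> times
  the diameter of either one, and the factor \<open>diameter (pts P')\<close> cancels against the
  weight.\<close>

theorem Xi_efficiency:
  assumes P: "P \<in> \<T>"
  shows "(Xi \<Omega> \<T> u\<^sub>h P)\<^sup>2 \<le> jump_const / \<rho> * (\<Sum>E\<in>edges P. \<Sum>P'\<in>sharing \<T> E. local_error P')"
proof -
  let ?j = "\<lambda>E. (L2_norm (edge_measure E) (jump \<Omega> \<T> (\<lambda>P'. proj 1 P' u\<^sub>h) E))\<^sup>2"
  have dE: "0 < diameter E" if E: "E \<in> edges P" for E
    using edge_diameter[OF P E] mesh_diameter(1)[OF P] rho_pos by (meson less_le_trans mult_pos_pos)
  have "inverse (diameter E) * ?j E \<le> jump_const / \<rho> * (\<Sum>P'\<in>sharing \<T> E. local_error P')" if E: "E \<in> edges P" for E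
  proof -
    have "inverse (diameter E) * ?j E \<le> inverse (diameter E) * (\<Sum>P'\<in>sharing \<T> E. jump_const * diameter (pts P') * local_error P')"
      using dE[OF E] by (intro mult_left_mono jump_bound[OF P E]) auto
    also have "\<dots> = (\<Sum>P'\<in>sharing \<T> E. jump_const * (diameter (pts P') / diameter E) * local_error P')"
      by (simp add: sum_distrib_left divide_inverse mult_ac)
    also have "\<dots> \<le> (\<Sum>P'\<in>sharing \<T> E. jump_const * (1 / \<rho>) * local_error P')"
    proof (intro sum_mono mult_right_mono mult_left_mono local_error_nonneg jump_const_nonneg)
      fix P' assume "P' \<in> sharing \<T> E"
      then have "P' \<in> \<T>" "E \<in> edges P'" using sharing_edges[OF P E] by auto
      from edge_diameter[OF this] show "diameter (pts P') / diameter E \<le> 1 / \<rho>"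
        using dE[OF E] rho_pos by (simp add: field_simps)
    qed
    finally show ?thesis by (simp add: sum_distrib_left)
  qed
  then have "(\<Sum>E\<in>edges P. inverse (diameter E) * ?j E) \<le> (\<Sum>E\<in>edges P. jump_const / \<rho> * (\<Sum>P'\<in>sharing \<T> E. local_error P'))"
    by (rule sum_mono)
  moreover have "0 \<le> (\<Sum>E\<in>edges P. inverse (diameter E) * ?j E)"
    using dE by (intro sum_nonneg) (auto intro!: mult_nonneg_nonneg simp: less_imp_le)
  ultimately show ?thesis by (simp add: Xi_def sum_distrib_left)
qed

end

theorem theorem5p2:
  fixes \<Omega> :: "plane set"
    and A :: "plane \<Rightarrow> real^2^2" and b :: "plane \<Rightarrow> plane" and \<gamma> :: "plane \<Rightarrow> real"
    and \<rho> C\<^sub>s \<sigma> a\<^sub>0 a\<^sub>1 M\<^sub>A M\<^sub>b M\<^sub>\<gamma> D\<^sub>A D\<^sub>b D\<^sub>\<gamma> :: real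
  assumes "polygonal_lipschitz_domain \<Omega>"
    and "\<rho> > 0" and "C\<^sub>s > 0"
    and "bounded_coeffs \<Omega> A b \<gamma> M\<^sub>A M\<^sub>b M\<^sub>\<gamma>"
    and "elliptic \<Omega> A a\<^sub>0 a\<^sub>1"
    and "injective_operator \<Omega> A b \<gamma>"
    and "elliptic_regularity \<Omega> A b \<gamma> \<sigma>"
  shows "\<exists>C>0. \<forall>\<TT> :: polygon set set.
    (\<forall>\<T>\<in>\<TT>. mesh \<Omega> \<rho> \<T> \<and>
       (\<forall>j k. piecewise_lipschitz \<T> D\<^sub>A (\<lambda>x. A x $ j $ k)) \<and>
       (\<forall>j. piecewise_lipschitz \<T> D\<^sub>b (\<lambda>x. b x $ j)) \<and>
       piecewise_lipschitz \<T> D\<^sub>\<gamma> \<gamma>) \<longrightarrow>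
    (\<forall>\<T>\<in>\<TT>. \<forall>S f u u\<^sub>h.
       h_max \<T> \<le> 1 \<longrightarrow>
       admissible_stabilization A C\<^sub>s \<T> S \<longrightarrow>
       f \<in> L2 (lebesgue_on \<Omega>) \<longrightarrow>
       weak_solution \<Omega> A b \<gamma> f u \<longrightarrow>
       unique_discrete_solution \<Omega> \<T> A b \<gamma> S f u\<^sub>h \<longrightarrow>
       (\<forall>P\<in>\<T>.
          (zeta S u\<^sub>h P)\<^sup>2 \<le> C * ((err_semi u u\<^sub>h P)\<^sup>2 + (err_proj u u\<^sub>h P)\<^sup>2) \<and>
          (eta \<gamma> f u\<^sub>h P)\<^sup>2 \<le> C * ((err_norm u u\<^sub>h P)\<^sup>2 + (err_proj u u\<^sub>h P)\<^sup>2
              + (flux_osc (flux \<Omega> A b u) P)\<^sup>2 + (osc1 (\<lambda>x. f x - \<gamma> x * u x) P)\<^sup>2) \<and>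
          (Lam A b u\<^sub>h P)\<^sup>2 \<le> C * ((err_norm u u\<^sub>h P)\<^sup>2 + (err_proj u u\<^sub>h P)\<^sup>2
              + (flux_osc (flux \<Omega> A b u) P)\<^sup>2) \<and>
          (Xi \<Omega> \<T> u\<^sub>h P)\<^sup>2 \<le> C * (\<Sum>E\<in>edges P. \<Sum>P'\<in>sharing \<T> E.
              (err_norm u u\<^sub>h P')\<^sup>2 + (err_proj u u\<^sub>h P')\<^sup>2)))"
proof -
  let ?c1 = "2 * (C\<^sub>s * a\<^sub>1)"
  let ?\<alpha> = "1 + (16 / \<rho>) ^ 4 * exp (4/3)"
  let ?\<beta> = "(16 / \<rho>) ^ 4 * exp (4/3) * ((16 / \<rho>)\<^sup>2 + 2 * bump_grad_bound / \<rho>)"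
  let ?\<kappa> = "\<bar>M\<^sub>\<gamma>\<bar> * (1 + 2 / \<rho>)"
  \<comment> \<open>Three squares give the factors 3; the last one doubles because its argument is a
    sum of two errors.\<close>
  let ?c2 = "3 * ?\<alpha>\<^sup>2 + 3 * ?\<beta>\<^sup>2 + 6 * ?\<kappa>\<^sup>2"
  let ?c3 = "2 + 4 * (\<bar>M\<^sub>A\<bar> + \<bar>M\<^sub>b\<bar> * (1 + 2 / \<rho>))\<^sup>2"
  let ?c4 = "16 * ((12 / \<rho>\<^sup>2 + 1) / \<rho>) / \<rho>"
  \<comment> \<open>The sum dominates each nonnegative summand, and \<open>?c3 \<ge> 2\<close> makes
    it positive.\<close>
  define C where "C = ?c1 + ?c2 + ?c3 + ?c4"
  have "a\<^sub>1 > 0" using assms(5) by (simp add: elliptic_def)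
  then have c: "0 \<le> ?c1" "0 \<le> ?c2" "2 \<le> ?c3" "0 \<le> ?c4" using assms(2,3) by auto
  then have C: "?c1 \<le> C" "?c2 \<le> C" "?c3 \<le> C" "?c4 \<le> C" "C > 0" unfolding C_def by linarith+
  show ?thesis
  proof (intro exI[of _ C] conjI C(5) allI impI ballI)
    fix \<TT> :: "polygon set set" and \<T> S f u u\<^sub>h P
    assume coeff: "\<forall>\<T>\<in>\<TT>. mesh \<Omega> \<rho> \<T> \<and>
       (\<forall>j k. piecewise_lipschitz \<T> D\<^sub>A (\<lambda>x. A x $ j $ k)) \<and>
       (\<forall>j. piecewise_lipschitz \<T> D\<^sub>b (\<lambda>x. b x $ j)) \<and>
       piecewise_lipschitz \<T> D\<^sub>\<gamma> \<gamma>"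
      and \<T>: "\<T> \<in> \<TT>" and hm: "h_max \<T> \<le> 1" and st: "admissible_stabilization A C\<^sub>s \<T> S"
      and f: "f \<in> L2 (lebesgue_on \<Omega>)" and w: "weak_solution \<Omega> A b \<gamma> f u"
      and d: "unique_discrete_solution \<Omega> \<T> A b \<gamma> S f u\<^sub>h" and P: "P \<in> \<T>"
    have m: "mesh \<Omega> \<rho> \<T>" and lip: "\<And>j k. piecewise_lipschitz \<T> D\<^sub>A (\<lambda>x. A x $ j $ k)"
      "\<And>j. piecewise_lipschitz \<T> D\<^sub>b (\<lambda>x. b x $ j)" "piecewise_lipschitz \<T> D\<^sub>\<gamma> \<gamma>"
      using coeff \<T> by blast+
    have uh: "u\<^sub>h \<in> Vh \<Omega> \<T>" using d by (simp add: unique_discrete_solution_def discrete_solution_def)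
    interpret vem \<Omega> \<rho> \<T> A b \<gamma> C\<^sub>s a\<^sub>0 a\<^sub>1 M\<^sub>A M\<^sub>b M\<^sub>\<gamma> D\<^sub>A D\<^sub>b D\<^sub>\<gamma> S f u u\<^sub>h
      by unfold_locales (use assms(1-5) m hm lip st f w uh in auto)
    obtain z r where "vem_polygon \<Omega> \<rho> \<T> A b \<gamma> C\<^sub>s a\<^sub>0 a\<^sub>1 M\<^sub>A M\<^sub>b M\<^sub>\<gamma> D\<^sub>A D\<^sub>b D\<^sub>\<gamma> S f u u\<^sub>h P z r"
      by (rule vem_polygonE[OF P])
    then interpret V: vem_polygon \<Omega> \<rho> \<T> A b \<gamma> C\<^sub>s a\<^sub>0 a\<^sub>1 M\<^sub>A M\<^sub>b M\<^sub>\<gamma> D\<^sub>A D\<^sub>b D\<^sub>\<gamma> S f u u\<^sub>h P z r .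
    let ?N = "err_norm u u\<^sub>h P" and ?e = "err_proj u u\<^sub>h P" and ?o = "flux_osc (flux \<Omega> A b u) P"
      and ?s = "osc1 (\<lambda>x. f x - \<gamma> x * u x) P"
    have up: "k * y \<le> C * y" if "k \<le> C" "0 \<le> y" for k y using that by (rule mult_right_mono)
    show "(zeta S u\<^sub>h P)\<^sup>2 \<le> C * ((err_semi u u\<^sub>h P)\<^sup>2 + ?e\<^sup>2)"
      by (rule order_trans[OF V.zeta_efficiency up[OF C(1)]]) simp
    show "(Lam A b u\<^sub>h P)\<^sup>2 \<le> C * (?N\<^sup>2 + ?e\<^sup>2 + ?o\<^sup>2)"
      by (rule order_trans[OF V.Lam_efficiency up[OF C(3)]]) simp
    show "(Xi \<Omega> \<T> u\<^sub>h P)\<^sup>2 \<le> C * (\<Sum>E\<in>edges P. \<Sum>P'\<in>sharing \<T> E. (err_norm u u\<^sub>h P')\<^sup>2 + (err_proj u u\<^sub>h P')\<^sup>2)"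
      by (rule order_trans[OF Xi_efficiency[OF P, unfolded jump_const_def local_error_def] up[OF C(4)]])
        (intro sum_nonneg, simp)
    show "(eta \<gamma> f u\<^sub>h P)\<^sup>2 \<le> C * (?N\<^sup>2 + ?e\<^sup>2 + ?o\<^sup>2 + ?s\<^sup>2)"
    proof (rule order_trans[OF _ up[OF C(2)]])
      have "(eta \<gamma> f u\<^sub>h P)\<^sup>2 \<le> (?\<alpha> * ?s + ?\<beta> * ?o + ?\<kappa> * (?N + ?e))\<^sup>2"
        by (rule power_mono[OF V.eta_bound]) (use V.h_pos in \<open>simp add: eta_def\<close>)
      also have "\<dots> \<le> 3 * (?\<alpha> * ?s)\<^sup>2 + 3 * (?\<beta> * ?o)\<^sup>2 + 3 * (?\<kappa> * (?N + ?e))\<^sup>2" by (rule three_squares)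
      also have "\<dots> \<le> 3 * (?\<alpha>\<^sup>2 * ?s\<^sup>2) + 3 * (?\<beta>\<^sup>2 * ?o\<^sup>2) + 3 * (?\<kappa>\<^sup>2 * (2 * ?N\<^sup>2 + 2 * ?e\<^sup>2))"
        unfolding power_mult_distrib[of ?\<alpha>] power_mult_distrib[of ?\<beta>] power_mult_distrib[of ?\<kappa>]
        by (intro add_mono mult_left_mono two_squares order_refl) auto
      also have "\<dots> = (3 * ?\<alpha>\<^sup>2) * ?s\<^sup>2 + (3 * ?\<beta>\<^sup>2) * ?o\<^sup>2 + (6 * ?\<kappa>\<^sup>2) * (?N\<^sup>2 + ?e\<^sup>2)" by (simp add: distrib_left mult.assoc)
      also have "\<dots> \<le> ?c2 * ?s\<^sup>2 + ?c2 * ?o\<^sup>2 + ?c2 * (?N\<^sup>2 + ?e\<^sup>2)"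
        by (intro add_mono mult_right_mono) auto
      also have "\<dots> = ?c2 * (?N\<^sup>2 + ?e\<^sup>2 + ?o\<^sup>2 + ?s\<^sup>2)" by (simp only: distrib_left add_ac)
      finally show "(eta \<gamma> f u\<^sub>h P)\<^sup>2 \<le> ?c2 * (?N\<^sup>2 + ?e\<^sup>2 + ?o\<^sup>2 + ?s\<^sup>2)" .
    qed simp
  qed
qed

end
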